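(* Let $T\in\mathcal{K}(V)$ be bisectorial of angle $\omega\in(0,\frac{\pi}{2})$, let $\theta\in(\omega,\frac{\pi}{2})$, $g\in\mathcal{N}^{\mathrm{bnd}}(D_\theta)$ and $f\in\mathcal{SH}_L^{\mathrm{bnd}}(D_\theta)$. Then $gf\in\mathcal{SH}_L^{\mathrm{bnd}}(D_\theta)$ and the product rule $$(gf)(T)=g(T)f(T)$$ holds, where all three operators are given by the extended $\omega$-functional calculus.
   Context: Clifford setting. Fix an integer $n\geq 1$. $\mathbb{R}_n$ is the real Clifford algebra generated by $e_1,\dots,e_n$ with $e_i^2=-1$, $e_ie_j=-e_je_i$ ($i\neq j$), with basis $e_A=e_{i_1}\cdots e_{i_r}$ for $A=(i_1<\dots<i_r)$, $e_\emptyset=1$, and $|s|^2=\sum_As_A^2$ for $s=\sum_As_Ae_A$. Paravectors: $\mathbb{R}^{n+1}=\{s_0+s_1e_1+\dots+s_ne_n\}\subseteq\mathbb{R}_n$ with $\overline{s}=s_0-s_1e_1-\dots-s_ne_n$. $\mathbb{S}=\{s\in\mathbb{R}^{n+1}: s_0=0,|s|=1\}$ and $\mathbb{C}_J=\{x+Jy: x,y\in\mathbb{R}\}$ for $J\in\mathbb{S}$. $U\subseteq\mathbb{R}^{n+1}$ is axially symmetric if $x+Jy\in U$ ($x,y\in\mathbb{R}$, $J\in\mathbb{S}$) implies $x+Iy\in U$ for all $I\in\mathbb{S}$. Slice hyperholomorphic functions. For $U$ open and axially symmetric, $f:U\to\mathbb{R}_n$ is left slice hyperholomorphic ($f\in\mathcal{SH}_L(U)$)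 if there are continuously differentiable $f_0,f_1:\{(x,y)\in\mathbb{R}^2: x+\mathbb{S}y\subseteq U\}\to\mathbb{R}_n$ with $f(x+Jy)=f_0(x,y)+Jf_1(x,y)$ for all $J\in\mathbb{S}$, $f_0(x,-y)=f_0(x,y)$, $f_1(x,-y)=-f_1(x,y)$, $\partial_xf_0=\partial_yf_1$, $\partial_yf_0=-\partial_xf_1$. If $f_0,f_1$ are real valued, $f$ is called intrinsic ($f\in\mathcal{N}(U)$). Operators. $V_\mathbb{R}$ is a real Banach space, $V=\{\sum_Av_A\otimes e_A: v_A\in V_\mathbb{R}\}$ the corresponding Clifford module with norm $\|v\|^2=\sum_A\|v_A\|^2$ and the natural left and right multiplications by $\mathbb{R}_n$. $\mathcal{B}(V)$: bounded everywhere defined right-linear operators; $\mathcal{K}(V)$: closed right-linear operators $T:\operatorname{dom}(T)\to V$ with right-linear domain $\operatorname{dom}(T)\subseteq V$. A Clifford number $a$ is identified with the operator $v\mapsto av$, so $(aT)v=a(Tv)$, $(Ta)v=T(av)$. For $s\in\mathbb{R}^{n+1}$, $Q_s[T]=T^2-2s_0T+|s|^2$ on $\operatorname{dom}(T^2)$; $\rho_S(T)=\{s\in\mathbb{R}^{n+1}: Q_s[T]^{-1}\in\mathcal{B}(V)\}$, $\sigma_S(T)=\mathbb{R}^{n+1}\setminus\rho_S(T)$, and $S_L^{-1}(s,T)=Q_s[T]^{-1}\overline{s}-TQ_s[T]^{-1}$ for $s\in\rho_S(T)$. Bisectorial operators. For $\omega\in(0,\frac{\pi}{2})$, $I_\omega=(-\omega,\omega)\cup(\pi-\omega,\pi+\omega)$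 and $D_\omega=\{re^{J\phi}: r>0,\,J\in\mathbb{S},\,\phi\in I_\omega\}\subseteq\mathbb{R}^{n+1}$. $T\in\mathcal{K}(V)$ is bisectorial of angle $\omega$ if $\sigma_S(T)\subseteq\overline{D_\omega}$ and for every $\varphi\in(\omega,\frac{\pi}{2})$ there is $C_\varphi\geq 0$ with $\|S_L^{-1}(s,T)\|\leq\frac{C_\varphi}{|s|}$ for all $s\in\mathbb{R}^{n+1}\setminus(D_\varphi\cup\{0\})$. $\omega$-functional calculus. $\mathcal{SH}_L^0(D_\theta)$ is the set of bounded $f\in\mathcal{SH}_L(D_\theta)$ with $\int_0^\infty|f(te^{J\phi})|\frac{dt}{t}<\infty$ for all $J\in\mathbb{S}$, $\phi\in I_\theta$; $\mathcal{N}^0(D_\theta)$ is the set of intrinsic such functions. For $T$ bisectorial of angle $\omega$, $\theta\in(\omega,\frac{\pi}{2})$ and $f\in\mathcal{SH}_L^0(D_\theta)$, $$f(T)=\frac{1}{2\pi}\int_{\partial D_\varphi\cap\mathbb{C}_J}S_L^{-1}(s,T)ds_Jf(s):=\frac{1}{2\pi}\sum_\pm\int_\mathbb{R}S_L^{-1}(\gamma_\pm(t),T)\frac{\gamma_\pm'(t)}{J}f(\gamma_\pm(t))dt\in\mathcal{B}(V),$$ with $\gamma_\pm(t)=\pm|t|e^{-\operatorname{sgn}(t)J\varphi}$; it does not depend on the choice of $\varphi\in(\omega,\theta)$ and $J\in\mathbb{S}$. Extended $\omega$-functional calculus. $\mathcal{SH}_L^{\mathrm{bnd}}(D_\theta)$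 is the set of functions $f(s)=f_\infty+\frac{1}{1+s^2}(f_0-f_\infty)+\widetilde{f}(s)$ on $D_\theta$ with $f_0,f_\infty\in\mathbb{R}_n$, $\widetilde{f}\in\mathcal{SH}_L^0(D_\theta)$ (unique components); $\mathcal{N}^{\mathrm{bnd}}(D_\theta)$ is the analogous set with $f_0,f_\infty\in\mathbb{R}$, $\widetilde{f}\in\mathcal{N}^0(D_\theta)$. For such $f$, $f(T):=f_\infty+(1+T^2)^{-1}(f_0-f_\infty)+\widetilde{f}(T)\in\mathcal{B}(V)$, with $\widetilde{f}(T)$ from the $\omega$-functional calculus; here $1+T^2$ is boundedly invertible since $\mathbb{S}\subseteq\rho_S(T)$. *)

theory Defs
  imports "HOL-Analysis.Analysis"
begin

section \<open>The real Clifford algebra\<close>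

text \<open>
  The generators are indexed by a finite linearly ordered type \<open>'n\<close>, so \<open>n = CARD('n) \<ge> 1\<close>.
  A Clifford number is the family of its coefficients with respect to the basis
  \<open>e_A\<close>, \<open>A \<subseteq> UNIV\<close>.
\<close>

typedef 'n clifford = "UNIV :: ('n set \<Rightarrow> real) set"
  morphisms coeff Clifford ..

lemma coeff_Clifford [simp]: "coeff (Clifford f) = f"
  by (simp add: Clifford_inverse)

lemma clifford_eq_iff: "a = b \<longleftrightarrow> (\<forall>A. coeff a A = coeff b A)"
  by (metis coeff_inject ext)

instantiation clifford :: (type) real_vector
begin

definition "0 = Clifford (\<lambda>A. 0)"
definition "a + b = Clifford (\<lambda>A. coeff a A + coeff b A)"
definition "- a = Clifford (\<lambda>A. - coeff a A)"
definition "a - b = Clifford (\<lambda>A. coeff a A - coeff b A)"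
definition "r *\<^sub>R a = Clifford (\<lambda>A. r * coeff a A)"

instance
  by standard
    (auto simp: clifford_eq_iff zero_clifford_def plus_clifford_def uminus_clifford_def
      minus_clifford_def scaleR_clifford_def algebra_simps)

end

lemma coeff_linear [simp]:
  "coeff 0 A = 0" "coeff (a + b) A = coeff a A + coeff b A" "coeff (- a) A = - coeff a A"
  "coeff (a - b) A = coeff a A - coeff b A" "coeff (r *\<^sub>R a) A = r * coeff a A"
  by (simp_all add: zero_clifford_def plus_clifford_def uminus_clifford_def
      minus_clifford_def scaleR_clifford_def)

instantiation clifford :: (finite) real_inner
begin

definition "inner a b = (\<Sum>A\<in>UNIV. coeff a A * coeff b A)"
definition "norm a = sqrt (\<Sum>A\<in>UNIV. (coeff a A)\<^sup>2)" for a :: "'a clifford"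
definition "dist a b = norm (a - b)" for a b :: "'a clifford"
definition "sgn a = a /\<^sub>R norm a" for a :: "'a clifford"
definition "(uniformity :: ('a clifford \<times> 'a clifford) filter) =
  (INF e\<in>{0 <..}. principal {(x, y). dist x y < e})"
definition "open (U :: 'a clifford set) \<longleftrightarrow>
  (\<forall>x\<in>U. eventually (\<lambda>(x', y). x' = x \<longrightarrow> y \<in> U) uniformity)"

instance
proof
  fix a b c :: "'a clifford" and r :: real
  show "inner a b = inner b a"
    by (simp add: inner_clifford_def mult.commute)
  show "inner (a + b) c = inner a c + inner b c"
    by (simp add: inner_clifford_def algebra_simps sum.distrib)
  show "inner (r *\<^sub>R a) b = r * inner a b"
    by (simp add: inner_clifford_def sum_distrib_left algebra_simps)
  show "0 \<le> inner a a"
    by (simp add: inner_clifford_def sum_nonneg)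
  show "(inner a a = 0) = (a = 0)"
    by (simp add: inner_clifford_def sum_nonneg_eq_0_iff clifford_eq_iff)
  show "norm a = sqrt (inner a a)"
    by (simp add: inner_clifford_def norm_clifford_def power2_eq_square)
qed (simp_all add: dist_clifford_def sgn_clifford_def uniformity_clifford_def open_clifford_def)

end

text \<open>
  Moving \<open>e_B\<close> past \<open>e_A\<close> into increasing order costs a sign for each pair \<open>i \<in> A\<close>, \<open>j \<in> B\<close> with
  \<open>j < i\<close> (anticommutation) and for each \<open>i = j \<in> A \<inter> B\<close> (\<open>e_i\<^sup>2 = -1\<close>), so that
  \<open>e_A e_B = reord_sign A B e_C\<close> for the symmetric difference \<open>C\<close>.
\<close>

definition reord_sign :: "'n::{finite,linorder} set \<Rightarrow> 'n set \<Rightarrow> real" where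
  "reord_sign A B = (- 1) ^ card {(i, j). i \<in> A \<and> j \<in> B \<and> j \<le> i}"

lemma reord_sign_prod:
  "reord_sign A B = (\<Prod>i\<in>A. \<Prod>j\<in>B. if j \<le> i then - 1 else 1)"
proof -
  have "(\<Prod>i\<in>A. \<Prod>j\<in>B. if j \<le> i then - 1 else (1::real))
      = (\<Prod>p\<in>A \<times> B. if snd p \<le> fst p then - 1 else 1)"
    by (simp add: prod.cartesian_product case_prod_beta)
  also have "\<dots> = (\<Prod>p\<in>{p \<in> A \<times> B. snd p \<le> fst p}. - 1)"
    by (intro prod.mono_neutral_cong_right) auto
  also have "{p \<in> A \<times> B. snd p \<le> fst p} = {(i, j). i \<in> A \<and> j \<in> B \<and> j \<le> i}"
    by auto
  finally show ?thesis
    by (simp add: reord_sign_def)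
qed

lemma prod_sym_diff:
  fixes h :: "'a::finite \<Rightarrow> real"
  assumes "\<And>x. h x * h x = 1"
  shows "prod h (sym_diff A B) = prod h A * prod h B"
proof -
  have A: "prod h A = prod h (A - B) * prod h (A \<inter> B)"
    by (metis finite mult.commute prod.Int_Diff)
  have B: "prod h B = prod h (B - A) * prod h (A \<inter> B)"
    by (metis finite inf.commute mult.commute prod.Int_Diff)
  have C: "prod h (sym_diff A B) = prod h (A - B) * prod h (B - A)"
    by (rule prod.union_disjoint) auto
  have D: "prod h (A \<inter> B) * prod h (A \<inter> B) = 1"
    by (simp add: assms flip: prod.distrib)
  have "prod h A * prod h B
      = prod h (A - B) * prod h (B - A) * (prod h (A \<inter> B) * prod h (A \<inter> B))"
    unfolding A B by (simp only: mult_ac)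
  then show ?thesis
    unfolding C D by simp
qed

lemma reord_sign_sym_diff_left:
  "reord_sign (sym_diff A B) C = reord_sign A C * reord_sign B C"
  unfolding reord_sign_prod
  by (rule prod_sym_diff) (auto simp flip: prod.distrib intro!: prod.neutral)

lemma reord_sign_sym_diff_right:
  "reord_sign A (sym_diff B C) = reord_sign A B * reord_sign A C"
  unfolding reord_sign_prod prod.distrib [symmetric]
  by (intro prod.cong refl prod_sym_diff) simp

lemma reord_sign_empty [simp]: "reord_sign {} A = 1" "reord_sign A {} = 1"
  by (simp_all add: reord_sign_prod)

lemma sym_diff_eq_iff: "sym_diff A B = C \<longleftrightarrow> B = sym_diff A C"
  by blast

lemma sym_diff_cancel: "sym_diff A (sym_diff A B) = B"
  by blast

instantiation clifford :: ("{finite,linorder}") real_algebra_1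
begin

definition "1 = Clifford (\<lambda>A. if A = {} then 1 else 0)"
definition "a * b = Clifford (\<lambda>C. \<Sum>A\<in>UNIV. \<Sum>B\<in>UNIV.
  if sym_diff A B = C then reord_sign A B * coeff a A * coeff b B else 0)"

lemma coeff_mult_aux:
  "coeff (a * b) C =
    (\<Sum>A\<in>UNIV. reord_sign A (sym_diff A C) * coeff a A * coeff b (sym_diff A C))"
  by (simp add: times_clifford_def sym_diff_eq_iff)

lemma mult_assoc_aux: "a * b * c = a * (b * c)" for a b c :: "'a clifford"
proof -
  have "coeff (a * b * c) D = coeff (a * (b * c)) D" for D
  proof -
    let ?R = "\<lambda>A Q. reord_sign A (sym_diff A D) * coeff a A *
      (reord_sign Q (sym_diff Q (sym_diff A D)) * coeff b Q * coeff c (sym_diff Q (sym_diff A D)))"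
    have "coeff (a * b * c) D = (\<Sum>P\<in>UNIV. \<Sum>A\<in>UNIV. reord_sign P (sym_diff P D) *
        (reord_sign A (sym_diff A P) * coeff a A * coeff b (sym_diff A P)) * coeff c (sym_diff P D))"
      by (simp only: coeff_mult_aux sum_distrib_left sum_distrib_right)
    also have "\<dots> = (\<Sum>A\<in>UNIV. \<Sum>P\<in>UNIV. reord_sign P (sym_diff P D) *
        (reord_sign A (sym_diff A P) * coeff a A * coeff b (sym_diff A P)) * coeff c (sym_diff P D))"
      by (rule sum.swap)
    also have "\<dots> = (\<Sum>A\<in>UNIV. \<Sum>P\<in>UNIV. ?R A (sym_diff A P))"
    proof (intro sum.cong refl)
      fix A P :: "'a set"
      define Q where "Q = sym_diff A P"
      have P: "P = sym_diff A Q"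
        unfolding Q_def by blast
      have PD: "sym_diff P D = sym_diff Q (sym_diff A D)"
        unfolding Q_def by blast
      have sq: "reord_sign A Q * reord_sign A Q = 1"
        unfolding reord_sign_def by (simp flip: power_mult_distrib)
      have s1: "reord_sign P (sym_diff P D) =
          reord_sign A (sym_diff Q (sym_diff A D)) * reord_sign Q (sym_diff Q (sym_diff A D))"
        unfolding PD by (subst P) (rule reord_sign_sym_diff_left)
      have s2: "reord_sign A (sym_diff Q (sym_diff A D)) = reord_sign A Q * reord_sign A (sym_diff A D)"
        by (rule reord_sign_sym_diff_right)
      have "reord_sign P (sym_diff P D) * reord_sign A Q =
          (reord_sign A Q * reord_sign A Q) * reord_sign A (sym_diff A D) *
          reord_sign Q (sym_diff Q (sym_diff A D))"
        unfolding s1 s2 by (simp only: mult_ac)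
      then have s: "reord_sign P (sym_diff P D) * reord_sign A Q =
          reord_sign A (sym_diff A D) * reord_sign Q (sym_diff Q (sym_diff A D))"
        unfolding sq by simp
      have "reord_sign P (sym_diff P D) * (reord_sign A Q * coeff a A * coeff b Q) *
            coeff c (sym_diff P D)
          = (reord_sign P (sym_diff P D) * reord_sign A Q) *
            (coeff a A * coeff b Q * coeff c (sym_diff P D))"
        by (simp only: mult_ac)
      also have "\<dots> = ?R A Q"
        by (simp only: s) (simp only: PD mult_ac)
      finally show "reord_sign P (sym_diff P D) *
          (reord_sign A (sym_diff A P) * coeff a A * coeff b (sym_diff A P)) *
          coeff c (sym_diff P D) = ?R A (sym_diff A P)"
        unfolding Q_def .
    qed
    also have "\<dots> = (\<Sum>A\<in>UNIV. \<Sum>Q\<in>UNIV. ?R A Q)"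
    proof (rule sum.cong [OF refl])
      fix A :: "'a set"
      have "bij (sym_diff A)"
        by (rule involuntory_imp_bij) (rule sym_diff_cancel)
      then show "(\<Sum>P\<in>UNIV. ?R A (sym_diff A P)) = (\<Sum>Q\<in>UNIV. ?R A Q)"
        by (rule sum.reindex_bij_betw [of "sym_diff A" UNIV UNIV "?R A"])
    qed
    also have "\<dots> = coeff (a * (b * c)) D"
      by (simp only: coeff_mult_aux sum_distrib_left)
    finally show ?thesis .
  qed
  then show ?thesis
    by (simp add: clifford_eq_iff)
qed

instance
proof
  fix a b c :: "'a clifford" and r :: real
  show "a * b * c = a * (b * c)"
    by (rule mult_assoc_aux)
  show "1 * a = a"
    by (simp add: clifford_eq_iff coeff_mult_aux one_clifford_def if_distrib if_distribR cong: if_cong)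
  show "a * 1 = a"
  proof -
    have "sym_diff A C = {} \<longleftrightarrow> A = C" for A C :: "'a set"
      by blast
    then show ?thesis
      by (simp add: clifford_eq_iff coeff_mult_aux one_clifford_def if_distrib if_distribR cong: if_cong)
  qed
  show "(a + b) * c = a * c + b * c" "a * (b + c) = a * b + a * c"
    by (simp_all add: clifford_eq_iff coeff_mult_aux algebra_simps sum.distrib)
  show "(0::'a clifford) \<noteq> 1"
    by (auto simp: clifford_eq_iff one_clifford_def)
  show "r *\<^sub>R a * b = r *\<^sub>R (a * b)" "a * r *\<^sub>R b = r *\<^sub>R (a * b)"
    by (simp_all add: clifford_eq_iff coeff_mult_aux sum_distrib_left algebra_simps)
qed

end

text \<open>Not every nonzero Clifford number is invertible; the inverse is \<open>0\<close> by convention if there is none.\<close>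

instantiation clifford :: ("{finite,linorder}") inverse
begin

definition "inverse a = (if \<exists>b. a * b = 1 \<and> b * a = 1 then THE b. a * b = 1 \<and> b * a = 1 else 0)"
  for a :: "'a clifford"
definition "a div b = a * inverse b" for a b :: "'a clifford"

instance ..

end

definition cbasis :: "'n::{finite,linorder} set \<Rightarrow> 'n clifford" where
  "cbasis A = Clifford (\<lambda>B. if B = A then 1 else 0)"

definition gen :: "'n::{finite,linorder} \<Rightarrow> 'n clifford" where
  "gen i = cbasis {i}"

lemma coeff_cbasis: "coeff (cbasis A) B = (if B = A then 1 else 0)"
  by (simp add: cbasis_def)

lemma cbasis_mult: "cbasis A * cbasis B = reord_sign A B *\<^sub>R cbasis (sym_diff A B)"
proof -
  have "coeff (cbasis A * cbasis B) C = coeff (reord_sign A B *\<^sub>R cbasis (sym_diff A B)) C" for C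
  proof -
    have "coeff (cbasis A * cbasis B) C =
        (\<Sum>D\<in>UNIV. if D = A then reord_sign A (sym_diff A C) * coeff (cbasis B) (sym_diff A C) else 0)"
      unfolding coeff_mult_aux by (rule sum.cong) (auto simp: coeff_cbasis)
    also have "\<dots> = reord_sign A (sym_diff A C) * coeff (cbasis B) (sym_diff A C)"
      by simp
    also have "\<dots> = coeff (reord_sign A B *\<^sub>R cbasis (sym_diff A B)) C"
    proof (cases "sym_diff A C = B")
      case True
      then have "C = sym_diff A B" by blast
      with True show ?thesis by (simp only: coeff_linear coeff_cbasis refl if_True)
    next
      case False
      then have "C \<noteq> sym_diff A B" by blast
      with False show ?thesis by (simp only: coeff_linear coeff_cbasis if_False mult_zero_right)
    qed
    finally show ?thesis .
  qed
  then show ?thesis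
    unfolding clifford_eq_iff by blast
qed

lemma cbasis_empty: "cbasis {} = 1"
  by (simp add: cbasis_def one_clifford_def)

lemma gen_square: "gen i * gen i = - 1"
  by (simp add: gen_def cbasis_mult cbasis_empty reord_sign_prod)

lemma gen_anticommute: "i \<noteq> j \<Longrightarrow> gen i * gen j = - (gen j * gen i)"
proof -
  assume "i \<noteq> j"
  moreover from this have "reord_sign {i} {j} = - reord_sign {j} {i}"
    by (cases "i < j") (auto simp: reord_sign_prod)
  moreover have "sym_diff {i} {j} = sym_diff {j} {i}"
    by blast
  ultimately show ?thesis
    unfolding gen_def cbasis_mult by (simp only: scaleR_minus_left)
qed

lemma cbasis_eq_prod_gen: "cbasis A = prod_list (map gen (sorted_list_of_set A))"
  using finite [of A]
proof (induction A rule: finite_linorder_min_induct)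
  case empty
  then show ?case by (simp add: cbasis_empty)
next
  case (insert x A)
  then have "x \<notin> A" by auto
  then have "sym_diff {x} A = insert x A" by auto
  moreover have "reord_sign {x} A = 1"
    using insert.hyps by (auto simp: reord_sign_prod intro!: prod.neutral)
  ultimately have "gen x * cbasis A = cbasis (insert x A)"
    using cbasis_mult [of "{x}" A] by (simp add: gen_def)
  moreover have "sorted_list_of_set (insert x A) = x # sorted_list_of_set A"
    using insert.hyps \<open>x \<notin> A\<close>
    by (simp add: insort_is_Cons less_imp_le)
  ultimately show ?case
    using insert.IH by simp
qed

lemma clifford_expansion: "a = (\<Sum>A\<in>UNIV. coeff a A *\<^sub>R cbasis A)"
proof -
  have "coeff (\<Sum>A\<in>S. coeff a A *\<^sub>R cbasis A) B = (\<Sum>A\<in>S. coeff a A * coeff (cbasis A) B)"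
    if "finite S" for S B
    using that by induction auto
  then show ?thesis
    by (simp add: clifford_eq_iff cbasis_def if_distrib cong: if_cong)
qed


section \<open>Paravectors and slices\<close>

definition paravectors :: "'n::{finite,linorder} clifford set" where
  "paravectors = {s. \<exists>x0 x. s = of_real x0 + (\<Sum>i\<in>UNIV. x i *\<^sub>R gen i)}"

definition pconj :: "'n::{finite,linorder} clifford \<Rightarrow> 'n clifford" where
  "pconj s = of_real (coeff s {}) - (\<Sum>i\<in>UNIV. coeff s {i} *\<^sub>R gen i)"

definition imag_sphere :: "'n::{finite,linorder} clifford set" where
  "imag_sphere = {s \<in> paravectors. coeff s {} = 0 \<and> norm s = 1}"

definition slice_pt :: "'n::{finite,linorder} clifford \<Rightarrow> real \<Rightarrow> real \<Rightarrow> 'n clifford" where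
  "slice_pt J x y = of_real x + J * of_real y"

definition axially_symmetric :: "'n::{finite,linorder} clifford set \<Rightarrow> bool" where
  "axially_symmetric U \<longleftrightarrow>
    (\<forall>x y. \<forall>J\<in>imag_sphere. slice_pt J x y \<in> U \<longrightarrow> (\<forall>I\<in>imag_sphere. slice_pt I x y \<in> U))"

text \<open>\<open>e\<^sup>J\<^sup>\<phi>\<close>; the library's \<open>exp\<close> does not apply, as the norm is not submultiplicative.\<close>

definition slice_exp :: "'n::{finite,linorder} clifford \<Rightarrow> real \<Rightarrow> 'n clifford" where
  "slice_exp J \<phi> = slice_pt J (cos \<phi>) (sin \<phi>)"


section \<open>Slice hyperholomorphic functions\<close>

text \<open>
  Functions on \<open>U\<close> are represented by total functions, of which only the values on \<open>U\<close> matter.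
\<close>

definition slice_domain :: "'n::{finite,linorder} clifford set \<Rightarrow> (real \<times> real) set" where
  "slice_domain U = {(x, y). \<forall>J\<in>imag_sphere. slice_pt J x y \<in> U}"

text \<open>
  \<open>f0'\<close> and \<open>f1'\<close> are the continuous derivatives of \<open>f0\<close> and \<open>f1\<close>, so that \<open>f0' p (1, 0)\<close> and
  \<open>f0' p (0, 1)\<close> are the partial derivatives of \<open>f0\<close> at \<open>p\<close>.
\<close>

definition slice_components ::
    "'n::{finite,linorder} clifford set \<Rightarrow> ('n clifford \<Rightarrow> 'n clifford) \<Rightarrow>
      (real \<times> real \<Rightarrow> 'n clifford) \<Rightarrow> (real \<times> real \<Rightarrow> 'n clifford) \<Rightarrow> bool" where
  "slice_components U f f0 f1 \<longleftrightarrow>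
    (\<forall>(x, y)\<in>slice_domain U.
        (\<forall>J\<in>imag_sphere. f (slice_pt J x y) = f0 (x, y) + J * f1 (x, y)) \<and>
        f0 (x, - y) = f0 (x, y) \<and> f1 (x, - y) = - f1 (x, y)) \<and>
    (\<exists>f0' f1' :: real \<times> real \<Rightarrow> (real \<times> real) \<Rightarrow>\<^sub>L 'n clifford.
        continuous_on (slice_domain U) f0' \<and> continuous_on (slice_domain U) f1' \<and>
        (\<forall>p\<in>slice_domain U.
          (f0 has_derivative blinfun_apply (f0' p)) (at p) \<and>
          (f1 has_derivative blinfun_apply (f1' p)) (at p) \<and>
          blinfun_apply (f0' p) (1, 0) = blinfun_apply (f1' p) (0, 1) \<and>
          blinfun_apply (f0' p) (0, 1) = - blinfun_apply (f1' p) (1, 0)))"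

definition SH_L :: "'n::{finite,linorder} clifford set \<Rightarrow> ('n clifford \<Rightarrow> 'n clifford) set" where
  "SH_L U = {f. openin (top_of_set paravectors) U \<and> axially_symmetric U \<and>
    (\<exists>f0 f1. slice_components U f f0 f1)}"

definition intrinsic :: "'n::{finite,linorder} clifford set \<Rightarrow> ('n clifford \<Rightarrow> 'n clifford) set" where
  "intrinsic U = {f. openin (top_of_set paravectors) U \<and> axially_symmetric U \<and>
    (\<exists>f0 f1. slice_components U f f0 f1 \<and> (\<forall>p\<in>slice_domain U. f0 p \<in> \<real> \<and> f1 p \<in> \<real>))}"


section \<open>The Clifford module and its operators\<close>

text \<open>
  For a Banach space \<open>'v\<close>, the module \<open>V\<close> is \<open>'v ^ 'n set\<close>, with the library's Euclidean product
  norm; \<open>axis A u\<close> is \<open>u \<otimes> e_A\<close>.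
\<close>

definition lmul :: "'n::{finite,linorder} clifford \<Rightarrow> 'v::real_vector ^ 'n set \<Rightarrow> 'v ^ 'n set" where
  "lmul a v = (\<Sum>A\<in>UNIV. \<Sum>B\<in>UNIV.
    axis (sym_diff A B) ((reord_sign A B * coeff a A) *\<^sub>R (v $ B)))"

definition rmul :: "'v::real_vector ^ 'n set \<Rightarrow> 'n::{finite,linorder} clifford \<Rightarrow> 'v ^ 'n set" where
  "rmul v a = (\<Sum>A\<in>UNIV. \<Sum>B\<in>UNIV.
    axis (sym_diff A B) ((reord_sign A B * coeff a B) *\<^sub>R (v $ A)))"

lemma bounded_linear_axis: "bounded_linear (axis A :: 'v::real_normed_vector \<Rightarrow> 'v ^ 'm::finite)"
proof (rule bounded_linear_intro [where K = 1])
  fix x :: 'v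
  have "norm (axis A x :: 'v ^ 'm) \<le> (\<Sum>i\<in>UNIV. norm (axis A x $ i))"
    unfolding norm_vec_def by (rule L2_set_le_sum) simp
  also have "\<dots> = norm x"
    by (simp add: axis_def if_distrib cong: if_cong)
  finally show "norm (axis A x :: 'v ^ 'm) \<le> norm x * 1" by simp
qed (auto simp: axis_def vec_eq_iff)

lift_definition lmul_op ::
    "'n::{finite,linorder} clifford \<Rightarrow> ('v::real_normed_vector ^ 'n set) \<Rightarrow>\<^sub>L ('v ^ 'n set)"
  is lmul
  unfolding lmul_def [abs_def]
  by (intro bounded_linear_sum bounded_linear_compose [OF bounded_linear_axis]
      bounded_linear_compose [OF bounded_linear_scaleR_right] bounded_linear_vec_nth)

text \<open>\<open>\<B>(V)\<close>\<close>

definition right_linear_bounded :: "(('v::real_normed_vector ^ 'n::{finite,linorder} set) \<Rightarrow>\<^sub>L ('v ^ 'n set)) set" where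
  "right_linear_bounded =
    {A. \<forall>v a. blinfun_apply A (rmul v a) = rmul (blinfun_apply A v) a}"

text \<open>
  An unbounded operator is a partial function, with domain \<open>dom T\<close>; \<open>T \<circ>\<^sub>m T\<close> is then \<open>T\<^sup>2\<close> with its
  natural domain. The following set is \<open>\<K>(V)\<close>. Real linearity is the case of real scalars in the
  third condition.
\<close>

definition closed_right_linear :: "('v::real_normed_vector ^ 'n::{finite,linorder} set \<rightharpoonup> 'v ^ 'n set) set" where
  "closed_right_linear = {T.
    T 0 = Some 0 \<and>
    (\<forall>u v x y. T u = Some x \<longrightarrow> T v = Some y \<longrightarrow> T (u + v) = Some (x + y)) \<and>
    (\<forall>v x a. T v = Some x \<longrightarrow> T (rmul v a) = Some (rmul x a)) \<and>
    closed {(v, x). T v = Some x}}"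

definition is_bounded_inverse ::
    "('v::real_normed_vector ^ 'n::{finite,linorder} set \<rightharpoonup> 'v ^ 'n set) \<Rightarrow>
      (('v ^ 'n set) \<Rightarrow>\<^sub>L ('v ^ 'n set)) \<Rightarrow> bool" where
  "is_bounded_inverse P A \<longleftrightarrow>
    A \<in> right_linear_bounded \<and> (\<forall>v w. P v = Some w \<longleftrightarrow> blinfun_apply A w = v)"

definition bounded_inverse ::
    "('v::real_normed_vector ^ 'n::{finite,linorder} set \<rightharpoonup> 'v ^ 'n set) \<Rightarrow>
      ('v ^ 'n set) \<Rightarrow>\<^sub>L ('v ^ 'n set)" where
  "bounded_inverse P = (THE A. is_bounded_inverse P A)"

definition Q_op :: "'n::{finite,linorder} clifford \<Rightarrow>
    ('v::real_normed_vector ^ 'n set \<rightharpoonup> 'v ^ 'n set) \<Rightarrow> ('v ^ 'n set \<rightharpoonup> 'v ^ 'n set)" where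
  "Q_op s T v = (if v \<in> dom (T \<circ>\<^sub>m T)
    then Some (the ((T \<circ>\<^sub>m T) v) - (2 * coeff s {}) *\<^sub>R the (T v) + (norm s)\<^sup>2 *\<^sub>R v)
    else None)"

definition S_resolvent_set ::
    "('v::real_normed_vector ^ 'n::{finite,linorder} set \<rightharpoonup> 'v ^ 'n set) \<Rightarrow> 'n clifford set" where
  "S_resolvent_set T = {s \<in> paravectors. \<exists>A. is_bounded_inverse (Q_op s T) A}"

definition S_spectrum ::
    "('v::real_normed_vector ^ 'n::{finite,linorder} set \<rightharpoonup> 'v ^ 'n set) \<Rightarrow> 'n clifford set" where
  "S_spectrum T = paravectors - S_resolvent_set T"

text \<open>
  For closed \<open>T\<close> and \<open>s\<close> in the resolvent set the map below is bounded, by the closed graph theorem.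
\<close>

definition S_L_inv :: "'n::{finite,linorder} clifford \<Rightarrow>
    ('v::real_normed_vector ^ 'n set \<rightharpoonup> 'v ^ 'n set) \<Rightarrow> ('v ^ 'n set) \<Rightarrow>\<^sub>L ('v ^ 'n set)" where
  "S_L_inv s T = Blinfun (\<lambda>v. blinfun_apply (bounded_inverse (Q_op s T)) (lmul (pconj s) v)
    - the (T (blinfun_apply (bounded_inverse (Q_op s T)) v)))"


section \<open>Bisectorial operators\<close>

definition I_angle :: "real \<Rightarrow> real set" where
  "I_angle \<omega> = {- \<omega> <..< \<omega>} \<union> {pi - \<omega> <..< pi + \<omega>}"

definition double_sector :: "real \<Rightarrow> 'n::{finite,linorder} clifford set" where
  "double_sector \<omega> = {r *\<^sub>R slice_exp J \<phi> | r J \<phi>. r > 0 \<and> J \<in> imag_sphere \<and> \<phi> \<in> I_angle \<omega>}"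

definition bisectorial :: "real \<Rightarrow>
    ('v::real_normed_vector ^ 'n::{finite,linorder} set \<rightharpoonup> 'v ^ 'n set) \<Rightarrow> bool" where
  "bisectorial \<omega> T \<longleftrightarrow>
    T \<in> closed_right_linear \<and>
    S_spectrum T \<subseteq> closure (double_sector \<omega>) \<and>
    (\<forall>\<phi>\<in>{\<omega> <..< pi / 2}. \<exists>C\<ge>0. \<forall>s\<in>paravectors - (double_sector \<phi> \<union> {0}).
      norm (S_L_inv s T) \<le> C / norm s)"


section \<open>The functional calculi\<close>

definition SH_L_0 :: "real \<Rightarrow> ('n::{finite,linorder} clifford \<Rightarrow> 'n clifford) set" where
  "SH_L_0 \<theta> = {f \<in> SH_L (double_sector \<theta>).
    bounded (f ` double_sector \<theta>) \<and>
    (\<forall>J\<in>imag_sphere. \<forall>\<phi>\<in>I_angle \<theta>.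
      (\<integral>\<^sup>+t\<in>{0<..}. ennreal (norm (f (t *\<^sub>R slice_exp J \<phi>)) / t) \<partial>lborel) < \<infinity>)}"

definition N_0 :: "real \<Rightarrow> ('n::{finite,linorder} clifford \<Rightarrow> 'n clifford) set" where
  "N_0 \<theta> = SH_L_0 \<theta> \<inter> intrinsic (double_sector \<theta>)"

definition bnd_decomposition :: "real \<Rightarrow> ('n::{finite,linorder} clifford \<Rightarrow> 'n clifford) \<Rightarrow>
    'n clifford \<Rightarrow> 'n clifford \<Rightarrow> ('n clifford \<Rightarrow> 'n clifford) \<Rightarrow> bool" where
  "bnd_decomposition \<theta> f f0 finf ft \<longleftrightarrow>
    ft \<in> SH_L_0 \<theta> \<and>
    (\<forall>s\<in>double_sector \<theta>. f s = finf + 1 / (1 + s\<^sup>2) * (f0 - finf) + ft s)"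

definition SH_L_bnd :: "real \<Rightarrow> ('n::{finite,linorder} clifford \<Rightarrow> 'n clifford) set" where
  "SH_L_bnd \<theta> = {f. \<exists>f0 finf ft. bnd_decomposition \<theta> f f0 finf ft}"

definition N_bnd :: "real \<Rightarrow> ('n::{finite,linorder} clifford \<Rightarrow> 'n clifford) set" where
  "N_bnd \<theta> = {f. \<exists>f0 finf ft. bnd_decomposition \<theta> f f0 finf ft \<and>
    f0 \<in> \<real> \<and> finf \<in> \<real> \<and> ft \<in> N_0 \<theta>}"

text \<open>The two branches of the contour correspond to \<open>\<sigma> = 1\<close> and \<open>\<sigma> = -1\<close>.\<close>

definition contour :: "real \<Rightarrow> real \<Rightarrow> 'n::{finite,linorder} clifford \<Rightarrow> real \<Rightarrow> 'n clifford" where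
  "contour \<sigma> \<phi> J t = (\<sigma> * \<bar>t\<bar>) *\<^sub>R slice_exp J (- sgn t * \<phi>)"

text \<open>
  The integrand is continuous away from \<open>t = 0\<close> and absolutely integrable in operator norm.
  The Henstock-Kurzweil integral is used because the library's Bochner integral needs a separable
  target space, which the space of bounded operators is not. For bisectorial \<open>T\<close> of angle \<open>\<omega>\<close> and
  \<open>f \<in> SH_L_0 \<theta>\<close> the value does not depend on \<open>\<phi> \<in> (\<omega>, \<theta>)\<close> and \<open>J \<in> imag_sphere\<close>; both are kept as
  explicit parameters.
\<close>

definition omega_calculus :: "real \<Rightarrow> 'n::{finite,linorder} clifford \<Rightarrow>
    ('v::banach ^ 'n set \<rightharpoonup> 'v ^ 'n set) \<Rightarrow> ('n clifford \<Rightarrow> 'n clifford) \<Rightarrow>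
    ('v ^ 'n set) \<Rightarrow>\<^sub>L ('v ^ 'n set)" where
  "omega_calculus \<phi> J T f = (1 / (2 * pi)) *\<^sub>R (\<Sum>\<sigma>\<in>{1, - 1}. integral UNIV (\<lambda>t.
    S_L_inv (contour \<sigma> \<phi> J t) T
    o\<^sub>L lmul_op (vector_derivative (contour \<sigma> \<phi> J) (at t) / J)
    o\<^sub>L lmul_op (f (contour \<sigma> \<phi> J t))))"

definition one_plus_square ::
    "('v::real_normed_vector ^ 'n::{finite,linorder} set \<rightharpoonup> 'v ^ 'n set) \<Rightarrow> ('v ^ 'n set \<rightharpoonup> 'v ^ 'n set)" where
  "one_plus_square T v = map_option (\<lambda>w. v + w) ((T \<circ>\<^sub>m T) v)"

text \<open>
  The constants \<open>f0\<close>, \<open>finf\<close> and the values of \<open>ft\<close> on the double sector are uniquely determined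
  by \<open>f\<close>, so the choice below does not affect the result.
\<close>

definition ext_omega_calculus :: "real \<Rightarrow> real \<Rightarrow> 'n::{finite,linorder} clifford \<Rightarrow>
    ('v::banach ^ 'n set \<rightharpoonup> 'v ^ 'n set) \<Rightarrow> ('n clifford \<Rightarrow> 'n clifford) \<Rightarrow>
    ('v ^ 'n set) \<Rightarrow>\<^sub>L ('v ^ 'n set)" where
  "ext_omega_calculus \<theta> \<phi> J T f =
    (case (SOME (f0, finf, ft). bnd_decomposition \<theta> f f0 finf ft) of (f0, finf, ft) \<Rightarrow>
      lmul_op finf
      + (bounded_inverse (one_plus_square T) o\<^sub>L lmul_op (f0 - finf))
      + omega_calculus \<phi> J T ft)"

end

theory Submission
  imports Defs "HOL-Complex_Analysis.Complex_Analysis"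
begin

text \<open>
  Along every slice, \<open>f\<close> is \<open>\<Sum>\<^sub>A F\<^sub>A e\<^sub>A\<close> with intrinsic \<open>F\<^sub>A\<close>, and
  \<open>S\<^sub>L\<inverse>(x + J y, T) = R0 z + R1 z J\<close> where \<open>z = x + \<i> y\<close> and \<open>R0 z + \<i> R1 z\<close> is the resolvent of \<open>T\<close> on the
  complexification of \<open>V\<close>. The term with \<open>R1 z J\<close> drops out of the integral because of the symmetry
  under complex conjugation, hence \<open>f(T) = \<Sum>\<^sub>A F\<^sub>A(T) e\<^sub>A\<close>, where \<open>F\<^sub>A(T)\<close> is a Riesz--Dunford integral that
  involves only \<open>R0\<close> and \<open>R1\<close>. This reduces the product rule to that of the holomorphic calculus of a bisectorial
  operator, which follows from the resolvent identity and Cauchy's formula on two nested contours.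
  As the integrals are tested against functionals, scalar complex analysis suffices.
\<close>

section \<open>Real functionals and improper integrals\<close>

text \<open>The units \<open>e_A\<close> stand to the right of the coefficient functions. On each
  slice an intrinsic \<open>g\<close> is one complex function that multiplies every
  \<open>F_A\<close> from the left within the slice; this is where intrinsicness of \<open>g\<close>
  enters, and multiplication by \<open>e_A\<close> never has to pass \<open>T\<close>. Rays are
  written as z = exp (x + i a), so that turning a contour becomes shifting a horizontal line, and
  integrability against dt / t becomes plain integrability in x. The values at 0 and infinity do not
  decay, and their products are handled by algebra. Two decompositions multiply to a term e^2 with e
  = 1 / (1 + z^2); it is rewritten as e - (z e)^2, and z e decays, so the remainder is again
  admissible. The operators (1 + T^2)^-1 and T (1 + T^2)^-1 satisfy the same identity. Hence,
  besides the product of two decaying functions, the calculus must be computed for z e, where it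
  gives T (1 + T^2)^-1, and for e times a decaying function.\<close>

lemma hahn_banach_extension_step:
  fixes M :: "('a::real_normed_vector \<times> real) set"
  assumes M: "subspace M" and le: "\<And>x a. (x, a) \<in> M \<Longrightarrow> a \<le> norm x"
  obtains M' b where "subspace M'" "\<And>x a. (x, a) \<in> M' \<Longrightarrow> a \<le> norm x" "M \<subseteq> M'" "(y, b) \<in> M'"
proof -
  \<comment> \<open>\<open>L\<close> collects the lower bounds that the pairs of \<open>M\<close>
    impose on the value at \<open>y\<close>; by \<open>cross\<close> each of them is below every
    upper bound \<open>norm (x + y) - a\<close>, so the supremum meets all constraints.\<close>
  define L where "L = {a - norm (x - y) | x a. (x, a) \<in> M}"
  have cross: "a - norm (x - y) \<le> norm (x' + y) - a'" if "(x, a) \<in> M" "(x', a') \<in> M" for x a x' a'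
  proof -
    have "(x + x', a + a') \<in> M"
      using subspace_add [OF M that] by simp
    then have "a + a' \<le> norm ((x - y) + (x' + y))"
      using le by fastforce
    also have "\<dots> \<le> norm (x - y) + norm (x' + y)"
      by (rule norm_triangle_ineq)
    finally show ?thesis by simp
  qed
  have zero: "(0, 0) \<in> M"
    using subspace_0 [OF M] by (simp add: zero_prod_def)
  have L: "L \<noteq> {}" "bdd_above L"
    using zero cross [OF _ zero] by (auto simp: L_def bdd_above_def)
  define b where "b = Sup L"
  have lower: "a - norm (x - y) \<le> b" if "(x, a) \<in> M" for x a
    unfolding b_def using that L by (intro cSup_upper) (auto simp: L_def)
  have upper: "b \<le> norm (x + y) - a" if "(x, a) \<in> M" for x a
    unfolding b_def using that L cross by (intro cSup_least) (auto simp: L_def)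
  define M' where "M' = {m + t *\<^sub>R (y, b) | m t. m \<in> M}"
  show ?thesis
  proof
    show "subspace M'"
      unfolding M'_def
    proof (rule subspaceI)
      show "0 \<in> {m + t *\<^sub>R (y, b) | m t. m \<in> M}"
        using subspace_0 [OF M] by (metis (mono_tags, lifting) add.right_neutral mem_Collect_eq scale_zero_left)
    next
      fix p q assume "p \<in> {m + t *\<^sub>R (y, b) | m t. m \<in> M}" "q \<in> {m + t *\<^sub>R (y, b) | m t. m \<in> M}"
      then obtain m t n s where "p = m + t *\<^sub>R (y, b)" "m \<in> M" "q = n + s *\<^sub>R (y, b)" "n \<in> M"
        by blast
      then have "p + q = (m + n) + (t + s) *\<^sub>R (y, b)" "m + n \<in> M"
        using subspace_add [OF M] by (auto simp: algebra_simps)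
      then show "p + q \<in> {m + t *\<^sub>R (y, b) | m t. m \<in> M}"
        by blast
    next
      fix c p assume "p \<in> {m + t *\<^sub>R (y, b) | m t. m \<in> M}"
      then obtain m t where "p = m + t *\<^sub>R (y, b)" "m \<in> M"
        by blast
      then have "c *\<^sub>R p = c *\<^sub>R m + (c * t) *\<^sub>R (y, b)" "c *\<^sub>R m \<in> M"
        using subspace_scale [OF M] by (auto simp: algebra_simps)
      then show "c *\<^sub>R p \<in> {m + t *\<^sub>R (y, b) | m t. m \<in> M}"
        by blast
    qed
    show "M \<subseteq> M'"
      unfolding M'_def by (force intro: exI [of _ 0])
    show "(y, b) \<in> M'"
      unfolding M'_def using zero by (force intro: exI [of _ 1])
    fix x a assume "(x, a) \<in> M'"
    then obtain u d t where ud: "(u, d) \<in> M" and x: "x = u + t *\<^sub>R y" and a: "a = d + t * b"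
      unfolding M'_def by auto
    have scaled: "(r *\<^sub>R u, r * d) \<in> M" for r
      using subspace_scale [OF M ud, of r] by simp
    consider "t = 0" | "t > 0" | "t < 0" by linarith
    then show "a \<le> norm x"
    proof cases
      case 1
      then show ?thesis using le ud x a by simp
    next
      case 2
      have "t * b \<le> t * (norm ((1 / t) *\<^sub>R u + y) - (1 / t) * d)"
        using 2 upper [OF scaled [of "1 / t"]] by (intro mult_left_mono) auto
      also have "\<dots> = norm (t *\<^sub>R ((1 / t) *\<^sub>R u + y)) - d"
        using 2 by (simp only: norm_scaleR) (simp add: right_diff_distrib)
      also have "t *\<^sub>R ((1 / t) *\<^sub>R u + y) = x"
        using 2 by (simp add: x algebra_simps)
      finally show ?thesis by (simp add: a)
    next
      case 3
      define s where "s = - t"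
      have s: "s > 0" "x = u - s *\<^sub>R y" "a = d - s * b"
        using 3 x a by (simp_all add: s_def)
      have "s * ((1 / s) * d - norm ((1 / s) *\<^sub>R u - y)) \<le> s * b"
        using s(1) lower [OF scaled [of "1 / s"]] by (intro mult_left_mono) auto
      moreover have "s * ((1 / s) * d - norm ((1 / s) *\<^sub>R u - y)) = d - norm (s *\<^sub>R ((1 / s) *\<^sub>R u - y))"
        using s(1) by (simp only: norm_scaleR) (simp add: right_diff_distrib)
      moreover have "s *\<^sub>R ((1 / s) *\<^sub>R u - y) = x"
        using s(1) by (simp add: s(2) scaleR_diff_right)
      ultimately show ?thesis by (simp add: s(3))
    qed
  qed
qed

text \<open>
  Functionals dominated by the norm are encoded by their graphs: for a subspace \<open>M\<close> of the product,
  \<open>a \<le> norm x\<close> on \<open>M\<close> already forces \<open>M\<close> to be single-valued.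
\<close>

lemma exists_norming_functional:
  fixes x0 :: "'a::real_normed_vector"
  obtains f :: "'a \<Rightarrow>\<^sub>L real" where "blinfun_apply f x0 = norm x0"
proof -
  define \<A> where "\<A> = {M :: ('a \<times> real) set.
    subspace M \<and> (\<forall>x a. (x, a) \<in> M \<longrightarrow> a \<le> norm x) \<and> (x0, norm x0) \<in> M}"
  define M0 where "M0 = span {(x0, norm x0)}"
  have "a \<le> norm x" if "(x, a) \<in> M0" for x a
  proof -
    from that obtain k where "x = k *\<^sub>R x0" "a = k * norm x0"
      by (auto simp: M0_def span_singleton)
    then show ?thesis
      by (simp add: mult_right_mono)
  qed
  then have M0: "M0 \<in> \<A>"
    by (auto simp: \<A>_def M0_def span_base)
  have "\<exists>M\<in>\<A>. \<forall>X\<in>\<A>. M \<subseteq> X \<longrightarrow> X = M"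
  proof (rule subset_Zorn_nonempty)
    show "\<A> \<noteq> {}" using M0 by blast
    fix \<C> assume ne: "\<C> \<noteq> {}" and chain: "subset.chain \<A> \<C>"
    then have sub: "\<C> \<subseteq> \<A>" and tot: "\<And>X Y. X \<in> \<C> \<Longrightarrow> Y \<in> \<C> \<Longrightarrow> X \<subseteq> Y \<or> Y \<subseteq> X"
      by (auto simp: subset_chain_def)
    have "subspace (\<Union>\<C>)"
    proof (rule subspaceI)
      obtain X where X: "X \<in> \<C>"
        using ne by blast
      then have "subspace X"
        using sub by (auto simp: \<A>_def)
      then show "0 \<in> \<Union>\<C>"
        using X subspace_0 by blast
    next
      fix p q assume "p \<in> \<Union>\<C>" "q \<in> \<Union>\<C>"
      then obtain X where "X \<in> \<C>" "p \<in> X" "q \<in> X"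
        using tot by blast
      then show "p + q \<in> \<Union>\<C>"
        using sub by (auto simp: \<A>_def intro: subspace_add)
    next
      fix c p assume "p \<in> \<Union>\<C>"
      then show "c *\<^sub>R p \<in> \<Union>\<C>"
        using sub by (auto simp: \<A>_def intro: subspace_scale)
    qed
    then show "\<Union>\<C> \<in> \<A>"
      using ne sub by (auto simp: \<A>_def)
  qed
  then obtain M where M: "M \<in> \<A>" and max: "\<And>X. X \<in> \<A> \<Longrightarrow> M \<subseteq> X \<Longrightarrow> X = M"
    by blast
  have sub: "subspace M" and le: "\<And>x a. (x, a) \<in> M \<Longrightarrow> a \<le> norm x" and x0: "(x0, norm x0) \<in> M"
    using M by (auto simp: \<A>_def)
  have total: "\<exists>a. (y, a) \<in> M" for y
  proof -
    obtain M' b where M': "subspace M'" "\<And>x a. (x, a) \<in> M' \<Longrightarrow> a \<le> norm x" "M \<subseteq> M'" "(y, b) \<in> M'"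
      using hahn_banach_extension_step [OF sub le] by metis
    then have "M' \<in> \<A>"
      using x0 by (auto simp: \<A>_def)
    then have "M' = M"
      using max M' by blast
    then show ?thesis using M' by blast
  qed
  have unique: "a = b" if "(y, a) \<in> M" "(y, b) \<in> M" for y a b
  proof -
    have "(0, a - b) \<in> M" "(0, b - a) \<in> M"
      using subspace_diff [OF sub that] subspace_diff [OF sub that(2) that(1)] by simp_all
    from le [OF this(1)] le [OF this(2)] show ?thesis by simp
  qed
  define f where "f y = (THE a. (y, a) \<in> M)" for y
  have f: "(y, f y) \<in> M" for y
  proof -
    have "\<exists>!a. (y, a) \<in> M"
      using total [of y] unique by (intro ex_ex1I)
    then show ?thesis
      unfolding f_def by (rule theI')
  qed
  have f_eq: "f y = a" if "(y, a) \<in> M" for y a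
    using f that unique by blast
  have "bounded_linear f"
  proof (rule bounded_linear_intro [where K = 1])
    show "f (x + y) = f x + f y" for x y
      using subspace_add [OF sub f f, of x y] by (intro f_eq) simp
    show "f (r *\<^sub>R x) = r *\<^sub>R f x" for r x
      using subspace_scale [OF sub f, of r x] by (intro f_eq) simp
    show "norm (f x) \<le> norm x * 1" for x
      using le [OF f, of x] le [of "- x" "- f x"] subspace_neg [OF sub f, of x] by (simp add: abs_le_iff)
  qed
  then have "blinfun_apply (Blinfun f) x0 = norm x0"
    using f_eq [OF x0] by (simp add: bounded_linear_Blinfun_apply)
  then show ?thesis using that by blast
qed

text \<open>Norming functionals separate points, so an identity of operators may be checked after
  applying a real functional to the image of a vector.\<close>

lemma blinfun_eq_by_functionals:
  fixes A B :: "'a::real_normed_vector \<Rightarrow>\<^sub>L 'b::real_normed_vector"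
  assumes "\<And>(l :: 'b \<Rightarrow>\<^sub>L real) v. l (A v) = l (B v)"
  shows "A = B"
proof (rule blinfun_eqI)
  fix v
  obtain l :: "'b \<Rightarrow>\<^sub>L real" where l: "l (A v - B v) = norm (A v - B v)"
    using exists_norming_functional by blast
  have "norm (A v - B v) = 0"
    using assms [of l v] l by (simp add: blinfun.diff_right)
  then show "A v = B v" by simp
qed

section \<open>Gauge integrals with values in a Banach space\<close>

text \<open>Along a fine tagged division the Riemann sums of \<open>f\<close> and \<open>g\<close>
  differ by at most the Riemann sum of \<open>m\<close>, which is close to its small integral. The
  Cauchy criterion for \<open>g\<close> therefore passes to \<open>f\<close>; only norms of values
  are compared, so any Banach space may be the target.\<close>

lemma integrable_on_interval_approx:
  fixes f :: "real \<Rightarrow> 'a::banach"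
  assumes "\<And>e. e > 0 \<Longrightarrow> \<exists>g m. g integrable_on {a..b} \<and> m integrable_on {a..b} \<and>
    integral {a..b} m < e \<and> (\<forall>x\<in>{a..b}. norm (f x - g x) \<le> m x)"
  shows "f integrable_on {a..b}"
proof -
  have "f integrable_on cbox a b"
    unfolding integrable_Cauchy
  proof (intro allI impI)
    fix e :: real assume "e > 0"
    \<comment> \<open>The budget is \<open>e / 2\<close> for the sums of \<open>g\<close> and twice
      \<open>e / 4\<close> for the passage from \<open>f\<close> to \<open>g\<close>; the latter
      consists of the integral of \<open>m\<close>, below \<open>e / 8\<close>, and a Riemann sum
      error of \<open>e / 8\<close>.\<close>
    then obtain g m where g: "g integrable_on cbox a b" and m: "m integrable_on cbox a b"
      and im: "integral (cbox a b) m < e / 8" and le: "\<And>x. x \<in> cbox a b \<Longrightarrow> norm (f x - g x) \<le> m x"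
      using assms [of "e / 8"] by auto
    have "e / 2 > 0" using \<open>e > 0\<close> by simp
    from g [unfolded integrable_Cauchy, rule_format, OF this]
    obtain \<gamma>1 where \<gamma>1: "gauge \<gamma>1" "\<forall>\<D>1 \<D>2. \<D>1 tagged_division_of cbox a b \<and> \<gamma>1 fine \<D>1 \<and>
        \<D>2 tagged_division_of cbox a b \<and> \<gamma>1 fine \<D>2 \<longrightarrow>
        norm ((\<Sum>(x, K)\<in>\<D>1. measure lborel K *\<^sub>R g x) - (\<Sum>(x, K)\<in>\<D>2. measure lborel K *\<^sub>R g x)) < e / 2"
      by (elim exE conjE) (rule that)
    have "e / 8 > 0" using \<open>e > 0\<close> by simp
    from integrable_integral [OF m, unfolded has_integral, rule_format, OF this]
    obtain \<gamma>2 where \<gamma>2: "gauge \<gamma>2" "\<forall>\<D>. \<D> tagged_division_of cbox a b \<and> \<gamma>2 fine \<D> \<longrightarrow>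
        norm ((\<Sum>(x, K)\<in>\<D>. measure lborel K *\<^sub>R m x) - integral (cbox a b) m) < e / 8"
      by (elim exE conjE) (rule that)
    have sum_le: "norm ((\<Sum>(x, K)\<in>\<D>. measure lborel K *\<^sub>R f x) - (\<Sum>(x, K)\<in>\<D>. measure lborel K *\<^sub>R g x)) \<le> e / 4"
      if D: "\<D> tagged_division_of cbox a b" "\<gamma>2 fine \<D>" for \<D>
    proof -
      have "(\<Sum>(x, K)\<in>\<D>. measure lborel K *\<^sub>R f x) - (\<Sum>(x, K)\<in>\<D>. measure lborel K *\<^sub>R g x) =
          (\<Sum>(x, K)\<in>\<D>. measure lborel K *\<^sub>R (f x - g x))"
        by (simp add: sum_subtractf [symmetric] scaleR_diff_right case_prod_beta)
      also have "norm \<dots> \<le> (\<Sum>(x, K)\<in>\<D>. measure lborel K *\<^sub>R m x)"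
      proof (rule sum_norm_le, clarify)
        fix x K assume "(x, K) \<in> \<D>"
        then have "x \<in> cbox a b"
          using tagged_division_ofD(2,3) [OF D(1)] by blast
        then show "norm (measure lborel K *\<^sub>R (f x - g x)) \<le> measure lborel K *\<^sub>R m x"
          using le by (simp add: mult_left_mono)
      qed
      also have "\<dots> \<le> e / 4"
        using \<gamma>2(2) [rule_format, OF conjI [OF D]] im unfolding real_norm_def by linarith
      finally show ?thesis .
    qed
    show "\<exists>\<gamma>. gauge \<gamma> \<and> (\<forall>\<D>1 \<D>2. \<D>1 tagged_division_of cbox a b \<and> \<gamma> fine \<D>1 \<and>
        \<D>2 tagged_division_of cbox a b \<and> \<gamma> fine \<D>2 \<longrightarrow>
        norm ((\<Sum>(x, K)\<in>\<D>1. measure lborel K *\<^sub>R f x) - (\<Sum>(x, K)\<in>\<D>2. measure lborel K *\<^sub>R f x)) < e)"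
    proof (intro exI conjI allI impI; (elim conjE)?)
      show "gauge (\<lambda>x. \<gamma>1 x \<inter> \<gamma>2 x)"
        using \<gamma>1(1) \<gamma>2(1) by (rule gauge_Int)
      fix \<D>1 \<D>2
      assume D: "\<D>1 tagged_division_of cbox a b" "(\<lambda>x. \<gamma>1 x \<inter> \<gamma>2 x) fine \<D>1"
        "\<D>2 tagged_division_of cbox a b" "(\<lambda>x. \<gamma>1 x \<inter> \<gamma>2 x) fine \<D>2"
      define F where "F = (\<lambda>\<D> :: (real \<times> real set) set. \<Sum>(x, K)\<in>\<D>. measure lborel K *\<^sub>R f x)"
      define G where "G = (\<lambda>\<D> :: (real \<times> real set) set. \<Sum>(x, K)\<in>\<D>. measure lborel K *\<^sub>R g x)"
      have fine: "\<gamma>1 fine \<D>1" "\<gamma>2 fine \<D>1" "\<gamma>1 fine \<D>2" "\<gamma>2 fine \<D>2"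
        using D(2,4) by (simp_all add: fine_Int)
      have "norm (F \<D>1 - G \<D>1) \<le> e / 4" "norm (F \<D>2 - G \<D>2) \<le> e / 4" "norm (G \<D>1 - G \<D>2) < e / 2"
        unfolding F_def G_def
        by (rule sum_le [OF D(1) fine(2)], rule sum_le [OF D(3) fine(4)],
          rule \<gamma>1(2) [rule_format, OF conjI [OF D(1) conjI [OF fine(1) conjI [OF D(3) fine(3)]]]])
      moreover have "F \<D>1 - F \<D>2 = (F \<D>1 - G \<D>1) + (G \<D>1 - G \<D>2) + (G \<D>2 - F \<D>2)"
        by simp
      ultimately have "norm (F \<D>1 - F \<D>2) < e"
        using norm_triangle_ineq [of "F \<D>1 - G \<D>1 + (G \<D>1 - G \<D>2)" "G \<D>2 - F \<D>2"]
          norm_triangle_ineq [of "F \<D>1 - G \<D>1" "G \<D>1 - G \<D>2"]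
        by (simp add: norm_minus_commute)
      then show "norm ((\<Sum>(x, K)\<in>\<D>1. measure lborel K *\<^sub>R f x) - (\<Sum>(x, K)\<in>\<D>2. measure lborel K *\<^sub>R f x)) < e"
        by (simp add: F_def G_def)
    qed
  qed
  then show ?thesis by simp
qed

text \<open>Lebesgue theory is not available for functions with values in a non-separable space.\<close>

lemma integrable_on_UNIV_punctured_bound:
  fixes f :: "real \<Rightarrow> 'a::banach"
  assumes cont: "continuous_on (- {0}) f"
    and m: "m integrable_on UNIV" and le: "\<And>x. norm (f x) \<le> m x"
  shows "f integrable_on UNIV"
proof (rule integrable_on_all_intervals_integrable_bound)
  show "m integrable_on UNIV" by (rule m)
  show "norm (f x) \<le> m x" for x by (rule le)
  have m0: "0 \<le> m x" for x
    using le [of x] norm_ge_zero order_trans by blast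
  have m_int: "integrable lebesgue m"
    using nonnegative_absolutely_integrable [OF m] m0 by (simp add: set_integrable_def)
  have int: "f integrable_on {a..b}" for a b
  proof (rule integrable_on_interval_approx)
    fix e :: real assume "e > 0"
    \<comment> \<open>Replacing \<open>f\<close> by 0 on \<open>I n\<close> leaves a function that
      is continuous on the pieces outside \<open>I n\<close>; the error is dominated by
      \<open>m\<close> restricted to \<open>I n\<close>, whose integral tends to 0 even if
      \<open>m\<close> is unbounded near 0.\<close>
    define I where "I n = {- 1 / real (Suc n) <..< 1 / real (Suc n)}" for n
    have "(\<lambda>n. LINT x|lebesgue. indicator (I n) x * m x) \<longlonglongrightarrow> (LINT (x::real)|lebesgue. (0::real))"
    proof (rule integral_dominated_convergence [where w = m])
      show "(\<lambda>x. 0) \<in> borel_measurable lebesgue"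
        by simp
      show "(\<lambda>x. indicator (I n) x * m x) \<in> borel_measurable lebesgue" for n
        by (intro borel_measurable_times borel_measurable_integrable [OF m_int] borel_measurable_indicator) (simp add: I_def)
      have pw: "(\<lambda>n. indicator (I n) x * m x) \<longlonglongrightarrow> 0" if "x \<noteq> 0" for x
      proof (rule tendsto_eventually)
        have "\<bar>x\<bar> > 0" using that by simp
        then obtain N where N: "1 / real (Suc N) < \<bar>x\<bar>"
          by (rule nat_approx_posE)
        have "x \<notin> I n" if "n \<ge> N" for n
        proof -
          have "1 / real (Suc n) \<le> 1 / real (Suc N)"
            using that by (intro divide_left_mono) auto
          then show ?thesis using N by (auto simp: I_def)
        qed
        then show "\<forall>\<^sub>F n in sequentially. indicator (I n) x * m x = 0"
          unfolding eventually_sequentially by (intro exI [of _ N]) auto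
      qed
      show "AE x in lebesgue. (\<lambda>n. indicator (I n) x * m x) \<longlonglongrightarrow> 0"
        by (rule eventually_mono [OF AE_completion [OF AE_lborel_singleton [of "0::real"]]]) (erule pw)
    qed (use m_int m0 in \<open>auto simp: indicator_def\<close>)
    then have "\<forall>\<^sub>F n in sequentially. (LINT x|lebesgue. indicator (I n) x * m x) < e"
      using \<open>e > 0\<close> by (intro order_tendstoD(2)) auto
    then obtain n where n: "(LINT x|lebesgue. indicator (I n) x * m x) < e"
      by (auto simp: eventually_sequentially)
    define M where "M x = indicator (I n) x * m x" for x
    define g where "g x = (if x \<in> I n then 0 else f x)" for x
    have M: "integrable lebesgue M"
      using integrable_mult_indicator [OF _ m_int, of "I n"] by (simp add: M_def [abs_def] I_def)
    have M0: "0 \<le> M x" for x by (simp add: M_def m0)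
    have "M integrable_on UNIV"
      using has_integral_integral_lebesgue [OF M] by blast
    then have Mab: "M integrable_on {a..b}"
      by (rule integrable_on_subinterval) auto
    have "integral {a..b} M \<le> integral UNIV M"
      using Mab \<open>M integrable_on UNIV\<close> M0 by (intro integral_subset_le) auto
    also have "\<dots> = integral\<^sup>L lebesgue M"
      using integral_unique [OF has_integral_integral_lebesgue [OF M]] .
    finally have "integral {a..b} M < e"
      using n by (simp add: M_def [abs_def])
    define d where "d = 1 / real (Suc n)"
    have d: "d > 0" "I n = {- d <..< d}" by (simp_all add: d_def I_def)
    have "g integrable_on {a..b}"
    proof -
      have "f integrable_on {a..b} \<inter> {..- d}" "f integrable_on {a..b} \<inter> {d..}"
      proof -
        have "{a..b} \<inter> {..- d} = {a..min b (- d)}" "{a..b} \<inter> {d..} = {max a d..b}"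
          by auto
        then show "f integrable_on {a..b} \<inter> {..- d}" "f integrable_on {a..b} \<inter> {d..}"
          using d by (auto intro!: integrable_continuous_interval continuous_on_subset [OF cont])
      qed
      then have "(\<lambda>x. (if x \<in> {a..b} \<inter> {..- d} then f x else 0) + (if x \<in> {a..b} \<inter> {d..} then f x else 0))
          integrable_on UNIV"
        by (intro integrable_add) (simp_all only: integrable_restrict_UNIV)
      also have "(\<lambda>x. (if x \<in> {a..b} \<inter> {..- d} then f x else 0) + (if x \<in> {a..b} \<inter> {d..} then f x else 0)) =
          (\<lambda>x. if x \<in> {a..b} then g x else 0)"
        using d by (auto simp: g_def fun_eq_iff)
      finally show ?thesis
        by (simp only: integrable_restrict_UNIV)
    qed
    moreover have "norm (f x - g x) \<le> M x" for x
      using le [of x] by (auto simp: g_def M_def)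
    ultimately show "\<exists>g m. g integrable_on {a..b} \<and> m integrable_on {a..b} \<and>
        integral {a..b} m < e \<and> (\<forall>x\<in>{a..b}. norm (f x - g x) \<le> m x)"
      using Mab \<open>integral {a..b} M < e\<close> by blast
  qed
  show "(\<lambda>x. if x \<in> UNIV then f x else 0) integrable_on cbox a b" for a b
    using int by simp
qed


section \<open>The closed graph theorem\<close>

text \<open>By Baire's theorem one of the closures \<open>F n\<close> contains a ball, so every
  \<open>y\<close> is approximated within half its norm by some \<open>x\<close> with controlled
  \<open>S x\<close>. Iteration on the remainder yields a series for \<open>y\<close> whose image
  converges geometrically, and closedness of the graph identifies the limit with \<open>S y\<close>.
  The theorem serves to show that T Q_s[T]^-1 is bounded.\<close>

theorem closed_graph:
  fixes S :: "'a::banach \<Rightarrow> 'b::banach"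
  assumes S: "linear S" and closed: "closed {(x, y). S x = y}"
  shows "bounded_linear S"
proof -
  define F where "F n = closure {x. norm (S x) \<le> real n}" for n :: nat
  have "\<Union>(range F) = UNIV"
  proof -
    have "x \<in> F (nat \<lceil>norm (S x)\<rceil>)" for x
      unfolding F_def by (rule closure_subset [THEN subsetD]) (simp add: real_nat_ceiling_ge)
    then show ?thesis by blast
  qed
  then have "euclidean interior_of \<Union>(range F) \<noteq> {}"
    by simp
  then have "\<exists>n. interior (F n) \<noteq> {}"
    using Baire_category_alt [of euclidean "range F"] completely_metrizable_space_euclidean
    by (auto simp: F_def)
  then obtain n x0 r where r: "r > 0" "ball x0 r \<subseteq> F n"
    by (meson equals0I mem_interior)
  have approx: "\<exists>x. norm (y - x) \<le> norm y / 2 \<and> norm (S x) \<le> 2 * (real n / r) * norm y" for y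
  proof (cases "y = 0")
    case True
    then show ?thesis using linear_0 [OF S] by auto
  next
    case False
    \<comment> \<open>\<open>k\<close> scales \<open>y\<close> to length \<open>r / 2\<close>, so
      that \<open>x0 + u\<close> and \<open>x0 - u\<close> both lie in the ball; in the difference
      of their approximants the centre \<open>x0\<close> cancels.\<close>
    define k where "k = 2 * norm y / r"
    have k: "k > 0" using False r by (simp add: k_def)
    define u where "u = (1 / k) *\<^sub>R y"
    have "norm u = r / 2"
      using r False by (simp add: u_def k_def)
    then have "x0 + u \<in> F n" "x0 - u \<in> F n"
      using r by (auto intro!: subsetD [OF r(2)] simp: dist_norm)
    moreover have "r / 4 > 0" using r by simp
    ultimately obtain a b where a: "norm (S a) \<le> n" "dist a (x0 + u) < r / 4"
      and b: "norm (S b) \<le> n" "dist b (x0 - u) < r / 4"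
      unfolding F_def closure_approachable by blast
    define x where "x = (k / 2) *\<^sub>R (a - b)"
    have "norm (S x) = k / 2 * norm (S a - S b)"
      using k by (simp add: x_def linear_scale [OF S] linear_diff [OF S])
    also have "\<dots> \<le> k / 2 * (n + n)"
      using a(1) b(1) k norm_triangle_ineq4 [of "S a" "S b"] by (intro mult_left_mono) auto
    finally have "norm (S x) \<le> k / 2 * (n + n)" .
    then have Sx: "norm (S x) \<le> 2 * (real n / r) * norm y"
      using r by (simp add: k_def field_simps)
    have "y = (k / 2) *\<^sub>R ((x0 + u) - (x0 - u))"
      using k by (simp add: u_def scaleR_2 [symmetric])
    then have "y - x = (k / 2) *\<^sub>R (((x0 + u) - a) - ((x0 - u) - b))"
      unfolding x_def scaleR_diff_right [symmetric] by (simp add: algebra_simps)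
    then have "norm (y - x) = k / 2 * norm (((x0 + u) - a) - ((x0 - u) - b))"
      using k by simp
    also have "\<dots> \<le> k / 2 * (r / 4 + r / 4)"
      using a(2) b(2) k norm_triangle_ineq4 [of "(x0 + u) - a" "(x0 - u) - b"]
      by (intro mult_left_mono) (auto simp: dist_norm norm_minus_commute)
    also have "\<dots> = norm y / 2"
      using r by (simp add: k_def)
    finally have "norm (y - x) \<le> norm y / 2" .
    then show ?thesis using Sx by blast
  qed
  define M where "M = 2 * (real n / r)"
  have M: "M \<ge> 0" using r by (simp add: M_def)
  obtain \<xi> where \<xi>: "\<And>y. norm (y - \<xi> y) \<le> norm y / 2" "\<And>y. norm (S (\<xi> y)) \<le> M * norm y"
    using approx unfolding M_def by metis
  have bound: "norm (S y) \<le> norm y * (2 * M)" for y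
  proof -
    define rest where "rest k = ((\<lambda>y. y - \<xi> y) ^^ k) y" for k
    have rest_Suc: "rest (Suc k) = rest k - \<xi> (rest k)" for k
      by (simp add: rest_def)
    have rest: "norm (rest k) \<le> norm y * (1 / 2) ^ k" for k
    proof (induction k)
      case (Suc k)
      then show ?case
        using \<xi>(1) [of "rest k"] by (simp add: rest_Suc)
    qed (simp add: rest_def)
    define x where "x k = \<xi> (rest k)" for k
    have part: "(\<Sum>k<m. x k) = y - rest m" for m
      by (induction m) (simp_all add: rest_def x_def)
    have "(\<lambda>m. norm y * (1 / 2) ^ m) \<longlonglongrightarrow> norm y * 0"
      by (intro tendsto_intros LIMSEQ_realpow_zero) auto
    then have "rest \<longlonglongrightarrow> 0"
      using rest by (intro Lim_null_comparison [of rest "\<lambda>m. norm y * (1 / 2) ^ m"]) auto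
    then have lim: "(\<lambda>m. \<Sum>k<m. x k) \<longlonglongrightarrow> y"
      unfolding part using tendsto_diff [OF tendsto_const [of y]] by force
    have Sx: "norm (S (x k)) \<le> M * norm y * (1 / 2) ^ k" for k
      using \<xi>(2) [of "rest k"] mult_left_mono [OF rest [of k] M] by (simp add: x_def algebra_simps)
    have geo: "(\<lambda>k. M * norm y * (1 / 2) ^ k) sums (M * norm y * 2)"
      using geometric_sums [of "1 / 2 :: real"] by (intro sums_mult) simp
    then have summ: "summable (\<lambda>k. S (x k))"
      using Sx by (intro summable_comparison_test [OF _ sums_summable [OF geo]]) auto
    then have "(\<lambda>m. \<Sum>k<m. S (x k)) \<longlonglongrightarrow> (\<Sum>k. S (x k))"
      by (rule summable_LIMSEQ)
    then have "(\<lambda>m. S (\<Sum>k<m. x k)) \<longlonglongrightarrow> (\<Sum>k. S (x k))"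
      by (simp add: linear_sum [OF S])
    with lim have "(\<lambda>m. (\<Sum>k<m. x k, S (\<Sum>k<m. x k))) \<longlonglongrightarrow> (y, \<Sum>k. S (x k))"
      by (rule tendsto_Pair)
    then have "(y, \<Sum>k. S (x k)) \<in> {(x, y). S x = y}"
      by (rule closed_sequentially [OF closed, rotated]) auto
    then have "S y = (\<Sum>k. S (x k))" by simp
    also have "norm \<dots> \<le> (\<Sum>k. M * norm y * (1 / 2) ^ k)"
      using Sx sums_summable [OF geo] by (intro norm_suminf_le) auto
    also have "\<dots> = norm y * (2 * M)"
      by (subst sums_unique [OF geo, symmetric]) simp
    finally show ?thesis .
  qed
  show ?thesis
    by (rule bounded_linear_intro [OF linear_add [OF S] linear_scale [OF S] bound])
qed

section \<open>Contour integrals along rays\<close>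

definition ray_pt :: "real \<Rightarrow> real \<Rightarrow> complex" where
  "ray_pt a x = exp (Complex x a)"

text \<open>For z = exp (x + i a) one has dz = z dx, so the factor \<open>ray_pt a x\<close> makes
  this the integral of \<open>F\<close> dz from 0 to infinity along the ray of angle
  \<open>a\<close>.\<close>

definition ray_integral :: "real \<Rightarrow> (complex \<Rightarrow> complex) \<Rightarrow> complex" where
  "ray_integral a F = (LINT x|lborel. F (ray_pt a x) * ray_pt a x)"

lemma ray_pt_eq: "ray_pt a x = of_real (exp x) * cis a"
  by (simp add: ray_pt_def exp_eq_polar)

lemma norm_ray_pt [simp]: "norm (ray_pt a x) = exp x"
  by (simp add: ray_pt_def)

lemma ray_pt_nonzero [simp]: "ray_pt a x \<noteq> 0"
  by (simp add: ray_pt_def)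

lemma Re_ray_pt: "Re (ray_pt a x) = exp x * cos a"
  by (simp add: ray_pt_def Re_exp)

lemma continuous_on_ray_pt: "continuous_on A (ray_pt a)"
  unfolding ray_pt_eq by (intro continuous_intros)

lemma integral_lborel_symmetric_limit:
  fixes f :: "real \<Rightarrow> 'a::{banach,second_countable_topology}"
  assumes "integrable lborel f"
  shows "(\<lambda>n::nat. LINT x|lborel. indicator {- real n..real n} x *\<^sub>R f x) \<longlonglongrightarrow> integral\<^sup>L lborel f"
proof (rule integral_dominated_convergence [where w = "\<lambda>x. norm (f x)"])
  have pw: "(\<lambda>n. indicator {- real n..real n} x *\<^sub>R f x) \<longlonglongrightarrow> f x" for x
  proof (rule tendsto_eventually)
    have "x \<in> {- real n..real n}" if "n \<ge> nat \<lceil>\<bar>x\<bar>\<rceil>" for n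
      using that real_nat_ceiling_ge [of "\<bar>x\<bar>"] by auto
    then show "\<forall>\<^sub>F n in sequentially. indicator {- real n..real n} x *\<^sub>R f x = f x"
      unfolding eventually_sequentially by (intro exI [of _ "nat \<lceil>\<bar>x\<bar>\<rceil>"]) auto
  qed
  show "AE x in lborel. (\<lambda>n. indicator {- real n..real n} x *\<^sub>R f x) \<longlonglongrightarrow> f x"
    using pw by simp
qed (use assms in \<open>auto simp: indicator_def\<close>)

text \<open>The majorants for turning contours: integrability makes the ray integrals converge, the
  limits at both ends annihilate the connecting sides, and the bound uniform in the angle permits
  dominated convergence on those sides.\<close>

definition tame :: "real set \<Rightarrow> (complex \<Rightarrow> real) \<Rightarrow> bool" where
  "tame A h \<longleftrightarrow> (\<exists>B. \<forall>a\<in>A. \<forall>x. norm (h (ray_pt a x)) \<le> B) \<and>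
    (\<forall>a\<in>A. integrable lborel (\<lambda>x. h (ray_pt a x)) \<and>
      ((\<lambda>x. h (ray_pt a x)) \<longlongrightarrow> 0) at_top \<and> ((\<lambda>x. h (ray_pt a x)) \<longlongrightarrow> 0) at_bot)"

text \<open>On the compact middle part continuity is enough. Domination is asked only for
  \<open>\<bar>x\<bar> \<ge> N\<close>, which spares estimates of a Cauchy kernel near the modulus
  of its pole.\<close>

lemma integrable_continuous_dominated:
  fixes f :: "real \<Rightarrow> complex" and h :: "real \<Rightarrow> real"
  assumes cont: "continuous_on UNIV f" and h: "integrable lborel h"
    and le: "\<And>x. \<bar>x\<bar> \<ge> N \<Longrightarrow> norm (f x) \<le> C * norm (h x)"
  shows "integrable lborel f"
proof -
  have "bounded (f ` {- N..N})"
    by (intro compact_imp_bounded compact_continuous_image continuous_on_subset [OF cont]) auto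
  then obtain M where M: "\<And>x. x \<in> {- N..N} \<Longrightarrow> norm (f x) \<le> M"
    unfolding bounded_iff by blast
  show ?thesis
  proof (rule Bochner_Integration.integrable_bound)
    show "integrable lborel (\<lambda>x. indicator {- N..N} x *\<^sub>R \<bar>M\<bar> + \<bar>C\<bar> * norm (h x))"
      using h by (intro Bochner_Integration.integrable_add integrable_mult_right integrable_norm
          integrable_scaleR_left) (auto simp: integrable_indicator_iff emeasure_lborel_Icc_eq)
    show "f \<in> borel_measurable lborel"
      using borel_measurable_continuous_onI [OF cont] by simp
    have "norm (f x) \<le> norm (indicator {- N..N} x *\<^sub>R \<bar>M\<bar> + \<bar>C\<bar> * norm (h x))" for x
    proof (cases "x \<in> {- N..N}")
      case True
      then have "norm (f x) \<le> \<bar>M\<bar>"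
        using M [of x] by simp
      also have "\<dots> \<le> \<bar>M\<bar> + \<bar>C\<bar> * norm (h x)" by simp
      finally show ?thesis using True by simp
    next
      case False
      then have "norm (f x) \<le> C * norm (h x)" by (intro le) auto
      also have "\<dots> \<le> \<bar>C\<bar> * norm (h x)" by (intro mult_right_mono) auto
      finally show ?thesis using False by simp
    qed
    then show "AE x in lborel. norm (f x) \<le> norm (indicator {- N..N} x *\<^sub>R \<bar>M\<bar> + \<bar>C\<bar> * norm (h x))"
      by simp
  qed
qed

text \<open>Cauchy's theorem on long rectangles in the coordinate \<open>u = log z\<close>.\<close>

lemma ray_integral_rotate:
  assumes "a1 \<le> a2" and F: "F holomorphic_on U" "open U"
    and U: "\<And>a x. a \<in> {a1..a2} \<Longrightarrow> ray_pt a x \<in> U"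
    and h: "tame {a1..a2} h"
    and le: "\<And>a x. a \<in> {a1..a2} \<Longrightarrow> \<bar>x\<bar> \<ge> N \<Longrightarrow>
      norm (F (ray_pt a x) * ray_pt a x) \<le> C * norm (h (ray_pt a x))"
  shows "ray_integral a1 F = ray_integral a2 F"
proof -
  define \<Phi> where "\<Phi> u = F (exp u) * exp u" for u
  define S where "S = {u. a1 \<le> Im u \<and> Im u \<le> a2}"
  have S: "convex S"
    unfolding S_def by (intro convex_Int [of "{u. a1 \<le> Im u}" "{u. Im u \<le> a2}", simplified Collect_conj_eq [symmetric]]
        convex_halfspace_Im_ge convex_halfspace_Im_le)
  have exp_S: "exp u \<in> U" if "u \<in> S" for u
    using that U [of "Im u" "Re u"] by (simp add: S_def ray_pt_def)
  have diff: "\<Phi> field_differentiable at u" if "u \<in> S" for u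
  proof -
    have "F field_differentiable at (exp u)"
      using F exp_S [OF that] holomorphic_on_imp_differentiable_at by blast
    then show ?thesis
      unfolding \<Phi>_def
      by (intro field_differentiable_mult field_differentiable_compose [of exp _ F, unfolded o_def]
          field_differentiable_within_exp)
  qed
  have cont: "continuous_on S \<Phi>"
    using diff by (intro continuous_at_imp_continuous_on ballI field_differentiable_imp_continuous_at) auto
  \<comment> \<open>In the logarithmic coordinate the region is a convex strip, so there is a global
    primitive, and integrals over the sides of a rectangle are differences of its corner
    values.\<close>
  obtain g where g: "\<And>u. u \<in> S \<Longrightarrow> (g has_field_derivative \<Phi> u) (at u within S)"
    using holomorphic_convex_primitive [OF S finite.emptyI cont] diff interior_subset by (metis Diff_empty subsetD)
  have ray: "\<Phi> (Complex x a) = F (ray_pt a x) * ray_pt a x" for x a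
    by (simp add: \<Phi>_def ray_pt_def)
  have horizontal: "(LINT x|lborel. indicator {- real n..real n} x *\<^sub>R (F (ray_pt a x) * ray_pt a x)) =
      g (Complex (real n) a) - g (Complex (- real n) a)" if "a \<in> {a1..a2}" for n a
    unfolding ray [symmetric]
  proof (rule integral_FTC_atLeastAtMost)
    have line: "((\<lambda>x. Complex x a) has_vector_derivative 1) (at x within {- real n..real n})" for x
      by (auto simp: has_vector_derivative_complex_iff intro!: derivative_eq_intros)
    have "(g has_field_derivative \<Phi> (Complex x a)) (at (Complex x a) within (\<lambda>x. Complex x a) ` {- real n..real n})" for x
      using that by (intro DERIV_subset [OF g]) (auto simp: S_def)
    from field_vector_diff_chain_within [OF line this]
    show "((\<lambda>x. g (Complex x a)) has_vector_derivative \<Phi> (Complex x a)) (at x within {- real n..real n})" for x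
      by (simp add: o_def)
    show "continuous_on {- real n..real n} (\<lambda>x. \<Phi> (Complex x a))"
      using that by (intro continuous_on_compose2 [OF cont]) (auto simp: S_def Complex_eq intro!: continuous_intros)
  qed simp
  have vertical: "(LINT y|lborel. indicator {a1..a2} y *\<^sub>R (\<i> * \<Phi> (Complex x y))) =
      g (Complex x a2) - g (Complex x a1)" for x
  proof (rule integral_FTC_atLeastAtMost)
    have line: "((\<lambda>y. Complex x y) has_vector_derivative \<i>) (at y within {a1..a2})" for y
      by (auto simp: has_vector_derivative_complex_iff intro!: derivative_eq_intros)
    have "(g has_field_derivative \<Phi> (Complex x y)) (at (Complex x y) within (\<lambda>y. Complex x y) ` {a1..a2})"
      if "a1 \<le> y" "y \<le> a2" for y
      using that by (intro DERIV_subset [OF g]) (auto simp: S_def)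
    from field_vector_diff_chain_within [OF line this]
    show "((\<lambda>y. g (Complex x y)) has_vector_derivative \<i> * \<Phi> (Complex x y)) (at y within {a1..a2})"
      if "a1 \<le> y" "y \<le> a2" for y
      using that by (simp add: o_def)
    show "continuous_on {a1..a2} (\<lambda>y. \<i> * \<Phi> (Complex x y))"
      by (intro continuous_intros continuous_on_compose2 [OF cont]) (auto simp: S_def Complex_eq intro!: continuous_intros)
  qed (use \<open>a1 \<le> a2\<close> in simp)
  obtain B where B: "\<And>a x. a \<in> {a1..a2} \<Longrightarrow> norm (h (ray_pt a x)) \<le> B"
    using h unfolding tame_def by blast
  have vertical_0: "(\<lambda>n. LINT y|lborel. indicator {a1..a2} y *\<^sub>R (\<i> * \<Phi> (Complex (X n) y))) \<longlonglongrightarrow> 0"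
    if X: "\<And>n. \<bar>X n\<bar> \<ge> N" and lim: "filterlim X at_top sequentially \<or> filterlim X at_bot sequentially" for X
  proof -
    have "(\<lambda>n. LINT y|lborel. indicator {a1..a2} y *\<^sub>R (\<i> * \<Phi> (Complex (X n) y))) \<longlonglongrightarrow> (LINT (y::real)|lborel. (0::complex))"
    proof (rule integral_dominated_convergence [where w = "\<lambda>y. indicator {a1..a2} y *\<^sub>R (\<bar>C\<bar> * \<bar>B\<bar>)"])
      show "integrable lborel (\<lambda>y. indicator {a1..a2} y *\<^sub>R (\<bar>C\<bar> * \<bar>B\<bar>))"
        by (intro integrable_scaleR_left) (auto simp: integrable_indicator_iff emeasure_lborel_Icc_eq)
      show "(\<lambda>y. indicator {a1..a2} y *\<^sub>R (\<i> * \<Phi> (Complex (X n) y))) \<in> borel_measurable lborel" for n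
      proof -
        have "continuous_on {a1..a2} (\<lambda>y. \<i> * \<Phi> (Complex (X n) y))"
          by (intro continuous_intros continuous_on_compose2 [OF cont]) (auto simp: S_def Complex_eq intro!: continuous_intros)
        from borel_measurable_continuous_on_indicator [OF _ this] show ?thesis by simp
      qed
      have pw: "(\<lambda>n. indicator {a1..a2} y *\<^sub>R (\<i> * \<Phi> (Complex (X n) y))) \<longlonglongrightarrow> 0" for y
      proof (cases "y \<in> {a1..a2}")
        case True
        have "((\<lambda>x. h (ray_pt y x)) \<longlongrightarrow> 0) at_top" "((\<lambda>x. h (ray_pt y x)) \<longlongrightarrow> 0) at_bot"
          using h True by (auto simp: tame_def)
        then have "(\<lambda>n. h (ray_pt y (X n))) \<longlonglongrightarrow> 0"
          using lim filterlim_compose by blast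
        then have "(\<lambda>n. C * norm (h (ray_pt y (X n)))) \<longlonglongrightarrow> 0"
          by (intro tendsto_mult_right_zero tendsto_norm_zero)
        then have "(\<lambda>n. \<Phi> (Complex (X n) y)) \<longlonglongrightarrow> 0"
          by (rule Lim_null_comparison [rotated]) (use le [OF True X] in \<open>simp add: ray\<close>)
        then show ?thesis
          using True by (simp add: tendsto_mult_right_zero)
      qed simp
      show "AE y in lborel. (\<lambda>n. indicator {a1..a2} y *\<^sub>R (\<i> * \<Phi> (Complex (X n) y))) \<longlonglongrightarrow> 0"
        using pw by simp
      have "norm (indicator {a1..a2} y *\<^sub>R (\<i> * \<Phi> (Complex (X n) y))) \<le> indicator {a1..a2} y *\<^sub>R (\<bar>C\<bar> * \<bar>B\<bar>)" for n y
      proof (cases "y \<in> {a1..a2}")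
        case True
        have "norm (\<Phi> (Complex (X n) y)) \<le> C * norm (h (ray_pt y (X n)))"
          using le [OF True X] by (simp add: ray)
        also have "\<dots> \<le> \<bar>C\<bar> * \<bar>B\<bar>"
          using B [OF True, of "X n"] by (intro mult_mono) auto
        finally show ?thesis using True by (simp add: norm_mult)
      qed simp
      then show "AE y in lborel. norm (indicator {a1..a2} y *\<^sub>R (\<i> * \<Phi> (Complex (X n) y))) \<le>
          indicator {a1..a2} y *\<^sub>R (\<bar>C\<bar> * \<bar>B\<bar>)" for n
        by simp
    qed simp
    then show ?thesis by simp
  qed
  have edge: "(\<lambda>n. g (Complex (real n) a) - g (Complex (- real n) a)) \<longlonglongrightarrow> ray_integral a F"
    if a: "a \<in> {a1..a2}" for a
  proof -
    have "continuous_on UNIV (\<lambda>x. \<Phi> (Complex x a))"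
      using a by (intro continuous_on_compose2 [OF cont]) (auto simp: S_def Complex_eq intro!: continuous_intros)
    then have "integrable lborel (\<lambda>x. F (ray_pt a x) * ray_pt a x)"
      unfolding ray using h a le
      by (intro integrable_continuous_dominated [where h = "\<lambda>x. h (ray_pt a x)" and N = N and C = C])
        (auto simp: tame_def)
    from integral_lborel_symmetric_limit [OF this] show ?thesis
      unfolding horizontal [OF a] ray_integral_def .
  qed
  define k where "k = nat \<lceil>\<bar>N\<bar>\<rceil>"
  have k: "N \<le> real (n + k)" for n
    using real_nat_ceiling_ge [of "\<bar>N\<bar>"] unfolding k_def of_nat_add by linarith
  have abs_k: "N \<le> \<bar>real (n + k)\<bar>" "N \<le> \<bar>- real (n + k)\<bar>" for n
    using k [of n] by linarith+
  have lim: "filterlim (\<lambda>n. real (n + k)) at_top sequentially" "filterlim (\<lambda>n. - real (n + k)) at_bot sequentially"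
    by real_asymp+
  \<comment> \<open>The same four corner values are grouped once by vertical sides, which tend to 0,
    and once by horizontal sides, which tend to the ray integrals.\<close>
  have "(\<lambda>n. (g (Complex (real (n + k)) a2) - g (Complex (real (n + k)) a1)) -
      (g (Complex (- real (n + k)) a2) - g (Complex (- real (n + k)) a1))) \<longlonglongrightarrow> 0 - 0"
    unfolding vertical [symmetric]
    by (rule tendsto_diff [OF vertical_0 [OF abs_k(1) disjI1 [OF lim(1)]] vertical_0 [OF abs_k(2) disjI2 [OF lim(2)]]])
  moreover have "(\<lambda>n. (g (Complex (real (n + k)) a2) - g (Complex (- real (n + k)) a2)) -
      (g (Complex (real (n + k)) a1) - g (Complex (- real (n + k)) a1))) \<longlonglongrightarrow> ray_integral a2 F - ray_integral a1 F"
    using \<open>a1 \<le> a2\<close> by (intro tendsto_diff LIMSEQ_ignore_initial_segment [OF edge]) auto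
  ultimately have "ray_integral a2 F - ray_integral a1 F = 0 - 0"
    by (intro LIMSEQ_unique [OF _ \<open>_ \<longlonglongrightarrow> 0 - 0\<close>]) (simp add: algebra_simps)
  then show ?thesis by simp
qed

section \<open>Decay along rays and functions on the double sector\<close>

text \<open>A model of decay: of order |z| at 0 and 1 / |z| at infinity, and along every ray equal
  to the derivative of \<open>arctan (exp x)\<close>. It majorises the rational integrands that
  occur.\<close>

definition bump :: "complex \<Rightarrow> real" where
  "bump z = norm z / (1 + (norm z)\<^sup>2)"

lemma bump_nonneg: "0 \<le> bump z"
  by (simp add: bump_def add_nonneg_nonneg)

lemma bump_ray_pt: "bump (ray_pt a x) = exp x / (1 + (exp x)\<^sup>2)"
  by (simp add: bump_def)

lemma bump_integral:
  "integrable lborel (\<lambda>x. exp x / (1 + (exp x)\<^sup>2) :: real)" (is ?I)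
  "(LINT x|lborel. exp x / (1 + (exp x)\<^sup>2) :: real) = pi / 2" (is ?E)
proof -
  have deriv: "((\<lambda>x. arctan (exp x)) has_real_derivative exp x / (1 + (exp x)\<^sup>2)) (at x)" for x
    by (auto intro!: derivative_eq_intros simp: field_simps)
  have bot: "((\<lambda>x. arctan (exp x)) \<longlongrightarrow> 0) at_bot"
    by real_asymp
  have top: "((\<lambda>x. arctan (exp x)) \<longlongrightarrow> pi / 2) at_top"
    by real_asymp
  have cont: "isCont (\<lambda>x. exp x / (1 + (exp x)\<^sup>2) :: real) x" for x :: real
    by (intro continuous_intros) (simp add: add_pos_nonneg less_imp_neq [symmetric])
  have "set_integrable lborel (einterval (- \<infinity>) \<infinity>) (\<lambda>x. exp x / (1 + (exp x)\<^sup>2) :: real)"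
    by (rule interval_integral_FTC_nonneg [where F = "\<lambda>x. arctan (exp x)" and A = 0 and B = "pi / 2"])
      (use deriv bot top cont in \<open>auto simp: ereal_tendsto_simps add_nonneg_nonneg\<close>)
  moreover have "(LBINT x=- \<infinity>..\<infinity>. exp x / (1 + (exp x)\<^sup>2) :: real) = pi / 2 - 0"
    by (rule interval_integral_FTC_nonneg [where F = "\<lambda>x. arctan (exp x)" and A = 0 and B = "pi / 2"])
      (use deriv bot top cont in \<open>auto simp: ereal_tendsto_simps add_nonneg_nonneg\<close>)
  ultimately show ?I ?E
    by (simp_all add: set_integrable_def interval_lebesgue_integral_def set_lebesgue_integral_def einterval_eq)
qed

lemma tame_bump: "tame A bump"
  unfolding tame_def bump_ray_pt
proof (intro conjI exI ballI allI)
  show "norm (exp x / (1 + (exp x)\<^sup>2) :: real) \<le> 1" for x :: real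
  proof -
    have "exp x \<le> 1 + (exp x)\<^sup>2"
      using zero_le_power2 [of "exp x - 1 :: real"] exp_gt_zero [of x] unfolding power2_diff
      by (smt (verit) mult_cancel_left1 power_one)
    then show ?thesis
      by (simp add: divide_le_eq add_pos_nonneg)
  qed
  show "integrable lborel (\<lambda>x. exp x / (1 + (exp x)\<^sup>2) :: real)"
    by (rule bump_integral)
  show "((\<lambda>x. exp x / (1 + (exp x)\<^sup>2) :: real) \<longlongrightarrow> 0) at_top"
    by real_asymp
  show "((\<lambda>x. exp x / (1 + (exp x)\<^sup>2) :: real) \<longlongrightarrow> 0) at_bot"
    by real_asymp
qed

lemma tame_add:
  assumes "tame A h" "tame A k"
  shows "tame A (\<lambda>z. h z + k z)"
proof -
  obtain B C where "\<forall>a\<in>A. \<forall>x. norm (h (ray_pt a x)) \<le> B" "\<forall>a\<in>A. \<forall>x. norm (k (ray_pt a x)) \<le> C"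
    using assms unfolding tame_def by blast
  then have "\<forall>a\<in>A. \<forall>x. norm (h (ray_pt a x) + k (ray_pt a x)) \<le> B + C"
    by (meson norm_triangle_mono)
  moreover have "((\<lambda>x. h (ray_pt a x) + k (ray_pt a x)) \<longlongrightarrow> 0) F"
    if "((\<lambda>x. h (ray_pt a x)) \<longlongrightarrow> 0) F" "((\<lambda>x. k (ray_pt a x)) \<longlongrightarrow> 0) F" for a F
    using tendsto_add [OF that] by simp
  moreover have "integrable lborel (\<lambda>x. h (ray_pt a x) + k (ray_pt a x))" if "a \<in> A" for a
    using assms that by (intro Bochner_Integration.integrable_add) (auto simp: tame_def)
  ultimately show ?thesis
    using assms unfolding tame_def by (intro conjI exI [of _ "B + C"] ballI) blast+
qed

text \<open>The double sector as seen in one slice. Comparing \<open>Re z\<close> with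
  \<open>norm z\<close> by means of the cosine avoids a choice of argument and covers both halves at
  once.\<close>

definition double_sector_complex :: "real \<Rightarrow> complex set" where
  "double_sector_complex \<theta> = {z. cos \<theta> * norm z < \<bar>Re z\<bar>}"

lemma open_double_sector_complex: "open (double_sector_complex \<theta>)"
  unfolding double_sector_complex_def by (intro open_Collect_less continuous_intros)

lemma ray_pt_in_double_sector: "ray_pt a x \<in> double_sector_complex \<theta> \<longleftrightarrow> cos \<theta> < \<bar>cos a\<bar>"
  by (simp add: double_sector_complex_def Re_ray_pt abs_mult mult.commute)

text \<open>The functions of one complex variable that stand for intrinsic elements of
  \<open>SH_L_0\<close>: since dt / t = dx for t = exp x, the integrability condition there is
  integrability in \<open>x\<close>.\<close>

definition symmetric_decaying :: "real \<Rightarrow> (complex \<Rightarrow> complex) set" where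
  "symmetric_decaying \<theta> = {F. F holomorphic_on double_sector_complex \<theta> \<and>
    (\<forall>z\<in>double_sector_complex \<theta>. F (cnj z) = cnj (F z)) \<and>
    bounded (F ` double_sector_complex \<theta>) \<and>
    (\<forall>a. cos \<theta> < \<bar>cos a\<bar> \<longrightarrow> integrable lborel (\<lambda>x. F (ray_pt a x)))}"

text \<open>If the norm of \<open>f\<close> is at least \<open>e\<close> at \<open>x\<close>, the
  Lipschitz bound keeps it above \<open>e / 2\<close> on an interval of fixed length
  \<open>d\<close>, so the tail integral from \<open>x\<close> on is at least
  \<open>d * (e / 2)\<close>; but tails tend to 0.\<close>

lemma lipschitz_integrable_tendsto_0:
  fixes f :: "real \<Rightarrow> complex"
  assumes f: "integrable lborel f" and lip: "\<And>x y. norm (f x - f y) \<le> K * \<bar>x - y\<bar>"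
  shows "(f \<longlongrightarrow> 0) at_top"
proof -
  define T where "T x = (LINT y|lborel. indicator {x..} y *\<^sub>R norm (f y))" for x
  have "(T \<longlongrightarrow> (LINT (y::real)|lborel. (0::real))) at_top"
    unfolding T_def
  proof (rule integral_dominated_convergence_at_top [where w = "\<lambda>x. norm (f x)"])
    have pw: "((\<lambda>x. indicator {x..} y *\<^sub>R norm (f y)) \<longlongrightarrow> 0) at_top" for y
      by (intro tendsto_eventually eventually_mono [OF eventually_gt_at_top [of y]]) simp
    show "AE y in lborel. ((\<lambda>x. indicator {x..} y *\<^sub>R norm (f y)) \<longlongrightarrow> 0) at_top"
      using pw by simp
  qed (use f in \<open>auto simp: indicator_def\<close>)
  then have T: "(T \<longlongrightarrow> 0) at_top" by simp
  show ?thesis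
  proof (rule tendstoI)
    fix e :: real assume "e > 0"
    define d where "d = e / (2 * (\<bar>K\<bar> + 1))"
    have d: "d > 0" "\<bar>K\<bar> * d \<le> e / 2"
      using \<open>e > 0\<close> by (auto simp: d_def field_simps)
    have "\<forall>\<^sub>F x in at_top. T x < d * (e / 2)"
      using \<open>e > 0\<close> d T by (intro order_tendstoD(2)) auto
    then show "\<forall>\<^sub>F x in at_top. dist (f x) 0 < e"
    proof eventually_elim
      case (elim x)
      show ?case
      proof (rule ccontr)
        assume "\<not> dist (f x) 0 < e"
        then have "norm (f x) \<ge> e" by simp
        have ge: "norm (f y) \<ge> e / 2" if "y \<in> {x..x + d}" for y
        proof -
          have "norm (f x - f y) \<le> \<bar>K\<bar> * \<bar>x - y\<bar>"
            by (rule order_trans [OF lip]) (simp add: mult_right_mono)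
          also have "\<dots> \<le> \<bar>K\<bar> * d"
            using that by (intro mult_left_mono) auto
          finally show ?thesis
            using d \<open>norm (f x) \<ge> e\<close> norm_triangle_ineq2 [of "f x" "f y"] by linarith
        qed
        have "d * (e / 2) = (LINT y|lborel. indicator {x..x + d} y *\<^sub>R (e / 2))"
          using d by simp
        also have "\<dots> \<le> T x"
          unfolding T_def
        proof (rule integral_mono)
          show "integrable lborel (\<lambda>y. indicator {x..x + d} y *\<^sub>R (e / 2))"
            by (intro integrable_scaleR_left) (auto simp: integrable_indicator_iff emeasure_lborel_Icc_eq)
          show "integrable lborel (\<lambda>y. indicator {x..} y *\<^sub>R norm (f y))"
            using f by (intro integrable_mult_indicator) auto
          show "indicator {x..x + d} y *\<^sub>R (e / 2) \<le> indicator {x..} y *\<^sub>R norm (f y)" for y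
            using ge [of y] by (auto simp: indicator_def)
        qed
        finally show False using elim by simp
      qed
    qed
  qed
qed

text \<open>Integrability along a ray alone gives no limits at its ends. In the logarithmic
  coordinate the domain is invariant under real shifts, so discs of one radius \<open>d\<close> fit
  around all points of the line; Cauchy's estimate with the global bound \<open>B\<close> makes the
  function Lipschitz there, and integrability then forces the limit 0.\<close>

lemma symmetric_decaying_tendsto_0:
  assumes F: "F \<in> symmetric_decaying \<theta>" and a: "cos \<theta> < \<bar>cos a\<bar>"
  shows "((\<lambda>x. F (ray_pt a x)) \<longlongrightarrow> 0) at_top" "((\<lambda>x. F (ray_pt a x)) \<longlongrightarrow> 0) at_bot"
proof -
  have int: "integrable lborel (\<lambda>x. F (ray_pt a x))"
    using F a by (simp add: symmetric_decaying_def)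
  obtain B where B: "\<And>z. z \<in> double_sector_complex \<theta> \<Longrightarrow> norm (F z) \<le> B"
    using F by (auto simp: symmetric_decaying_def bounded_iff)
  define S where "S = {u. cos \<theta> < \<bar>cos (Im u)\<bar>}"
  have exp_S: "exp u \<in> double_sector_complex \<theta>" if "u \<in> S" for u
    using that ray_pt_in_double_sector [of "Im u" "Re u" \<theta>] by (simp add: S_def ray_pt_def)
  have S: "open S"
    unfolding S_def by (intro open_Collect_less continuous_intros)
  have hol: "(\<lambda>u. F (exp u)) holomorphic_on S"
    using F exp_S by (intro holomorphic_on_compose_gen [of exp S F, unfolded o_def] holomorphic_intros)
      (auto simp: symmetric_decaying_def)
  have "Complex 0 a \<in> S" using a by (simp add: S_def)
  then obtain d where d: "d > 0" "cball (Complex 0 a) d \<subseteq> S"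
    using S open_contains_cball by blast
  have ball: "cball (Complex x a) d \<subseteq> S" for x
  proof
    fix u assume "u \<in> cball (Complex x a) d"
    then have "u - of_real x \<in> cball (Complex 0 a) d"
      by (simp add: dist_norm Complex_eq algebra_simps)
    then show "u \<in> S" using d by (auto simp: S_def)
  qed
  have deriv_le: "norm (deriv (\<lambda>u. F (exp u)) (Complex x a)) \<le> B / d" for x
  proof -
    have "norm ((deriv ^^ 1) (\<lambda>u. F (exp u)) (Complex x a)) \<le> fact 1 * B / d ^ 1"
    proof (rule Cauchy_inequality)
      show "(\<lambda>u. F (exp u)) holomorphic_on ball (Complex x a) d"
        using holomorphic_on_subset [OF hol] ball [of x] by (meson ball_subset_cball order_trans)
      show "continuous_on (cball (Complex x a) d) (\<lambda>u. F (exp u))"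
        by (intro holomorphic_on_imp_continuous_on holomorphic_on_subset [OF hol] ball)
      show "norm (F (exp u)) \<le> B" if "norm (Complex x a - u) = d" for u
        using that ball [of x] by (intro B exp_S) (auto simp: dist_norm)
    qed (rule d)
    then show ?thesis by simp
  qed
  have lip: "norm (F (ray_pt a x) - F (ray_pt a y)) \<le> (B / d) * \<bar>x - y\<bar>" for x y
  proof -
    have "norm (F (exp (Complex x a)) - F (exp (Complex y a))) \<le> (B / d) * norm (Complex x a - Complex y a)"
    proof (rule field_differentiable_bound [of "{u. Im u = a}" "\<lambda>u. F (exp u)" "deriv (\<lambda>u. F (exp u))"])
      show "convex {u. Im u = a}"
        by (rule convex_hyperplane [of \<i> a, simplified inner_complex_def, simplified])
      fix u assume "u \<in> {u. Im u = a}"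
      then have u: "u = Complex (Re u) a" by (simp add: complex_eq_iff)
      show "((\<lambda>u. F (exp u)) has_field_derivative deriv (\<lambda>u. F (exp u)) u) (at u within {u. Im u = a})"
        using ball [of "Re u"] d(1) u by (intro holomorphic_derivI [OF hol S]) auto
      show "norm (deriv (\<lambda>u. F (exp u)) u) \<le> B / d"
        using deriv_le [of "Re u"] u by simp
    qed auto
    also have "Complex x a - Complex y a = of_real (x - y)"
      by (simp add: complex_eq_iff)
    finally show ?thesis by (simp only: ray_pt_def norm_of_real)
  qed
  show "((\<lambda>x. F (ray_pt a x)) \<longlongrightarrow> 0) at_top"
    by (rule lipschitz_integrable_tendsto_0 [OF int lip])
  have "((\<lambda>x. F (ray_pt a (- x))) \<longlongrightarrow> 0) at_top"
  proof (rule lipschitz_integrable_tendsto_0 [where K = "B / d"])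
    show "integrable lborel (\<lambda>x. F (ray_pt a (- x)))"
      using lborel_integrable_real_affine [OF int, of "- 1" 0] by simp
    show "norm (F (ray_pt a (- x)) - F (ray_pt a (- y))) \<le> B / d * \<bar>x - y\<bar>" for x y
      using lip [of "- x" "- y"] by (simp add: abs_minus_commute)
  qed
  then show "((\<lambda>x. F (ray_pt a x)) \<longlongrightarrow> 0) at_bot"
    by (simp add: filterlim_at_bot_mirror)
qed

lemma symmetric_decaying_tame:
  assumes F: "F \<in> symmetric_decaying \<theta>" and A: "\<And>a. a \<in> A \<Longrightarrow> cos \<theta> < \<bar>cos a\<bar>"
  shows "tame A (\<lambda>z. norm (F z))"
proof -
  obtain B where "\<And>z. z \<in> double_sector_complex \<theta> \<Longrightarrow> norm (F z) \<le> B"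
    using F by (auto simp: symmetric_decaying_def bounded_iff)
  then have "\<forall>a\<in>A. \<forall>x. norm (norm (F (ray_pt a x))) \<le> B"
    using A by (simp add: ray_pt_in_double_sector)
  moreover have "integrable lborel (\<lambda>x. norm (F (ray_pt a x)))" if "a \<in> A" for a
    using F A [OF that] by (auto simp: symmetric_decaying_def)
  ultimately show ?thesis
    unfolding tame_def using symmetric_decaying_tendsto_0 [OF F A]
    by (auto intro!: tendsto_norm_zero)
qed

section \<open>Model integrals with two poles\<close>

text \<open>With r = exp x, R = exp y and h = (b - a) / 2, the law of cosines reads (R - r)^2 (1 -
  sin(h)^2) + (R + r)^2 sin(h)^2 for the squared distance; the first summand is dropped.\<close>

lemma norm_ray_diff:
  "norm (ray_pt b y - ray_pt a x) \<ge> \<bar>sin ((b - a) / 2)\<bar> * (exp y + exp x)"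
proof -
  have c: "cos (b - a) = 1 - 2 * (sin ((b - a) / 2))\<^sup>2"
    using cos_double_sin [of "(b - a) / 2"] by (simp only: field_sum_of_halves mult_2)
  have "(norm (ray_pt b y - ray_pt a x))\<^sup>2 =
      (exp y * cos b - exp x * cos a)\<^sup>2 + (exp y * sin b - exp x * sin a)\<^sup>2"
    by (simp add: ray_pt_eq cmod_power2)
  also have "\<dots> = (exp y)\<^sup>2 * ((cos b)\<^sup>2 + (sin b)\<^sup>2) + (exp x)\<^sup>2 * ((cos a)\<^sup>2 + (sin a)\<^sup>2)
      - 2 * exp x * exp y * (cos b * cos a + sin b * sin a)"
    by algebra
  also have "\<dots> = (exp y)\<^sup>2 + (exp x)\<^sup>2 - 2 * exp x * exp y * cos (b - a)"
    by (simp only: sin_cos_squared_add2 cos_diff mult_1_right)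
  also have "\<dots> = (exp y - exp x)\<^sup>2 * (1 - (sin ((b - a) / 2))\<^sup>2) + (\<bar>sin ((b - a) / 2)\<bar> * (exp y + exp x))\<^sup>2"
    unfolding c power_mult_distrib power2_abs by (simp add: power2_eq_square algebra_simps)
  finally have "(\<bar>sin ((b - a) / 2)\<bar> * (exp y + exp x))\<^sup>2 \<le> (norm (ray_pt b y - ray_pt a x))\<^sup>2"
    by (simp add: abs_square_le_1 power2_le_iff_abs_le)
  then show ?thesis
    by (rule power2_le_imp_le) simp
qed

lemma ray_pt_shift: "ray_pt b x = ray_pt a x0 * ray_pt (b - a) (x - x0)"
  by (simp add: ray_pt_def mult_exp_exp complex_eq_iff [of "_ + _"] flip: exp_add)
    (simp add: Complex_eq algebra_simps)

lemma ray_pt_periodic: "ray_pt (a + 2 * pi) = ray_pt a"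
  by (simp add: ray_pt_eq fun_eq_iff complex_eq_iff)

lemma ray_pt_cnj: "cnj (ray_pt a x) = ray_pt (- a) x"
  by (simp add: ray_pt_eq complex_eq_iff)

lemma ray_pt_power2: "(ray_pt a x)\<^sup>2 = ray_pt (2 * a) (2 * x)"
  by (simp add: ray_pt_def exp_of_nat_mult [of 2, symmetric, simplified] Complex_eq algebra_simps)

lemma ray_integral_periodic: "ray_integral (a + 2 * pi) F = ray_integral a F"
  by (simp add: ray_integral_def ray_pt_periodic)

lemma ray_integral_cnj:
  assumes "\<And>x. F (ray_pt (- a) x) = cnj (F (ray_pt a x))"
  shows "ray_integral (- a) F = cnj (ray_integral a F)"
proof -
  have "F (ray_pt (- a) x) * ray_pt (- a) x = cnj (F (ray_pt a x) * ray_pt a x)" for x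
    using assms by (simp add: ray_pt_cnj)
  then show ?thesis
    unfolding ray_integral_def by (simp only: Bochner_Integration.integral_cnj)
qed

text \<open>The open upper half plane contains no pole, so the ray may be turned to the imaginary
  axis, where the integrand becomes -2 i exp x / (1 + exp (2 x)) and is integrated by
  \<open>arctan\<close>.\<close>

lemma ray_integral_two_poles_upper:
  assumes c: "0 < c" "c < pi"
  shows "ray_integral c (\<lambda>u. 2 / (u\<^sup>2 - 1)) = - \<i> * pi"
proof -
  have rotate: "ray_integral a1 (\<lambda>u. 2 / (u\<^sup>2 - 1)) = ray_integral a2 (\<lambda>u. 2 / (u\<^sup>2 - 1))"
    if a: "0 < a1" "a1 \<le> a2" "a2 < pi" for a1 a2
  proof -
    \<comment> \<open>The minimum of the sine over the compact range of angles gives one constant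
      for all rays; \<open>norm_ray_diff\<close> with doubled angle turns it into a lower bound of
      the denominator.\<close>
    have "\<exists>a\<in>{a1..a2}. \<forall>b\<in>{a1..a2}. sin a \<le> sin b"
      using a by (intro continuous_attains_inf continuous_intros) auto
    then obtain a where a': "a \<in> {a1..a2}" "\<And>b. b \<in> {a1..a2} \<Longrightarrow> sin a \<le> sin b"
      by blast
    have sin_pos: "sin a > 0" using a' a by (intro sin_gt_zero) auto
    show ?thesis
    proof (rule ray_integral_rotate [where U = "{u. Im u > 0}" and h = bump and N = 0 and C = "2 / sin a"])
      have "u\<^sup>2 \<noteq> 1" if "Im u > 0" for u
        using that by (auto simp: power2_eq_1_iff)
      then show "(\<lambda>u. 2 / (u\<^sup>2 - 1)) holomorphic_on {u. Im u > 0}"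
        by (intro holomorphic_intros) auto
      show "open {u. 0 < Im u}"
        by (rule open_halfspace_Im_gt)
      fix b x assume b: "b \<in> {a1..a2}"
      then show "ray_pt b x \<in> {u. 0 < Im u}"
        using a by (auto simp: ray_pt_eq intro!: mult_pos_pos sin_gt_zero)
      have le: "sin a \<le> \<bar>sin b\<bar>" using a'(2) [OF b] by linarith
      have "sin a * (1 + (exp x)\<^sup>2) \<le> \<bar>sin b\<bar> * (exp (2 * x) + exp 0)"
        using le by (simp add: exp_double mult_right_mono add.commute add_nonneg_nonneg)
      also have "\<dots> \<le> norm ((ray_pt b x)\<^sup>2 - 1)"
        using norm_ray_diff [where b = "2 * b" and y = "2 * x" and a = 0 and x = 0]
        by (simp add: ray_pt_power2) (simp add: ray_pt_def zero_complex.code [symmetric])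
      finally have le: "sin a * (1 + (exp x)\<^sup>2) \<le> norm ((ray_pt b x)\<^sup>2 - 1)" .
      have pos: "0 < 1 + (exp x)\<^sup>2" by (simp add: add_pos_nonneg)
      have "2 * exp x / norm ((ray_pt b x)\<^sup>2 - 1) \<le> 2 * exp x / (sin a * (1 + (exp x)\<^sup>2))"
        using le sin_pos pos by (intro divide_left_mono) (auto intro!: mult_pos_pos intro: less_le_trans)
      then show "norm (2 / ((ray_pt b x)\<^sup>2 - 1) * ray_pt b x) \<le> 2 / sin a * norm (bump (ray_pt b x))"
        using sin_pos pos by (simp add: norm_divide norm_mult bump_ray_pt)
    qed (use a tame_bump in auto)
  qed
  have "ray_integral c (\<lambda>u. 2 / (u\<^sup>2 - 1)) = ray_integral (pi / 2) (\<lambda>u. 2 / (u\<^sup>2 - 1))"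
    using rotate [of c "pi / 2"] rotate [of "pi / 2" c] c by (cases "c \<le> pi / 2") auto
  also have "\<dots> = (LINT x|lborel. (- 2 * \<i>) * of_real (exp x / (1 + (exp x)\<^sup>2)))"
    unfolding ray_integral_def
  proof (rule Bochner_Integration.integral_cong [OF refl])
    fix x
    have ray: "ray_pt (pi / 2) x = \<i> * of_real (exp x)"
      by (simp add: ray_pt_eq)
    have sq: "(\<i> * of_real (exp x))\<^sup>2 - 1 = - (of_real (1 + (exp x)\<^sup>2) :: complex)"
      by (simp add: power_mult_distrib)
    show "2 / ((ray_pt (pi / 2) x)\<^sup>2 - 1) * ray_pt (pi / 2) x = (- 2 * \<i>) * of_real (exp x / (1 + (exp x)\<^sup>2))"
      unfolding ray sq of_real_divide by (simp only: divide_minus_right) simp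
  qed
  also have "\<dots> = (- 2 * \<i>) * of_real (LINT x|lborel. exp x / (1 + (exp x)\<^sup>2))"
    unfolding integral_mult_right_zero integral_complex_of_real ..
  also have "\<dots> = - \<i> * pi"
    unfolding bump_integral(2) by simp
  finally show ?thesis .
qed

lemma ray_integral_two_poles_lower:
  assumes c: "- pi < c" "c < 0"
  shows "ray_integral c (\<lambda>u. 2 / (u\<^sup>2 - 1)) = \<i> * pi"
  using ray_integral_cnj [of "\<lambda>u. 2 / (u\<^sup>2 - 1)" "- c"] ray_integral_two_poles_upper [of "- c"] c
  by (simp flip: ray_pt_cnj)

text \<open>The substitution w = z u, a rotation together with a shift of \<open>x\<close>, moves
  the poles z and -z to 1 and -1; the value depends only on the angle between ray and pole.\<close>

lemma ray_integral_two_poles_at: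
  "ray_integral b (\<lambda>w. 2 * ray_pt a x0 / (w\<^sup>2 - (ray_pt a x0)\<^sup>2)) = ray_integral (b - a) (\<lambda>u. 2 / (u\<^sup>2 - 1))"
proof -
  define z where "z = ray_pt a x0"
  have z: "z \<noteq> 0" by (simp add: z_def)
  have "ray_integral b (\<lambda>w. 2 * z / (w\<^sup>2 - z\<^sup>2)) =
      (LINT x|lborel. 2 / ((ray_pt (b - a) (- x0 + 1 * x))\<^sup>2 - 1) * ray_pt (b - a) (- x0 + 1 * x))"
    unfolding ray_integral_def
  proof (rule Bochner_Integration.integral_cong [OF refl])
    fix x
    define u where "u = ray_pt (b - a) (- x0 + 1 * x)"
    have w: "ray_pt b x = z * u"
      using ray_pt_shift [of b x a x0] by (simp add: z_def u_def)
    have "2 * z / ((z * u)\<^sup>2 - z\<^sup>2) * (z * u) = (z\<^sup>2 * (2 * u)) / (z\<^sup>2 * (u\<^sup>2 - 1))"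
      by (simp add: power2_eq_square algebra_simps)
    also have "\<dots> = 2 / (u\<^sup>2 - 1) * u"
      using z by simp
    finally show "2 * z / ((ray_pt b x)\<^sup>2 - z\<^sup>2) * ray_pt b x = 2 / (u\<^sup>2 - 1) * u"
      unfolding w .
  qed
  also have "\<dots> = ray_integral (b - a) (\<lambda>u. 2 / (u\<^sup>2 - 1))"
    unfolding ray_integral_def by (subst (2) lborel_integral_real_affine [of 1 _ "- x0"]) auto
  finally show ?thesis unfolding z_def .
qed

text \<open>The quarter turn from u to i u carries the poles i and -i to -1 and 1; the two ranges of
  angles become the upper and the lower half plane.\<close>

lemma ray_integral_inverse_one_plus_square:
  shows "- pi / 2 < c \<Longrightarrow> c < pi / 2 \<Longrightarrow> ray_integral c (\<lambda>u. 1 / (1 + u\<^sup>2)) = pi / 2"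
    and "pi / 2 < c \<Longrightarrow> c < 3 * pi / 2 \<Longrightarrow> ray_integral c (\<lambda>u. 1 / (1 + u\<^sup>2)) = - pi / 2"
proof -
  have eq: "ray_integral (c + pi / 2) (\<lambda>u. 2 / (u\<^sup>2 - 1)) = (- 2 * \<i>) * ray_integral c (\<lambda>u. 1 / (1 + u\<^sup>2))" for c
  proof -
    have "2 / ((ray_pt (c + pi / 2) x)\<^sup>2 - 1) * ray_pt (c + pi / 2) x =
        (- 2 * \<i>) * (1 / (1 + (ray_pt c x)\<^sup>2) * ray_pt c x)" for x
    proof -
      have ray: "ray_pt (c + pi / 2) x = \<i> * ray_pt c x"
        by (simp add: ray_pt_eq complex_eq_iff cos_add sin_add)
      have sq: "(\<i> * ray_pt c x)\<^sup>2 - 1 = - (1 + (ray_pt c x)\<^sup>2)"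
        by (simp add: power_mult_distrib)
      show ?thesis
        unfolding ray sq by (simp only: divide_minus_right) simp
    qed
    then show ?thesis
      unfolding ray_integral_def by (simp only: integral_mult_right_zero)
  qed
  show "ray_integral c (\<lambda>u. 1 / (1 + u\<^sup>2)) = pi / 2" if "- pi / 2 < c" "c < pi / 2"
    using ray_integral_two_poles_upper [of "c + pi / 2"] that unfolding eq by (simp add: field_simps)
  show "ray_integral c (\<lambda>u. 1 / (1 + u\<^sup>2)) = - pi / 2" if "pi / 2 < c" "c < 3 * pi / 2"
  proof -
    have "ray_integral (c + pi / 2) (\<lambda>u. 2 / (u\<^sup>2 - 1)) = \<i> * pi"
      using ray_integral_two_poles_lower [of "c + pi / 2 - 2 * pi"] ray_integral_periodic [of "c + pi / 2 - 2 * pi"] that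
      by (simp add: add.commute)
    then have "(- 2 * \<i>) * ray_integral c (\<lambda>u. 1 / (1 + u\<^sup>2)) = (- 2 * \<i>) * (- pi / 2)"
      unfolding eq by simp
    then show ?thesis
      by (simp add: complex_eq_iff)
  qed
qed

section \<open>The boundary of the double sector and Cauchy's formula\<close>

lemma cos_abs_right: "\<lbrakk>0 < \<phi>; \<phi> < \<theta>; \<theta> < pi / 2; a \<in> {- \<phi>..\<phi>}\<rbrakk> \<Longrightarrow> cos \<phi> \<le> cos a"
  using cos_monotone_0_pi_le [of "\<bar>a\<bar>" \<phi>] by (auto simp: abs_le_iff)

lemma cos_abs_left:
  assumes "0 < \<phi>" "\<phi> < \<theta>" "\<theta> < pi / 2" "a \<in> {pi - \<phi>..pi + \<phi>}"
  shows "cos a \<le> - cos \<phi>"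
  using cos_abs_right [of \<phi> \<theta> "a - pi"] assms by (simp add: cos_diff)

lemma cos_less: "\<lbrakk>0 < \<phi>; \<phi> < \<theta>; \<theta> < pi / 2\<rbrakk> \<Longrightarrow> cos \<theta> < cos \<phi>"
  by (rule cos_monotone_0_pi) auto

text \<open>This is 1 / (2 pi i) times the integral over the boundary of the double sector with its
  interior on the left: in each half, out along the ray of smaller angle and back along the
  other.\<close>

definition contour_mean :: "real \<Rightarrow> (complex \<Rightarrow> complex) \<Rightarrow> complex" where
  "contour_mean \<phi> F = (ray_integral (- \<phi>) F - ray_integral \<phi> F +
    ray_integral (pi - \<phi>) F - ray_integral (pi + \<phi>) F) / (2 * pi * \<i>)"

text \<open>Within each half one boundary ray can be turned into the other without meeting a
  singularity, so the contributions of each half cancel. The margin up to \<phi>' provides an open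
  domain that contains the closed double sector without 0.\<close>

lemma contour_mean_zero:
  assumes \<phi>: "0 < \<phi>" "\<phi> < \<phi>'" "\<phi>' \<le> \<theta>" "\<theta> < pi / 2"
    and F: "F holomorphic_on double_sector_complex \<phi>'"
    and h: "tame {a. cos \<theta> < \<bar>cos a\<bar>} h"
    and le: "\<And>z. z \<noteq> 0 \<Longrightarrow> cos \<phi> * norm z \<le> \<bar>Re z\<bar> \<Longrightarrow> norm (F z * z) \<le> C * norm (h z)"
  shows "contour_mean \<phi> F = 0"
proof -
  have tame_mono: "tame A h" if "A \<subseteq> {a. cos \<theta> < \<bar>cos a\<bar>}" for A
    using h that unfolding tame_def by blast
  have c: "0 < cos \<phi>" "cos \<phi>' < cos \<phi>" "cos \<theta> < cos \<phi>"
    using \<phi> by (auto intro!: cos_gt_zero cos_monotone_0_pi)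
  have rotate: "ray_integral a1 F = ray_integral a2 F"
    if "a1 \<le> a2" and cos: "\<And>a. a \<in> {a1..a2} \<Longrightarrow> cos \<phi> \<le> \<bar>cos a\<bar>" for a1 a2
  proof (rule ray_integral_rotate [OF that(1) F open_double_sector_complex])
    show "ray_pt a x \<in> double_sector_complex \<phi>'" if "a \<in> {a1..a2}" for a x
      using cos [OF that] c by (auto simp: ray_pt_in_double_sector)
    show "tame {a1..a2} h"
      using cos c by (intro tame_mono) force
    show "norm (F (ray_pt a x) * ray_pt a x) \<le> C * norm (h (ray_pt a x))" if "a \<in> {a1..a2}" "\<bar>x\<bar> \<ge> 0" for a x
      using cos [OF that(1)] by (intro le) (auto simp: Re_ray_pt abs_mult mult.commute)
  qed
  have "ray_integral (- \<phi>) F = ray_integral \<phi> F"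
    by (intro rotate order_trans [OF cos_abs_right [of \<phi> \<phi>'] abs_ge_self]) (use \<phi> in auto)
  moreover have "cos \<phi> \<le> \<bar>cos a\<bar>" if "a \<in> {pi - \<phi>..pi + \<phi>}" for a
    using cos_abs_left [of \<phi> \<phi>' a] that \<phi> by auto
  then have "ray_integral (pi - \<phi>) F = ray_integral (pi + \<phi>) F"
    by (intro rotate) (use \<phi> in auto)
  ultimately show ?thesis by (simp add: contour_mean_def)
qed

text \<open>Each of the four rays is turned separately through the gap between the two double
  sectors, so singularities on either side of the gap do no harm.\<close>

lemma contour_mean_shift:
  assumes \<phi>: "0 < \<phi>" "\<phi> < \<phi>'" "\<phi>' < \<theta>" "\<theta> < pi / 2"
    and F: "F holomorphic_on U" "open U"
    and U: "\<And>z. z \<noteq> 0 \<Longrightarrow> cos \<phi>' * norm z \<le> \<bar>Re z\<bar> \<Longrightarrow> \<bar>Re z\<bar> \<le> cos \<phi> * norm z \<Longrightarrow> z \<in> U"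
    and h: "tame {a. cos \<theta> < \<bar>cos a\<bar>} h"
    and le: "\<And>z. z \<in> U \<Longrightarrow> norm (F z * z) \<le> C * norm (h z)"
  shows "contour_mean \<phi> F = contour_mean \<phi>' F"
proof -
  have tame_mono: "tame A h" if "A \<subseteq> {a. cos \<theta> < \<bar>cos a\<bar>}" for A
    using h that unfolding tame_def by blast
  have c: "cos \<theta> < cos \<phi>'"
    using \<phi> by (auto intro!: cos_monotone_0_pi)
  have rotate: "ray_integral a1 F = ray_integral a2 F"
    if "a1 \<le> a2" and cos: "\<And>a. a \<in> {a1..a2} \<Longrightarrow> cos \<phi>' \<le> \<bar>cos a\<bar> \<and> \<bar>cos a\<bar> \<le> cos \<phi>" for a1 a2
  proof (rule ray_integral_rotate [OF that(1) F])
    show *: "ray_pt a x \<in> U" if "a \<in> {a1..a2}" for a x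
      using cos [OF that] by (intro U) (auto simp: Re_ray_pt abs_mult mult.commute)
    show "tame {a1..a2} h"
      using cos c by (intro tame_mono) force
    show "norm (F (ray_pt a x) * ray_pt a x) \<le> C * norm (h (ray_pt a x))" if "a \<in> {a1..a2}" "\<bar>x\<bar> \<ge> 0" for a x
      using * [OF that(1)] by (rule le)
  qed
  have cos: "cos \<phi>' \<le> \<bar>cos a\<bar> \<and> \<bar>cos a\<bar> \<le> cos \<phi>" if "a \<in> {\<phi>..\<phi>'}" for a
  proof -
    have "cos \<phi>' \<le> cos a" "cos a \<le> cos \<phi>" "0 \<le> cos a"
      using that \<phi> by (auto intro!: cos_monotone_0_pi_le cos_ge_zero)
    then show ?thesis by simp
  qed
  have cos_diff_pi: "cos (a - pi) = - cos a" for a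
    by (simp add: cos_diff)
  have "ray_integral \<phi> F = ray_integral \<phi>' F"
    using \<phi> cos by (intro rotate) auto
  moreover have "ray_integral (- \<phi>') F = ray_integral (- \<phi>) F"
    using \<phi> cos [of "- a" for a] by (intro rotate) auto
  moreover have "ray_integral (pi - \<phi>') F = ray_integral (pi - \<phi>) F"
    using \<phi> cos [of "pi - a" for a] by (intro rotate) auto
  moreover have "ray_integral (pi + \<phi>) F = ray_integral (pi + \<phi>') F"
    using \<phi> cos [of "a - pi" for a] by (intro rotate) (auto simp: cos_diff_pi)
  ultimately show ?thesis by (simp add: contour_mean_def)
qed

text \<open>\<open>R\<close> and \<open>I\<close> are lower bounds for the real and imaginary
  distance. By the addition theorem, the weights sin and cos of \<phi>' eliminate |w| and those of
  \<phi> eliminate |z|, which leaves sin (\<phi>' - \<phi>) times the other modulus; the weights are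
  at most 1, hence the factor 2.\<close>

lemma sector_gap:
  assumes \<phi>: "0 < \<phi>" "\<phi> < \<phi>'" "\<phi>' \<le> pi / 2"
    and z: "cos \<phi> * norm z \<le> \<bar>Re z\<bar>" and w: "\<bar>Re w\<bar> \<le> cos \<phi>' * norm w"
  shows "sin (\<phi>' - \<phi>) * norm z \<le> 2 * norm (w - z)" "sin (\<phi>' - \<phi>) * norm w \<le> 2 * norm (w - z)"
proof -
  have pos: "0 < cos \<phi>" "0 \<le> cos \<phi>'" "0 < sin \<phi>" "0 < sin \<phi>'"
    using \<phi> by (auto intro!: cos_gt_zero cos_ge_zero sin_gt_zero)
  have le1: "cos \<phi> \<le> 1" "cos \<phi>' \<le> 1" "sin \<phi> \<le> 1" "sin \<phi>' \<le> 1" by auto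
  have "(cos \<phi> * norm z)\<^sup>2 \<le> (Re z)\<^sup>2"
    using power_mono [OF z, of 2] pos by simp
  then have "(Im z)\<^sup>2 \<le> (sin \<phi> * norm z)\<^sup>2"
    using cmod_power2 [of z] sin_cos_squared_add [of \<phi>] unfolding power_mult_distrib
    by (smt (verit, ccfv_SIG) distrib_right mult_cancel_right1)
  then have Im_z: "\<bar>Im z\<bar> \<le> sin \<phi> * norm z"
    using pos by (metis abs_le_square_iff abs_of_nonneg mult_nonneg_nonneg norm_ge_zero less_imp_le)
  have "(Re w)\<^sup>2 \<le> (cos \<phi>' * norm w)\<^sup>2"
    using power_mono [OF w, of 2] by simp
  then have "(sin \<phi>' * norm w)\<^sup>2 \<le> (Im w)\<^sup>2"
    using cmod_power2 [of w] sin_cos_squared_add [of \<phi>'] unfolding power_mult_distrib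
    by (smt (verit, ccfv_SIG) distrib_right mult_cancel_right1)
  then have Im_w: "sin \<phi>' * norm w \<le> \<bar>Im w\<bar>"
    using pos by (metis abs_le_square_iff abs_of_nonneg mult_nonneg_nonneg norm_ge_zero less_imp_le)
  have n: "\<bar>Re (w - z)\<bar> \<le> norm (w - z)" "\<bar>Im (w - z)\<bar> \<le> norm (w - z)"
    by (rule abs_Re_le_cmod, rule abs_Im_le_cmod)
  define R I where "R = cos \<phi> * norm z - cos \<phi>' * norm w" and "I = sin \<phi>' * norm w - sin \<phi> * norm z"
  have R: "R \<le> norm (w - z)" and I: "I \<le> norm (w - z)"
    unfolding R_def I_def using n z w Im_z Im_w by auto
  have mono: "p * R + q * I \<le> 2 * norm (w - z)" if "0 \<le> p" "p \<le> 1" "0 \<le> q" "q \<le> 1" for p q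
  proof -
    have "p * R \<le> p * norm (w - z)" "q * I \<le> q * norm (w - z)"
      using R I that by (auto intro!: mult_left_mono)
    moreover have "p * norm (w - z) \<le> norm (w - z)" "q * norm (w - z) \<le> norm (w - z)"
      using that by (auto intro!: mult_left_le_one_le)
    ultimately show ?thesis by linarith
  qed
  have "sin (\<phi>' - \<phi>) * norm z = sin \<phi>' * R + cos \<phi>' * I"
    by (simp add: R_def I_def sin_diff algebra_simps)
  then show "sin (\<phi>' - \<phi>) * norm z \<le> 2 * norm (w - z)"
    using mono [of "sin \<phi>'" "cos \<phi>'"] pos le1 by simp
  have "sin (\<phi>' - \<phi>) * norm w = sin \<phi> * R + cos \<phi> * I"
    by (simp add: R_def I_def sin_diff algebra_simps)
  then show "sin (\<phi>' - \<phi>) * norm w \<le> 2 * norm (w - z)"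
    using mono [of "sin \<phi>" "cos \<phi>"] pos le1 by simp
qed

text \<open>The logarithms of the two moduli differ by at least 1, so one modulus is at least twice
  the other because 2 \<le> exp 1; both estimates then follow from the triangle inequality in the
  two cases.\<close>

lemma far_from_pole:
  fixes w z :: complex
  assumes x: "\<bar>x\<bar> \<ge> \<bar>x0\<bar> + 1" and w: "norm w = exp x" and z: "norm z = exp x0"
  shows "norm w \<le> 2 * norm (w - z)"
    and "min (1 / 2) ((norm z)\<^sup>2 / 2) * (1 + (norm w)\<^sup>2) \<le> norm (w\<^sup>2 - z\<^sup>2)"
proof -
  have 2: "2 \<le> exp (1 :: real)"
    using exp_ge_add_one_self [of 1] by simp
  have "2 * norm z \<le> norm w \<or> 2 * norm w \<le> norm z"
  proof (cases "x \<ge> x0 + 1")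
    case True
    then have "exp 1 * exp x0 \<le> exp x" by (simp add: add.commute flip: exp_add)
    then show ?thesis using mult_right_mono [OF 2 exp_ge_zero [of x0]] unfolding w z by linarith
  next
    case False
    then have "exp 1 * exp x \<le> exp x0" using x by (simp flip: exp_add)
    then show ?thesis using mult_right_mono [OF 2 exp_ge_zero [of x]] unfolding w z by linarith
  qed
  then have cases: "2 * norm z \<le> norm w \<or> 2 * norm w \<le> norm z" .
  then show "norm w \<le> 2 * norm (w - z)"
    using norm_triangle_ineq2 [of w z] norm_triangle_ineq3 [of w z] by (auto simp: abs_le_iff)
  define k where "k = min (1 / 2) ((norm z)\<^sup>2 / 2)"
  have k: "k \<le> 1 / 2" "k \<le> (norm z)\<^sup>2 / 2"
    by (auto simp: k_def)
  then have k: "k \<le> 1 / 2" "k \<le> (norm z)\<^sup>2 / 2" "k * (norm w)\<^sup>2 \<le> 1 / 2 * (norm w)\<^sup>2"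
    using mult_right_mono [OF k(1) zero_le_power2] by blast+
  have "k * (1 + (norm w)\<^sup>2) \<le> \<bar>(norm w)\<^sup>2 - (norm z)\<^sup>2\<bar>"
    using cases
  proof
    assume "2 * norm z \<le> norm w"
    then have "(2 * norm z)\<^sup>2 \<le> (norm w)\<^sup>2" by (intro power_mono) auto
    then have "4 * (norm z)\<^sup>2 \<le> (norm w)\<^sup>2" by (simp add: power_mult_distrib)
    then show ?thesis using k zero_le_power2 [of "norm w"] by (simp add: algebra_simps)
  next
    assume "2 * norm w \<le> norm z"
    then have "(2 * norm w)\<^sup>2 \<le> (norm z)\<^sup>2" by (intro power_mono) auto
    then have "4 * (norm w)\<^sup>2 \<le> (norm z)\<^sup>2" by (simp add: power_mult_distrib)
    then show ?thesis using k zero_le_power2 [of "norm w"] by (simp add: algebra_simps)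
  qed
  also have "\<dots> \<le> norm (w\<^sup>2 - z\<^sup>2)"
    using norm_triangle_ineq3 [of "w\<^sup>2" "z\<^sup>2"] by (simp add: norm_power)
  finally show "min (1 / 2) ((norm z)\<^sup>2 / 2) * (1 + (norm w)\<^sup>2) \<le> norm (w\<^sup>2 - z\<^sup>2)"
    by (simp add: k_def)
qed

text \<open>
  Cauchy's formula in one half \<open>c0 = 0\<close> or \<open>c0 = pi\<close> of the double sector. The pole at \<open>z\<close> is cancelled
  by a multiple of \<open>2 z / (w\<^sup>2 - z\<^sup>2)\<close>, whose second pole lies in the other half, and which
  decays fast enough at both ends of the rays.
\<close>

lemma sector_cauchy:
  assumes H: "H \<in> symmetric_decaying \<theta>" and \<phi>: "0 < \<phi>" "\<phi> < \<theta>" "\<theta> < pi / 2"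
    and c0: "c0 = 0 \<or> c0 = pi" and a: "\<bar>a - c0\<bar> < \<phi>" and z_def: "z = ray_pt a x0"
  shows "ray_integral (c0 - \<phi>) (\<lambda>w. H w / (w - z)) - ray_integral (c0 + \<phi>) (\<lambda>w. H w / (w - z)) =
    2 * pi * \<i> * H z"
proof -
  \<comment> \<open>\<sigma> is 1 or -1 according to the half of the double sector; it lets both
    halves be described by \<open>0 < \<sigma> * Re w\<close>.\<close>
  define \<sigma> where "\<sigma> = cos c0"
  have \<sigma>: "\<bar>\<sigma>\<bar> = 1" "cos (b - c0) = \<sigma> * cos b" for b
    using c0 by (auto simp: \<sigma>_def cos_diff)
  define U where "U = double_sector_complex \<theta> \<inter> {w. 0 < \<sigma> * Re w}"
  have "open U"
    unfolding U_def by (intro open_Int open_double_sector_complex open_Collect_less continuous_intros)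
  have cos_\<theta>: "cos \<theta> < cos \<phi>" "0 < cos \<phi>"
    using cos_less [OF \<phi>] \<phi> by (auto intro!: cos_gt_zero)
  have cos_c0: "cos \<phi> \<le> cos (b - c0)" if "\<bar>b - c0\<bar> \<le> \<phi>" for b
    using cos_abs_right [OF \<phi>, of "b - c0"] that by (simp add: abs_le_iff)
  have angle: "cos \<theta> < \<bar>cos b\<bar> \<and> 0 < \<sigma> * cos b" if "\<bar>b - c0\<bar> \<le> \<phi>" for b
  proof -
    have "cos \<phi> \<le> \<sigma> * cos b"
      using cos_c0 [OF that] \<sigma>(2) by simp
    then show ?thesis
      using cos_\<theta> \<sigma>(1) by (simp add: abs_if split: if_splits)
  qed
  have ray_U: "ray_pt b x \<in> U" if "\<bar>b - c0\<bar> \<le> \<phi>" for b x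
    using angle [OF that] by (simp add: U_def ray_pt_in_double_sector Re_ray_pt zero_less_mult_iff mult_less_0_iff)
  have z: "z \<in> U" "z \<noteq> 0" "norm z = exp x0"
    using a by (auto simp: z_def intro!: ray_U)
  have sum_nz: "w + z \<noteq> 0" if "w \<in> U" for w
  proof -
    have "0 < \<sigma> * Re (w + z)"
      using that z by (simp add: U_def distrib_left)
    then show ?thesis by force
  qed
  \<comment> \<open>Division of \<open>N w\<close> by w - z gives H w / (w - z) minus H z times 2 z
    / (w^2 - z^2), the announced correction; \<open>N z = 0\<close> makes the quotient extend
    holomorphically to z.\<close>
  define N where "N w = H w - 2 * z * H z / (w + z)" for w
  have "N z = 0" using z by (simp add: N_def)
  have "H holomorphic_on U"
    using H holomorphic_on_subset by (auto simp: symmetric_decaying_def U_def)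
  then have "N holomorphic_on U"
    unfolding N_def using sum_nz by (intro holomorphic_intros) auto
  define F where "F w = (if w = z then deriv N z else (N w - N z) / (w - z))" for w
  have F: "F holomorphic_on U"
    unfolding F_def using pole_lemma [OF \<open>N holomorphic_on U\<close>, of z] z \<open>open U\<close> by (simp add: interior_open)
  have F_eq: "F w * w = H w / (w - z) * w - 2 * z / (w\<^sup>2 - z\<^sup>2) * w * H z" if "w \<in> U" "w \<noteq> z" for w
  proof -
    have "w + z \<noteq> 0" "w - z \<noteq> 0" "w\<^sup>2 - z\<^sup>2 = (w + z) * (w - z)"
      using that sum_nz by (auto simp: power2_eq_square algebra_simps)
    then show ?thesis
      using that \<open>N z = 0\<close> by (simp add: F_def N_def divide_simps) (simp add: algebra_simps)
  qed
  define k where "k = min (1 / 2) ((norm z)\<^sup>2 / 2)"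
  have "k > 0" using z by (simp add: k_def)
  define K where "K = 2 * norm z / k"
  have far1: "norm (H w / (w - z) * w) \<le> 2 * norm (H w)" if "\<bar>x\<bar> \<ge> \<bar>x0\<bar> + 1" "norm w = exp x" for x w
  proof -
    have le: "norm w \<le> 2 * norm (w - z)"
      using far_from_pole(1) [OF that z(3)] .
    moreover have "norm w > 0" using that by simp
    ultimately have "norm (w - z) > 0" by linarith
    then show ?thesis
      using mult_left_mono [OF le, of "norm (H w)"] by (simp add: norm_divide norm_mult divide_simps)
  qed
  have far2: "norm (2 * z / (w\<^sup>2 - z\<^sup>2) * w) \<le> K * norm (bump w)" if "\<bar>x\<bar> \<ge> \<bar>x0\<bar> + 1" "norm w = exp x" for x w
  proof -
    have le: "k * (1 + (norm w)\<^sup>2) \<le> norm (w\<^sup>2 - z\<^sup>2)"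
      unfolding k_def by (rule far_from_pole(2) [OF that z(3)])
    have pos: "0 < k * (1 + (norm w)\<^sup>2)"
      using \<open>k > 0\<close> by (simp add: add_pos_nonneg)
    have "norm (2 * z / (w\<^sup>2 - z\<^sup>2) * w) = 2 * norm z * norm w / norm (w\<^sup>2 - z\<^sup>2)"
      by (simp add: norm_divide norm_mult)
    also have "\<dots> \<le> 2 * norm z * norm w / (k * (1 + (norm w)\<^sup>2))"
      using le pos by (intro divide_left_mono) (auto intro!: mult_pos_pos intro: less_le_trans)
    also have "\<dots> = K * bump w"
      using pos by (simp add: K_def bump_def)
    finally show ?thesis by (simp add: bump_nonneg)
  qed
  define C where "C = 2 + K * norm (H z)"
  have K: "K \<ge> 0" using \<open>k > 0\<close> by (simp add: K_def)
  have rotate: "ray_integral (c0 - \<phi>) F = ray_integral (c0 + \<phi>) F"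
  proof (rule ray_integral_rotate [OF _ F \<open>open U\<close>, where h = "\<lambda>w. norm (H w) + bump w" and N = "\<bar>x0\<bar> + 1" and C = C])
    show "c0 - \<phi> \<le> c0 + \<phi>" using \<phi> by simp
    show in_U: "ray_pt b x \<in> U" if "b \<in> {c0 - \<phi>..c0 + \<phi>}" for b x
      using that by (intro ray_U) (auto simp: abs_le_iff)
    show "tame {c0 - \<phi>..c0 + \<phi>} (\<lambda>w. norm (H w) + bump w)"
      by (intro tame_add tame_bump symmetric_decaying_tame [OF H] angle [THEN conjunct1]) (auto simp: abs_le_iff)
    fix b x assume b: "b \<in> {c0 - \<phi>..c0 + \<phi>}" and x: "\<bar>x\<bar> \<ge> \<bar>x0\<bar> + 1"
    define w where "w = ray_pt b x"
    have w: "norm w = exp x" "w \<in> U" using in_U [OF b] by (simp_all add: w_def)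
    have "w \<noteq> z" using w(1) z(3) x by force
    have "norm (F w * w) \<le> norm (H w / (w - z) * w) + norm (2 * z / (w\<^sup>2 - z\<^sup>2) * w) * norm (H z)"
      unfolding F_eq [OF w(2) \<open>w \<noteq> z\<close>] norm_mult [symmetric] by (rule norm_triangle_ineq4)
    also have "\<dots> \<le> 2 * norm (H w) + K * norm (bump w) * norm (H z)"
      by (intro add_mono mult_right_mono far1 [OF x w(1)] far2 [OF x w(1)]) auto
    also have "\<dots> \<le> C * (norm (H w) + bump w)"
      using K bump_nonneg [of w] by (simp add: C_def algebra_simps)
    also have "\<dots> \<le> C * norm (norm (H w) + bump w)"
      using K by (intro mult_left_mono) (auto simp: C_def)
    finally show "norm (F (ray_pt b x) * ray_pt b x) \<le> C * norm (norm (H (ray_pt b x)) + bump (ray_pt b x))"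
      unfolding w_def .
  qed
  have edge: "ray_integral b F = ray_integral b (\<lambda>w. H w / (w - z)) - ray_integral b (\<lambda>w. 2 * z / (w\<^sup>2 - z\<^sup>2)) * H z"
    if b: "\<bar>b - c0\<bar> = \<phi>" for b
  proof -
    have in_U: "ray_pt b x \<in> U" for x using b by (intro ray_U) simp
    have ne: "ray_pt b x \<noteq> z" for x
    proof
      assume eq: "ray_pt b x = z"
      then have "x = x0" using z(3) norm_ray_pt [of b x] by simp
      then have "cos a = cos b"
        using arg_cong [OF eq, of Re] by (simp add: z_def Re_ray_pt)
      then have "cos \<bar>a - c0\<bar> = cos \<bar>b - c0\<bar>"
        using \<sigma>(2) by simp
      moreover have "cos \<bar>b - c0\<bar> < cos \<bar>a - c0\<bar>"
        unfolding b using a \<phi> by (intro cos_monotone_0_pi) auto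
      ultimately show False by simp
    qed
    have ne2: "(ray_pt b x)\<^sup>2 - z\<^sup>2 \<noteq> 0" for x
    proof -
      have "(ray_pt b x)\<^sup>2 - z\<^sup>2 = (ray_pt b x + z) * (ray_pt b x - z)"
        by (simp add: power2_eq_square algebra_simps)
      then show ?thesis using ne sum_nz [OF in_U] by simp
    qed
    have cont_H: "continuous_on UNIV (\<lambda>x. H (ray_pt b x))"
      using in_U by (intro continuous_on_compose2 [OF holomorphic_on_imp_continuous_on [OF \<open>H holomorphic_on U\<close>]]
          continuous_on_ray_pt) auto
    have tame_b: "tame {b} (\<lambda>w. norm (H w))"
      using b by (intro symmetric_decaying_tame [OF H] angle [THEN conjunct1]) auto
    have int1: "integrable lborel (\<lambda>x. H (ray_pt b x) / (ray_pt b x - z) * ray_pt b x)"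
      using ne tame_b
      by (intro integrable_continuous_dominated [where h = "\<lambda>x. norm (H (ray_pt b x))" and N = "\<bar>x0\<bar> + 1" and C = 2]
          continuous_intros cont_H continuous_on_ray_pt)
        (use far1 in \<open>auto simp: tame_def\<close>)
    have int2: "integrable lborel (\<lambda>x. 2 * z / ((ray_pt b x)\<^sup>2 - z\<^sup>2) * ray_pt b x)"
      using ne2 tame_bump [of "{b}"]
      by (intro integrable_continuous_dominated [where h = "\<lambda>x. bump (ray_pt b x)" and N = "\<bar>x0\<bar> + 1" and C = K]
          continuous_intros continuous_on_ray_pt)
        (use far2 in \<open>auto simp: tame_def\<close>)
    show ?thesis
      unfolding ray_integral_def F_eq [OF in_U ne]
      using int1 int2 by (simp only: Bochner_Integration.integral_diff integrable_mult_left integral_mult_left_zero)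
  qed
  \<comment> \<open>The correction contributes -i pi on the ray of larger angle and i pi on the
    other; the difference is the 2 pi i of Cauchy's formula.\<close>
  have "ray_integral (c0 + \<phi>) (\<lambda>w. 2 * z / (w\<^sup>2 - z\<^sup>2)) = - \<i> * pi"
    unfolding z_def ray_integral_two_poles_at using a \<phi> by (intro ray_integral_two_poles_upper) auto
  moreover have "ray_integral (c0 - \<phi>) (\<lambda>w. 2 * z / (w\<^sup>2 - z\<^sup>2)) = \<i> * pi"
    unfolding z_def ray_integral_two_poles_at using a \<phi> by (intro ray_integral_two_poles_lower) auto
  ultimately show ?thesis
    using rotate edge [of "c0 - \<phi>"] edge [of "c0 + \<phi>"] \<phi> by (simp add: algebra_simps)
qed

text \<open>A pole in the opposite half plane does not obstruct turning one boundary ray of this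
  half into the other; as the real parts of w and z have opposite signs, |w - z| is at least cos
  \<phi> times |w|.\<close>

lemma sector_cauchy_outside:
  assumes H: "H \<in> symmetric_decaying \<theta>" and \<phi>: "0 < \<phi>" "\<phi> < \<theta>" "\<theta> < pi / 2"
    and c0: "c0 = 0 \<or> c0 = pi" and z: "cos c0 * Re z < 0"
  shows "ray_integral (c0 - \<phi>) (\<lambda>w. H w / (w - z)) = ray_integral (c0 + \<phi>) (\<lambda>w. H w / (w - z))"
proof -
  define \<sigma> where "\<sigma> = cos c0"
  have \<sigma>: "\<bar>\<sigma>\<bar> = 1" "\<sigma> * \<sigma> = 1" "cos (b - c0) = \<sigma> * cos b" for b
    using c0 by (auto simp: \<sigma>_def cos_diff)
  define U where "U = double_sector_complex \<theta> \<inter> {w. 0 < \<sigma> * Re w}"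
  have "open U"
    unfolding U_def by (intro open_Int open_double_sector_complex open_Collect_less continuous_intros)
  have cos_\<theta>: "cos \<theta> < cos \<phi>" "0 < cos \<phi>"
    using cos_less [OF \<phi>] \<phi> by (auto intro!: cos_gt_zero)
  have angle: "cos \<phi> \<le> \<sigma> * cos b" "cos \<theta> < \<bar>cos b\<bar>" if "b \<in> {c0 - \<phi>..c0 + \<phi>}" for b
  proof -
    show *: "cos \<phi> \<le> \<sigma> * cos b"
      using cos_abs_right [OF \<phi>, of "b - c0"] that \<sigma>(3) [of b] by simp
    show "cos \<theta> < \<bar>cos b\<bar>"
      using * cos_\<theta> \<sigma>(1) by (simp add: abs_if split: if_splits)
  qed
  show ?thesis
  proof (rule ray_integral_rotate [OF _ _ \<open>open U\<close>, where h = "\<lambda>w. norm (H w)" and N = 0 and C = "1 / cos \<phi>"])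
    show "c0 - \<phi> \<le> c0 + \<phi>" using \<phi> by simp
    have "w \<noteq> z" if "w \<in> U" for w
      using that z by (auto simp: U_def \<sigma>_def)
    moreover have "H holomorphic_on U"
      using H holomorphic_on_subset by (auto simp: symmetric_decaying_def U_def)
    ultimately show "(\<lambda>w. H w / (w - z)) holomorphic_on U"
      by (intro holomorphic_intros) auto
    show "tame {c0 - \<phi>..c0 + \<phi>} (\<lambda>w. norm (H w))"
      using angle by (intro symmetric_decaying_tame [OF H]) auto
    fix b x assume b: "b \<in> {c0 - \<phi>..c0 + \<phi>}"
    define w where "w = ray_pt b x"
    have "0 < \<sigma> * cos b" using angle(1) [OF b] cos_\<theta> by linarith
    then show "ray_pt b x \<in> U"
      using angle(2) [OF b] by (simp add: U_def ray_pt_in_double_sector Re_ray_pt zero_less_mult_iff mult_less_0_iff)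
    have "cos \<phi> * norm w \<le> \<sigma> * Re w"
      using mult_right_mono [OF angle(1) [OF b], of "exp x"] by (simp add: w_def Re_ray_pt mult_ac)
    also have "\<dots> \<le> \<sigma> * Re (w - z)"
      using z by (simp add: right_diff_distrib \<sigma>_def)
    also have "\<dots> \<le> \<bar>Re (w - z)\<bar>"
      using \<sigma>(1) abs_ge_self [of "\<sigma> * Re (w - z)"] by (simp add: abs_mult)
    also have "\<dots> \<le> norm (w - z)"
      by (rule abs_Re_le_cmod)
    finally have le: "cos \<phi> * norm w \<le> norm (w - z)" .
    moreover have "0 < cos \<phi> * norm w" using cos_\<theta> by (simp add: w_def)
    ultimately have "0 < norm (w - z)" by linarith
    then have "norm (H w / (w - z) * w) \<le> 1 / cos \<phi> * norm (norm (H w))"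
      using mult_left_mono [OF le, of "norm (H w)"] cos_\<theta> by (simp add: norm_divide norm_mult divide_simps mult_ac)
    then show "norm (H (ray_pt b x) / (ray_pt b x - z) * ray_pt b x) \<le> 1 / cos \<phi> * norm (norm (H (ray_pt b x)))"
      unfolding w_def .
  qed
qed

text \<open>The half that contains z yields the value, and the other half contributes
  nothing.\<close>

lemma contour_mean_cauchy:
  assumes H: "H \<in> symmetric_decaying \<theta>" and \<phi>: "0 < \<phi>" "\<phi> < \<theta>" "\<theta> < pi / 2"
    and a: "\<bar>a\<bar> < \<phi> \<or> \<bar>a - pi\<bar> < \<phi>" and z: "z = ray_pt a x"
  shows "contour_mean \<phi> (\<lambda>w. H w / (w - z)) = H z"
  using a
proof
  assume a: "\<bar>a\<bar> < \<phi>"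
  have "0 < cos a" using a \<phi> by (intro cos_gt_zero_pi) auto
  then have "cos pi * Re z < 0" by (simp add: z Re_ray_pt)
  then show ?thesis
    using sector_cauchy [OF H \<phi>, of 0 a z x] sector_cauchy_outside [OF H \<phi>, of pi z] a z
    by (simp add: contour_mean_def)
next
  assume a: "\<bar>a - pi\<bar> < \<phi>"
  have "0 < cos (a - pi)" using a \<phi> by (intro cos_gt_zero_pi) auto
  then have "cos 0 * Re z < 0" by (simp add: z Re_ray_pt cos_diff mult_less_0_iff)
  then show ?thesis
    using sector_cauchy [OF H \<phi>, of pi a z x] sector_cauchy_outside [OF H \<phi>, of 0 z] a z
    by (simp add: contour_mean_def)
qed

section \<open>Integrability, linearity and exchange of contour integrals\<close>

definition ray_integrable :: "real \<Rightarrow> (complex \<Rightarrow> complex) \<Rightarrow> bool" where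
  "ray_integrable a F \<longleftrightarrow> integrable lborel (\<lambda>x. F (ray_pt a x) * ray_pt a x)"

definition contour_angles :: "real \<Rightarrow> real set" where
  "contour_angles \<phi> = {- \<phi>, \<phi>, pi - \<phi>, pi + \<phi>}"

definition contour_integrable :: "real \<Rightarrow> (complex \<Rightarrow> complex) \<Rightarrow> bool" where
  "contour_integrable \<phi> F \<longleftrightarrow> (\<forall>a\<in>contour_angles \<phi>. ray_integrable a F)"

lemma ray_integrableI:
  assumes cont: "continuous_on UNIV (\<lambda>x. F (ray_pt a x))" and h: "integrable lborel (\<lambda>x. h (ray_pt a x))"
    and le: "\<And>x. norm (F (ray_pt a x) * ray_pt a x) \<le> C * norm (h (ray_pt a x) :: real)"
  shows "ray_integrable a F"
  unfolding ray_integrable_def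
  by (rule integrable_continuous_dominated [where h = "\<lambda>x. h (ray_pt a x)" and C = C and N = 0])
    (intro continuous_intros cont continuous_on_ray_pt h le)+

lemma ray_integral_cong:
  assumes "\<And>x. F (ray_pt a x) = G (ray_pt a x)"
  shows "ray_integral a F = ray_integral a G"
  by (simp add: ray_integral_def assms)

lemma ray_integral_linear:
  assumes "ray_integrable a F" "ray_integrable a G"
  shows "ray_integrable a (\<lambda>z. c * F z + d * G z)"
    and "ray_integral a (\<lambda>z. c * F z + d * G z) = c * ray_integral a F + d * ray_integral a G"
proof -
  have eq: "(c * F z + d * G z) * z = c * (F z * z) + d * (G z * z)" for z
    by (simp add: algebra_simps)
  show "ray_integrable a (\<lambda>z. c * F z + d * G z)"
    using assms unfolding ray_integrable_def eq by (intro Bochner_Integration.integrable_add integrable_mult_right)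
  show "ray_integral a (\<lambda>z. c * F z + d * G z) = c * ray_integral a F + d * ray_integral a G"
    using assms unfolding ray_integrable_def ray_integral_def eq
    by (simp add: Bochner_Integration.integral_add)
qed

lemma contour_mean_cong:
  assumes "\<And>a x. a \<in> contour_angles \<phi> \<Longrightarrow> F (ray_pt a x) = G (ray_pt a x)"
  shows "contour_mean \<phi> F = contour_mean \<phi> G"
proof -
  have "ray_integral a F = ray_integral a G" if "a \<in> contour_angles \<phi>" for a
    using assms that by (intro ray_integral_cong)
  then show ?thesis by (simp add: contour_mean_def contour_angles_def)
qed

lemma contour_mean_linear:
  assumes "contour_integrable \<phi> F" "contour_integrable \<phi> G"
  shows "contour_integrable \<phi> (\<lambda>z. c * F z + d * G z)"
    and "contour_mean \<phi> (\<lambda>z. c * F z + d * G z) = c * contour_mean \<phi> F + d * contour_mean \<phi> G"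
proof -
  have int: "ray_integrable a F" "ray_integrable a G" if "a \<in> contour_angles \<phi>" for a
    using assms that by (auto simp: contour_integrable_def)
  show "contour_integrable \<phi> (\<lambda>z. c * F z + d * G z)"
    using int by (auto simp: contour_integrable_def intro!: ray_integral_linear)
  have "contour_mean \<phi> (\<lambda>z. c * F z + d * G z) =
      ((c * ray_integral (- \<phi>) F + d * ray_integral (- \<phi>) G) - (c * ray_integral \<phi> F + d * ray_integral \<phi> G) +
      (c * ray_integral (pi - \<phi>) F + d * ray_integral (pi - \<phi>) G) -
      (c * ray_integral (pi + \<phi>) F + d * ray_integral (pi + \<phi>) G)) / (2 * pi * \<i>)"
    unfolding contour_mean_def by (simp add: ray_integral_linear [OF int] contour_angles_def)
  then show "contour_mean \<phi> (\<lambda>z. c * F z + d * G z) = c * contour_mean \<phi> F + d * contour_mean \<phi> G"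
    unfolding contour_mean_def by (simp add: add_divide_distrib diff_divide_distrib algebra_simps)
qed

lemma contour_angles_cos:
  assumes "a \<in> contour_angles \<phi>"
  shows "\<bar>cos a\<bar> = \<bar>cos \<phi>\<bar>"
  using assms by (auto simp: contour_angles_def cos_diff)

lemma integrable_product_real:
  fixes A B :: "real \<Rightarrow> real"
  assumes "integrable lborel A" "integrable lborel B"
  shows "integrable (lborel \<Otimes>\<^sub>M lborel) (\<lambda>(x, y). A x * B y)"
proof (rule lborel_pair.Fubini_integrable)
  show "(\<lambda>(x, y). A x * B y) \<in> borel_measurable (lborel \<Otimes>\<^sub>M lborel)"
    using borel_measurable_integrable [OF assms(1)] borel_measurable_integrable [OF assms(2)] by measurable
  show "integrable lborel (\<lambda>x. LINT y|lborel. norm (case (x, y) of (x, y) \<Rightarrow> A x * B y))"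
    using assms by (simp add: abs_mult)
  show "AE x in lborel. integrable lborel (\<lambda>y. case (x, y) of (x, y) \<Rightarrow> A x * B y)"
    using assms by simp
qed

text \<open>Fubini's theorem. The gap absorbs the factor |z| of dz, because |z| / |w - z| is at most
  1 / k. So \<open>p\<close> is taken integrable in the logarithmic coordinate and \<open>q\<close>
  integrable against dw, which suits p = G and q = r H, where the resolvent supplies the decay 1 /
  |w|.\<close>

lemma ray_integral_swap:
  assumes p: "continuous_on UNIV (\<lambda>x. p (ray_pt a x))" "integrable lborel (\<lambda>x. norm (p (ray_pt a x)))"
    and q: "continuous_on UNIV (\<lambda>y. q (ray_pt b y))" "ray_integrable b q"
    and gap: "\<And>x y. k * norm (ray_pt a x) \<le> norm (ray_pt b y - ray_pt a x)" and k: "k > 0"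
  shows "ray_integrable a (\<lambda>z. p z * ray_integral b (\<lambda>w. q w / (w - z)))"
    and "ray_integral a (\<lambda>z. p z * ray_integral b (\<lambda>w. q w / (w - z))) =
      ray_integral b (\<lambda>w. q w * ray_integral a (\<lambda>z. p z / (w - z)))"
    and "ray_integrable b (\<lambda>w. q w * ray_integral a (\<lambda>z. p z / (w - z)))"
proof -
  define f where "f x y = p (ray_pt a x) * ray_pt a x * (q (ray_pt b y) * ray_pt b y) / (ray_pt b y - ray_pt a x)" for x y
  have pos: "0 < norm (ray_pt b y - ray_pt a x)" for x y
  proof -
    have "0 < k * norm (ray_pt a x)" using k by simp
    then show ?thesis using gap [of x y] by linarith
  qed
  have ne: "ray_pt b y \<noteq> ray_pt a x" for x y
    using pos [of y x] by simp
  have "continuous_on UNIV (case_prod f)"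
    unfolding f_def case_prod_beta
    by (intro continuous_intros continuous_on_compose2 [OF p(1)] continuous_on_compose2 [OF q(1)]
        continuous_on_compose2 [OF continuous_on_ray_pt [of UNIV]]) (auto simp: ne)
  then have meas: "case_prod f \<in> borel_measurable (lborel \<Otimes>\<^sub>M lborel)"
    using borel_measurable_continuous_onI by (simp add: lborel_prod)
  have int: "integrable (lborel \<Otimes>\<^sub>M lborel) (case_prod f)"
  proof (rule Bochner_Integration.integrable_bound [OF _ meas])
    show "integrable (lborel \<Otimes>\<^sub>M lborel) (\<lambda>(x, y). norm (p (ray_pt a x)) * (norm (q (ray_pt b y) * ray_pt b y) / k))"
      using p(2) q(2) by (intro integrable_product_real) (auto simp: ray_integrable_def)
    have "norm (f x y) \<le> norm (p (ray_pt a x)) * (norm (q (ray_pt b y) * ray_pt b y) / k)" for x y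
    proof -
      have "norm (ray_pt a x) / norm (ray_pt b y - ray_pt a x) \<le> 1 / k"
        using gap [of x y] k pos [of y x] by (simp add: divide_simps mult.commute)
      then have "norm (p (ray_pt a x)) * norm (q (ray_pt b y) * ray_pt b y) * (norm (ray_pt a x) / norm (ray_pt b y - ray_pt a x)) \<le>
          norm (p (ray_pt a x)) * norm (q (ray_pt b y) * ray_pt b y) * (1 / k)"
        by (intro mult_left_mono) auto
      then show ?thesis by (simp add: f_def norm_mult norm_divide mult_ac)
    qed
    then show "AE z in lborel \<Otimes>\<^sub>M lborel. norm (case_prod f z) \<le>
        norm (case z of (x, y) \<Rightarrow> norm (p (ray_pt a x)) * (norm (q (ray_pt b y) * ray_pt b y) / k))"
      using k by (auto intro!: AE_I2 simp: abs_mult)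
  qed
  have inner1: "(LINT y|lborel. f x y) = p (ray_pt a x) * ray_integral b (\<lambda>w. q w / (w - ray_pt a x)) * ray_pt a x" for x
  proof -
    have "f x y = p (ray_pt a x) * ray_pt a x * (q (ray_pt b y) / (ray_pt b y - ray_pt a x) * ray_pt b y)" for y
      by (simp add: f_def)
    then have "(LINT y|lborel. f x y) = p (ray_pt a x) * ray_pt a x * ray_integral b (\<lambda>w. q w / (w - ray_pt a x))"
      unfolding ray_integral_def by (simp only: integral_mult_right_zero)
    then show ?thesis by (simp only: mult_ac)
  qed
  have inner2: "(LINT x|lborel. f x y) = q (ray_pt b y) * ray_integral a (\<lambda>z. p z / (ray_pt b y - z)) * ray_pt b y" for y
  proof -
    have "f x y = q (ray_pt b y) * ray_pt b y * (p (ray_pt a x) / (ray_pt b y - ray_pt a x) * ray_pt a x)" for x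
      by (simp add: f_def)
    then have "(LINT x|lborel. f x y) = q (ray_pt b y) * ray_pt b y * ray_integral a (\<lambda>z. p z / (ray_pt b y - z))"
      unfolding ray_integral_def by (simp only: integral_mult_right_zero)
    then show ?thesis by (simp only: mult_ac)
  qed
  show "ray_integrable a (\<lambda>z. p z * ray_integral b (\<lambda>w. q w / (w - z)))"
    using lborel_pair.integrable_fst [OF int] unfolding inner1 ray_integrable_def .
  show "ray_integrable b (\<lambda>w. q w * ray_integral a (\<lambda>z. p z / (w - z)))"
    using lborel_pair.integrable_snd [OF int] unfolding inner2 ray_integrable_def .
  show "ray_integral a (\<lambda>z. p z * ray_integral b (\<lambda>w. q w / (w - z))) =
      ray_integral b (\<lambda>w. q w * ray_integral a (\<lambda>z. p z / (w - z)))"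
    using lborel_pair.Fubini_integral [OF int] unfolding inner1 inner2 ray_integral_def by simp
qed

text \<open>The substitutions \<open>t = exp x\<close> and \<open>t = - exp x\<close> turn the two halves of the real line into rays.\<close>

lemma integral_real_line_exp:
  fixes f :: "real \<Rightarrow> 'a::euclidean_space"
  assumes pos: "integrable lborel (\<lambda>x. exp x *\<^sub>R f (exp x))"
    and neg: "integrable lborel (\<lambda>x. exp x *\<^sub>R f (- exp x))"
  shows "f integrable_on UNIV"
    and "integral UNIV f = (LINT x|lborel. exp x *\<^sub>R f (exp x)) + (LINT x|lborel. exp x *\<^sub>R f (- exp x))"
proof -
  have half: "f integrable_on g ` UNIV \<and> integral (g ` UNIV) f = (LINT x|lborel. exp x *\<^sub>R f (g x))"
    if g: "\<And>x. (g has_field_derivative g' x) (at x)" "inj g" "\<And>x. \<bar>g' x\<bar> = exp x"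
      and int: "integrable lborel (\<lambda>x. exp x *\<^sub>R f (g x))" for g g'
  proof -
    have "(\<lambda>x. \<bar>g' x\<bar> *\<^sub>R f (g x)) absolutely_integrable_on UNIV"
      using integrable_completion [THEN iffD2, OF borel_measurable_integrable [OF int] int]
      by (simp add: set_integrable_def g(3))
    moreover have "integral UNIV (\<lambda>x. \<bar>g' x\<bar> *\<^sub>R f (g x)) = (LINT x|lborel. exp x *\<^sub>R f (g x))"
      unfolding g(3) by (rule integral_lborel [OF int])
    ultimately have "f absolutely_integrable_on g ` UNIV \<and> integral (g ` UNIV) f = (LINT x|lborel. exp x *\<^sub>R f (g x))"
      using has_absolute_integral_change_of_variables_real [of UNIV g g' f "LINT x|lborel. exp x *\<^sub>R f (g x)"] g by simp
    then show ?thesis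
      using absolutely_integrable_on_def by blast
  qed
  have "x \<in> range exp" if "0 < x" for x :: real
    using that by (intro range_eqI [of _ _ "ln x"]) simp
  then have "exp ` UNIV = {0::real<..}"
    by auto
  moreover have "x \<in> range (\<lambda>x. - exp x)" if "x < 0" for x :: real
    using that by (intro range_eqI [of _ _ "ln (- x)"]) simp
  then have "(\<lambda>x. - exp x) ` UNIV = {..<0::real}"
    by auto
  moreover have "((\<lambda>x. - exp x) has_real_derivative - exp x) (at x)" for x :: real
    by (auto intro!: derivative_eq_intros)
  ultimately have right: "f integrable_on {0<..}" "integral {0<..} f = (LINT x|lborel. exp x *\<^sub>R f (exp x))"
    and left: "f integrable_on {..<0}" "integral {..<0} f = (LINT x|lborel. exp x *\<^sub>R f (- exp x))"
    using half [of exp exp] half [of "\<lambda>x. - exp x" "\<lambda>x. - exp x"] pos neg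
    by (auto simp: inj_on_def)
  have int: "(f has_integral (integral {0<..} f + integral {..<0} f)) ({0<..} \<union> {..<0})"
    by (intro has_integral_Un integrable_integral right(1) left(1) empty_imp_negligible) auto
  have "negligible {x \<in> UNIV - ({0<..} \<union> {..<0}). f x \<noteq> 0}"
    by (rule negligible_subset [OF negligible_sing [of 0]]) auto
  then have "(f has_integral (integral {0<..} f + integral {..<0} f)) UNIV"
    using int has_integral_spike_set_eq [of UNIV "{0<..} \<union> {..<0}" f] by simp
  then show "f integrable_on UNIV"
    "integral UNIV f = (LINT x|lborel. exp x *\<^sub>R f (exp x)) + (LINT x|lborel. exp x *\<^sub>R f (- exp x))"
    using right left by (auto simp: integral_unique)
qed

section \<open>Resolvent families\<close>

text \<open>
  \<open>R0 z + i R1 z\<close> is the resolvent at \<open>z\<close>, on the complexification of a real Banach space, of an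
  operator that commutes with complex conjugation; the resolvent identity is split into its real and
  imaginary parts.
\<close>

locale resolvent_family =
  fixes R0 R1 :: "complex \<Rightarrow> 'a::banach \<Rightarrow>\<^sub>L 'a" and c M :: real
  assumes c_pos: "0 < c"
    and resolvent_Re: "\<And>z w. \<bar>Re z\<bar> < c * norm z \<Longrightarrow> \<bar>Re w\<bar> < c * norm w \<Longrightarrow>
      Re (w - z) *\<^sub>R ((R0 z o\<^sub>L R0 w) - (R1 z o\<^sub>L R1 w)) - Im (w - z) *\<^sub>R ((R0 z o\<^sub>L R1 w) + (R1 z o\<^sub>L R0 w)) = R0 z - R0 w"
    and resolvent_Im: "\<And>z w. \<bar>Re z\<bar> < c * norm z \<Longrightarrow> \<bar>Re w\<bar> < c * norm w \<Longrightarrow>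
      Re (w - z) *\<^sub>R ((R0 z o\<^sub>L R1 w) + (R1 z o\<^sub>L R0 w)) + Im (w - z) *\<^sub>R ((R0 z o\<^sub>L R0 w) - (R1 z o\<^sub>L R1 w)) = R1 z - R1 w"
    and bound_R0: "\<And>z. \<bar>Re z\<bar> < c * norm z \<Longrightarrow> norm (R0 z) * norm z \<le> M"
    and bound_R1: "\<And>z. \<bar>Re z\<bar> < c * norm z \<Longrightarrow> norm (R1 z) * norm z \<le> M"
    and R0_cnj: "\<And>z. \<bar>Re z\<bar> < c * norm z \<Longrightarrow> R0 (cnj z) = R0 z"
    and R1_cnj: "\<And>z. \<bar>Re z\<bar> < c * norm z \<Longrightarrow> R1 (cnj z) = - R1 z"
begin

definition resolvent_dom :: "complex set" where
  "resolvent_dom = {z. \<bar>Re z\<bar> < c * norm z}"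

lemma open_resolvent_dom: "open resolvent_dom"
  unfolding resolvent_dom_def by (intro open_Collect_less continuous_intros)

lemma resolvent_dom_nonzero: "z \<in> resolvent_dom \<Longrightarrow> z \<noteq> 0"
  by (auto simp: resolvent_dom_def)

lemma cnj_resolvent_dom: "cnj z \<in> resolvent_dom \<longleftrightarrow> z \<in> resolvent_dom"
  by (simp add: resolvent_dom_def)

lemma i_resolvent_dom: "\<i> \<in> resolvent_dom"
  using c_pos by (simp add: resolvent_dom_def)

lemma ray_pt_resolvent_dom: "ray_pt a x \<in> resolvent_dom \<longleftrightarrow> \<bar>cos a\<bar> < c"
  by (simp add: resolvent_dom_def Re_ray_pt abs_mult mult.commute)

text \<open>The complex linear extension of \<open>l\<close>, applied to the resolvent at
  \<open>z\<close> acting on \<open>v\<close>; the variant with two points does the same for a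
  product of two resolvents.\<close>

definition scalar_resolvent :: "('a \<Rightarrow>\<^sub>L real) \<Rightarrow> 'a \<Rightarrow> complex \<Rightarrow> complex" where
  "scalar_resolvent l v z = Complex (l (R0 z v)) (l (R1 z v))"

definition scalar_resolvent2 :: "('a \<Rightarrow>\<^sub>L real) \<Rightarrow> 'a \<Rightarrow> complex \<Rightarrow> complex \<Rightarrow> complex" where
  "scalar_resolvent2 l v z w =
    Complex (l (R0 z (R0 w v) - R1 z (R1 w v))) (l (R0 z (R1 w v) + R1 z (R0 w v)))"

lemma scalar_resolvent_identity:
  assumes "z \<in> resolvent_dom" "w \<in> resolvent_dom"
  shows "(w - z) * scalar_resolvent2 l v z w = scalar_resolvent l v z - scalar_resolvent l v w"
proof -
  have "l ((Re (w - z) *\<^sub>R ((R0 z o\<^sub>L R0 w) - (R1 z o\<^sub>L R1 w)) - Im (w - z) *\<^sub>R ((R0 z o\<^sub>L R1 w) + (R1 z o\<^sub>L R0 w))) v) =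
      l ((R0 z - R0 w) v)"
    "l ((Re (w - z) *\<^sub>R ((R0 z o\<^sub>L R1 w) + (R1 z o\<^sub>L R0 w)) + Im (w - z) *\<^sub>R ((R0 z o\<^sub>L R0 w) - (R1 z o\<^sub>L R1 w))) v) =
      l ((R1 z - R1 w) v)"
    using resolvent_Re resolvent_Im assms by (simp_all add: resolvent_dom_def)
  then show ?thesis
    by (simp add: scalar_resolvent_def scalar_resolvent2_def complex_eq_iff
        blinfun.add_left blinfun.diff_left blinfun.scaleR_left blinfun.add_right blinfun.diff_right blinfun.scaleR_right)
qed

lemma scalar_resolvent_bound:
  assumes "z \<in> resolvent_dom"
  shows "norm (scalar_resolvent l v z * z) \<le> 2 * M * norm l * norm v"
proof -
  have le: "\<bar>l (A v)\<bar> * norm z \<le> M * norm l * norm v" if "norm A * norm z \<le> M" for A :: "'a \<Rightarrow>\<^sub>L 'a"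
  proof -
    have "\<bar>l (A v)\<bar> \<le> norm l * (norm A * norm v)"
      using norm_blinfun [of l "A v"] mult_left_mono [OF norm_blinfun [of A v], of "norm l"] by simp
    then have "\<bar>l (A v)\<bar> * norm z \<le> norm l * (norm A * norm v) * norm z"
      by (intro mult_right_mono) auto
    also have "\<dots> = (norm A * norm z) * (norm l * norm v)" by simp
    also have "\<dots> \<le> M * (norm l * norm v)"
      using that by (intro mult_right_mono) auto
    finally show ?thesis by (simp add: mult.assoc)
  qed
  have "norm (scalar_resolvent l v z * z) \<le> (\<bar>l (R0 z v)\<bar> + \<bar>l (R1 z v)\<bar>) * norm z"
    unfolding norm_mult using cmod_le [of "scalar_resolvent l v z"]
    by (intro mult_right_mono) (auto simp: scalar_resolvent_def)
  also have "\<dots> \<le> 2 * M * norm l * norm v"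
    using le [OF bound_R0] le [OF bound_R1] assms by (fastforce simp: resolvent_dom_def distrib_right)
  finally show ?thesis .
qed

lemma scalar_resolvent_cnj:
  "z \<in> resolvent_dom \<Longrightarrow> scalar_resolvent l v (cnj z) = cnj (scalar_resolvent l v z)"
  by (simp add: scalar_resolvent_def R0_cnj R1_cnj resolvent_dom_def blinfun.minus_left blinfun.minus_right complex_eq_iff)

text \<open>This is the resolvent identity together with the bounds M / |z| at \<open>z\<close> and
  2 M / |z| at points of more than half that modulus. The resulting norm continuity serves both the
  operator-valued integrals and the complex derivative of the scalar functions.\<close>

lemma resolvent_lipschitz:
  assumes z: "z \<in> resolvent_dom"
  obtains K where "\<forall>\<^sub>F w in at z. w \<in> resolvent_dom \<and>
    norm (R0 w - R0 z) \<le> K * norm (w - z) \<and> norm (R1 w - R1 z) \<le> K * norm (w - z)"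
proof -
  define m where "m = M / norm z"
  define m' where "m' = 2 * M / norm z"
  have nz: "0 < norm z" using resolvent_dom_nonzero [OF z] by simp
  have Rz: "norm (R0 z) \<le> m" "norm (R1 z) \<le> m"
    using bound_R0 bound_R1 z nz by (auto simp: m_def resolvent_dom_def field_simps)
  then have m: "0 \<le> m" by (meson norm_ge_zero order_trans)
  have "\<forall>\<^sub>F w in at z. w \<in> resolvent_dom \<inter> {w. norm z / 2 < norm w}"
    using z nz by (intro eventually_at_in_open' open_Int open_resolvent_dom open_Collect_less continuous_intros) auto
  then have "\<forall>\<^sub>F w in at z. w \<in> resolvent_dom \<and>
    norm (R0 w - R0 z) \<le> (4 * m * m') * norm (w - z) \<and> norm (R1 w - R1 z) \<le> (4 * m * m') * norm (w - z)"
  proof eventually_elim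
    case (elim w)
    then have w: "w \<in> resolvent_dom" "norm z / 2 < norm w" by auto
    then have dom: "\<bar>Re w\<bar> < c * norm w" "\<bar>Re z\<bar> < c * norm z"
      using z by (simp_all add: resolvent_dom_def)
    have "norm A \<le> m'" if A: "norm A * norm w \<le> M" for A :: "'a \<Rightarrow>\<^sub>L 'a"
    proof -
      have "norm A * (norm z / 2) \<le> norm A * norm w"
        using w by (intro mult_left_mono) auto
      then show ?thesis using A nz by (simp add: m'_def field_simps)
    qed
    then have Rw: "norm (R0 w) \<le> m'" "norm (R1 w) \<le> m'"
      using bound_R0 [OF dom(1)] bound_R1 [OF dom(1)] by auto
    have comp: "norm (A o\<^sub>L B) \<le> m * m'" if "norm A \<le> m" "norm B \<le> m'" for A B :: "'a \<Rightarrow>\<^sub>L 'a"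
      using norm_blinfun_compose [of A B] mult_mono [OF that m norm_ge_zero] by linarith
    have diff: "norm ((R0 z o\<^sub>L R0 w) - (R1 z o\<^sub>L R1 w)) \<le> 2 * (m * m')"
      using norm_triangle_ineq4 [of "R0 z o\<^sub>L R0 w" "R1 z o\<^sub>L R1 w"] comp [OF Rz(1) Rw(1)] comp [OF Rz(2) Rw(2)]
      by linarith
    have sum: "norm ((R0 z o\<^sub>L R1 w) + (R1 z o\<^sub>L R0 w)) \<le> 2 * (m * m')"
      using norm_triangle_ineq [of "R0 z o\<^sub>L R1 w" "R1 z o\<^sub>L R0 w"] comp [OF Rz(1) Rw(2)] comp [OF Rz(2) Rw(1)]
      by linarith
    have scale: "norm (r *\<^sub>R A) \<le> norm (w - z) * (2 * (m * m'))"
      if "\<bar>r\<bar> \<le> norm (w - z)" "norm A \<le> 2 * (m * m')" for r and A :: "'a \<Rightarrow>\<^sub>L 'a"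
      using that by (auto intro!: mult_mono)
    have "norm (R0 z - R0 w) \<le> norm (w - z) * (2 * (m * m')) + norm (w - z) * (2 * (m * m'))"
      unfolding resolvent_Re [OF dom(2,1), symmetric]
      by (intro order_trans [OF norm_triangle_ineq4] add_mono scale diff sum abs_Re_le_cmod abs_Im_le_cmod)
    moreover have "norm (R1 z - R1 w) \<le> norm (w - z) * (2 * (m * m')) + norm (w - z) * (2 * (m * m'))"
      unfolding resolvent_Im [OF dom(2,1), symmetric]
      by (intro order_trans [OF norm_triangle_ineq] add_mono scale diff sum abs_Re_le_cmod abs_Im_le_cmod)
    ultimately show ?case
      using w by (simp add: norm_minus_commute algebra_simps)
  qed
  then show ?thesis using that by blast
qed

lemma resolvent_tendsto:
  assumes z: "z \<in> resolvent_dom"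
  shows "(R0 \<longlongrightarrow> R0 z) (at z)" "(R1 \<longlongrightarrow> R1 z) (at z)"
proof -
  obtain K where K: "\<forall>\<^sub>F w in at z. w \<in> resolvent_dom \<and>
    norm (R0 w - R0 z) \<le> K * norm (w - z) \<and> norm (R1 w - R1 z) \<le> K * norm (w - z)"
    using resolvent_lipschitz [OF z] .
  have lim: "((\<lambda>w. K * norm (w - z)) \<longlongrightarrow> 0) (at z)"
    by (rule tendsto_eq_intros tendsto_norm_zero | simp)+
  have "((\<lambda>w. R0 w - R0 z) \<longlongrightarrow> 0) (at z)" "((\<lambda>w. R1 w - R1 z) \<longlongrightarrow> 0) (at z)"
    using K by (auto intro!: Lim_null_comparison [OF _ lim] elim: eventually_mono)
  then show "(R0 \<longlongrightarrow> R0 z) (at z)" "(R1 \<longlongrightarrow> R1 z) (at z)"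
    by (simp_all add: Lim_null [symmetric])
qed

lemma continuous_on_resolvent: "continuous_on resolvent_dom R0" "continuous_on resolvent_dom R1"
  using resolvent_tendsto by (auto simp: continuous_on_def intro: tendsto_within_subset)

text \<open>By the resolvent identity the difference quotient is minus the tested product of
  resolvents, which converges by norm continuity.\<close>

lemma scalar_resolvent_holomorphic: "scalar_resolvent l v holomorphic_on resolvent_dom"
proof (rule holomorphic_onI)
  fix z assume z: "z \<in> resolvent_dom"
  have "((\<lambda>w. scalar_resolvent2 l v z w) \<longlongrightarrow> scalar_resolvent2 l v z z) (at z)"
    unfolding scalar_resolvent2_def
    by (intro tendsto_Complex blinfun.tendsto tendsto_const tendsto_diff tendsto_add resolvent_tendsto z)
  then have "((\<lambda>w. - scalar_resolvent2 l v z w) \<longlongrightarrow> - scalar_resolvent2 l v z z) (at z)"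
    by (rule tendsto_minus)
  moreover have "\<forall>\<^sub>F w in at z. - scalar_resolvent2 l v z w =
      (scalar_resolvent l v w - scalar_resolvent l v z) / (w - z)"
  proof -
    have "\<forall>\<^sub>F w in at z. w \<in> resolvent_dom \<and> w \<noteq> z"
      using z open_resolvent_dom eventually_at_topological by blast
    then show ?thesis
    proof eventually_elim
      case (elim w)
      then have "- ((w - z) * scalar_resolvent2 l v z w) / (w - z) =
          (scalar_resolvent l v w - scalar_resolvent l v z) / (w - z)"
        using scalar_resolvent_identity [OF z, of w l v] by simp
      then show ?case using elim by simp
    qed
  qed
  ultimately have "((\<lambda>w. (scalar_resolvent l v w - scalar_resolvent l v z) / (w - z)) \<longlongrightarrow> - scalar_resolvent2 l v z z) (at z)"
    by (rule Lim_transform_eventually)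
  then have "(scalar_resolvent l v has_field_derivative - scalar_resolvent2 l v z z) (at z)"
    by (simp add: has_field_derivative_iff)
  then show "scalar_resolvent l v field_differentiable at z within resolvent_dom"
    using field_differentiable_at_within field_differentiable_def by blast
qed

end

section \<open>The parametrised contour and the operator-valued integral\<close>

text \<open>A branch of the contour and, below, the factor gamma' / J of the calculus, carried to
  the complex plane with i in place of J. At t = 0 the weight is 0 because
  \<open>sgn 0 = 0\<close>.\<close>

definition contour_pt :: "real \<Rightarrow> real \<Rightarrow> real \<Rightarrow> complex" where
  "contour_pt \<sigma> \<phi> t = of_real (\<sigma> * \<bar>t\<bar>) * cis (- sgn t * \<phi>)"

definition contour_weight :: "real \<Rightarrow> real \<Rightarrow> real \<Rightarrow> complex" where
  "contour_weight \<sigma> \<phi> t = of_real (\<sigma> * sgn t) * cis (- sgn t * \<phi>) / \<i>"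

definition branch_angle :: "real \<Rightarrow> real" where
  "branch_angle \<sigma> = (if \<sigma> = 1 then 0 else pi)"

lemma branch_angle_simps [simp]: "branch_angle 1 = 0" "branch_angle (- 1) = pi"
  by (simp_all add: branch_angle_def)

text \<open>Positive \<open>t\<close> traverse the ray of smaller angle outwards, negative
  \<open>t\<close> the ray of larger angle inwards, hence the minus sign in the last equation; this
  is the orientation of \<open>contour_mean\<close>.\<close>

lemma contour_pt_exp:
  assumes "\<sigma> \<in> {1, - 1}"
  shows "contour_pt \<sigma> \<phi> (exp x) = ray_pt (branch_angle \<sigma> - \<phi>) x"
    and "contour_pt \<sigma> \<phi> (- exp x) = ray_pt (branch_angle \<sigma> + \<phi>) x"
    and "of_real (exp x) * contour_weight \<sigma> \<phi> (exp x) = ray_pt (branch_angle \<sigma> - \<phi>) x / \<i>"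
    and "of_real (exp x) * contour_weight \<sigma> \<phi> (- exp x) = - ray_pt (branch_angle \<sigma> + \<phi>) x / \<i>"
  using assms
  by (auto simp: contour_pt_def contour_weight_def branch_angle_def ray_pt_eq complex_eq_iff cos_diff sin_diff)

lemma contour_pt_cases:
  assumes "t \<noteq> 0" "\<sigma> \<in> {1, - 1}"
  obtains a x where "a \<in> contour_angles \<phi>" "contour_pt \<sigma> \<phi> t = ray_pt a x"
proof (cases "t > 0")
  case True
  then have "contour_pt \<sigma> \<phi> t = ray_pt (branch_angle \<sigma> - \<phi>) (ln t)"
    using contour_pt_exp(1) [OF assms(2), of \<phi> "ln t"] by simp
  then show ?thesis using that assms(2) by (fastforce simp: contour_angles_def)
next
  case False
  then have "contour_pt \<sigma> \<phi> t = ray_pt (branch_angle \<sigma> + \<phi>) (ln (- t))"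
    using contour_pt_exp(2) [OF assms(2), of \<phi> "ln (- t)"] assms(1) by simp
  then show ?thesis using that assms(2) by (fastforce simp: contour_angles_def)
qed

lemma norm_contour_pt: "\<sigma> \<in> {1, - 1} \<Longrightarrow> norm (contour_pt \<sigma> \<phi> t) = \<bar>t\<bar>"
  by (auto simp: contour_pt_def norm_mult)

lemma norm_contour_weight: "\<sigma> \<in> {1, - 1} \<Longrightarrow> norm (contour_weight \<sigma> \<phi> t) \<le> 1"
  by (auto simp: contour_weight_def norm_mult norm_divide abs_sgn_eq)

lemma continuous_on_contour_pt: "continuous_on (- {0}) (contour_pt \<sigma> \<phi>)"
  unfolding contour_pt_def by (intro continuous_intros) auto

lemma continuous_on_contour_weight: "continuous_on (- {0}) (contour_weight \<sigma> \<phi>)"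
  unfolding contour_weight_def by (intro continuous_intros) auto

context resolvent_family
begin

text \<open>Together with \<open>integrand_Im\<close> this is R0 + i R1 multiplied by the complex
  number weight times \<open>H\<close>, split into real and imaginary part.\<close>

definition integrand_Re :: "(complex \<Rightarrow> complex) \<Rightarrow> real \<Rightarrow> real \<Rightarrow> real \<Rightarrow> 'a \<Rightarrow>\<^sub>L 'a" where
  "integrand_Re H \<phi> \<sigma> t = Re (contour_weight \<sigma> \<phi> t * H (contour_pt \<sigma> \<phi> t)) *\<^sub>R R0 (contour_pt \<sigma> \<phi> t) -
    Im (contour_weight \<sigma> \<phi> t * H (contour_pt \<sigma> \<phi> t)) *\<^sub>R R1 (contour_pt \<sigma> \<phi> t)"

definition integrand_Im :: "(complex \<Rightarrow> complex) \<Rightarrow> real \<Rightarrow> real \<Rightarrow> real \<Rightarrow> 'a \<Rightarrow>\<^sub>L 'a" where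
  "integrand_Im H \<phi> \<sigma> t = Re (contour_weight \<sigma> \<phi> t * H (contour_pt \<sigma> \<phi> t)) *\<^sub>R R1 (contour_pt \<sigma> \<phi> t) +
    Im (contour_weight \<sigma> \<phi> t * H (contour_pt \<sigma> \<phi> t)) *\<^sub>R R0 (contour_pt \<sigma> \<phi> t)"

text \<open>Integrating the real part gives the whole Riesz--Dunford integral, because the imaginary
  part integrates to 0 on each branch.\<close>

definition calc :: "real \<Rightarrow> (complex \<Rightarrow> complex) \<Rightarrow> 'a \<Rightarrow>\<^sub>L 'a" where
  "calc \<phi> H = (1 / (2 * pi)) *\<^sub>R (\<Sum>\<sigma>\<in>{1, - 1}. integral UNIV (integrand_Re H \<phi> \<sigma>))"

lemma scalar_integrand:
  fixes l :: "'a \<Rightarrow>\<^sub>L real"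
  shows "Complex (l (integrand_Re H \<phi> \<sigma> t v)) (l (integrand_Im H \<phi> \<sigma> t v)) =
    contour_weight \<sigma> \<phi> t * H (contour_pt \<sigma> \<phi> t) * scalar_resolvent l v (contour_pt \<sigma> \<phi> t)"
proof -
  define k where "k = contour_weight \<sigma> \<phi> t * H (contour_pt \<sigma> \<phi> t)"
  show ?thesis
    unfolding integrand_Re_def integrand_Im_def scalar_resolvent_def k_def [symmetric]
    by (simp add: complex_eq_iff blinfun.add_left blinfun.diff_left blinfun.scaleR_left
        blinfun.add_right blinfun.diff_right blinfun.scaleR_right)
qed

lemma M_nonneg: "0 \<le> M"
  using bound_R0 [of \<i>] i_resolvent_dom by (simp add: resolvent_dom_def) (meson norm_ge_zero order_trans)

context
  fixes \<phi> \<theta> :: real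
  assumes \<phi>: "0 < \<phi>" "\<phi> < \<theta>" "\<theta> < pi / 2" and cos_\<phi>: "cos \<phi> < c"
begin

lemma cos_\<phi>_pos: "0 < cos \<phi>" "cos \<theta> < cos \<phi>"
  using \<phi> cos_less [OF \<phi>] by (auto intro!: cos_gt_zero)

lemma contour_angles_admissible:
  assumes "a \<in> contour_angles \<phi>"
  shows "cos \<theta> < \<bar>cos a\<bar>" "\<bar>cos a\<bar> < c"
  using contour_angles_cos [OF assms] cos_\<phi>_pos cos_\<phi> by auto

lemma contour_pt_dom:
  assumes "t \<noteq> 0" "\<sigma> \<in> {1, - 1}"
  shows "contour_pt \<sigma> \<phi> t \<in> resolvent_dom" "contour_pt \<sigma> \<phi> t \<in> double_sector_complex \<theta>"
proof -
  obtain a x where "a \<in> contour_angles \<phi>" "contour_pt \<sigma> \<phi> t = ray_pt a x"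
    using contour_pt_cases [OF assms] .
  then show "contour_pt \<sigma> \<phi> t \<in> resolvent_dom" "contour_pt \<sigma> \<phi> t \<in> double_sector_complex \<theta>"
    using contour_angles_admissible by (simp_all add: ray_pt_resolvent_dom ray_pt_in_double_sector)
qed

lemma branch_angles:
  assumes "\<sigma> \<in> {1, - 1}"
  shows "branch_angle \<sigma> - \<phi> \<in> contour_angles \<phi>" "branch_angle \<sigma> + \<phi> \<in> contour_angles \<phi>"
  using assms by (auto simp: contour_angles_def)

text \<open>The majorant 2 M |H| / |t| is integrable since dt / t = dx turns it into
  \<open>H\<close> along rays. The integrands are continuous away from t = 0, and at 0 itself the
  weight vanishes.\<close>

lemma integrands_integrable:
  assumes H: "H \<in> symmetric_decaying \<theta>" and \<sigma>: "\<sigma> \<in> {1, - 1}"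
  shows "integrand_Re H \<phi> \<sigma> integrable_on UNIV" "integrand_Im H \<phi> \<sigma> integrable_on UNIV"
proof -
  define m where "m t = 2 * M * norm (H (contour_pt \<sigma> \<phi> t)) / \<bar>t\<bar>" for t
  have int: "integrable lborel (\<lambda>x. 2 * M * norm (H (ray_pt a x)))" if "a \<in> contour_angles \<phi>" for a
    using H contour_angles_admissible [OF that] by (simp add: symmetric_decaying_def)
  have m: "m integrable_on UNIV"
    using int branch_angles [OF \<sigma>] by (intro integral_real_line_exp) (simp_all add: m_def contour_pt_exp [OF \<sigma>])
  have hol: "H holomorphic_on double_sector_complex \<theta>"
    using H by (simp add: symmetric_decaying_def)
  have cont_H: "continuous_on (- {0}) (\<lambda>t. H (contour_pt \<sigma> \<phi> t))"
    using contour_pt_dom [OF _ \<sigma>]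
    by (intro continuous_on_compose2 [OF holomorphic_on_imp_continuous_on [OF hol]] continuous_on_contour_pt) auto
  have cont_R: "continuous_on (- {0}) (\<lambda>t. R0 (contour_pt \<sigma> \<phi> t))" "continuous_on (- {0}) (\<lambda>t. R1 (contour_pt \<sigma> \<phi> t))"
    using contour_pt_dom [OF _ \<sigma>]
    by (auto intro!: continuous_on_compose2 [OF continuous_on_resolvent(1)]
        continuous_on_compose2 [OF continuous_on_resolvent(2)] continuous_on_contour_pt)
  have bound: "norm (r *\<^sub>R A) \<le> M * norm (H (contour_pt \<sigma> \<phi> t)) / \<bar>t\<bar>"
    if "\<bar>r\<bar> \<le> norm (contour_weight \<sigma> \<phi> t * H (contour_pt \<sigma> \<phi> t))" "norm A * norm (contour_pt \<sigma> \<phi> t) \<le> M" "t \<noteq> 0"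
    for r t and A :: "'a \<Rightarrow>\<^sub>L 'a"
  proof -
    have "\<bar>r\<bar> \<le> 1 * norm (H (contour_pt \<sigma> \<phi> t))"
      using that(1) norm_contour_weight [OF \<sigma>, of \<phi> t] unfolding norm_mult
      by (meson mult_right_mono norm_ge_zero order_trans)
    then have "\<bar>r\<bar> * (norm A * \<bar>t\<bar>) \<le> norm (H (contour_pt \<sigma> \<phi> t)) * M"
      using that(2) by (intro mult_mono) (auto simp: norm_contour_pt [OF \<sigma>])
    then show ?thesis
      using that(3) by (simp add: pos_le_divide_eq mult_ac)
  qed
  have dom: "\<bar>Re (contour_pt \<sigma> \<phi> t)\<bar> < c * norm (contour_pt \<sigma> \<phi> t)" if "t \<noteq> 0" for t
    using contour_pt_dom(1) [OF that \<sigma>] by (simp add: resolvent_dom_def)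
  have zero: "contour_weight \<sigma> \<phi> 0 = 0"
    by (simp add: contour_weight_def)
  have two: "2 * M * h / \<bar>t\<bar> = M * h / \<bar>t\<bar> + M * h / \<bar>t\<bar>" for h t :: real
    by (simp add: field_simps)
  show "integrand_Re H \<phi> \<sigma> integrable_on UNIV"
  proof (rule integrable_on_UNIV_punctured_bound [OF _ m])
    show "continuous_on (- {0}) (integrand_Re H \<phi> \<sigma>)"
      unfolding integrand_Re_def by (intro continuous_intros cont_H cont_R continuous_on_contour_weight)
    show "norm (integrand_Re H \<phi> \<sigma> t) \<le> m t" for t
    proof (cases "t = 0")
      case False
      then show ?thesis
        unfolding integrand_Re_def m_def two
        by (intro order_trans [OF norm_triangle_ineq4] add_mono bound abs_Re_le_cmod abs_Im_le_cmod
            bound_R0 bound_R1 dom)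
    qed (simp add: integrand_Re_def m_def zero)
  qed
  show "integrand_Im H \<phi> \<sigma> integrable_on UNIV"
  proof (rule integrable_on_UNIV_punctured_bound [OF _ m])
    show "continuous_on (- {0}) (integrand_Im H \<phi> \<sigma>)"
      unfolding integrand_Im_def by (intro continuous_intros cont_H cont_R continuous_on_contour_weight)
    show "norm (integrand_Im H \<phi> \<sigma> t) \<le> m t" for t
    proof (cases "t = 0")
      case False
      then show ?thesis
        unfolding integrand_Im_def m_def two
        by (intro order_trans [OF norm_triangle_ineq] add_mono bound abs_Re_le_cmod abs_Im_le_cmod
            bound_R0 bound_R1 dom)
    qed (simp add: integrand_Im_def m_def zero)
  qed
qed

lemma resolvent_contour_integrable:
  assumes H: "H \<in> symmetric_decaying \<theta>"
  shows "contour_integrable \<phi> (\<lambda>z. scalar_resolvent l v z * H z)"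
  unfolding contour_integrable_def
proof
  fix a assume a: "a \<in> contour_angles \<phi>"
  note adm = contour_angles_admissible [OF a]
  have dom: "ray_pt a x \<in> resolvent_dom" "ray_pt a x \<in> double_sector_complex \<theta>" for x
    using adm by (simp_all add: ray_pt_resolvent_dom ray_pt_in_double_sector)
  have hol: "H holomorphic_on double_sector_complex \<theta>"
    using H by (simp add: symmetric_decaying_def)
  show "ray_integrable a (\<lambda>z. scalar_resolvent l v z * H z)"
  proof (rule ray_integrableI)
    show "continuous_on UNIV (\<lambda>x. scalar_resolvent l v (ray_pt a x) * H (ray_pt a x))"
      using dom
      by (intro continuous_on_mult continuous_on_compose2 [OF holomorphic_on_imp_continuous_on [OF hol]]
          continuous_on_compose2 [OF holomorphic_on_imp_continuous_on [OF scalar_resolvent_holomorphic]]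
          continuous_on_ray_pt) auto
    show "integrable lborel (\<lambda>x. norm (H (ray_pt a x)))"
      using H adm by (simp add: symmetric_decaying_def)
    show "norm (scalar_resolvent l v (ray_pt a x) * H (ray_pt a x) * ray_pt a x) \<le>
        2 * M * norm l * norm v * norm (norm (H (ray_pt a x)))" for x
      using mult_right_mono [OF scalar_resolvent_bound [OF dom(1)] norm_ge_zero [of "H (ray_pt a x)"]]
      by (simp add: norm_mult mult_ac)
  qed
qed

lemma resolvent_ray_cnj:
  assumes H: "H \<in> symmetric_decaying \<theta>" and a: "a \<in> contour_angles \<phi>"
  shows "ray_integral (- a) (\<lambda>z. scalar_resolvent l v z * H z) = cnj (ray_integral a (\<lambda>z. scalar_resolvent l v z * H z))"
  using contour_angles_admissible [OF a] H
  by (intro ray_integral_cnj)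
    (simp add: symmetric_decaying_def scalar_resolvent_cnj ray_pt_resolvent_dom ray_pt_in_double_sector flip: ray_pt_cnj)

text \<open>Tested against \<open>l\<close> and \<open>v\<close>, real and imaginary integrand
  combine into weight times a scalar function, and the exponential substitution splits its integral
  into the two rays of the branch with opposite orientation.\<close>

lemma branch_integral:
  fixes l :: "'a \<Rightarrow>\<^sub>L real"
  assumes H: "H \<in> symmetric_decaying \<theta>" and \<sigma>: "\<sigma> \<in> {1, - 1}"
  shows "Complex (l (integral UNIV (integrand_Re H \<phi> \<sigma>) v)) (l (integral UNIV (integrand_Im H \<phi> \<sigma>) v)) =
    (ray_integral (branch_angle \<sigma> - \<phi>) (\<lambda>z. scalar_resolvent l v z * H z) -
     ray_integral (branch_angle \<sigma> + \<phi>) (\<lambda>z. scalar_resolvent l v z * H z)) / \<i>"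
proof -
  define f where "f t = contour_weight \<sigma> \<phi> t * H (contour_pt \<sigma> \<phi> t) * scalar_resolvent l v (contour_pt \<sigma> \<phi> t)" for t
  define F where "F z = scalar_resolvent l v z * H z" for z
  have int: "integrable lborel (\<lambda>x. F (ray_pt a x) * ray_pt a x)" if "a \<in> contour_angles \<phi>" for a
    using resolvent_contour_integrable [OF H, of l v] that by (simp add: contour_integrable_def ray_integrable_def F_def)
  have right: "exp x *\<^sub>R f (exp x) = F (ray_pt (branch_angle \<sigma> - \<phi>) x) * ray_pt (branch_angle \<sigma> - \<phi>) x / \<i>" for x
  proof -
    have "exp x *\<^sub>R f (exp x) = (of_real (exp x) * contour_weight \<sigma> \<phi> (exp x)) * F (contour_pt \<sigma> \<phi> (exp x))"
      by (simp add: f_def F_def scaleR_conv_of_real)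
    then show ?thesis
      unfolding contour_pt_exp [OF \<sigma>] by simp
  qed
  have left: "exp x *\<^sub>R f (- exp x) = - (F (ray_pt (branch_angle \<sigma> + \<phi>) x) * ray_pt (branch_angle \<sigma> + \<phi>) x / \<i>)" for x
  proof -
    have "exp x *\<^sub>R f (- exp x) = (of_real (exp x) * contour_weight \<sigma> \<phi> (- exp x)) * F (contour_pt \<sigma> \<phi> (- exp x))"
      by (simp add: f_def F_def scaleR_conv_of_real)
    then show ?thesis
      unfolding contour_pt_exp [OF \<sigma>] by simp
  qed
  have "integrable lborel (\<lambda>x. exp x *\<^sub>R f (exp x))" "integrable lborel (\<lambda>x. exp x *\<^sub>R f (- exp x))"
    using int branch_angles [OF \<sigma>] by (simp_all add: right left)
  note f = integral_real_line_exp [OF this]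
  then have "integral UNIV f = (ray_integral (branch_angle \<sigma> - \<phi>) F - ray_integral (branch_angle \<sigma> + \<phi>) F) / \<i>"
    unfolding right left
    by (simp only: ray_integral_def diff_divide_distrib Bochner_Integration.integral_minus
        integral_divide_zero add_uminus_conv_diff)
  moreover have "integral UNIV f = Complex (l (integral UNIV (integrand_Re H \<phi> \<sigma>) v)) (l (integral UNIV (integrand_Im H \<phi> \<sigma>) v))"
  proof -
    have lin: "bounded_linear (\<lambda>A. l (blinfun_apply A v))"
      by (intro bounded_linear_intros)
    have "integral UNIV (\<lambda>t. l (integrand_Re H \<phi> \<sigma> t v)) = l (integral UNIV (integrand_Re H \<phi> \<sigma>) v)"
      "integral UNIV (\<lambda>t. l (integrand_Im H \<phi> \<sigma> t v)) = l (integral UNIV (integrand_Im H \<phi> \<sigma>) v)"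
      using integral_linear [OF integrands_integrable(1) [OF H \<sigma>] lin] integral_linear [OF integrands_integrable(2) [OF H \<sigma>] lin]
      by (simp_all add: o_def)
    moreover have "l (integrand_Re H \<phi> \<sigma> t v) = Re (f t)" "l (integrand_Im H \<phi> \<sigma> t v) = Im (f t)" for t
      unfolding f_def scalar_integrand [symmetric] by simp_all
    ultimately show ?thesis
      using integral_linear [OF f(1) bounded_linear_Re] integral_linear [OF f(1) bounded_linear_Im]
      by (simp add: o_def complex_eq_iff)
  qed
  ultimately show ?thesis unfolding F_def by simp
qed

lemma branch_ray_cnj:
  assumes H: "H \<in> symmetric_decaying \<theta>" and \<sigma>: "\<sigma> \<in> {1, - 1}"
  shows "ray_integral (branch_angle \<sigma> - \<phi>) (\<lambda>z. scalar_resolvent l v z * H z) =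
    cnj (ray_integral (branch_angle \<sigma> + \<phi>) (\<lambda>z. scalar_resolvent l v z * H z))"
proof -
  have "ray_integral (branch_angle \<sigma> - \<phi>) F = ray_integral (- (branch_angle \<sigma> + \<phi>)) F" for F
  proof (cases "\<sigma> = 1")
    case False
    have "- (pi + \<phi>) + 2 * pi = pi - \<phi>" by simp
    with ray_integral_periodic [of "- (pi + \<phi>)" F] False show ?thesis
      by (simp only: branch_angle_def if_False)
  qed simp
  then show ?thesis
    using resolvent_ray_cnj [OF H branch_angles(2) [OF \<sigma>]] by simp
qed

text \<open>Conjugation interchanges the two rays of a branch, so the difference of their integrals
  is purely imaginary; division by i makes it real, and the tested operator is the imaginary part of
  that number.\<close>

lemma integral_integrand_Im:
  assumes H: "H \<in> symmetric_decaying \<theta>" and \<sigma>: "\<sigma> \<in> {1, - 1}"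
  shows "integral UNIV (integrand_Im H \<phi> \<sigma>) = 0"
proof (rule blinfun_eq_by_functionals)
  fix l :: "'a \<Rightarrow>\<^sub>L real" and v :: 'a
  show "l (integral UNIV (integrand_Im H \<phi> \<sigma>) v) = l (blinfun_apply 0 v)"
    using arg_cong [OF branch_integral [OF H \<sigma>, of l v], of Im]
    by (simp add: branch_ray_cnj [OF H \<sigma>] Im_divide blinfun.zero_left blinfun.zero_right)
qed

text \<open>The bridge to scalar analysis: identities for \<open>calc\<close> are proved for
  \<open>contour_mean\<close> and return to operators because functionals separate points.\<close>

lemma calc_scalar:
  fixes l :: "'a \<Rightarrow>\<^sub>L real"
  assumes H: "H \<in> symmetric_decaying \<theta>"
  shows "of_real (l (calc \<phi> H v)) = contour_mean \<phi> (\<lambda>z. scalar_resolvent l v z * H z)"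
proof -
  define F where "F z = scalar_resolvent l v z * H z" for z
  have "of_real (l (integral UNIV (integrand_Re H \<phi> \<sigma>) v)) =
    (ray_integral (branch_angle \<sigma> - \<phi>) F - ray_integral (branch_angle \<sigma> + \<phi>) F) / \<i>" if "\<sigma> \<in> {1, - 1}" for \<sigma>
    using branch_integral [OF H that, of l v] integral_integrand_Im [OF H that]
    by (simp add: F_def [abs_def] complex_eq_iff blinfun.zero_left blinfun.zero_right)
  from this [of 1] this [of "- 1"]
  have "complex_of_real (l (calc \<phi> H v)) =
      ((ray_integral (- \<phi>) F - ray_integral \<phi> F) / \<i> + (ray_integral (pi - \<phi>) F - ray_integral (pi + \<phi>) F) / \<i>) / (2 * pi)"
    by (simp add: calc_def blinfun.scaleR_left blinfun.scaleR_right blinfun.add_left blinfun.add_right)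
  also have "\<dots> = contour_mean \<phi> F"
    by (simp add: contour_mean_def field_simps)
  finally show ?thesis unfolding F_def .
qed

end

end

section \<open>Operations on decaying functions\<close>

lemma double_sector_polar:
  assumes "z \<in> double_sector_complex \<theta>" "0 < \<theta>" "\<theta> < pi / 2"
  obtains a x where "z = ray_pt a x" "cos \<theta> < \<bar>cos a\<bar>"
proof -
  have "z \<noteq> 0"
    using assms by (auto simp: double_sector_complex_def)
  then have z: "z = ray_pt (Arg z) (ln (norm z))"
    by (simp add: ray_pt_eq cis_Arg sgn_eq)
  moreover have "cos \<theta> < \<bar>cos (Arg z)\<bar>"
    using assms(1) by (subst (asm) z) (simp add: ray_pt_in_double_sector)
  ultimately show ?thesis using that by blast
qed

lemma symmetric_decayingI:
  assumes \<theta>: "0 < \<theta>" "\<theta> < pi / 2" and hol: "F holomorphic_on double_sector_complex \<theta>"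
    and sym: "\<And>z. z \<in> double_sector_complex \<theta> \<Longrightarrow> F (cnj z) = cnj (F z)"
    and h: "tame {a. cos \<theta> < \<bar>cos a\<bar>} h"
    and le: "\<And>z. z \<in> double_sector_complex \<theta> \<Longrightarrow> norm (F z) \<le> C * norm (h z)"
  shows "F \<in> symmetric_decaying \<theta>"
proof -
  obtain B where B: "\<And>a x. cos \<theta> < \<bar>cos a\<bar> \<Longrightarrow> norm (h (ray_pt a x)) \<le> B"
    using h unfolding tame_def by blast
  have "norm (F z) \<le> \<bar>C\<bar> * \<bar>B\<bar>" if z: "z \<in> double_sector_complex \<theta>" for z
  proof -
    obtain a x where "z = ray_pt a x" "cos \<theta> < \<bar>cos a\<bar>"
      using double_sector_polar [OF z \<theta>] .
    then have "norm (h z) \<le> \<bar>B\<bar>" using B [of a x] by simp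
    then have "C * norm (h z) \<le> \<bar>C\<bar> * \<bar>B\<bar>" by (intro mult_mono) auto
    then show ?thesis using le [OF z] by linarith
  qed
  then have "bounded (F ` double_sector_complex \<theta>)"
    by (auto simp: bounded_iff)
  moreover have "integrable lborel (\<lambda>x. F (ray_pt a x))" if a: "cos \<theta> < \<bar>cos a\<bar>" for a
  proof (rule integrable_continuous_dominated)
    show "continuous_on UNIV (\<lambda>x. F (ray_pt a x))"
      using a by (intro continuous_on_compose2 [OF holomorphic_on_imp_continuous_on [OF hol] continuous_on_ray_pt])
        (auto simp: ray_pt_in_double_sector)
    show "integrable lborel (\<lambda>x. h (ray_pt a x))"
      using h a by (simp add: tame_def)
    show "norm (F (ray_pt a x)) \<le> C * norm (h (ray_pt a x))" for x
      using a by (intro le) (simp add: ray_pt_in_double_sector)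
  qed
  ultimately show ?thesis
    using hol sym by (simp add: symmetric_decaying_def)
qed

context
  fixes \<theta> :: real
  assumes \<theta>: "0 < \<theta>" "\<theta> < pi / 2"
begin

lemma tame_norm: "H \<in> symmetric_decaying \<theta> \<Longrightarrow> tame {a. cos \<theta> < \<bar>cos a\<bar>} (\<lambda>z. norm (H z))"
  by (rule symmetric_decaying_tame) auto

lemma symmetric_decaying_dominated:
  assumes "H \<in> symmetric_decaying \<theta>" "F holomorphic_on double_sector_complex \<theta>"
    and "\<And>z. z \<in> double_sector_complex \<theta> \<Longrightarrow> F (cnj z) = cnj (F z)"
    and "\<And>z. z \<in> double_sector_complex \<theta> \<Longrightarrow> norm (F z) \<le> C * norm (H z)"
  shows "F \<in> symmetric_decaying \<theta>"
  by (rule symmetric_decayingI [OF \<theta> assms(2,3) tame_norm [OF assms(1)]]) (use assms(4) in auto)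

lemma symmetric_decaying_linear:
  assumes G: "G \<in> symmetric_decaying \<theta>" and H: "H \<in> symmetric_decaying \<theta>"
  shows "(\<lambda>z. of_real a * G z + of_real b * H z) \<in> symmetric_decaying \<theta>"
proof (rule symmetric_decayingI [OF \<theta> _ _ tame_add [OF tame_norm [OF G] tame_norm [OF H]], where C = "\<bar>a\<bar> + \<bar>b\<bar>"])
  show "(\<lambda>z. of_real a * G z + of_real b * H z) holomorphic_on double_sector_complex \<theta>"
    using G H by (intro holomorphic_intros) (auto simp: symmetric_decaying_def)
  fix z assume "z \<in> double_sector_complex \<theta>"
  then show "of_real a * G (cnj z) + of_real b * H (cnj z) = cnj (of_real a * G z + of_real b * H z)"
    using G H by (simp add: symmetric_decaying_def)
  have "norm (of_real a * G z + of_real b * H z) \<le> \<bar>a\<bar> * norm (G z) + \<bar>b\<bar> * norm (H z)"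
    by (rule order_trans [OF norm_triangle_ineq]) (simp add: norm_mult)
  also have "\<dots> \<le> (\<bar>a\<bar> + \<bar>b\<bar>) * norm (norm (G z) + norm (H z))"
    by (simp add: algebra_simps)
  finally show "norm (of_real a * G z + of_real b * H z) \<le> (\<bar>a\<bar> + \<bar>b\<bar>) * norm (norm (G z) + norm (H z))" .
qed

lemma symmetric_decaying_mult:
  assumes G: "G \<in> symmetric_decaying \<theta>" and H: "H \<in> symmetric_decaying \<theta>"
  shows "(\<lambda>z. G z * H z) \<in> symmetric_decaying \<theta>"
proof -
  obtain B where B: "\<And>z. z \<in> double_sector_complex \<theta> \<Longrightarrow> norm (G z) \<le> B"
    using G by (auto simp: symmetric_decaying_def bounded_iff)
  show ?thesis
  proof (rule symmetric_decaying_dominated [OF H])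
    show "(\<lambda>z. G z * H z) holomorphic_on double_sector_complex \<theta>"
      using G H by (intro holomorphic_intros) (auto simp: symmetric_decaying_def)
    fix z assume "z \<in> double_sector_complex \<theta>"
    then show "G (cnj z) * H (cnj z) = cnj (G z * H z)" "norm (G z * H z) \<le> B * norm (H z)"
      using G H B by (auto simp: symmetric_decaying_def norm_mult intro!: mult_right_mono)
  qed
qed

text \<open>The factors of 1 + z^2 are the differences of i and -i from z, and these two points lie
  on the imaginary axis. So \<open>sector_gap\<close> with outer angle pi / 2 bounds twice each
  factor below by cos \<theta> times |z| and by cos \<theta> times 1; adding the two resulting
  products gives the constant 1 / 8.\<close>

lemma one_plus_square_lower:
  assumes "z \<in> double_sector_complex \<theta>"
  shows "(cos \<theta>)\<^sup>2 / 8 * (1 + (norm z)\<^sup>2) \<le> norm (1 + z\<^sup>2)"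
proof -
  have z: "cos \<theta> * norm z \<le> \<bar>Re z\<bar>"
    using assms by (simp add: double_sector_complex_def)
  have c: "sin (pi / 2 - \<theta>) = cos \<theta>" "0 < cos \<theta>"
    using \<theta> by (auto simp: sin_diff intro!: cos_gt_zero)
  have gap: "cos \<theta> * norm z \<le> 2 * norm (w - z)" "cos \<theta> * 1 \<le> 2 * norm (w - z)" if "w = \<i> \<or> w = - \<i>" for w
    using sector_gap [OF \<theta>(1) \<theta>(2) order_refl z, of w] that c by auto
  have prod: "cos \<theta> * u * (cos \<theta> * u) \<le> 4 * norm (1 + z\<^sup>2)"
    if u: "0 \<le> u" "cos \<theta> * u \<le> 2 * norm (\<i> - z)" "cos \<theta> * u \<le> 2 * norm (- \<i> - z)" for u
  proof -
    have "cos \<theta> * u * (cos \<theta> * u) \<le> (2 * norm (\<i> - z)) * (2 * norm (- \<i> - z))"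
      by (rule mult_mono [OF u(2,3)]) (use u c in auto)
    also have "\<dots> = 4 * norm ((\<i> - z) * (- \<i> - z))"
      by (simp add: norm_mult)
    also have "(\<i> - z) * (- \<i> - z) = 1 + z\<^sup>2"
      by (simp add: power2_eq_square algebra_simps)
    finally show ?thesis .
  qed
  have "cos \<theta> * norm z * (cos \<theta> * norm z) \<le> 4 * norm (1 + z\<^sup>2)" "cos \<theta> * 1 * (cos \<theta> * 1) \<le> 4 * norm (1 + z\<^sup>2)"
    by (rule prod; use gap in simp)+
  then show ?thesis
    by (simp add: power2_eq_square algebra_simps)
qed

lemma one_plus_square_nonzero: "z \<in> double_sector_complex \<theta> \<Longrightarrow> 1 + z\<^sup>2 \<noteq> 0"
proof -
  assume z: "z \<in> double_sector_complex \<theta>"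
  have "0 < cos \<theta>" using \<theta> by (intro cos_gt_zero)
  then have "0 < (cos \<theta>)\<^sup>2 / 8 * (1 + (norm z)\<^sup>2)"
    by (intro mult_pos_pos) (auto simp: add_pos_nonneg)
  then show ?thesis
    using one_plus_square_lower [OF z] by force
qed

lemma inverse_one_plus_square_bound:
  assumes "z \<in> double_sector_complex \<theta>"
  shows "norm (1 / (1 + z\<^sup>2)) * (1 + (norm z)\<^sup>2) \<le> 8 / (cos \<theta>)\<^sup>2"
proof -
  have "0 < cos \<theta>" using \<theta> by (intro cos_gt_zero)
  moreover have "0 < norm (1 + z\<^sup>2)"
    using one_plus_square_nonzero [OF assms] by simp
  ultimately show ?thesis
    using one_plus_square_lower [OF assms] by (simp add: norm_divide field_simps)
qed

lemma inverse_one_plus_square_holomorphic: "(\<lambda>z. 1 / (1 + z\<^sup>2)) holomorphic_on double_sector_complex \<theta>"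
  using one_plus_square_nonzero by (intro holomorphic_intros) auto

lemma symmetric_decaying_mult_inverse:
  assumes H: "H \<in> symmetric_decaying \<theta>"
  shows "(\<lambda>z. 1 / (1 + z\<^sup>2) * H z) \<in> symmetric_decaying \<theta>"
proof (rule symmetric_decaying_dominated [OF H])
  show "(\<lambda>z. 1 / (1 + z\<^sup>2) * H z) holomorphic_on double_sector_complex \<theta>"
    using H by (intro holomorphic_intros inverse_one_plus_square_holomorphic) (auto simp: symmetric_decaying_def)
  fix z assume z: "z \<in> double_sector_complex \<theta>"
  then show "1 / (1 + (cnj z)\<^sup>2) * H (cnj z) = cnj (1 / (1 + z\<^sup>2) * H z)"
    using H by (simp add: symmetric_decaying_def)
  have "norm (1 / (1 + z\<^sup>2)) * 1 \<le> norm (1 / (1 + z\<^sup>2)) * (1 + (norm z)\<^sup>2)"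
    by (intro mult_left_mono) auto
  then have "norm (1 / (1 + z\<^sup>2)) \<le> 8 / (cos \<theta>)\<^sup>2"
    using inverse_one_plus_square_bound [OF z] by linarith
  then show "norm (1 / (1 + z\<^sup>2) * H z) \<le> 8 / (cos \<theta>)\<^sup>2 * norm (H z)"
    unfolding norm_mult by (rule mult_right_mono) simp
qed

lemma symmetric_decaying_quotient: "(\<lambda>z. z / (1 + z\<^sup>2)) \<in> symmetric_decaying \<theta>"
proof (rule symmetric_decayingI [OF \<theta> _ _ tame_bump])
  show "(\<lambda>z. z / (1 + z\<^sup>2)) holomorphic_on double_sector_complex \<theta>"
    using one_plus_square_nonzero by (intro holomorphic_intros) auto
  fix z assume z: "z \<in> double_sector_complex \<theta>"
  show "cnj z / (1 + (cnj z)\<^sup>2) = cnj (z / (1 + z\<^sup>2))" by simp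
  have "0 < 1 + (norm z)\<^sup>2" by (simp add: add_pos_nonneg)
  then have "norm (1 / (1 + z\<^sup>2)) \<le> 8 / (cos \<theta>)\<^sup>2 / (1 + (norm z)\<^sup>2)"
    using inverse_one_plus_square_bound [OF z] by (simp only: pos_le_divide_eq)
  from mult_right_mono [OF this norm_ge_zero [of z]]
  show "norm (z / (1 + z\<^sup>2)) \<le> 8 / (cos \<theta>)\<^sup>2 * norm (bump z)"
    by (simp add: norm_divide bump_def add_nonneg_nonneg)
qed

end

section \<open>Linearity, independence of the angle and multiplicativity\<close>

context resolvent_family
begin

lemma calc_eqI:
  assumes "\<And>l v. complex_of_real (blinfun_apply l (blinfun_apply A v)) = of_real (blinfun_apply l (blinfun_apply B v))"
  shows "A = (B :: 'a \<Rightarrow>\<^sub>L 'a)"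
  using assms by (intro blinfun_eq_by_functionals) simp

lemma calc_linear:
  assumes \<phi>: "0 < \<phi>" "\<phi> < \<theta>" "\<theta> < pi / 2" "cos \<phi> < c"
    and G: "G \<in> symmetric_decaying \<theta>" and H: "H \<in> symmetric_decaying \<theta>"
  shows "calc \<phi> (\<lambda>z. of_real a * G z + of_real b * H z) = a *\<^sub>R calc \<phi> G + b *\<^sub>R calc \<phi> H"
proof (rule calc_eqI)
  fix l v
  have \<theta>: "0 < \<theta>" "\<theta> < pi / 2" using \<phi> by auto
  have "scalar_resolvent l v z * (of_real a * G z + of_real b * H z) =
      of_real a * (scalar_resolvent l v z * G z) + of_real b * (scalar_resolvent l v z * H z)" for z
    by (simp add: algebra_simps)
  then have "complex_of_real (blinfun_apply l (calc \<phi> (\<lambda>z. of_real a * G z + of_real b * H z) v)) =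
      of_real a * of_real (blinfun_apply l (calc \<phi> G v)) + of_real b * of_real (blinfun_apply l (calc \<phi> H v))"
    unfolding calc_scalar [OF \<phi> symmetric_decaying_linear [OF \<theta> G H]] calc_scalar [OF \<phi> G] calc_scalar [OF \<phi> H]
    using contour_mean_linear(2) [OF resolvent_contour_integrable [OF \<phi> G] resolvent_contour_integrable [OF \<phi> H]]
    by simp
  then show "complex_of_real (blinfun_apply l (calc \<phi> (\<lambda>z. of_real a * G z + of_real b * H z) v)) =
      of_real (blinfun_apply l ((a *\<^sub>R calc \<phi> G + b *\<^sub>R calc \<phi> H) v))"
    by (simp add: blinfun.add_left blinfun.add_right blinfun.scaleR_left blinfun.scaleR_right)
qed

text \<open>Between the two contours both the scalar resolvent and \<open>H\<close> are holomorphic,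
  so the rays may be moved; the resolvent bound cancels the factor z of dz and leaves |H| as
  majorant.\<close>

lemma calc_angle_independent:
  assumes \<phi>: "0 < \<phi>" "\<phi> < \<phi>'" "\<phi>' < \<theta>" "\<theta> < pi / 2" "cos \<phi> < c"
    and H: "H \<in> symmetric_decaying \<theta>"
  shows "calc \<phi> H = calc \<phi>' H"
proof (rule calc_eqI)
  fix l v
  have cos: "cos \<phi>' < cos \<phi>" "cos \<theta> < cos \<phi>'"
    using \<phi> by (auto intro!: cos_monotone_0_pi)
  have \<phi>1: "0 < \<phi>" "\<phi> < \<theta>" "\<theta> < pi / 2" "cos \<phi> < c" and \<phi>2: "0 < \<phi>'" "\<phi>' < \<theta>" "\<theta> < pi / 2" "cos \<phi>' < c"
    using \<phi> cos by auto
  have "contour_mean \<phi> (\<lambda>z. scalar_resolvent l v z * H z) = contour_mean \<phi>' (\<lambda>z. scalar_resolvent l v z * H z)"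
  proof (rule contour_mean_shift [OF \<phi>(1-4), where U = "resolvent_dom \<inter> double_sector_complex \<theta>"
        and h = "\<lambda>z. norm (H z)" and C = "2 * M * norm l * norm v"])
    show "(\<lambda>z. scalar_resolvent l v z * H z) holomorphic_on resolvent_dom \<inter> double_sector_complex \<theta>"
      using H holomorphic_on_subset [OF scalar_resolvent_holomorphic]
      by (intro holomorphic_intros) (auto simp: symmetric_decaying_def intro: holomorphic_on_subset)
    show "open (resolvent_dom \<inter> double_sector_complex \<theta>)"
      by (intro open_Int open_resolvent_dom open_double_sector_complex)
    show "z \<in> resolvent_dom \<inter> double_sector_complex \<theta>"
      if "z \<noteq> 0" "cos \<phi>' * norm z \<le> \<bar>Re z\<bar>" "\<bar>Re z\<bar> \<le> cos \<phi> * norm z" for z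
    proof -
      have "cos \<phi> * norm z < c * norm z" "cos \<theta> * norm z < cos \<phi>' * norm z"
        using that(1) cos \<phi>(5) by (auto intro!: mult_strict_right_mono)
      then have "\<bar>Re z\<bar> < c * norm z" "cos \<theta> * norm z < \<bar>Re z\<bar>"
        using that by linarith+
      then show ?thesis
        by (simp add: resolvent_dom_def double_sector_complex_def)
    qed
    show "tame {a. cos \<theta> < \<bar>cos a\<bar>} (\<lambda>z. norm (H z))"
      using \<phi> H by (intro tame_norm) auto
    show "norm (scalar_resolvent l v z * H z * z) \<le> 2 * M * norm l * norm v * norm (norm (H z))"
      if "z \<in> resolvent_dom \<inter> double_sector_complex \<theta>" for z
      using mult_right_mono [OF scalar_resolvent_bound [of z l v] norm_ge_zero [of "H z"]] that
      by (simp add: norm_mult mult_ac)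
  qed
  then show "complex_of_real (blinfun_apply l (calc \<phi> H v)) = of_real (blinfun_apply l (calc \<phi>' H v))"
    unfolding calc_scalar [OF \<phi>1 H] calc_scalar [OF \<phi>2 H] .
qed

text \<open>For fixed \<open>z\<close> the tested product is a complex combination of ordinary
  scalar resolvents in \<open>w\<close>, for the functionals \<open>l o\<^sub>L R0 z\<close> and
  \<open>l o\<^sub>L R1 z\<close>. In this way a resolvent applied to \<open>calc\<close> becomes
  one contour integral over \<open>w\<close>.\<close>

lemma scalar_resolvent2_eq:
  "scalar_resolvent (l o\<^sub>L R0 z) v w + \<i> * scalar_resolvent (l o\<^sub>L R1 z) v w = scalar_resolvent2 l v z w"
  by (simp add: scalar_resolvent_def scalar_resolvent2_def complex_eq_iff blinfun.add_right blinfun.diff_right)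

text \<open>
  In the variable \<open>w\<close> the resolvent identity and Cauchy's formula produce \<open>r z H z - K z\<close>, where the
  Cauchy integral \<open>K\<close> is annihilated by integration over the inner contour.
\<close>

lemma calc_mult:
  assumes \<phi>: "0 < \<phi>" "\<phi> < \<theta>" "\<theta> < pi / 2" "cos \<phi> < c"
    and G: "G \<in> symmetric_decaying \<theta>" and H: "H \<in> symmetric_decaying \<theta>"
  shows "calc \<phi> (\<lambda>z. G z * H z) = calc \<phi> G o\<^sub>L calc \<phi> H"
proof (rule calc_eqI)
  fix l v
  \<comment> \<open>\<open>G\<close> is integrated over the angle \<phi> and \<open>H\<close> over
    the larger \<phi>', so that z lies inside the outer contour, w lies outside the inner one, and
    |w - z| dominates multiples of both |z| and |w|.\<close>
  define \<phi>' where "\<phi>' = (\<phi> + \<theta>) / 2"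
  have \<phi>': "\<phi> < \<phi>'" "0 < \<phi>'" "\<phi>' < \<theta>" "\<phi>' < pi / 2" using \<phi> by (simp_all add: \<phi>'_def)
  have cos: "cos \<phi>' < cos \<phi>"
    using \<phi> \<phi>' by (intro cos_monotone_0_pi) auto
  have \<phi>2: "0 < \<phi>'" "\<phi>' < \<theta>" "\<theta> < pi / 2" "cos \<phi>' < c"
    using \<phi> \<phi>' cos by auto
  have \<theta>: "0 < \<theta>" "\<theta> < pi / 2" using \<phi> by auto
  define k where "k = sin (\<phi>' - \<phi>) / 2"
  have k: "k > 0" unfolding k_def using \<phi> \<phi>' by (intro divide_pos_pos sin_gt_zero) auto
  note adm = contour_angles_admissible [OF \<phi>] and adm' = contour_angles_admissible [OF \<phi>2]
  have cos_eq: "\<bar>cos a\<bar> = cos \<phi>" if "a \<in> contour_angles \<phi>" for a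
    using contour_angles_cos [OF that] cos_\<phi>_pos [OF \<phi>] by simp
  have cos_eq': "\<bar>cos b\<bar> = cos \<phi>'" if "b \<in> contour_angles \<phi>'" for b
    using contour_angles_cos [OF that] cos_\<phi>_pos [OF \<phi>2] by simp
  have gap: "k * norm z \<le> norm (w - z)"
    if z: "cos \<phi> * norm z \<le> \<bar>Re z\<bar>" and w: "w = ray_pt b y" "b \<in> contour_angles \<phi>'" for z w b y
    using sector_gap(1) [OF \<phi>(1) \<phi>'(1) less_imp_le [OF \<phi>'(4)] z, of w] w cos_eq' [OF w(2)]
    by (simp add: k_def Re_ray_pt abs_mult)
  have gap_ray: "k * norm (ray_pt a x) \<le> norm (ray_pt b y - ray_pt a x)"
    if "a \<in> contour_angles \<phi>" "b \<in> contour_angles \<phi>'" for a b x y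
    using gap [of "ray_pt a x" "ray_pt b y" b y] that cos_eq [OF that(1)] by (simp add: Re_ray_pt abs_mult)
  have ne: "ray_pt b y \<noteq> ray_pt a x" if "a \<in> contour_angles \<phi>" "b \<in> contour_angles \<phi>'" for a b x y
  proof
    assume "ray_pt b y = ray_pt a x"
    then have "k * norm (ray_pt a x) \<le> 0" using gap_ray [OF that, of x y] by simp
    then show False using k by (simp add: mult_le_0_iff)
  qed
  define r where "r = scalar_resolvent l v"
  define q where "q w = r w * H w" for w
  have q_int: "contour_integrable \<phi>' q"
    unfolding q_def r_def by (rule resolvent_contour_integrable [OF \<phi>2 H])
  have hol: "G holomorphic_on double_sector_complex \<theta>" "H holomorphic_on double_sector_complex \<theta>"
    using G H by (auto simp: symmetric_decaying_def)
  have cont: "continuous_on UNIV (\<lambda>x. G (ray_pt a x))" if "a \<in> contour_angles \<phi>" for a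
    using adm [OF that]
    by (intro continuous_on_compose2 [OF holomorphic_on_imp_continuous_on [OF hol(1)] continuous_on_ray_pt])
      (auto simp: ray_pt_in_double_sector)
  have cont_q: "continuous_on UNIV (\<lambda>y. q (ray_pt b y))" and cont_H: "continuous_on UNIV (\<lambda>y. H (ray_pt b y))"
    if "b \<in> contour_angles \<phi>'" for b
  proof -
    show *: "continuous_on UNIV (\<lambda>y. H (ray_pt b y))"
      using adm' [OF that]
      by (intro continuous_on_compose2 [OF holomorphic_on_imp_continuous_on [OF hol(2)] continuous_on_ray_pt])
        (auto simp: ray_pt_in_double_sector)
    have "continuous_on UNIV (\<lambda>y. r (ray_pt b y))"
      using adm' [OF that] unfolding r_def
      by (intro continuous_on_compose2 [OF holomorphic_on_imp_continuous_on [OF scalar_resolvent_holomorphic] continuous_on_ray_pt])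
        (auto simp: ray_pt_resolvent_dom)
    then show "continuous_on UNIV (\<lambda>y. q (ray_pt b y))"
      unfolding q_def by (intro continuous_intros *)
  qed
  define K where "K z = contour_mean \<phi>' (\<lambda>w. q w / (w - z))" for z
  \<comment> \<open>With \<open>H\<close> moved to the outer contour, the quotient (r z - r w) / (w
    - z) splits the integral into a Cauchy integral of \<open>H\<close>, with value
    \<open>H z\<close>, and the remainder \<open>K\<close>.\<close>
  have inner: "scalar_resolvent l (calc \<phi> H v) z = r z * H z - K z"
    if z: "z = ray_pt a x" "a \<in> contour_angles \<phi>" for z a x
  proof -
    have "z \<in> resolvent_dom" using adm [OF z(2)] by (simp add: z ray_pt_resolvent_dom)
    have "calc \<phi> H = calc \<phi>' H"
      by (rule calc_angle_independent [OF \<phi>(1) \<phi>'(1,3) \<phi>(3,4) H])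
    have cauchy_int: "contour_integrable \<phi>' (\<lambda>w. H w / (w - z))"
      unfolding contour_integrable_def
    proof
      fix b assume b: "b \<in> contour_angles \<phi>'"
      show "ray_integrable b (\<lambda>w. H w / (w - z))"
      proof (rule ray_integrableI [where h = "\<lambda>w. norm (H w)" and C = "1 / k"])
        show "continuous_on UNIV (\<lambda>x. H (ray_pt b x) / (ray_pt b x - z))"
          using ne [OF z(2) b] by (intro continuous_intros cont_H [OF b] continuous_on_ray_pt) (auto simp: z)
        show "integrable lborel (\<lambda>x. norm (H (ray_pt b x)))"
          using adm' [OF b] H by (simp add: symmetric_decaying_def)
        fix y
        have "k * norm (ray_pt b y) \<le> norm (ray_pt b y - z)"
          using sector_gap(2) [OF \<phi>(1) \<phi>'(1) less_imp_le [OF \<phi>'(4)], of z "ray_pt b y"] cos_eq' [OF b] cos_eq [OF z(2)]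
          by (simp add: k_def z(1) Re_ray_pt abs_mult)
        from mult_left_mono [OF this norm_ge_zero [of "H (ray_pt b y)"]]
        show "norm (H (ray_pt b y) / (ray_pt b y - z) * ray_pt b y) \<le> 1 / k * norm (norm (H (ray_pt b y)))"
          using k ne [OF z(2) b, of y x] by (simp add: norm_divide norm_mult z(1) divide_simps mult_ac)
      qed
    qed
    have q_cauchy_int: "contour_integrable \<phi>' (\<lambda>w. q w / (w - z))"
      unfolding contour_integrable_def
    proof
      fix b assume b: "b \<in> contour_angles \<phi>'"
      show "ray_integrable b (\<lambda>w. q w / (w - z))"
      proof (rule ray_integrableI [where h = "\<lambda>w. norm (q w * w)" and C = "1 / (k * norm z)"])
        show "continuous_on UNIV (\<lambda>x. q (ray_pt b x) / (ray_pt b x - z))"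
          using ne [OF z(2) b] by (intro continuous_intros cont_q [OF b] continuous_on_ray_pt) (auto simp: z)
        show "integrable lborel (\<lambda>x. norm (q (ray_pt b x) * ray_pt b x))"
          using q_int b by (simp add: contour_integrable_def ray_integrable_def)
        fix y
        have "k * norm z \<le> norm (ray_pt b y - z)" "0 < k * norm z" "0 < norm (ray_pt b y - z)"
          using gap_ray [OF z(2) b, of x y] ne [OF z(2) b, of y x] k by (simp_all add: z(1))
        then have "1 / norm (ray_pt b y - z) \<le> 1 / (k * norm z)"
          by (intro divide_left_mono) auto
        from mult_left_mono [OF this norm_ge_zero [of "q (ray_pt b y) * ray_pt b y"]]
        show "norm (q (ray_pt b y) / (ray_pt b y - z) * ray_pt b y) \<le> 1 / (k * norm z) * norm (norm (q (ray_pt b y) * ray_pt b y))"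
          by (simp add: norm_divide norm_mult)
      qed
    qed
    have "scalar_resolvent l (calc \<phi> H v) z =
        of_real ((l o\<^sub>L R0 z) (calc \<phi>' H v)) + \<i> * of_real ((l o\<^sub>L R1 z) (calc \<phi>' H v))"
      by (simp add: scalar_resolvent_def complex_eq_iff \<open>calc \<phi> H = calc \<phi>' H\<close>)
    also have "\<dots> = 1 * contour_mean \<phi>' (\<lambda>w. scalar_resolvent (l o\<^sub>L R0 z) v w * H w) +
        \<i> * contour_mean \<phi>' (\<lambda>w. scalar_resolvent (l o\<^sub>L R1 z) v w * H w)"
      unfolding calc_scalar [OF \<phi>2 H] by simp
    also have "\<dots> = contour_mean \<phi>' (\<lambda>w. 1 * (scalar_resolvent (l o\<^sub>L R0 z) v w * H w) +
        \<i> * (scalar_resolvent (l o\<^sub>L R1 z) v w * H w))"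
      by (rule contour_mean_linear(2) [symmetric]) (rule resolvent_contour_integrable [OF \<phi>2 H])+
    also have "\<dots> = contour_mean \<phi>' (\<lambda>w. r z * (H w / (w - z)) + (- 1) * (q w / (w - z)))"
    proof (rule contour_mean_cong)
      fix b y assume b: "b \<in> contour_angles \<phi>'"
      define w where "w = ray_pt b y"
      have w: "w \<in> resolvent_dom" "w - z \<noteq> 0"
        using adm' [OF b] ne [OF z(2) b] by (simp_all add: w_def ray_pt_resolvent_dom z(1))
      have "1 * (scalar_resolvent (l o\<^sub>L R0 z) v w * H w) + \<i> * (scalar_resolvent (l o\<^sub>L R1 z) v w * H w) =
          (scalar_resolvent (l o\<^sub>L R0 z) v w + \<i> * scalar_resolvent (l o\<^sub>L R1 z) v w) * H w"
        by (simp add: algebra_simps)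
      also have "\<dots> = scalar_resolvent2 l v z w * H w"
        unfolding scalar_resolvent2_eq ..
      also have "scalar_resolvent2 l v z w = (r z - r w) / (w - z)"
        using scalar_resolvent_identity [OF \<open>z \<in> resolvent_dom\<close> w(1), of l v] w(2)
        by (simp add: r_def eq_divide_eq mult.commute)
      also have "(r z - r w) / (w - z) * H w = r z * (H w / (w - z)) + (- 1) * (q w / (w - z))"
        by (simp add: q_def diff_divide_distrib algebra_simps)
      finally show "1 * (scalar_resolvent (l o\<^sub>L R0 z) v (ray_pt b y) * H (ray_pt b y)) +
          \<i> * (scalar_resolvent (l o\<^sub>L R1 z) v (ray_pt b y) * H (ray_pt b y)) =
          r z * (H (ray_pt b y) / (ray_pt b y - z)) + (- 1) * (q (ray_pt b y) / (ray_pt b y - z))"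
        unfolding w_def .
    qed
    also have "\<dots> = r z * contour_mean \<phi>' (\<lambda>w. H w / (w - z)) + (- 1) * K z"
      unfolding K_def by (rule contour_mean_linear(2) [OF cauchy_int q_cauchy_int])
    also have "contour_mean \<phi>' (\<lambda>w. H w / (w - z)) = H z"
    proof -
      have "\<bar>a\<bar> < \<phi>' \<or> \<bar>a - pi\<bar> < \<phi>'"
        using z(2) \<phi>(1) \<phi>'(1) by (auto simp: contour_angles_def)
      then show ?thesis
        by (rule contour_mean_cauchy [OF H \<phi>2(1-3) _ z(1)])
    qed
    finally show ?thesis by simp
  qed
  have swap: "ray_integrable a (\<lambda>z. G z * ray_integral b (\<lambda>w. q w / (w - z)))"
    "ray_integral a (\<lambda>z. G z * ray_integral b (\<lambda>w. q w / (w - z))) =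
      ray_integral b (\<lambda>w. q w * ray_integral a (\<lambda>z. G z / (w - z)))"
    "ray_integrable b (\<lambda>w. q w * ray_integral a (\<lambda>z. G z / (w - z)))"
    if "a \<in> contour_angles \<phi>" "b \<in> contour_angles \<phi>'" for a b
  proof -
    have "integrable lborel (\<lambda>x. norm (G (ray_pt a x)))" "ray_integrable b q"
      using adm [OF that(1)] G q_int that(2) by (simp_all add: symmetric_decaying_def contour_integrable_def)
    note * = cont [OF that(1)] this(1) cont_q [OF that(2)] this(2) gap_ray [OF that] k
    show "ray_integrable a (\<lambda>z. G z * ray_integral b (\<lambda>w. q w / (w - z)))"
      by (rule ray_integral_swap(1) [OF *])
    show "ray_integral a (\<lambda>z. G z * ray_integral b (\<lambda>w. q w / (w - z))) =
      ray_integral b (\<lambda>w. q w * ray_integral a (\<lambda>z. G z / (w - z)))"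
      by (rule ray_integral_swap(2) [OF *])
    show "ray_integrable b (\<lambda>w. q w * ray_integral a (\<lambda>z. G z / (w - z)))"
      by (rule ray_integral_swap(3) [OF *])
  qed
  define S where "S b z = ray_integral b (\<lambda>w. q w / (w - z))" for b z
  have S_int: "contour_integrable \<phi> (\<lambda>z. G z * S b z)" if "b \<in> contour_angles \<phi>'" for b
    using swap(1) that unfolding contour_integrable_def S_def by blast
  \<comment> \<open>Here w is not in the open double sector of angle \<phi>', so the Cauchy kernel
    has no pole inside the inner contour, in contrast to the integral of \<open>H\<close> over the
    outer one.\<close>
  have G_cauchy: "contour_mean \<phi> (\<lambda>z. G z / (w - z)) = 0" if w: "w = ray_pt b y" "b \<in> contour_angles \<phi>'" for w b y
  proof (rule contour_mean_zero [OF \<phi>(1) \<phi>'(1) less_imp_le [OF \<phi>'(3)] \<phi>(3), where h = "\<lambda>z. norm (G z)" and C = "1 / k"])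
    have "w \<notin> double_sector_complex \<phi>'"
      using cos_eq' [OF w(2)] by (simp add: w(1) ray_pt_in_double_sector)
    moreover have "double_sector_complex \<phi>' \<subseteq> double_sector_complex \<theta>"
    proof
      fix z assume "z \<in> double_sector_complex \<phi>'"
      moreover have "cos \<theta> * norm z \<le> cos \<phi>' * norm z"
        using cos_\<phi>_pos(2) [OF \<phi>2] by (intro mult_right_mono) auto
      ultimately show "z \<in> double_sector_complex \<theta>"
        by (simp add: double_sector_complex_def)
    qed
    ultimately show "(\<lambda>z. G z / (w - z)) holomorphic_on double_sector_complex \<phi>'"
      by (intro holomorphic_intros holomorphic_on_subset [OF hol(1)]) auto
    show "tame {a. cos \<theta> < \<bar>cos a\<bar>} (\<lambda>z. norm (G z))"
      by (rule tame_norm [OF \<theta> G])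
    fix z :: complex assume z: "z \<noteq> 0" "cos \<phi> * norm z \<le> \<bar>Re z\<bar>"
    have le: "k * norm z \<le> norm (w - z)" by (rule gap [OF z(2) w])
    moreover have "0 < k * norm z" using k z(1) by simp
    ultimately have "0 < norm (w - z)" by linarith
    with mult_left_mono [OF le norm_ge_zero [of "G z"]]
    show "norm (G z / (w - z) * z) \<le> 1 / k * norm (norm (G z))"
      using k by (simp add: norm_divide norm_mult divide_simps mult_ac)
  qed
  \<comment> \<open>After the exchange of integrals, the four inner rays recombine under one outer
    ray integral into the vanishing mean of \<open>G_cauchy\<close>.\<close>
  have S_zero: "contour_mean \<phi> (\<lambda>z. G z * S b z) = 0" if b: "b \<in> contour_angles \<phi>'" for b
  proof -
    define A where "A a w = q w * ray_integral a (\<lambda>z. G z / (w - z))" for a w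
    have angles: "- \<phi> \<in> contour_angles \<phi>" "\<phi> \<in> contour_angles \<phi>" "pi - \<phi> \<in> contour_angles \<phi>" "pi + \<phi> \<in> contour_angles \<phi>"
      by (simp_all add: contour_angles_def)
    have A: "ray_integrable b (A a)" "ray_integral a (\<lambda>z. G z * S b z) = ray_integral b (A a)" if "a \<in> contour_angles \<phi>" for a
      using swap(2,3) [OF that b] unfolding A_def S_def by simp_all
    note lin = ray_integral_linear [OF A(1) A(1)]
    have pair1: "ray_integral b (\<lambda>w. 1 * A (- \<phi>) w + (- 1) * A \<phi> w) = ray_integral b (A (- \<phi>)) - ray_integral b (A \<phi>)"
      "ray_integral b (\<lambda>w. 1 * A (pi - \<phi>) w + (- 1) * A (pi + \<phi>) w) = ray_integral b (A (pi - \<phi>)) - ray_integral b (A (pi + \<phi>))"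
      using lin(2) [OF angles(1,2), of 1 "- 1"] lin(2) [OF angles(3,4), of 1 "- 1"] by simp_all
    have "contour_mean \<phi> (\<lambda>z. G z * S b z) = ((ray_integral b (A (- \<phi>)) - ray_integral b (A \<phi>)) +
        (ray_integral b (A (pi - \<phi>)) - ray_integral b (A (pi + \<phi>)))) / (2 * pi * \<i>)"
      unfolding contour_mean_def by (simp add: A(2) angles)
    also have "(ray_integral b (A (- \<phi>)) - ray_integral b (A \<phi>)) + (ray_integral b (A (pi - \<phi>)) - ray_integral b (A (pi + \<phi>))) =
        ray_integral b (\<lambda>w. 1 * (1 * A (- \<phi>) w + (- 1) * A \<phi> w) + 1 * (1 * A (pi - \<phi>) w + (- 1) * A (pi + \<phi>) w))"
      unfolding pair1 [symmetric]
      using ray_integral_linear(2) [OF lin(1) [OF angles(1,2), of 1 "- 1"] lin(1) [OF angles(3,4), of 1 "- 1"], of 1 1] by simp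
    also have "\<dots> = ray_integral b (\<lambda>w. 0)"
    proof (rule ray_integral_cong)
      fix y
      define w where "w = ray_pt b y"
      have "1 * (1 * A (- \<phi>) w + (- 1) * A \<phi> w) + 1 * (1 * A (pi - \<phi>) w + (- 1) * A (pi + \<phi>) w) =
          q w * (2 * pi * \<i> * contour_mean \<phi> (\<lambda>z. G z / (w - z)))"
      proof -
        have eq: "2 * pi * \<i> * contour_mean \<phi> F = ray_integral (- \<phi>) F - ray_integral \<phi> F +
            ray_integral (pi - \<phi>) F - ray_integral (pi + \<phi>) F" for F
          by (simp add: contour_mean_def)
        show ?thesis unfolding eq A_def by (simp add: algebra_simps)
      qed
      also have "\<dots> = 0"
        using G_cauchy [OF w_def b] by simp
      finally show "1 * (1 * A (- \<phi>) (ray_pt b y) + (- 1) * A \<phi> (ray_pt b y)) +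
          1 * (1 * A (pi - \<phi>) (ray_pt b y) + (- 1) * A (pi + \<phi>) (ray_pt b y)) = 0"
        unfolding w_def .
    qed
    finally show ?thesis
      by (simp add: ray_integral_def)
  qed
  have angles': "- \<phi>' \<in> contour_angles \<phi>'" "\<phi>' \<in> contour_angles \<phi>'" "pi - \<phi>' \<in> contour_angles \<phi>'" "pi + \<phi>' \<in> contour_angles \<phi>'"
    by (simp_all add: contour_angles_def)
  \<comment> \<open>The four outer rays with their signs, written as nested binary combinations to
    fit \<open>contour_mean_linear\<close>; times \<open>- d\<close> this is
    \<open>G z * K z\<close>.\<close>
  define L where "L z = 1 * (1 * (G z * S (- \<phi>') z) + (- 1) * (G z * S \<phi>' z)) +
      1 * (1 * (G z * S (pi - \<phi>') z) + (- 1) * (G z * S (pi + \<phi>') z))" for z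
  note pairs = contour_mean_linear [OF S_int [OF angles'(1)] S_int [OF angles'(2)], of 1 "- 1"]
    contour_mean_linear [OF S_int [OF angles'(3)] S_int [OF angles'(4)], of 1 "- 1"]
  have L_int: "contour_integrable \<phi> L" and L_zero: "contour_mean \<phi> L = 0"
    unfolding L_def contour_mean_linear(2) [OF pairs(1,3)] pairs(2,4)
    by (rule contour_mean_linear(1) [OF pairs(1,3)]) (simp add: S_zero angles')
  define d where "d = - 1 / (2 * pi * \<i>)"
  have K_L: "G z * K z = - d * L z" for z
    unfolding d_def K_def contour_mean_def L_def S_def by (simp add: algebra_simps add_divide_distrib diff_divide_distrib)
  have GH: "(\<lambda>z. G z * H z) \<in> symmetric_decaying \<theta>"
    by (rule symmetric_decaying_mult [OF \<theta> G H])
  have "of_real (blinfun_apply l ((calc \<phi> G o\<^sub>L calc \<phi> H) v)) =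
      contour_mean \<phi> (\<lambda>z. scalar_resolvent l (calc \<phi> H v) z * G z)"
    using calc_scalar [OF \<phi> G, of l "calc \<phi> H v"] by simp
  also have "\<dots> = contour_mean \<phi> (\<lambda>z. 1 * (r z * (G z * H z)) + d * L z)"
  proof (rule contour_mean_cong)
    fix a x assume "a \<in> contour_angles \<phi>"
    from inner [OF refl this, of x]
    show "scalar_resolvent l (calc \<phi> H v) (ray_pt a x) * G (ray_pt a x) =
        1 * (r (ray_pt a x) * (G (ray_pt a x) * H (ray_pt a x))) + d * L (ray_pt a x)"
      using K_L [of "ray_pt a x"] by (simp add: left_diff_distrib right_diff_distrib mult_ac)
  qed
  also have "\<dots> = 1 * contour_mean \<phi> (\<lambda>z. r z * (G z * H z)) + d * contour_mean \<phi> L"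
    using resolvent_contour_integrable [OF \<phi> GH, of l v] L_int
    by (intro contour_mean_linear(2)) (simp_all add: r_def)
  also have "\<dots> = complex_of_real (blinfun_apply l (calc \<phi> (\<lambda>z. G z * H z) v))"
    using calc_scalar [OF \<phi> GH, of l v] L_zero by (simp add: r_def)
  finally show "complex_of_real (blinfun_apply l (calc \<phi> (\<lambda>z. G z * H z) v)) =
      of_real (blinfun_apply l ((calc \<phi> G o\<^sub>L calc \<phi> H) v))"
    by (rule sym)
qed

end

context resolvent_family
begin

text \<open>\<open>Ei = (1 + T\<^sup>2)\<inverse>\<close> and \<open>TEi = T (1 + T\<^sup>2)\<inverse>\<close> for the underlying operator \<open>T\<close>.\<close>

definition Ei :: "'a \<Rightarrow>\<^sub>L 'a" where "Ei = - R1 \<i>"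

definition TEi :: "'a \<Rightarrow>\<^sub>L 'a" where "TEi = - R0 \<i>"

lemma resolvent_at_i: "R0 \<i> = - TEi" "R1 \<i> = - Ei" "R0 (- \<i>) = - TEi" "R1 (- \<i>) = Ei"
  using R0_cnj [of \<i>] R1_cnj [of \<i>] i_resolvent_dom by (simp_all add: Ei_def TEi_def resolvent_dom_def)

lemma minus_i_resolvent_dom: "- \<i> \<in> resolvent_dom"
  using cnj_resolvent_dom [of \<i>] i_resolvent_dom by simp

text \<open>Formally (1 + T^2)^-1 = (1 + T^2)^-2 + (T (1 + T^2)^-1)^2. It is the resolvent identity
  between i and -i, where the resolvents are -TEi - i Ei and -TEi + i Ei.\<close>

lemma Ei_square: "Ei (Ei v) - Ei v = - TEi (TEi v)"
proof (rule ccontr)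
  assume "Ei (Ei v) - Ei v \<noteq> - TEi (TEi v)"
  then have "norm (Ei (Ei v) - Ei v + TEi (TEi v)) \<noteq> 0"
    by (simp add: eq_neg_iff_add_eq_0)
  moreover obtain l :: "'a \<Rightarrow>\<^sub>L real" where "l (Ei (Ei v) - Ei v + TEi (TEi v)) = norm (Ei (Ei v) - Ei v + TEi (TEi v))"
    using exists_norming_functional by blast
  ultimately have l: "l (Ei (Ei v) - Ei v + TEi (TEi v)) \<noteq> 0"
    by simp
  have "(- \<i> - \<i>) * scalar_resolvent2 l v \<i> (- \<i>) = scalar_resolvent l v \<i> - scalar_resolvent l v (- \<i>)"
    by (rule scalar_resolvent_identity [OF i_resolvent_dom minus_i_resolvent_dom])
  then have "l (TEi (TEi v)) + l (Ei (Ei v)) = l (Ei v)"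
    by (simp add: scalar_resolvent_def scalar_resolvent2_def resolvent_at_i complex_eq_iff
        blinfun.minus_left blinfun.minus_right blinfun.add_right blinfun.diff_right)
  then show False
    using l by (simp add: blinfun.add_right blinfun.diff_right)
qed

text \<open>Partial fractions in the resolvent identity at \<open>i\<close> and \<open>- i\<close>.\<close>

lemma scalar_resolvent_Ei:
  assumes w: "w \<in> resolvent_dom" "1 + w\<^sup>2 \<noteq> 0"
  shows "1 / (1 + w\<^sup>2) * scalar_resolvent l v w =
      scalar_resolvent (l o\<^sub>L Ei) v w - 1 / (1 + w\<^sup>2) * (of_real (l (TEi v)) + w * of_real (l (Ei v)))"
    and "1 / (1 + w\<^sup>2) * scalar_resolvent l v w =
      scalar_resolvent l (Ei v) w - 1 / (1 + w\<^sup>2) * (of_real (l (TEi v)) + w * of_real (l (Ei v)))"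
proof -
  have ne: "w - \<i> \<noteq> 0" "w + \<i> \<noteq> 0" and fact: "1 + w\<^sup>2 = (w - \<i>) * (w + \<i>)"
  proof -
    show fact: "1 + w\<^sup>2 = (w - \<i>) * (w + \<i>)" by (simp add: power2_eq_square algebra_simps)
    then show "w - \<i> \<noteq> 0" "w + \<i> \<noteq> 0" using w(2) by auto
  qed
  define r where "r = scalar_resolvent l v w"
  define t e where "t = complex_of_real (l (TEi v))" and "e = complex_of_real (l (Ei v))"
  have at_i: "scalar_resolvent l v \<i> = - t - \<i> * e" "scalar_resolvent l v (- \<i>) = - t + \<i> * e"
    by (simp_all add: t_def e_def scalar_resolvent_def resolvent_at_i complex_eq_iff blinfun.minus_left blinfun.minus_right)
  \<comment> \<open>\<open>p\<close> stands for the term with \<open>Ei\<close> and \<open>s\<close>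
    for minus the term with \<open>TEi\<close>; the identities at i and -i are combined so that
    \<open>s\<close> drops out. Both orders of the factors produce data of this shape.\<close>
  have solve: "1 / (1 + w\<^sup>2) * r = p - 1 / (1 + w\<^sup>2) * (t + w * e)"
    if p: "(w - \<i>) * (s - \<i> * p) = - t - \<i> * e - r" "(w + \<i>) * (s + \<i> * p) = - t + \<i> * e - r" for s p
  proof -
    have "(w - \<i>) * (w + \<i>) * (2 * \<i> * p) =
        (w - \<i>) * ((w + \<i>) * (s + \<i> * p)) - (w + \<i>) * ((w - \<i>) * (s - \<i> * p))"
      by (simp add: algebra_simps)
    also have "\<dots> = 2 * \<i> * (w * e + t + r)"
      unfolding p by (simp add: algebra_simps)
    finally have "2 * \<i> * ((1 + w\<^sup>2) * p) = 2 * \<i> * (w * e + t + r)"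
      unfolding fact by (simp only: mult_ac)
    then have "(1 + w\<^sup>2) * p = w * e + t + r"
      by simp
    then have "p = (w * e + t + r) / (1 + w\<^sup>2)"
      using w(2) by (simp add: eq_divide_eq mult.commute)
    then show ?thesis
      by (simp add: add_divide_distrib)
  qed
  have "(w - \<i>) * scalar_resolvent2 l v \<i> w = - t - \<i> * e - r"
    "(w - (- \<i>)) * scalar_resolvent2 l v (- \<i>) w = - t + \<i> * e - r"
    unfolding scalar_resolvent_identity [OF i_resolvent_dom w(1)] scalar_resolvent_identity [OF minus_i_resolvent_dom w(1)]
      at_i r_def by simp_all
  moreover have "scalar_resolvent2 l v \<i> w = - scalar_resolvent (l o\<^sub>L TEi) v w - \<i> * scalar_resolvent (l o\<^sub>L Ei) v w"
    "scalar_resolvent2 l v (- \<i>) w = - scalar_resolvent (l o\<^sub>L TEi) v w + \<i> * scalar_resolvent (l o\<^sub>L Ei) v w"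
    by (simp_all add: scalar_resolvent2_def scalar_resolvent_def resolvent_at_i complex_eq_iff
        blinfun.minus_left blinfun.minus_right blinfun.add_right blinfun.diff_right)
  ultimately have "1 / (1 + w\<^sup>2) * r = scalar_resolvent (l o\<^sub>L Ei) v w - 1 / (1 + w\<^sup>2) * (t + w * e)"
    by (intro solve [where s = "- scalar_resolvent (l o\<^sub>L TEi) v w"]) simp_all
  then show "1 / (1 + w\<^sup>2) * scalar_resolvent l v w =
      scalar_resolvent (l o\<^sub>L Ei) v w - 1 / (1 + w\<^sup>2) * (of_real (l (TEi v)) + w * of_real (l (Ei v)))"
    by (simp add: r_def t_def e_def)
  have "(\<i> - w) * scalar_resolvent2 l v w \<i> = r - (- t - \<i> * e)"
    "(- \<i> - w) * scalar_resolvent2 l v w (- \<i>) = r - (- t + \<i> * e)"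
    unfolding scalar_resolvent_identity [OF w(1) i_resolvent_dom] scalar_resolvent_identity [OF w(1) minus_i_resolvent_dom]
      at_i r_def by simp_all
  then have "(w - \<i>) * scalar_resolvent2 l v w \<i> = - t - \<i> * e - r"
    "(w + \<i>) * scalar_resolvent2 l v w (- \<i>) = - t + \<i> * e - r"
    by (simp_all add: algebra_simps eq_neg_iff_add_eq_0)
  moreover have "scalar_resolvent2 l v w \<i> = - scalar_resolvent l (TEi v) w - \<i> * scalar_resolvent l (Ei v) w"
    "scalar_resolvent2 l v w (- \<i>) = - scalar_resolvent l (TEi v) w + \<i> * scalar_resolvent l (Ei v) w"
    by (simp_all add: scalar_resolvent2_def scalar_resolvent_def resolvent_at_i complex_eq_iff
        blinfun.minus_left blinfun.minus_right blinfun.add_right blinfun.diff_right)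
  ultimately have "1 / (1 + w\<^sup>2) * r = scalar_resolvent l (Ei v) w - 1 / (1 + w\<^sup>2) * (t + w * e)"
    by (intro solve [where s = "- scalar_resolvent l (TEi v) w"]) simp_all
  then show "1 / (1 + w\<^sup>2) * scalar_resolvent l v w =
      scalar_resolvent l (Ei v) w - 1 / (1 + w\<^sup>2) * (of_real (l (TEi v)) + w * of_real (l (Ei v)))"
    by (simp add: r_def t_def e_def)
qed

text \<open>Partial fractions replace the tested resolvent over 1 + w^2 by one with
  \<open>Ei\<close> on the left or on the right, up to a rational term (t + u w) / (1 + w^2). Times
  \<open>H\<close> that term is holomorphic inside the contour, as i and -i lie outside, so it
  integrates to 0.\<close>

lemma calc_mult_inverse:
  assumes \<phi>: "0 < \<phi>" "\<phi> < \<theta>" "\<theta> < pi / 2" "cos \<phi> < c" and H: "H \<in> symmetric_decaying \<theta>"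
  shows "calc \<phi> (\<lambda>z. 1 / (1 + z\<^sup>2) * H z) = Ei o\<^sub>L calc \<phi> H"
    and "calc \<phi> (\<lambda>z. 1 / (1 + z\<^sup>2) * H z) = calc \<phi> H o\<^sub>L Ei"
proof -
  have \<theta>: "0 < \<theta>" "\<theta> < pi / 2" using \<phi> by auto
  have hol: "H holomorphic_on double_sector_complex \<theta>"
    using H by (simp add: symmetric_decaying_def)
  have eH: "(\<lambda>z. 1 / (1 + z\<^sup>2) * H z) \<in> symmetric_decaying \<theta>"
    by (rule symmetric_decaying_mult_inverse [OF \<theta> H])
  have cos: "0 < cos \<phi>" "cos \<theta> < cos \<phi>" by (rule cos_\<phi>_pos [OF \<phi>])+
  have sector: "z \<in> double_sector_complex \<theta>" if "z \<noteq> 0" "cos \<phi> * norm z \<le> \<bar>Re z\<bar>" for z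
  proof -
    have "cos \<theta> * norm z < cos \<phi> * norm z" using cos that(1) by (intro mult_strict_right_mono) auto
    then show ?thesis using that(2) by (simp add: double_sector_complex_def)
  qed
  define e where "e z = 1 / (1 + z\<^sup>2)" for z :: complex
  have e_le: "norm (e z) * (1 + (norm z)\<^sup>2) \<le> 8 / (cos \<theta>)\<^sup>2" if "z \<in> double_sector_complex \<theta>" for z
    unfolding e_def by (rule inverse_one_plus_square_bound [OF \<theta> that])
  have small: "norm z \<le> 1 + (norm z)\<^sup>2" for z :: complex
    using zero_le_power2 [of "norm z - 1"] unfolding power2_diff by (simp add: power2_eq_square) (smt (verit) norm_ge_zero)
  \<comment> \<open>\<open>p\<close> will be 1 and z; the growth condition keeps e(z) p(z) z bounded
    on the double sector, so that \<open>H\<close> alone provides the decay.\<close>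
  have poly: "contour_integrable \<phi> (\<lambda>z. e z * p z * H z)" "contour_mean \<phi> (\<lambda>z. e z * p z * H z) = 0"
    if p: "p holomorphic_on UNIV" "\<And>z. norm (p z * z) \<le> 1 + (norm z)\<^sup>2" for p
  proof -
    have hol': "(\<lambda>z. e z * p z * H z) holomorphic_on double_sector_complex \<theta>"
      unfolding e_def
      by (intro holomorphic_intros hol inverse_one_plus_square_holomorphic [OF \<theta>] holomorphic_on_subset [OF p(1)]) auto
    have le: "norm (e z * p z * H z * z) \<le> 8 / (cos \<theta>)\<^sup>2 * norm (norm (H z))" if "z \<in> double_sector_complex \<theta>" for z
    proof -
      have "norm (e z * p z * H z * z) = norm (e z) * norm (p z * z) * norm (H z)"
        by (simp add: norm_mult)
      also have "\<dots> \<le> norm (e z) * (1 + (norm z)\<^sup>2) * norm (H z)"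
        using p(2) by (intro mult_left_mono mult_right_mono) auto
      also have "\<dots> \<le> 8 / (cos \<theta>)\<^sup>2 * norm (H z)"
        by (intro mult_right_mono e_le that) auto
      finally show ?thesis by simp
    qed
    show "contour_mean \<phi> (\<lambda>z. e z * p z * H z) = 0"
      by (rule contour_mean_zero [OF \<phi>(1,2) order_refl \<phi>(3) hol' tame_norm [OF \<theta> H] le]) (rule sector)
    show "contour_integrable \<phi> (\<lambda>z. e z * p z * H z)"
      unfolding contour_integrable_def
    proof
      fix a assume a: "a \<in> contour_angles \<phi>"
      have ray: "ray_pt a x \<in> double_sector_complex \<theta>" for x
        using contour_angles_admissible [OF \<phi> a] by (simp add: ray_pt_in_double_sector)
      show "ray_integrable a (\<lambda>z. e z * p z * H z)"
      proof (rule ray_integrableI [OF _ _ le [OF ray]])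
        show "continuous_on UNIV (\<lambda>x. e (ray_pt a x) * p (ray_pt a x) * H (ray_pt a x))"
          using ray by (intro continuous_on_compose2 [OF holomorphic_on_imp_continuous_on [OF hol'] continuous_on_ray_pt]) auto
        show "integrable lborel (\<lambda>x. norm (H (ray_pt a x)))"
          using contour_angles_admissible [OF \<phi> a] H by (simp add: symmetric_decaying_def)
      qed
    qed
  qed
  have one: "contour_integrable \<phi> (\<lambda>z. e z * 1 * H z)" "contour_mean \<phi> (\<lambda>z. e z * 1 * H z) = 0"
    using small by (intro poly; simp)+
  have id: "contour_integrable \<phi> (\<lambda>z. e z * z * H z)" "contour_mean \<phi> (\<lambda>z. e z * z * H z) = 0"
    by (intro poly; simp add: norm_mult power2_eq_square)+
  have main: "complex_of_real (l (calc \<phi> (\<lambda>z. 1 / (1 + z\<^sup>2) * H z) v)) = contour_mean \<phi> (\<lambda>z. R z * H z)"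
    if R: "\<And>w. w \<in> resolvent_dom \<Longrightarrow> 1 + w\<^sup>2 \<noteq> 0 \<Longrightarrow> 1 / (1 + w\<^sup>2) * scalar_resolvent l v w =
        R w - 1 / (1 + w\<^sup>2) * (of_real (l (TEi v)) + w * of_real (l (Ei v)))"
      and R_int: "contour_integrable \<phi> (\<lambda>z. R z * H z)" for l :: "'a \<Rightarrow>\<^sub>L real" and v R
  proof -
    define t u where "t = - complex_of_real (l (TEi v))" and "u = - complex_of_real (l (Ei v))"
    note lin = contour_mean_linear [OF one(1) id(1), of t u]
    have "complex_of_real (l (calc \<phi> (\<lambda>z. 1 / (1 + z\<^sup>2) * H z) v)) =
        contour_mean \<phi> (\<lambda>z. scalar_resolvent l v z * (1 / (1 + z\<^sup>2) * H z))"
      by (rule calc_scalar [OF \<phi> eH])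
    also have "\<dots> = contour_mean \<phi> (\<lambda>z. 1 * (R z * H z) + 1 * (t * (e z * 1 * H z) + u * (e z * z * H z)))"
    proof (rule contour_mean_cong)
      fix a x assume a: "a \<in> contour_angles \<phi>"
      define z where "z = ray_pt a x"
      have z: "z \<in> resolvent_dom" "1 + z\<^sup>2 \<noteq> 0"
        using contour_angles_admissible [OF \<phi> a]
        by (auto simp: z_def ray_pt_resolvent_dom ray_pt_in_double_sector intro!: one_plus_square_nonzero [OF \<theta>])
      have "scalar_resolvent l v z * (1 / (1 + z\<^sup>2) * H z) = (1 / (1 + z\<^sup>2) * scalar_resolvent l v z) * H z"
        by simp
      also have "\<dots> = 1 * (R z * H z) + 1 * (t * (e z * 1 * H z) + u * (e z * z * H z))"
        unfolding R [OF z] by (simp add: t_def u_def e_def algebra_simps add_divide_distrib)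
      finally show "scalar_resolvent l v (ray_pt a x) * (1 / (1 + (ray_pt a x)\<^sup>2) * H (ray_pt a x)) =
          1 * (R (ray_pt a x) * H (ray_pt a x)) +
          1 * (t * (e (ray_pt a x) * 1 * H (ray_pt a x)) + u * (e (ray_pt a x) * ray_pt a x * H (ray_pt a x)))"
        unfolding z_def .
    qed
    also have "\<dots> = contour_mean \<phi> (\<lambda>z. R z * H z)"
      unfolding contour_mean_linear(2) [OF R_int lin(1)] lin(2) one id by simp
    finally show ?thesis .
  qed
  show "calc \<phi> (\<lambda>z. 1 / (1 + z\<^sup>2) * H z) = Ei o\<^sub>L calc \<phi> H"
  proof (rule calc_eqI)
    fix l v
    have "complex_of_real (blinfun_apply l (calc \<phi> (\<lambda>z. 1 / (1 + z\<^sup>2) * H z) v)) =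
        contour_mean \<phi> (\<lambda>z. scalar_resolvent (l o\<^sub>L Ei) v z * H z)"
    proof (rule main)
      show "contour_integrable \<phi> (\<lambda>z. scalar_resolvent (l o\<^sub>L Ei) v z * H z)"
        by (rule resolvent_contour_integrable [OF \<phi> H])
    qed (rule scalar_resolvent_Ei(1))
    then show "complex_of_real (blinfun_apply l (calc \<phi> (\<lambda>z. 1 / (1 + z\<^sup>2) * H z) v)) =
        of_real (blinfun_apply l ((Ei o\<^sub>L calc \<phi> H) v))"
      using calc_scalar [OF \<phi> H, of "l o\<^sub>L Ei" v] by (simp only: blinfun_apply_blinfun_compose)
  qed
  show "calc \<phi> (\<lambda>z. 1 / (1 + z\<^sup>2) * H z) = calc \<phi> H o\<^sub>L Ei"
  proof (rule calc_eqI)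
    fix l v
    have "complex_of_real (blinfun_apply l (calc \<phi> (\<lambda>z. 1 / (1 + z\<^sup>2) * H z) v)) =
        contour_mean \<phi> (\<lambda>z. scalar_resolvent l (Ei v) z * H z)"
    proof (rule main)
      show "contour_integrable \<phi> (\<lambda>z. scalar_resolvent l (Ei v) z * H z)"
        by (rule resolvent_contour_integrable [OF \<phi> H])
    qed (rule scalar_resolvent_Ei(2))
    then show "complex_of_real (blinfun_apply l (calc \<phi> (\<lambda>z. 1 / (1 + z\<^sup>2) * H z) v)) =
        of_real (blinfun_apply l ((calc \<phi> H o\<^sub>L Ei) v))"
      using calc_scalar [OF \<phi> H, of l "Ei v"] by (simp only: blinfun_apply_blinfun_compose)
  qed
qed

text \<open>
  Here the contour is moved outwards, across the poles \<open>i\<close> and \<open>- i\<close>; the pole is cancelled by a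
  multiple of \<open>1 / (1 + z\<^sup>2)\<close>, whose ray integrals are known.
\<close>

lemma calc_quotient:
  assumes \<phi>: "0 < \<phi>" "\<phi> < \<theta>" "\<theta> < pi / 2" "cos \<phi> < c"
  shows "calc \<phi> (\<lambda>z. z / (1 + z\<^sup>2)) = TEi"
proof (rule calc_eqI)
  fix l :: "'a \<Rightarrow>\<^sub>L real" and v
  have \<theta>: "0 < \<theta>" "\<theta> < pi / 2" using \<phi> by auto
  have q: "(\<lambda>z. z / (1 + z\<^sup>2)) \<in> symmetric_decaying \<theta>"
    by (rule symmetric_decaying_quotient [OF \<theta>])
  define r where "r = scalar_resolvent l v"
  define P where "P z = r z * (z / (1 + z\<^sup>2))" for z
  \<comment> \<open>\<open>k\<close> is the value of z r(z) at i, which is 2 i times the residue of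
    \<open>P\<close> there.\<close>
  define k where "k = \<i> * r \<i>"
  define U where "U = resolvent_dom \<inter> {z. 0 < Im z}"
  define N where "N z = z * r z - k" for z
  have "open U"
    unfolding U_def by (intro open_Int open_resolvent_dom open_halfspace_Im_gt)
  have iU: "\<i> \<in> U" using i_resolvent_dom by (simp add: U_def)
  have N_hol: "N holomorphic_on U"
    unfolding N_def r_def U_def
    by (intro holomorphic_intros holomorphic_on_subset [OF scalar_resolvent_holomorphic]) auto
  have "N \<i> = 0" by (simp add: N_def k_def)
  define D where "D z = (if z = \<i> then deriv N \<i> else (N z - N \<i>) / (z - \<i>))" for z
  have D_hol: "D holomorphic_on U"
    unfolding D_def using pole_lemma [OF N_hol, of \<i>] iU \<open>open U\<close> by (simp add: interior_open)
  \<comment> \<open>Away from i this is (z r(z) - k) / (1 + z^2): the singularity at i has been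
    removed, and -i is below the region \<open>U\<close>.\<close>
  define F where "F z = D z / (z + \<i>)" for z
  have plus: "z + \<i> \<noteq> 0" if "z \<in> U" for z
  proof -
    have "0 < Im (z + \<i>)" using that by (simp add: U_def)
    then show ?thesis by force
  qed
  have F_hol: "F holomorphic_on U"
    unfolding F_def using plus by (intro holomorphic_intros D_hol) auto
  have F_eq: "F z = N z / (1 + z\<^sup>2)" "F z = 1 * P z + (- k) * (1 / (1 + z\<^sup>2))" if "z \<in> U" "z \<noteq> \<i>" for z
  proof -
    have "1 + z\<^sup>2 = (z - \<i>) * (z + \<i>)" by (simp add: power2_eq_square algebra_simps)
    then show "F z = N z / (1 + z\<^sup>2)"
      using that \<open>N \<i> = 0\<close> by (simp add: F_def D_def)
    then show "F z = 1 * P z + (- k) * (1 / (1 + z\<^sup>2))"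
      by (simp add: P_def N_def diff_divide_distrib mult.commute)
  qed
  have sin: "0 < sin a" "\<bar>cos a\<bar> < c" if "a \<in> {\<phi>..pi - \<phi>}" for a
  proof -
    show "0 < sin a" using that \<phi> by (intro sin_gt_zero) auto
    have "cos a \<le> cos \<phi>"
      by (rule cos_monotone_0_pi_le) (use that \<phi> in auto)
    moreover have "cos (pi - \<phi>) \<le> cos a"
      by (rule cos_monotone_0_pi_le) (use that \<phi> in auto)
    ultimately show "\<bar>cos a\<bar> < c" using \<phi>(4) by simp
  qed
  have ray_U: "ray_pt a x \<in> U" if "a \<in> {\<phi>..pi - \<phi>}" for a x
    using sin [OF that] by (simp add: U_def ray_pt_resolvent_dom) (simp add: ray_pt_eq)
  define C where "C = (2 * M * norm l * norm v + norm k) * 4"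
  have rotate: "ray_integral \<phi> F = ray_integral (pi - \<phi>) F"
  proof (rule ray_integral_rotate [OF _ F_hol \<open>open U\<close> ray_U tame_bump, where N = 1 and C = C])
    show "\<phi> \<le> pi - \<phi>" using \<phi> by simp
    fix a x :: real assume a: "a \<in> {\<phi>..pi - \<phi>}" and x: "1 \<le> \<bar>x\<bar>"
    define z where "z = ray_pt a x"
    have z: "z \<in> U" "norm z = exp x" using ray_U [OF a] by (simp_all add: z_def)
    have "z \<noteq> \<i>" using x z(2) by force
    have "min (1 / 2) ((norm \<i>)\<^sup>2 / 2) * (1 + (norm z)\<^sup>2) \<le> norm (z\<^sup>2 - \<i>\<^sup>2)"
      using x z(2) by (intro far_from_pole(2) [of 0]) auto
    then have "1 + (norm z)\<^sup>2 \<le> 2 * norm (1 + z\<^sup>2)"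
      by (simp add: add.commute)
    then have "1 / 4 * (1 + (norm z)\<^sup>2) \<le> 1 / 4 * (2 * norm (1 + z\<^sup>2))"
      by (rule mult_left_mono) simp
    also have "\<dots> \<le> norm (1 + z\<^sup>2)" by simp
    finally have low: "1 / 4 * (1 + (norm z)\<^sup>2) \<le> norm (1 + z\<^sup>2)" .
    have pos: "0 < 1 / 4 * (1 + (norm z)\<^sup>2)" by (simp add: add_pos_nonneg)
    have "norm (N z) \<le> 2 * M * norm l * norm v + norm k"
      unfolding N_def using norm_triangle_ineq4 [of "z * r z" k] scalar_resolvent_bound [of z l v] z(1)
      by (simp add: r_def U_def mult.commute)
    then have "norm (N z) * norm z / norm (1 + z\<^sup>2) \<le>
        (2 * M * norm l * norm v + norm k) * norm z / (1 / 4 * (1 + (norm z)\<^sup>2))"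
      using low pos by (intro frac_le mult_right_mono mult_nonneg_nonneg add_nonneg_nonneg) (auto intro: M_nonneg)
    also have "\<dots> = C * bump z"
      by (simp add: C_def bump_def)
    finally show "norm (F (ray_pt a x) * ray_pt a x) \<le> C * norm (bump (ray_pt a x))"
      using F_eq(1) [OF z(1) \<open>z \<noteq> \<i>\<close>] by (simp add: norm_mult norm_divide bump_nonneg flip: z_def)
  qed
  have edge: "ray_integral a F = ray_integral a P - k * ray_integral a (\<lambda>z. 1 / (1 + z\<^sup>2))"
    if a: "a \<in> contour_angles \<phi>" "a \<in> {\<phi>..pi - \<phi>}" for a
  proof -
    note adm = contour_angles_admissible [OF \<phi> a(1)]
    have ne: "ray_pt a x \<noteq> \<i>" for x
    proof
      assume "ray_pt a x = \<i>"
      then have "\<bar>Re (ray_pt a x)\<bar> = 0" by simp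
      then show False using contour_angles_cos [OF a(1)] cos_\<phi>_pos [OF \<phi>] by (simp add: Re_ray_pt)
    qed
    have nz: "1 + (ray_pt a x)\<^sup>2 \<noteq> 0" for x
      using adm by (intro one_plus_square_nonzero [OF \<theta>]) (simp add: ray_pt_in_double_sector)
    have "ray_integrable a P"
      using resolvent_contour_integrable [OF \<phi> q, of l v] a(1) by (simp add: contour_integrable_def P_def [abs_def] r_def)
    moreover have "ray_integrable a (\<lambda>z. 1 / (1 + z\<^sup>2))"
    proof (rule ray_integrableI [where h = bump])
      show "continuous_on UNIV (\<lambda>x. 1 / (1 + (ray_pt a x)\<^sup>2))"
        using nz by (intro continuous_intros continuous_on_ray_pt) auto
      show "integrable lborel (\<lambda>x. bump (ray_pt a x))"
        using tame_bump [of "{a}"] by (simp add: tame_def)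
      show "norm (1 / (1 + (ray_pt a x)\<^sup>2) * ray_pt a x) \<le> 8 / (cos \<theta>)\<^sup>2 * norm (bump (ray_pt a x))" for x
      proof -
        have "0 < 1 + (norm (ray_pt a x))\<^sup>2" by (simp add: add_pos_nonneg)
        moreover have "ray_pt a x \<in> double_sector_complex \<theta>" using adm by (simp add: ray_pt_in_double_sector)
        ultimately have "norm (1 / (1 + (ray_pt a x)\<^sup>2)) \<le> 8 / (cos \<theta>)\<^sup>2 / (1 + (norm (ray_pt a x))\<^sup>2)"
          using inverse_one_plus_square_bound [OF \<theta>] by (simp only: pos_le_divide_eq)
        from mult_right_mono [OF this norm_ge_zero [of "ray_pt a x"]]
        show ?thesis by (simp add: norm_divide bump_def add_nonneg_nonneg)
      qed
    qed
    ultimately have "ray_integral a (\<lambda>z. 1 * P z + (- k) * (1 / (1 + z\<^sup>2))) =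
        1 * ray_integral a P + (- k) * ray_integral a (\<lambda>z. 1 / (1 + z\<^sup>2))"
      by (rule ray_integral_linear(2))
    moreover have "ray_integral a F = ray_integral a (\<lambda>z. 1 * P z + (- k) * (1 / (1 + z\<^sup>2)))"
      using ray_U [OF a(2)] ne by (intro ray_integral_cong F_eq(2)) auto
    ultimately show ?thesis by simp
  qed
  have "ray_integral \<phi> (\<lambda>z. 1 / (1 + z\<^sup>2)) = pi / 2" "ray_integral (pi - \<phi>) (\<lambda>z. 1 / (1 + z\<^sup>2)) = - pi / 2"
    using \<phi> by (intro ray_integral_inverse_one_plus_square; simp)+
  \<comment> \<open>The integrals of 1 / (1 + z^2) over the two rays are pi / 2 and - pi / 2; as
    \<open>F\<close> has equal integrals over them, the difference for \<open>P\<close> is -pi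
    k.\<close>
  then have upper: "ray_integral (pi - \<phi>) P - ray_integral \<phi> P = - pi * k"
    using rotate edge [of \<phi>] edge [of "pi - \<phi>"] \<phi> by (simp add: contour_angles_def algebra_simps)
  have cnj: "ray_integral (- \<phi>) P = cnj (ray_integral \<phi> P)" "ray_integral (pi + \<phi>) P = cnj (ray_integral (pi - \<phi>) P)"
  proof -
    have "- (pi - \<phi>) + 2 * pi = pi + \<phi>" by simp
    then have "ray_integral (pi + \<phi>) P = ray_integral (- (pi - \<phi>)) P"
      using ray_integral_periodic [of "- (pi - \<phi>)" P] by (simp only:)
    moreover have "ray_integral (- a) P = cnj (ray_integral a P)" if "a \<in> contour_angles \<phi>" for a
      using resolvent_ray_cnj [OF \<phi> q that, of l v] by (simp add: P_def [abs_def] r_def)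
    ultimately show "ray_integral (- \<phi>) P = cnj (ray_integral \<phi> P)" "ray_integral (pi + \<phi>) P = cnj (ray_integral (pi - \<phi>) P)"
      by (simp_all only: contour_angles_def insert_iff simp_thms)
  qed
  have "complex_of_real (l (calc \<phi> (\<lambda>z. z / (1 + z\<^sup>2)) v)) = contour_mean \<phi> P"
    unfolding P_def r_def by (rule calc_scalar [OF \<phi> q])
  also have "\<dots> = ((ray_integral (pi - \<phi>) P - ray_integral \<phi> P) -
      cnj (ray_integral (pi - \<phi>) P - ray_integral \<phi> P)) / (2 * pi * \<i>)"
    unfolding contour_mean_def cnj by (simp add: algebra_simps)
  also have "\<dots> = (- pi * k - cnj (- pi * k)) / (2 * pi * \<i>)"
    unfolding upper ..
  \<comment> \<open>The lower half plane contributes the conjugate, so only the imaginary part of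
    \<open>k\<close> survives; it is the real part of r(i), that is minus the tested
    \<open>TEi\<close>.\<close>
  also have "\<dots> = - of_real (Im k)"
    by (simp add: complex_eq_iff Re_divide Im_divide power2_eq_square)
  also have "Im k = - l (TEi v)"
    by (simp add: k_def r_def scalar_resolvent_def resolvent_at_i blinfun.minus_left blinfun.minus_right)
  finally show "complex_of_real (l (calc \<phi> (\<lambda>z. z / (1 + z\<^sup>2)) v)) = of_real (l (TEi v))"
    by simp
qed

section \<open>The extended calculus for functions of a complex variable\<close>

definition ext_calc :: "real \<Rightarrow> real \<Rightarrow> real \<Rightarrow> (complex \<Rightarrow> complex) \<Rightarrow> 'a \<Rightarrow>\<^sub>L 'a" where
  "ext_calc \<phi> c0 cinf H = cinf *\<^sub>R id_blinfun + (c0 - cinf) *\<^sub>R Ei + calc \<phi> H"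

end

text \<open>The third component of the product of two functions \<open>cinf + (c0 - cinf) / (1 + z\<^sup>2) + H z\<close>.\<close>

definition product_remainder ::
    "real \<Rightarrow> real \<Rightarrow> (complex \<Rightarrow> complex) \<Rightarrow> real \<Rightarrow> real \<Rightarrow> (complex \<Rightarrow> complex) \<Rightarrow> complex \<Rightarrow> complex" where
  "product_remainder g0 ginf G f0 finf F z =
    of_real 1 * (of_real 1 * (of_real ginf * F z + of_real finf * G z) +
      of_real 1 * (of_real (- ((g0 - ginf) * (f0 - finf))) * (z / (1 + z\<^sup>2) * (z / (1 + z\<^sup>2))) + of_real 1 * (G z * F z))) +
    of_real 1 * (of_real (g0 - ginf) * (1 / (1 + z\<^sup>2) * F z) + of_real (f0 - finf) * (1 / (1 + z\<^sup>2) * G z))"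

text \<open>With e = 1 / (1 + z^2), the cross term e^2 does not decay at 0; writing it as e - (z
  e)^2 completes the coefficient of e to g0 f0 - ginf finf and leaves a decaying square.\<close>

lemma product_remainder_eq:
  assumes "1 + z\<^sup>2 \<noteq> 0"
  shows "(of_real ginf + of_real (g0 - ginf) * (1 / (1 + z\<^sup>2)) + G z) * (of_real finf + of_real (f0 - finf) * (1 / (1 + z\<^sup>2)) + F z) =
    of_real (ginf * finf) + of_real (g0 * f0 - ginf * finf) * (1 / (1 + z\<^sup>2)) + product_remainder g0 ginf G f0 finf F z"
proof -
  define e where "e = 1 / (1 + z\<^sup>2)"
  have one: "(1 + z\<^sup>2) * e = 1" using assms by (simp add: e_def)
  have "e = ((1 + z\<^sup>2) * e) * e" by (simp only: one mult_1_left)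
  also have "\<dots> = e * e + (z * e) * (z * e)"
    by (simp add: power2_eq_square algebra_simps)
  finally have e: "(z * e) * (z * e) = e - e * e"
    by (metis add_diff_cancel_left')
  have q: "z / (1 + z\<^sup>2) = z * e" by (simp add: e_def)
  show ?thesis
    unfolding product_remainder_def q e e_def [symmetric] by (simp add: algebra_simps)
qed

lemma product_remainder_symmetric_decaying:
  assumes \<theta>: "0 < \<theta>" "\<theta> < pi / 2" and G: "G \<in> symmetric_decaying \<theta>" and F: "F \<in> symmetric_decaying \<theta>"
  shows "product_remainder g0 ginf G f0 finf F \<in> symmetric_decaying \<theta>"
  \<comment> \<open>The factors \<open>of_real 1\<close> in the definition give every sum the shape
    of a binary real combination, so that the linearity rules match syntactically.\<close>
  unfolding product_remainder_def [abs_def]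
  by (intro symmetric_decaying_linear [OF \<theta>] symmetric_decaying_mult [OF \<theta>] symmetric_decaying_mult_inverse [OF \<theta>]
      symmetric_decaying_quotient [OF \<theta>] G F)

context resolvent_family
begin

text \<open>Both sides expand into the same operators. \<open>calc\<close> sends (z e)^2 to the
  square of \<open>TEi\<close> and e times a decaying function to a product with \<open>Ei\<close>,
  put to the left of \<open>F\<close> and to the right of \<open>G\<close> as the expansion
  requires; \<open>Ei_square\<close> is the counterpart of e^2 = e - (z e)^2.\<close>

lemma ext_calc_mult:
  assumes \<phi>: "0 < \<phi>" "\<phi> < \<theta>" "\<theta> < pi / 2" "cos \<phi> < c"
    and G: "G \<in> symmetric_decaying \<theta>" and F: "F \<in> symmetric_decaying \<theta>"
  shows "ext_calc \<phi> (g0 * f0) (ginf * finf) (product_remainder g0 ginf G f0 finf F) =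
    ext_calc \<phi> g0 ginf G o\<^sub>L ext_calc \<phi> f0 finf F"
proof (rule blinfun_eqI)
  fix v
  have \<theta>: "0 < \<theta>" "\<theta> < pi / 2" using \<phi> by auto
  note sd = symmetric_decaying_linear [OF \<theta>] symmetric_decaying_mult [OF \<theta>] symmetric_decaying_mult_inverse [OF \<theta>]
    symmetric_decaying_quotient [OF \<theta>] G F
  have calc_K: "calc \<phi> (product_remainder g0 ginf G f0 finf F) =
      1 *\<^sub>R (1 *\<^sub>R (ginf *\<^sub>R calc \<phi> F + finf *\<^sub>R calc \<phi> G) +
        1 *\<^sub>R ((- ((g0 - ginf) * (f0 - finf))) *\<^sub>R (TEi o\<^sub>L TEi) + 1 *\<^sub>R (calc \<phi> G o\<^sub>L calc \<phi> F))) +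
      1 *\<^sub>R ((g0 - ginf) *\<^sub>R (Ei o\<^sub>L calc \<phi> F) + (f0 - finf) *\<^sub>R (calc \<phi> G o\<^sub>L Ei))"
    unfolding product_remainder_def [abs_def]
    by (subst calc_linear [OF \<phi>], (intro sd)+)+
      (simp only: calc_mult [OF \<phi> G F] calc_mult [OF \<phi> symmetric_decaying_quotient [OF \<theta>] symmetric_decaying_quotient [OF \<theta>]]
        calc_quotient [OF \<phi>] calc_mult_inverse(1) [OF \<phi> F] calc_mult_inverse(2) [OF \<phi> G])
  have Ei_Ei: "Ei (Ei w) = Ei w - TEi (TEi w)" for w
    using Ei_square [of w] by (simp add: algebra_simps)
  show "blinfun_apply (ext_calc \<phi> (g0 * f0) (ginf * finf) (product_remainder g0 ginf G f0 finf F)) v =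
      blinfun_apply (ext_calc \<phi> g0 ginf G o\<^sub>L ext_calc \<phi> f0 finf F) v"
    unfolding ext_calc_def calc_K
    by (simp add: blinfun.add_left blinfun.diff_left blinfun.scaleR_left blinfun.add_right blinfun.diff_right
        blinfun.scaleR_right blinfun.minus_left blinfun.minus_right Ei_Ei) (simp add: algebra_simps)
qed

end

section \<open>Slice representation\<close>

lemma norm_cbasis [simp]: "norm (cbasis A) = 1"
proof -
  have "(\<Sum>B\<in>UNIV. (coeff (cbasis A) B)\<^sup>2) = (\<Sum>B\<in>UNIV. if B = A then 1 else 0)"
    by (intro sum.cong) (auto simp: coeff_cbasis)
  then show ?thesis by (simp add: norm_clifford_def)
qed

lemma coeff_sum: "coeff (\<Sum>i\<in>S. f i) A = (\<Sum>i\<in>S. coeff (f i) A)"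
  by (induction S rule: infinite_finite_induct) auto

lemma coeff_of_real: "coeff (of_real r :: 'n::{finite,linorder} clifford) A = (if A = {} then r else 0)"
  by (simp add: of_real_def one_clifford_def)

lemma abs_coeff_le_norm: "\<bar>coeff a A\<bar> \<le> norm a"
proof -
  have "(coeff a A)\<^sup>2 \<le> (\<Sum>B\<in>UNIV. (coeff a B)\<^sup>2)"
    by (rule member_le_sum) auto
  then show ?thesis
    unfolding norm_clifford_def by (simp add: real_le_rsqrt)
qed

lemma norm_le_sum_coeff: "norm a \<le> (\<Sum>A\<in>UNIV. \<bar>coeff a A\<bar>)"
  for a :: "'n::{finite,linorder} clifford"
proof -
  have "norm (\<Sum>A\<in>UNIV. coeff a A *\<^sub>R cbasis A) \<le> (\<Sum>A\<in>UNIV. norm (coeff a A *\<^sub>R cbasis A))"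
    by (rule norm_sum)
  then show ?thesis
    by (simp flip: clifford_expansion)
qed

lemma bounded_linear_coeff: "bounded_linear (\<lambda>a. coeff a A)"
  by (rule bounded_linear_intro [where K = 1]) (auto simp: abs_coeff_le_norm)

text \<open>Each coefficient of the product is a sum over all basis indices of terms bounded by the
  product of the norms, and there are equally many coefficients. The crude constant suffices for
  boundedness and decay.\<close>

lemma norm_mult_clifford:
  fixes a b :: "'n::{finite,linorder} clifford"
  shows "norm (a * b) \<le> norm a * (norm b * (real CARD('n set))\<^sup>2)"
proof -
  have reord: "\<bar>reord_sign A B\<bar> = 1" for A B :: "'n set"
    by (simp add: reord_sign_def)
  have "\<bar>coeff (a * b) C\<bar> \<le> (\<Sum>A\<in>(UNIV :: 'n set set). norm a * norm b)" for C
    unfolding coeff_mult_aux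
  proof (rule order_trans [OF sum_abs sum_mono])
    fix A :: "'n set"
    show "\<bar>reord_sign A (sym_diff A C) * coeff a A * coeff b (sym_diff A C)\<bar> \<le> norm a * norm b"
      using mult_mono [OF abs_coeff_le_norm [of a A] abs_coeff_le_norm [of b "sym_diff A C"]]
      by (simp only: abs_mult reord mult_1_left norm_ge_zero abs_ge_zero)
  qed
  then have "(\<Sum>C\<in>UNIV. \<bar>coeff (a * b) C\<bar>) \<le> (\<Sum>C\<in>(UNIV :: 'n set set). \<Sum>A\<in>(UNIV :: 'n set set). norm a * norm b)"
    by (intro sum_mono)
  then show ?thesis
    using norm_le_sum_coeff [of "a * b"] by (simp add: power2_eq_square mult_ac)
qed

lemma of_real_mult_clifford: "of_real r * a = r *\<^sub>R (a :: 'n::{finite,linorder} clifford)"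
  and mult_of_real_clifford: "a * of_real r = r *\<^sub>R (a :: 'n::{finite,linorder} clifford)"
  by (simp_all add: of_real_def)

lemma paravectorI: "of_real x0 + (\<Sum>i\<in>UNIV. x i *\<^sub>R gen i) \<in> paravectors"
  unfolding paravectors_def by blast

lemma paravector_coeff:
  assumes "s \<in> paravectors"
  shows "s = of_real (coeff s {}) + (\<Sum>i\<in>UNIV. coeff s {i} *\<^sub>R gen i)"
proof -
  obtain x0 x where s: "s = of_real x0 + (\<Sum>i\<in>UNIV. x i *\<^sub>R gen i)"
    using assms by (auto simp: paravectors_def)
  have "coeff s {} = x0"
    by (simp add: s coeff_of_real coeff_sum gen_def coeff_cbasis)
  moreover have "coeff s {i} = x i" for i
    by (simp add: s coeff_of_real coeff_sum gen_def coeff_cbasis if_distrib cong: if_cong)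
  ultimately show ?thesis using s by simp
qed

lemma imag_sphere_expansion:
  assumes "J \<in> imag_sphere"
  shows "J = (\<Sum>i\<in>UNIV. coeff J {i} *\<^sub>R gen i)"
  using paravector_coeff [of J] assms by (simp add: imag_sphere_def)

text \<open>Adding the double sum to its transpose leaves anticommutators of generators, which
  vanish off the diagonal and equal -2 on it.\<close>

lemma vector_square:
  fixes x :: "'n::{finite,linorder} \<Rightarrow> real"
  shows "(\<Sum>i\<in>UNIV. x i *\<^sub>R gen i) * (\<Sum>i\<in>UNIV. x i *\<^sub>R gen i) = - of_real (\<Sum>i\<in>UNIV. (x i)\<^sup>2)"
proof -
  let ?s = "(\<Sum>i\<in>UNIV. x i *\<^sub>R gen i) * (\<Sum>i\<in>UNIV. x i *\<^sub>R gen i)"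
  have expand: "?s = (\<Sum>i\<in>UNIV. \<Sum>j\<in>UNIV. (x i * x j) *\<^sub>R (gen i * gen j))"
    by (simp add: sum_product mult.commute)
  have "?s + ?s = (\<Sum>i\<in>UNIV. \<Sum>j\<in>UNIV. (x i * x j) *\<^sub>R (gen i * gen j)) +
      (\<Sum>i\<in>UNIV. \<Sum>j\<in>UNIV. (x j * x i) *\<^sub>R (gen j * gen i))"
    unfolding expand by (subst (2) sum.swap) simp
  also have "\<dots> = (\<Sum>i\<in>UNIV. \<Sum>j\<in>UNIV. (x i * x j) *\<^sub>R (gen i * gen j + gen j * gen i))"
    by (simp add: sum.distrib [symmetric] scaleR_add_right mult.commute)
  also have "\<dots> = (\<Sum>i\<in>UNIV. \<Sum>j\<in>UNIV. if j = i then (- 2 * (x i)\<^sup>2) *\<^sub>R 1 else 0)"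
  proof (intro sum.cong refl)
    fix i j
    have "r *\<^sub>R (- 1 + - 1) = (- 2 * r) *\<^sub>R (1 :: 'n clifford)" for r
      by (simp only: mult_minus_left mult_2 scaleR_minus_left scaleR_left_distrib scaleR_right_distrib
          scaleR_minus_right minus_add_distrib)
    then show "(x i * x j) *\<^sub>R (gen i * gen j + gen j * gen i) = (if j = i then (- 2 * (x i)\<^sup>2) *\<^sub>R 1 else 0)"
      using gen_anticommute [of i j] by (cases "j = i") (simp_all only: gen_square power2_eq_square if_True if_False refl, simp)
  qed
  also have "\<dots> = (\<Sum>i\<in>UNIV. - 2 * (x i)\<^sup>2) *\<^sub>R 1"
    by (simp add: scaleR_sum_left)
  also have "(\<Sum>i\<in>UNIV. - 2 * (x i)\<^sup>2) = - 2 * (\<Sum>i\<in>UNIV. (x i)\<^sup>2)"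
    by (simp only: sum_distrib_left)
  finally have "(1 / 2) *\<^sub>R (?s + ?s) = (1 / 2) *\<^sub>R ((- 2 * (\<Sum>i\<in>UNIV. (x i)\<^sup>2)) *\<^sub>R 1)"
    by (rule arg_cong)
  then show ?thesis
    by (simp only: scaleR_half_double) (simp add: of_real_def)
qed

lemma norm_vector: "(norm (\<Sum>i\<in>UNIV. x i *\<^sub>R gen i))\<^sup>2 = (\<Sum>i\<in>UNIV. (x i)\<^sup>2)"
  for x :: "'n::{finite,linorder} \<Rightarrow> real"
proof -
  have orthonormal: "inner (gen i) (gen j) = (if j = i then 1 else 0)" for i j :: 'n
  proof -
    have "inner (gen i) (gen j) = (\<Sum>A\<in>UNIV. if A = {i} then (if j = i then 1 else 0) else 0)"
      unfolding gen_def inner_clifford_def coeff_cbasis by (intro sum.cong) auto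
    then show ?thesis by simp
  qed
  show ?thesis
    unfolding power2_norm_eq_inner
    by (simp add: inner_sum_left inner_sum_right orthonormal if_distrib power2_eq_square cong: if_cong)
qed

lemma imag_sphere_square:
  assumes "J \<in> imag_sphere"
  shows "J * J = - 1"
proof -
  have "(\<Sum>i\<in>UNIV. (coeff J {i})\<^sup>2) = (norm J)\<^sup>2"
    using norm_vector [of "\<lambda>i. coeff J {i}"] imag_sphere_expansion [OF assms] by simp
  also have "\<dots> = 1"
    using assms by (simp add: imag_sphere_def)
  finally show ?thesis
    using vector_square [of "\<lambda>i. coeff J {i}"] imag_sphere_expansion [OF assms] by simp
qed

lemma imag_sphere_uminus: "J \<in> imag_sphere \<Longrightarrow> - J \<in> imag_sphere"
proof -
  assume J: "J \<in> imag_sphere"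
  have "- J = of_real 0 + (\<Sum>i\<in>UNIV. (- coeff J {i}) *\<^sub>R gen i)"
    using imag_sphere_expansion [OF J] by (simp add: sum_negf)
  also have "\<dots> \<in> paravectors" by (rule paravectorI)
  finally show ?thesis
    using J by (simp add: imag_sphere_def)
qed

lemma imag_sphere_nonempty: "(imag_sphere :: 'n::{finite,linorder} clifford set) \<noteq> {}"
proof -
  fix i :: 'n
  have "gen i = of_real 0 + (\<Sum>j\<in>UNIV. (if j = i then 1 else 0) *\<^sub>R gen j)"
    by (simp add: if_distrib [of "\<lambda>r. r *\<^sub>R _"] cong: if_cong)
  also have "\<dots> \<in> paravectors" by (rule paravectorI)
  finally have "gen i \<in> imag_sphere"
    by (simp add: imag_sphere_def) (simp add: gen_def coeff_cbasis)
  then show ?thesis by blast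
qed

section \<open>Slices as copies of the complex plane\<close>

text \<open>For an imaginary unit \<open>J\<close> this is the isometric homomorphism of real
  algebras that sends i to J; through it slice data become functions of one complex
  variable.\<close>

definition embed :: "'n::{finite,linorder} clifford \<Rightarrow> complex \<Rightarrow> 'n clifford" where
  "embed J z = slice_pt J (Re z) (Im z)"

lemma embed_eq: "embed J z = of_real (Re z) + Im z *\<^sub>R J"
  by (simp add: embed_def slice_pt_def mult_of_real_clifford)

lemma embed_add: "embed J (z + w) = embed J z + embed J w"
  by (simp add: embed_eq algebra_simps)

lemma embed_of_real: "embed J (of_real r) = of_real r"
  by (simp add: embed_eq)

lemma embed_mult:
  assumes "J \<in> imag_sphere"
  shows "embed J (z * w) = embed J z * embed J w"
  using imag_sphere_square [OF assms]
  by (simp add: embed_eq algebra_simps of_real_mult_clifford mult_of_real_clifford) (simp add: of_real_def algebra_simps)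

lemma coeff_embed: "J \<in> imag_sphere \<Longrightarrow> coeff (embed J z) {} = Re z"
  by (simp add: embed_eq coeff_of_real imag_sphere_def)

lemma norm_embed:
  assumes "J \<in> imag_sphere"
  shows "norm (embed J z) = norm z"
proof -
  have "inner (1 :: 'a clifford) J = 0"
    using assms by (simp add: inner_clifford_def one_clifford_def imag_sphere_def if_distrib [of "\<lambda>x. x * _"] cong: if_cong)
  moreover have "norm (1 :: 'a clifford) = 1"
    by (simp add: cbasis_empty [symmetric])
  ultimately have "(norm (embed J z))\<^sup>2 = (norm z)\<^sup>2"
    using assms unfolding power2_norm_eq_inner embed_eq of_real_def
    by (simp add: inner_add_left inner_add_right inner_commute imag_sphere_def norm_eq_sqrt_inner
        power2_eq_square inner_complex_def)
  then show ?thesis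
    by (simp add: power2_eq_iff_nonneg)
qed

lemma embed_paravector:
  assumes "J \<in> imag_sphere"
  shows "embed J z \<in> paravectors"
proof -
  have "embed J z = of_real (Re z) + Im z *\<^sub>R (\<Sum>i\<in>UNIV. coeff J {i} *\<^sub>R gen i)"
    using imag_sphere_expansion [OF assms] by (simp add: embed_eq)
  also have "\<dots> = of_real (Re z) + (\<Sum>i\<in>UNIV. (Im z * coeff J {i}) *\<^sub>R gen i)"
    by (simp add: scaleR_right.sum)
  also have "\<dots> \<in> paravectors" by (rule paravectorI)
  finally show ?thesis .
qed

lemma pconj_embed:
  assumes "J \<in> imag_sphere"
  shows "pconj (embed J z) = embed J (cnj z)"
proof -
  have "(\<Sum>i\<in>UNIV. coeff (embed J z) {i} *\<^sub>R gen i) = Im z *\<^sub>R (\<Sum>i\<in>UNIV. coeff J {i} *\<^sub>R gen i)"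
    by (simp add: embed_eq coeff_of_real scaleR_right.sum)
  also have "\<dots> = Im z *\<^sub>R J"
    using imag_sphere_expansion [OF assms] by simp
  finally show ?thesis
    by (simp add: pconj_def coeff_embed [OF assms]) (simp add: embed_eq)
qed

lemma inverse_clifford_eq:
  fixes a b :: "'n::{finite,linorder} clifford"
  assumes "a * b = 1" "b * a = 1"
  shows "inverse a = b"
proof -
  have "(THE b. a * b = 1 \<and> b * a = 1) = b"
    using assms by (intro the_equality) (auto, metis mult.assoc mult_1_left mult_1_right)
  then show ?thesis
    using assms by (auto simp: inverse_clifford_def)
qed

lemma inverse_embed:
  assumes "J \<in> imag_sphere" "z \<noteq> 0"
  shows "inverse (embed J z) = embed J (1 / z)"
proof (rule inverse_clifford_eq)
  have "embed J 1 = 1" using embed_of_real [of J 1] by simp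
  then show "embed J z * embed J (1 / z) = 1" "embed J (1 / z) * embed J z = 1"
    using assms(2) by (simp_all flip: embed_mult [OF assms(1)])
qed

lemma embed_ii: "embed J \<i> = J"
  by (simp add: embed_eq)

lemma slice_exp_embed: "r *\<^sub>R slice_exp J a = embed J (of_real r * cis a)"
  by (simp add: slice_exp_def slice_pt_def embed_eq mult_of_real_clifford scaleR_add_right) (simp add: of_real_def)

text \<open>The double sector asks for an angle in the set \<open>I_angle\<close> itself, not modulo
  2 pi. The angle \<open>b\<close> between z and the real axis is below \<theta>, and one of b, -b,
  pi - b, pi + b is a representative in the required range.\<close>

lemma complex_polar_I_angle:
  assumes z: "z \<in> double_sector_complex \<theta>" and \<theta>: "0 < \<theta>" "\<theta> < pi / 2"
  obtains a where "a \<in> I_angle \<theta>" "z = of_real (norm z) * cis a"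
proof -
  define n where "n = norm z"
  have cos: "0 < cos \<theta>" using \<theta> by (intro cos_gt_zero)
  have "z \<noteq> 0" using z by (auto simp: double_sector_complex_def)
  then have n: "n > 0" by (simp add: n_def)
  define b where "b = arccos (\<bar>Re z\<bar> / n)"
  have le0: "0 \<le> \<bar>Re z\<bar> / n" using n by simp
  then have le1: "- 1 \<le> \<bar>Re z\<bar> / n" by linarith
  have le: "\<bar>Re z\<bar> / n \<le> 1" "cos \<theta> < \<bar>Re z\<bar> / n"
    using n z abs_Re_le_cmod [of z] by (auto simp: n_def double_sector_complex_def pos_less_divide_eq)
  have cos_b: "cos b = \<bar>Re z\<bar> / n"
    unfolding b_def by (rule cos_arccos [OF le1 le(1)])
  have b: "0 \<le> b" "b < \<theta>"
  proof -
    show "0 \<le> b" unfolding b_def by (rule arccos_lbound [OF le1 le(1)])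
    have "b < arccos (cos \<theta>)"
      unfolding b_def using le by (intro arccos_less_arccos) auto
    then show "b < \<theta>" using \<theta> by (simp add: arccos_cos)
  qed
  have "sin b = sqrt (1 - (\<bar>Re z\<bar> / n)\<^sup>2)"
    unfolding b_def by (rule sin_arccos_abs) (use le0 le(1) in simp)
  also have "1 - (\<bar>Re z\<bar> / n)\<^sup>2 = (\<bar>Im z\<bar> / n)\<^sup>2"
  proof -
    have "1 - (\<bar>Re z\<bar> / n)\<^sup>2 = (n\<^sup>2 - (Re z)\<^sup>2) / n\<^sup>2"
      using n by (simp add: power_divide diff_divide_distrib)
    also have "n\<^sup>2 - (Re z)\<^sup>2 = (Im z)\<^sup>2"
      using cmod_power2 [of z] by (simp add: n_def)
    finally show ?thesis by (simp add: power_divide)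
  qed
  finally have sin_b: "sin b = \<bar>Im z\<bar> / n"
    using n by simp
  define a where "a = (if Re z \<ge> 0 then (if Im z \<ge> 0 then b else - b) else (if Im z \<ge> 0 then pi - b else pi + b))"
  have "a \<in> I_angle \<theta>"
    using b by (auto simp: a_def I_angle_def)
  moreover have "z = of_real n * cis a"
    using n cos_b sin_b by (auto simp: a_def complex_eq_iff cos_diff sin_diff)
  ultimately show ?thesis using that unfolding n_def by blast
qed

lemma I_angle_cos: "a \<in> I_angle \<theta> \<Longrightarrow> 0 < \<theta> \<Longrightarrow> \<theta> < pi / 2 \<Longrightarrow> cos \<theta> < \<bar>cos a\<bar>"
proof -
  assume a: "a \<in> I_angle \<theta>" and \<theta>: "0 < \<theta>" "\<theta> < pi / 2"
  have *: "cos \<theta> < cos b" if "\<bar>b\<bar> < \<theta>" for b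
    using cos_monotone_0_pi [of "\<bar>b\<bar>" \<theta>] that \<theta> by simp
  from a consider "\<bar>a\<bar> < \<theta>" | "\<bar>a - pi\<bar> < \<theta>"
    by (auto simp: I_angle_def abs_less_iff)
  then show ?thesis
    using * [of a] * [of "a - pi"] by cases (auto simp: cos_diff)
qed

text \<open>A point of the slice of \<open>J\<close> may be given in the double sector by another
  unit; scalar part and norm do not depend on the unit, and they decide membership.\<close>

lemma double_sector_embed_iff:
  assumes J: "J \<in> imag_sphere" and \<theta>: "0 < \<theta>" "\<theta> < pi / 2"
  shows "embed J z \<in> double_sector \<theta> \<longleftrightarrow> z \<in> double_sector_complex \<theta>"
proof
  assume "embed J z \<in> double_sector \<theta>"
  then obtain r I a where s: "embed J z = r *\<^sub>R slice_exp I a" "r > 0" "I \<in> imag_sphere" "a \<in> I_angle \<theta>"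
    by (auto simp: double_sector_def)
  have "Re z = r * cos a" "norm z = r"
    using arg_cong [OF s(1), of "\<lambda>s. coeff s {}"] arg_cong [OF s(1), of norm] s(2)
    by (simp_all add: slice_exp_embed coeff_embed [OF J] coeff_embed [OF s(3)] norm_embed [OF J] norm_embed [OF s(3)] norm_mult)
  then show "z \<in> double_sector_complex \<theta>"
    using I_angle_cos [OF s(4) \<theta>] s(2) by (simp add: double_sector_complex_def abs_mult mult.commute)
next
  assume z: "z \<in> double_sector_complex \<theta>"
  obtain a where a: "a \<in> I_angle \<theta>" "z = of_real (norm z) * cis a"
    using complex_polar_I_angle [OF z \<theta>] .
  have "norm z > 0" using z by (auto simp: double_sector_complex_def)
  moreover have "embed J z = norm z *\<^sub>R slice_exp J a"
    unfolding slice_exp_embed using a(2) by simp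
  ultimately show "embed J z \<in> double_sector \<theta>"
    using a(1) J unfolding double_sector_def by blast
qed

lemma double_sector_cases:
  assumes "s \<in> double_sector \<theta>" "0 < \<theta>" "\<theta> < pi / 2"
  obtains J z where "J \<in> imag_sphere" "z \<in> double_sector_complex \<theta>" "s = embed J z"
proof -
  obtain r J a where s: "s = r *\<^sub>R slice_exp J a" "J \<in> imag_sphere"
    using assms by (auto simp: double_sector_def)
  then have "s = embed J (of_real r * cis a)"
    by (simp add: slice_exp_embed)
  then show ?thesis
    using that assms s(2) double_sector_embed_iff by blast
qed

lemma slice_domain_double_sector:
  assumes "0 < \<theta>" "\<theta> < pi / 2"
  shows "slice_domain (double_sector \<theta> :: 'n::{finite,linorder} clifford set) = {(x, y). Complex x y \<in> double_sector_complex \<theta>}"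
proof -
  have "slice_pt J x y \<in> double_sector \<theta> \<longleftrightarrow> Complex x y \<in> double_sector_complex \<theta>"
    if "J \<in> (imag_sphere :: 'n clifford set)" for J x y
    using double_sector_embed_iff [OF that assms, of "Complex x y"] by (simp add: embed_def)
  then show ?thesis
    using imag_sphere_nonempty [where 'n = 'n] unfolding slice_domain_def by blast
qed

text \<open>
  On every slice \<open>f = \<Sum>\<^sub>A F\<^sub>A e\<^sub>A\<close> with intrinsic \<open>F\<^sub>A\<close>, each given by one holomorphic function of a
  complex variable.
\<close>

definition slice_rep :: "real \<Rightarrow> ('n::{finite,linorder} clifford \<Rightarrow> 'n clifford) \<Rightarrow> ('n set \<Rightarrow> complex \<Rightarrow> complex) \<Rightarrow> bool" where
  "slice_rep \<theta> f F \<longleftrightarrow>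
    (\<forall>A. F A holomorphic_on double_sector_complex \<theta> \<and> (\<forall>z\<in>double_sector_complex \<theta>. F A (cnj z) = cnj (F A z))) \<and>
    (\<forall>J\<in>imag_sphere. \<forall>z\<in>double_sector_complex \<theta>. f (embed J z) = (\<Sum>A\<in>UNIV. embed J (F A z) * cbasis A))"

lemma sum_embed_cbasis:
  "(\<Sum>A\<in>UNIV. embed J (w A) * cbasis A) = Clifford (\<lambda>A. Re (w A)) + J * Clifford (\<lambda>A. Im (w A))"
proof -
  have "Clifford g = (\<Sum>A\<in>UNIV. g A *\<^sub>R cbasis A)" for g :: "'a set \<Rightarrow> real"
    using clifford_expansion [of "Clifford g"] by simp
  then show ?thesis
    by (simp add: embed_eq distrib_right sum.distrib of_real_mult_clifford sum_distrib_left)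
qed

section \<open>Slice components and holomorphic coefficient functions\<close>

text \<open>In each basis coefficient the equations for \<open>f0\<close> and \<open>f1\<close> are
  the Cauchy--Riemann equations of f0 + i f1, and the parities in y are symmetry under
  conjugation.\<close>

lemma slice_components_rep:
  fixes f :: "'n::{finite,linorder} clifford \<Rightarrow> 'n clifford"
  assumes comp: "slice_components (double_sector \<theta>) f f0 f1" and \<theta>: "0 < \<theta>" "\<theta> < pi / 2"
  shows "slice_rep \<theta> f (\<lambda>A z. Complex (coeff (f0 (Re z, Im z)) A) (coeff (f1 (Re z, Im z)) A))"
proof -
  note dom = slice_domain_double_sector [OF \<theta>, where 'n = 'n]
  have vals: "J \<in> imag_sphere \<Longrightarrow> f (slice_pt J x y) = f0 (x, y) + J * f1 (x, y)"
    "f0 (x, - y) = f0 (x, y)" "f1 (x, - y) = - f1 (x, y)" if "Complex x y \<in> double_sector_complex \<theta>" for J x y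
    using comp that unfolding slice_components_def dom by auto
  obtain f0' f1' :: "real \<times> real \<Rightarrow> (real \<times> real) \<Rightarrow>\<^sub>L 'n clifford" where
    derivs: "\<forall>p\<in>slice_domain (double_sector \<theta> :: 'n clifford set).
          (f0 has_derivative blinfun_apply (f0' p)) (at p) \<and>
          (f1 has_derivative blinfun_apply (f1' p)) (at p) \<and>
          blinfun_apply (f0' p) (1, 0) = blinfun_apply (f1' p) (0, 1) \<and>
          blinfun_apply (f0' p) (0, 1) = - blinfun_apply (f1' p) (1, 0)"
    using comp unfolding slice_components_def by (elim conjE exE) (rule that)
  define F where "F A z = Complex (coeff (f0 (Re z, Im z)) A) (coeff (f1 (Re z, Im z)) A)" for A z
  have hol: "F A holomorphic_on double_sector_complex \<theta>" for A
  proof (rule holomorphic_onI)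
    fix z assume z: "z \<in> double_sector_complex \<theta>"
    define p where "p = (Re z, Im z)"
    have "p \<in> slice_domain (double_sector \<theta> :: 'n clifford set)"
      using z by (simp add: dom p_def)
    from bspec [OF derivs this]
    have d0: "(f0 has_derivative blinfun_apply (f0' p)) (at p)" and d1: "(f1 has_derivative blinfun_apply (f1' p)) (at p)"
      and cr: "blinfun_apply (f1' p) (0, 1) = blinfun_apply (f0' p) (1, 0)"
        "blinfun_apply (f1' p) (1, 0) = - blinfun_apply (f0' p) (0, 1)"
      by auto
    \<comment> \<open>The complex derivative, read off from the partial derivatives of
      \<open>f0\<close> alone: minus its y-derivative is the x-derivative of
      \<open>f1\<close>.\<close>
    define D where "D = Complex (coeff (f0' p (1, 0)) A) (- coeff (f0' p (0, 1)) A)"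
    have lin: "blinfun_apply B (u, v) = u *\<^sub>R blinfun_apply B (1, 0) + v *\<^sub>R blinfun_apply B (0, 1)"
      for B :: "(real \<times> real) \<Rightarrow>\<^sub>L 'n clifford" and u v
      by (simp flip: blinfun.scaleR_right blinfun.add_right)
    have pair: "((\<lambda>z. (Re z, Im z)) has_derivative (\<lambda>h. (Re h, Im h))) (at z)"
      by (intro derivative_eq_intros | simp)+
    have c: "((\<lambda>z. coeff (g (Re z, Im z)) A) has_derivative (\<lambda>h. coeff (g' (Re h, Im h)) A)) (at z)"
      if "(g has_derivative blinfun_apply g') (at p)" for g :: "real \<times> real \<Rightarrow> 'n clifford" and g'
    proof -
      have "((\<lambda>z. g (Re z, Im z)) has_derivative (\<lambda>h. g' (Re h, Im h))) (at z)"
        using diff_chain_at [OF pair, of g g'] that by (simp add: o_def p_def)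
      then show ?thesis
        by (rule bounded_linear.has_derivative [OF bounded_linear_coeff])
    qed
    have "(F A has_derivative (\<lambda>h. of_real (coeff (f0' p (Re h, Im h)) A) + \<i> * of_real (coeff (f1' p (Re h, Im h)) A))) (at z)"
      unfolding F_def [abs_def] Complex_eq
      by (intro has_derivative_add has_derivative_mult_right has_derivative_of_real c d0 d1)
    also have "(\<lambda>h. of_real (coeff (f0' p (Re h, Im h)) A) + \<i> * of_real (coeff (f1' p (Re h, Im h)) A)) = (\<lambda>h. D * h)"
    proof
      fix h
      show "of_real (coeff (f0' p (Re h, Im h)) A) + \<i> * of_real (coeff (f1' p (Re h, Im h)) A) = D * h"
        unfolding lin [of "f0' p" "Re h" "Im h"] lin [of "f1' p" "Re h" "Im h"]
        by (simp add: D_def complex_eq_iff cr mult.commute)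
    qed
    finally show "F A field_differentiable at z within double_sector_complex \<theta>"
      by (auto simp: has_field_derivative_def field_differentiable_def intro: has_derivative_at_withinI)
  qed
  have "F A (cnj z) = cnj (F A z)" if "z \<in> double_sector_complex \<theta>" for A z
    using vals(2,3) [of "Re z" "Im z"] that by (simp add: F_def complex_eq_iff)
  moreover have "f (embed J z) = (\<Sum>A\<in>UNIV. embed J (F A z) * cbasis A)"
    if "J \<in> imag_sphere" "z \<in> double_sector_complex \<theta>" for J z
    unfolding sum_embed_cbasis using vals(1) [of "Re z" "Im z" J] that
    by (simp add: F_def embed_def coeff_inverse)
  ultimately show ?thesis
    using hol unfolding slice_rep_def F_def [abs_def] by blast
qed

text \<open>The components are the real and imaginary parts of the coefficient functions, and their
  derivatives come from multiplication by the complex derivative. This is how the remainder of a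
  product is seen to be slice hyperholomorphic.\<close>

lemma slice_rep_components:
  fixes f :: "'n::{finite,linorder} clifford \<Rightarrow> 'n clifford"
  assumes rep: "slice_rep \<theta> f F" and \<theta>: "0 < \<theta>" "\<theta> < pi / 2"
  shows "\<exists>f0 f1. slice_components (double_sector \<theta>) f f0 f1"
proof -
  note dom = slice_domain_double_sector [OF \<theta>, where 'n = 'n]
  have hol: "F A holomorphic_on double_sector_complex \<theta>" for A
    using rep by (simp add: slice_rep_def)
  have sym: "F A (cnj z) = cnj (F A z)" if "z \<in> double_sector_complex \<theta>" for A z
    using rep that by (simp add: slice_rep_def)
  define point :: "real \<times> real \<Rightarrow> complex" where "point p = Complex (fst p) (snd p)" for p
  define f0 f1 :: "real \<times> real \<Rightarrow> 'n clifford" where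
    "f0 p = (\<Sum>A\<in>UNIV. Re (F A (point p)) *\<^sub>R cbasis A)" and "f1 p = (\<Sum>A\<in>UNIV. Im (F A (point p)) *\<^sub>R cbasis A)" for p
  define U V :: "'n set \<Rightarrow> (real \<times> real) \<Rightarrow>\<^sub>L 'n clifford" where
    "U A = Blinfun (\<lambda>h. fst h *\<^sub>R cbasis A)" and "V A = Blinfun (\<lambda>h. snd h *\<^sub>R cbasis A)" for A
  have UV: "blinfun_apply (U A) h = fst h *\<^sub>R cbasis A" "blinfun_apply (V A) h = snd h *\<^sub>R cbasis A" for A h
    unfolding U_def V_def
    by (subst bounded_linear_Blinfun_apply;
        intro bounded_linear_scaleR_const bounded_linear_fst bounded_linear_snd refl)+
  define d where "d A p = deriv (F A) (point p)" for A p
  define f0' f1' :: "real \<times> real \<Rightarrow> (real \<times> real) \<Rightarrow>\<^sub>L 'n clifford" where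
    "f0' p = (\<Sum>A\<in>UNIV. Re (d A p) *\<^sub>R U A - Im (d A p) *\<^sub>R V A)" and
    "f1' p = (\<Sum>A\<in>UNIV. Im (d A p) *\<^sub>R U A + Re (d A p) *\<^sub>R V A)" for p
  have apply0: "blinfun_apply (f0' p) h = (\<Sum>A\<in>UNIV. Re (d A p * point h) *\<^sub>R cbasis A)" for p h
    by (simp add: f0'_def blinfun.sum_left blinfun.diff_left blinfun.scaleR_left UV point_def scaleR_diff_left)
  have apply1: "blinfun_apply (f1' p) h = (\<Sum>A\<in>UNIV. Im (d A p * point h) *\<^sub>R cbasis A)" for p h
    by (simp add: f1'_def blinfun.sum_left blinfun.add_left blinfun.scaleR_left UV point_def scaleR_add_left add.commute)
  have point: "(point has_derivative point) F" for F
    unfolding point_def [abs_def] Complex_eq by (intro derivative_eq_intros | simp)+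
  have cont_point: "continuous_on S point" for S
    unfolding point_def [abs_def] Complex_eq by (intro continuous_intros)
  have in_dom: "point p \<in> double_sector_complex \<theta>" if "p \<in> slice_domain (double_sector \<theta> :: 'n clifford set)" for p
    using that by (auto simp: dom point_def)
  have cont_d: "continuous_on (slice_domain (double_sector \<theta> :: 'n clifford set)) (d A)" for A
    unfolding d_def using in_dom
    by (intro continuous_on_compose2 [OF holomorphic_on_imp_continuous_on [OF holomorphic_deriv [OF hol open_double_sector_complex]]]
        cont_point) auto
  have "continuous_on (slice_domain (double_sector \<theta> :: 'n clifford set)) f0'"
    "continuous_on (slice_domain (double_sector \<theta> :: 'n clifford set)) f1'"
    unfolding f0'_def [abs_def] f1'_def [abs_def] by (intro continuous_intros cont_d)+
  moreover have "(f0 has_derivative blinfun_apply (f0' p)) (at p) \<and>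
      (f1 has_derivative blinfun_apply (f1' p)) (at p) \<and>
      blinfun_apply (f0' p) (1, 0) = blinfun_apply (f1' p) (0, 1) \<and>
      blinfun_apply (f0' p) (0, 1) = - blinfun_apply (f1' p) (1, 0)"
    if p: "p \<in> slice_domain (double_sector \<theta> :: 'n clifford set)" for p
  proof (intro conjI)
    have "(F A has_field_derivative d A p) (at (point p))" for A
      unfolding d_def by (rule holomorphic_derivI [OF hol open_double_sector_complex in_dom [OF p]])
    then have chain: "((\<lambda>p. F A (point p)) has_derivative (\<lambda>h. d A p * point h)) (at p)" for A
      using diff_chain_at [OF point [of "at p"], of "F A" "\<lambda>h. d A p * h"] by (simp add: has_field_derivative_def o_def)
    have eqs: "blinfun_apply (f0' p) = (\<lambda>h. \<Sum>A\<in>UNIV. Re (d A p * point h) *\<^sub>R cbasis A)"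
      "blinfun_apply (f1' p) = (\<lambda>h. \<Sum>A\<in>UNIV. Im (d A p * point h) *\<^sub>R cbasis A)"
      by (rule ext, rule apply0) (rule ext, rule apply1)
    show "(f0 has_derivative blinfun_apply (f0' p)) (at p)" "(f1 has_derivative blinfun_apply (f1' p)) (at p)"
      unfolding eqs f0_def [abs_def] f1_def [abs_def]
      by (intro has_derivative_sum has_derivative_scaleR_left bounded_linear.has_derivative [OF bounded_linear_Re]
          bounded_linear.has_derivative [OF bounded_linear_Im] chain)+
    show "blinfun_apply (f0' p) (1, 0) = blinfun_apply (f1' p) (0, 1)"
      "blinfun_apply (f0' p) (0, 1) = - blinfun_apply (f1' p) (1, 0)"
      unfolding apply0 apply1 by (simp_all add: point_def sum_negf)
  qed
  moreover have "(\<forall>J\<in>imag_sphere. f (slice_pt J x y) = f0 (x, y) + J * f1 (x, y)) \<and>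
      f0 (x, - y) = f0 (x, y) \<and> f1 (x, - y) = - f1 (x, y)"
    if "(x, y) \<in> slice_domain (double_sector \<theta> :: 'n clifford set)" for x y
  proof (intro conjI ballI)
    have z: "Complex x y \<in> double_sector_complex \<theta>"
      using that by (simp add: dom)
    show "f0 (x, - y) = f0 (x, y)" "f1 (x, - y) = - f1 (x, y)"
      using sym [OF z] by (simp_all add: f0_def f1_def point_def complex_cnj sum_negf)
    fix J :: "'n clifford" assume J: "J \<in> imag_sphere"
    have "f (slice_pt J x y) = (\<Sum>A\<in>UNIV. embed J (F A (Complex x y)) * cbasis A)"
      using rep J z unfolding slice_rep_def embed_def by fastforce
    also have "\<dots> = f0 (x, y) + J * f1 (x, y)"
      by (simp add: f0_def f1_def point_def embed_eq distrib_right sum.distrib of_real_mult_clifford sum_distrib_left)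
    finally show "f (slice_pt J x y) = f0 (x, y) + J * f1 (x, y)" .
  qed
  ultimately show ?thesis
    unfolding slice_components_def by blast
qed

text \<open>The substitution t = exp x with dt / t = dx. Both directions are used: to extract the
  decay of coefficient functions from \<open>SH_L_0\<close>, and to establish membership in
  it.\<close>

lemma log_substitution_integrable:
  fixes k :: "real \<Rightarrow> real"
  assumes cont: "continuous_on {0<..} k" and nonneg: "\<And>t. 0 < t \<Longrightarrow> 0 \<le> k t"
  shows "(\<integral>\<^sup>+t\<in>{0<..}. ennreal (k t / t) \<partial>lborel) < \<infinity> \<longleftrightarrow> integrable lborel (\<lambda>x. k (exp x))"
proof -
  define g where "g t = indicator {0<..} t *\<^sub>R (k t / t)" for t
  have "continuous_on {0<..} (\<lambda>t. k t / t)"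
    by (intro continuous_intros cont) auto
  from borel_measurable_continuous_on_indicator [OF _ this]
  have meas: "g \<in> borel_measurable lborel"
    by (simp add: g_def [abs_def])
  have cont_exp: "continuous_on UNIV (\<lambda>x. k (exp x))"
    by (intro continuous_on_compose2 [OF cont] continuous_intros) auto
  have "(\<integral>\<^sup>+t\<in>{0<..}. ennreal (k t / t) \<partial>lborel) = (\<integral>\<^sup>+t. ennreal (norm (g t)) \<partial>lborel)"
    using nonneg by (intro nn_integral_cong) (auto simp: g_def indicator_def)
  then have "(\<integral>\<^sup>+t\<in>{0<..}. ennreal (k t / t) \<partial>lborel) < \<infinity> \<longleftrightarrow> integrable lborel g"
    using meas by (simp add: integrable_iff_bounded)
  also have "\<dots> \<longleftrightarrow> integrable lebesgue g"
    using meas by (simp add: integrable_completion)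
  also have "\<dots> \<longleftrightarrow> (\<lambda>t. k t / t) absolutely_integrable_on exp ` UNIV"
  proof -
    have "x \<in> range exp" if "0 < x" for x :: real
      using that by (intro range_eqI [of _ _ "ln x"]) simp
    then have "exp ` UNIV = {0::real<..}"
      by auto
    then show ?thesis by (simp add: set_integrable_def g_def [abs_def])
  qed
  also have "\<dots> \<longleftrightarrow> (\<lambda>x. \<bar>exp x\<bar> *\<^sub>R (k (exp x) / exp x)) absolutely_integrable_on UNIV"
    by (intro absolutely_integrable_change_of_variables_real) (auto intro!: derivative_eq_intros simp: inj_on_def)
  also have "\<dots> \<longleftrightarrow> integrable lborel (\<lambda>x. k (exp x))"
  proof -
    have "(\<lambda>x. k (exp x)) \<in> borel_measurable lborel"
      using borel_measurable_continuous_onI [OF cont_exp] by simp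
    from integrable_completion [OF this] show ?thesis
      by (simp add: set_integrable_def)
  qed
  finally show ?thesis .
qed

lemma slice_rep_norm_le:
  fixes f :: "'n::{finite,linorder} clifford \<Rightarrow> 'n clifford"
  assumes rep: "slice_rep \<theta> f F" and J: "J \<in> imag_sphere" and z: "z \<in> double_sector_complex \<theta>"
  shows "norm (f (embed J z)) \<le> (\<Sum>A\<in>UNIV. norm (F A z) * (1 + norm (J * cbasis A)))"
proof -
  have "f (embed J z) = (\<Sum>A\<in>UNIV. Re (F A z) *\<^sub>R cbasis A + Im (F A z) *\<^sub>R (J * cbasis A))"
    using rep J z by (simp add: slice_rep_def embed_eq distrib_right of_real_mult_clifford)
  also have "norm \<dots> \<le> (\<Sum>A\<in>UNIV. norm (F A z) * (1 + norm (J * cbasis A)))"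
  proof (rule sum_norm_le)
    fix A
    have "norm (Re (F A z) *\<^sub>R cbasis A + Im (F A z) *\<^sub>R (J * cbasis A)) \<le>
        \<bar>Re (F A z)\<bar> * 1 + \<bar>Im (F A z)\<bar> * norm (J * cbasis A)"
      by (rule order_trans [OF norm_triangle_ineq]) simp
    also have "\<dots> \<le> norm (F A z) * 1 + norm (F A z) * norm (J * cbasis A)"
      by (intro add_mono mult_right_mono abs_Re_le_cmod abs_Im_le_cmod) auto
    finally show "norm (Re (F A z) *\<^sub>R cbasis A + Im (F A z) *\<^sub>R (J * cbasis A)) \<le> norm (F A z) * (1 + norm (J * cbasis A))"
      by (simp add: distrib_left)
  qed
  finally show ?thesis .
qed

text \<open>Over the same z the values on the slices of \<open>J\<close> and \<open>- J\<close> are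
  a + J b and a - J b, so their sum and, after multiplication by J, their difference recover both
  components. \<open>C\<close> depends on \<open>J\<close> only, so one estimate serves boundedness
  and integrability.\<close>

lemma slice_rep_coeff_le:
  fixes J :: "'n::{finite,linorder} clifford"
  assumes J: "J \<in> imag_sphere"
  obtains C where "\<And>\<theta> f F A z. slice_rep \<theta> f F \<Longrightarrow> z \<in> double_sector_complex \<theta> \<Longrightarrow>
    norm (F A z) \<le> C * (norm (f (embed J z)) + norm (f (embed (- J) z)))"
proof -
  define N where "N = (real CARD('n set))\<^sup>2"
  define C where "C = 1 + norm J * N"
  have "norm (F A z) \<le> C * (norm (f (embed J z)) + norm (f (embed (- J) z)))"
    if rep: "slice_rep \<theta> f F" and z: "z \<in> double_sector_complex \<theta>" for \<theta> f F A z
  proof -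
    define a b where "a = Clifford (\<lambda>A. Re (F A z))" and "b = Clifford (\<lambda>A. Im (F A z))"
    have plus: "f (embed J z) = a + J * b" and minus: "f (embed (- J) z) = a - J * b"
      using rep J imag_sphere_uminus [OF J] z by (simp_all add: slice_rep_def sum_embed_cbasis a_def b_def)
    have "J * (J * b) = - b"
      using imag_sphere_square [OF J] by (simp flip: mult.assoc)
    then have a2: "2 *\<^sub>R a = f (embed J z) + f (embed (- J) z)" and b2: "2 *\<^sub>R b = - (J * (f (embed J z) - f (embed (- J) z)))"
      unfolding plus minus by (simp_all add: algebra_simps scaleR_2)
    define S where "S = norm (f (embed J z)) + norm (f (embed (- J) z))"
    have "2 * norm a \<le> S"
      using arg_cong [OF a2, of norm] norm_triangle_ineq [of "f (embed J z)" "f (embed (- J) z)"] by (simp add: S_def)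
    moreover have "2 * norm b \<le> norm J * (S * N)"
    proof -
      have "2 * norm b = norm (J * (f (embed J z) - f (embed (- J) z)))"
        using arg_cong [OF b2, of norm] by simp
      also have "\<dots> \<le> norm J * (norm (f (embed J z) - f (embed (- J) z)) * N)"
        unfolding N_def by (rule norm_mult_clifford)
      also have "\<dots> \<le> norm J * (S * N)"
        unfolding S_def by (intro mult_left_mono mult_right_mono norm_triangle_ineq4) (auto simp: N_def)
      finally show ?thesis .
    qed
    moreover have "norm (F A z) \<le> norm a + norm b"
      using cmod_le [of "F A z"] abs_coeff_le_norm [of a A] abs_coeff_le_norm [of b A] by (simp add: a_def b_def)
    moreover have "0 \<le> S" "0 \<le> norm J * (S * N)" by (auto simp: S_def N_def)
    ultimately show ?thesis
      unfolding C_def S_def [symmetric] by (simp add: algebra_simps)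
  qed
  then show ?thesis using that by blast
qed

lemma slice_rep_continuous_ray:
  fixes f :: "'n::{finite,linorder} clifford \<Rightarrow> 'n clifford"
  assumes rep: "slice_rep \<theta> f F" and J: "J \<in> imag_sphere" and a: "cos \<theta> < \<bar>cos a\<bar>"
  shows "continuous_on {0<..} (\<lambda>t. norm (f (t *\<^sub>R slice_exp J a)))"
proof -
  have dom: "of_real t * cis a \<in> double_sector_complex \<theta>" if "t > 0" for t
    using that a by (simp add: double_sector_complex_def norm_mult abs_mult)
  have cont: "continuous_on {0<..} (\<lambda>t. F A (of_real t * cis a))" for A
    using rep dom unfolding slice_rep_def
    by (intro continuous_on_compose2 [OF holomorphic_on_imp_continuous_on [of "F A" "double_sector_complex \<theta>"]] continuous_intros) auto
  have *: "continuous_on {0<..} (\<lambda>t. norm (\<Sum>A\<in>UNIV. Re (F A (of_real t * cis a)) *\<^sub>R cbasis A + Im (F A (of_real t * cis a)) *\<^sub>R (J * cbasis A)))"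
    by (intro continuous_intros cont)
  have "norm (f (t *\<^sub>R slice_exp J a)) =
      norm (\<Sum>A\<in>UNIV. Re (F A (of_real t * cis a)) *\<^sub>R cbasis A + Im (F A (of_real t * cis a)) *\<^sub>R (J * cbasis A))"
    if "t > 0" for t
  proof -
    have f: "f (embed J (of_real t * cis a)) = (\<Sum>A\<in>UNIV. embed J (F A (of_real t * cis a)) * cbasis A)"
      using rep J dom [OF that] by (simp add: slice_rep_def)
    show ?thesis
      unfolding slice_exp_embed f by (simp add: embed_eq distrib_right of_real_mult_clifford)
  qed
  then show ?thesis
    by (intro continuous_on_eq [OF *]) simp
qed

lemma slice_rep_symmetric_decaying:
  fixes f :: "'n::{finite,linorder} clifford \<Rightarrow> 'n clifford"
  assumes f: "f \<in> SH_L_0 \<theta>" and rep: "slice_rep \<theta> f F" and \<theta>: "0 < \<theta>" "\<theta> < pi / 2"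
  shows "F A \<in> symmetric_decaying \<theta>"
proof -
  obtain J :: "'n clifford" where J: "J \<in> imag_sphere" using imag_sphere_nonempty by blast
  note J' = imag_sphere_uminus [OF J]
  obtain C where C: "\<And>\<theta> f F A z. slice_rep \<theta> f F \<Longrightarrow> z \<in> double_sector_complex \<theta> \<Longrightarrow>
      norm (F A z) \<le> C * (norm (f (embed J z)) + norm (f (embed (- J) z)))"
    using slice_rep_coeff_le [OF J] by blast
  obtain B where B: "\<And>s. s \<in> double_sector \<theta> \<Longrightarrow> norm (f s) \<le> B"
    using f by (auto simp: SH_L_0_def bounded_iff)
  have "norm (F A z) \<le> \<bar>C\<bar> * (B + B)" if z: "z \<in> double_sector_complex \<theta>" for z
  proof -
    have "norm (f (embed J z)) + norm (f (embed (- J) z)) \<le> B + B"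
      using z J J' by (intro add_mono B) (simp_all add: double_sector_embed_iff [OF _ \<theta>])
    then have "C * (norm (f (embed J z)) + norm (f (embed (- J) z))) \<le> \<bar>C\<bar> * (B + B)"
      by (intro mult_mono) auto
    then show ?thesis using C [OF rep z, of A] by linarith
  qed
  then have "bounded (F A ` double_sector_complex \<theta>)"
    by (auto simp: bounded_iff)
  moreover have "integrable lborel (\<lambda>x. F A (ray_pt a x))" if a: "cos \<theta> < \<bar>cos a\<bar>" for a
  proof -
    have "cis a \<in> double_sector_complex \<theta>"
      using a by (simp add: double_sector_complex_def)
    \<comment> \<open>Rays are indexed by all \<open>a\<close> with large |cos a|, the integrability
      condition of \<open>SH_L_0\<close> by \<open>I_angle\<close>; \<open>b\<close> represents the
      same direction in that set.\<close>
    then obtain b where b: "b \<in> I_angle \<theta>" "cis a = cis b"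
      using complex_polar_I_angle [OF _ \<theta>] by (metis mult_1_left norm_cis of_real_1)
    have cos_b: "cos \<theta> < \<bar>cos b\<bar>" using I_angle_cos [OF b(1) \<theta>] .
    have int: "integrable lborel (\<lambda>x. norm (f (exp x *\<^sub>R slice_exp I b)))" if I: "I \<in> imag_sphere" for I
    proof -
      have "(\<integral>\<^sup>+t\<in>{0<..}. ennreal (norm (f (t *\<^sub>R slice_exp I b)) / t) \<partial>lborel) < \<infinity>"
        using f I b(1) by (simp add: SH_L_0_def)
      then show ?thesis
        using log_substitution_integrable [OF slice_rep_continuous_ray [OF rep I cos_b]] by simp
    qed
    have ray: "ray_pt a x \<in> double_sector_complex \<theta>" for x
      using a by (simp add: ray_pt_in_double_sector)
    have embed_ray: "embed I (ray_pt a x) = exp x *\<^sub>R slice_exp I b" for I :: "'n clifford" and x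
      by (simp add: ray_pt_eq slice_exp_embed b(2))
    show ?thesis
    proof (rule integrable_continuous_dominated [where N = 0 and C = C])
      show "integrable lborel (\<lambda>x. norm (f (exp x *\<^sub>R slice_exp J b)) + norm (f (exp x *\<^sub>R slice_exp (- J) b)))"
        using int [OF J] int [OF J'] by (rule Bochner_Integration.integrable_add)
      have "F A holomorphic_on double_sector_complex \<theta>"
        using rep by (simp add: slice_rep_def)
      then show "continuous_on UNIV (\<lambda>x. F A (ray_pt a x))"
        using ray by (intro continuous_on_compose2 [OF holomorphic_on_imp_continuous_on continuous_on_ray_pt]) auto
      show "norm (F A (ray_pt a x)) \<le> C * norm (norm (f (exp x *\<^sub>R slice_exp J b)) + norm (f (exp x *\<^sub>R slice_exp (- J) b)))" for x
        using C [OF rep ray, of A x] by (simp add: embed_ray)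
    qed
  qed
  ultimately show ?thesis
    using rep by (simp add: symmetric_decaying_def slice_rep_def)
qed

lemma SH_L_0_rep:
  fixes f :: "'n::{finite,linorder} clifford \<Rightarrow> 'n clifford"
  assumes f: "f \<in> SH_L_0 \<theta>" and \<theta>: "0 < \<theta>" "\<theta> < pi / 2"
  obtains F where "slice_rep \<theta> f F" "\<And>A. F A \<in> symmetric_decaying \<theta>"
proof -
  obtain f0 f1 where "slice_components (double_sector \<theta>) f f0 f1"
    using f by (auto simp: SH_L_0_def SH_L_def)
  then have "slice_rep \<theta> f (\<lambda>A z. Complex (coeff (f0 (Re z, Im z)) A) (coeff (f1 (Re z, Im z)) A))"
    using slice_components_rep \<theta> by blast
  then show ?thesis
    using that slice_rep_symmetric_decaying [OF f _ \<theta>] by blast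
qed

text \<open>Real components have no coefficient outside the empty index, so the single function
  \<open>F {}\<close> describes \<open>f\<close> on every slice, with values in that slice.\<close>

lemma N_0_rep:
  fixes f :: "'n::{finite,linorder} clifford \<Rightarrow> 'n clifford"
  assumes f: "f \<in> N_0 \<theta>" and \<theta>: "0 < \<theta>" "\<theta> < pi / 2"
  obtains G where "G \<in> symmetric_decaying \<theta>"
    "\<And>J z. J \<in> imag_sphere \<Longrightarrow> z \<in> double_sector_complex \<theta> \<Longrightarrow> f (embed J z) = embed J (G z)"
proof -
  obtain f0 f1 where comp: "slice_components (double_sector \<theta>) f f0 f1"
    and real: "\<And>p. p \<in> slice_domain (double_sector \<theta> :: 'n clifford set) \<Longrightarrow> f0 p \<in> \<real> \<and> f1 p \<in> \<real>"
    using f by (auto simp: N_0_def intrinsic_def)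
  define F where "F A z = Complex (coeff (f0 (Re z, Im z)) A) (coeff (f1 (Re z, Im z)) A)" for A z
  have rep: "slice_rep \<theta> f F"
    using slice_components_rep [OF comp \<theta>] by (simp add: F_def [abs_def])
  have sd: "F {} \<in> symmetric_decaying \<theta>"
    using f by (intro slice_rep_symmetric_decaying [OF _ rep \<theta>]) (simp add: N_0_def)
  have "f (embed J z) = embed J (F {} z)" if J: "J \<in> imag_sphere" and z: "z \<in> double_sector_complex \<theta>" for J z
  proof -
    have "(Re z, Im z) \<in> slice_domain (double_sector \<theta> :: 'n clifford set)"
      using z by (simp add: slice_domain_double_sector [OF \<theta>])
    then have "f0 (Re z, Im z) \<in> \<real>" "f1 (Re z, Im z) \<in> \<real>"
      using real by auto
    then have "F A z = 0" if "A \<noteq> {}" for A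
      using that by (auto simp: F_def complex_eq_iff coeff_of_real elim!: Reals_cases)
    then have "embed J (F A z) * cbasis A = (if A = {} then embed J (F {} z) else 0)" for A
      by (simp add: embed_eq cbasis_empty)
    moreover have "f (embed J z) = (\<Sum>A\<in>UNIV. embed J (F A z) * cbasis A)"
      using rep J z by (simp add: slice_rep_def)
    ultimately show ?thesis by simp
  qed
  then show ?thesis using that sd by blast
qed

text \<open>Boundedness and integrability come from the finitely many coefficient functions.
  Relative openness and axial symmetry of the double sector are taken as \<open>U\<close>, since any
  known element of \<open>SH_L\<close> on it carries them.\<close>

lemma rep_SH_L_0:
  fixes f :: "'n::{finite,linorder} clifford \<Rightarrow> 'n clifford"
  assumes rep: "slice_rep \<theta> f F" and F: "\<And>A. F A \<in> symmetric_decaying \<theta>" and \<theta>: "0 < \<theta>" "\<theta> < pi / 2"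
    and U: "openin (top_of_set paravectors) (double_sector \<theta> :: 'n clifford set)"
      "axially_symmetric (double_sector \<theta> :: 'n clifford set)"
  shows "f \<in> SH_L_0 \<theta>"
proof -
  have "f \<in> SH_L (double_sector \<theta>)"
    using U slice_rep_components [OF rep \<theta>] by (simp add: SH_L_def)
  moreover have "bounded (f ` double_sector \<theta>)"
  proof -
    obtain B where B: "\<And>A z. z \<in> double_sector_complex \<theta> \<Longrightarrow> norm (F A z) \<le> B A"
    proof -
      have "\<exists>B. \<forall>z\<in>double_sector_complex \<theta>. norm (F A z) \<le> B" for A
        using F [of A] by (auto simp: symmetric_decaying_def bounded_iff)
      then show ?thesis using that by metis
    qed
    define N where "N = (real CARD('n set))\<^sup>2"
    have "norm (f s) \<le> (\<Sum>A\<in>UNIV. B A * (1 + N))" if s: "s \<in> double_sector \<theta>" for s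
    proof -
      obtain J z where s: "J \<in> imag_sphere" "z \<in> double_sector_complex \<theta>" "s = embed J z"
        using double_sector_cases [OF s \<theta>] .
      have "norm (J * cbasis A) \<le> N" for A
        using norm_mult_clifford [of J "cbasis A"] s(1) by (simp add: imag_sphere_def N_def)
      then have "(\<Sum>A\<in>UNIV. norm (F A z) * (1 + norm (J * cbasis A))) \<le> (\<Sum>A\<in>UNIV. B A * (1 + N))"
        using B [OF s(2)] by (intro sum_mono mult_mono add_mono) (auto intro: order_trans [OF norm_ge_zero])
      then show ?thesis
        using slice_rep_norm_le [OF rep s(1,2)] unfolding s(3) by linarith
    qed
    then show ?thesis by (auto simp: bounded_iff)
  qed
  moreover have "(\<integral>\<^sup>+t\<in>{0<..}. ennreal (norm (f (t *\<^sub>R slice_exp J a)) / t) \<partial>lborel) < \<infinity>"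
    if J: "J \<in> imag_sphere" and a: "a \<in> I_angle \<theta>" for J a
  proof -
    have cos: "cos \<theta> < \<bar>cos a\<bar>" using I_angle_cos [OF a \<theta>] .
    note cont = slice_rep_continuous_ray [OF rep J cos]
    have "integrable lborel (\<lambda>x. norm (f (exp x *\<^sub>R slice_exp J a)))"
    proof (rule Bochner_Integration.integrable_bound)
      show "integrable lborel (\<lambda>x. \<Sum>A\<in>UNIV. norm (F A (ray_pt a x)) * (1 + norm (J * cbasis A)))"
        using F cos by (intro Bochner_Integration.integrable_sum integrable_mult_left integrable_norm)
          (simp add: symmetric_decaying_def)
      show "(\<lambda>x. norm (f (exp x *\<^sub>R slice_exp J a))) \<in> borel_measurable lborel"
      proof -
        have "continuous_on UNIV (\<lambda>x. norm (f (exp x *\<^sub>R slice_exp J a)))"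
          by (intro continuous_on_compose2 [OF cont] continuous_intros) auto
        then show ?thesis
          using borel_measurable_continuous_onI by simp
      qed
      have "norm (f (exp x *\<^sub>R slice_exp J a)) \<le> (\<Sum>A\<in>UNIV. norm (F A (ray_pt a x)) * (1 + norm (J * cbasis A)))" for x
      proof -
        have "ray_pt a x \<in> double_sector_complex \<theta>"
          using cos by (simp add: ray_pt_in_double_sector)
        from slice_rep_norm_le [OF rep J this] show ?thesis
          by (simp add: slice_exp_embed ray_pt_eq)
      qed
      then show "AE x in lborel. norm (norm (f (exp x *\<^sub>R slice_exp J a))) \<le>
          norm (\<Sum>A\<in>UNIV. norm (F A (ray_pt a x)) * (1 + norm (J * cbasis A)))"
        by (auto intro!: AE_I2 order_trans [OF _ abs_ge_self])
    qed
    then show ?thesis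
      using log_substitution_integrable [OF cont] by simp
  qed
  ultimately show ?thesis
    by (simp add: SH_L_0_def)
qed

section \<open>The resolvent on the complexification\<close>

lemma axis_add: "axis A (x + y) = axis A x + axis A (y :: 'v::real_vector)"
  by (simp add: vec_eq_iff axis_def)

lemma axis_scaleR: "axis A (r *\<^sub>R x) = r *\<^sub>R axis A (x :: 'v::real_vector)"
  by (simp add: vec_eq_iff axis_def)

lemma vec_eq_sum_axis: "v = (\<Sum>A\<in>UNIV. axis A (v $ A))" for v :: "'v::real_vector ^ 'm::finite"
  by (simp add: vec_eq_iff axis_def cong: if_cong)

lemma linear_lmul: "linear (lmul a)"
  unfolding lmul_def
  by (rule linearI) (simp_all add: scaleR_add_right axis_add sum.distrib axis_scaleR scaleR_sum_right mult_ac)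

lemma lmul_sum_left: "lmul (\<Sum>i\<in>S. f i) v = (\<Sum>i\<in>S. lmul (f i) v)"
  and lmul_add_left: "lmul (a + b) v = lmul a v + lmul b v"
  and lmul_scaleR_left: "lmul (r *\<^sub>R a) v = r *\<^sub>R lmul a v"
proof -
  have lin: "linear (\<lambda>a. lmul a v)"
    unfolding lmul_def
    by (rule linearI) (simp_all add: distrib_left scaleR_add_left axis_add sum.distrib axis_scaleR scaleR_sum_right mult_ac
        flip: scaleR_scaleR)
  show "lmul (\<Sum>i\<in>S. f i) v = (\<Sum>i\<in>S. lmul (f i) v)" "lmul (a + b) v = lmul a v + lmul b v"
    "lmul (r *\<^sub>R a) v = r *\<^sub>R lmul a v"
    by (rule linear_sum [OF lin], rule linear_add [OF lin], rule linear_scale [OF lin])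
qed

lemma lmul_cbasis_axis:
  fixes u :: "'v::real_vector" and B :: "'n::{finite,linorder} set"
  shows "lmul (cbasis A) (axis B u) = reord_sign A B *\<^sub>R axis (sym_diff A B) u"
proof -
  have zero: "axis X 0 = (0 :: 'v ^ 'n set)" for X
    by (simp add: vec_eq_iff axis_def)
  have nth: "axis B u $ B' = (if B' = B then u else 0)" for B'
    by (simp add: axis_def)
  have "axis (sym_diff A' B') ((reord_sign A' B' * coeff (cbasis A) A') *\<^sub>R (axis B u $ B')) =
      (if A' = A then (if B' = B then reord_sign A B *\<^sub>R axis (sym_diff A B) u else 0) else 0)" for A' B'
    unfolding nth coeff_cbasis by (cases "A' = A"; cases "B' = B") (simp_all only: if_True if_False mult_zero_right
        mult_1_right scaleR_zero_left scaleR_zero_right zero axis_scaleR refl)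
  then have "lmul (cbasis A) (axis B u) =
      (\<Sum>A'\<in>UNIV. \<Sum>B'\<in>UNIV. if A' = A then (if B' = B then reord_sign A B *\<^sub>R axis (sym_diff A B) u else 0) else 0)"
    unfolding lmul_def by simp
  also have "\<dots> = (\<Sum>A'\<in>UNIV. if A' = A then reord_sign A B *\<^sub>R axis (sym_diff A B) u else 0)"
    by (rule sum.cong [OF refl]) simp
  finally show ?thesis by simp
qed

lemma lmul_one: "lmul 1 v = v"
proof -
  have "lmul (cbasis {}) (axis B (v $ B)) = axis B (v $ B)" for B
    by (simp add: lmul_cbasis_axis)
  then have "lmul (cbasis {}) (\<Sum>B\<in>UNIV. axis B (v $ B)) = (\<Sum>B\<in>UNIV. axis B (v $ B))"
    by (simp add: linear_sum [OF linear_lmul])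
  then show ?thesis
    by (simp add: cbasis_empty flip: vec_eq_sum_axis)
qed

text \<open>By linearity the claim reduces to basis elements acting on \<open>axis C u\<close>,
  where it is the cocycle identity of the signs, contained in the two multiplicativity rules of
  \<open>reord_sign\<close>.\<close>

lemma lmul_lmul:
  fixes v :: "'v::real_vector ^ 'n::{finite,linorder} set"
  shows "lmul a (lmul b v) = lmul (a * b) v"
proof -
  have basis_axis: "lmul (cbasis A) (lmul (cbasis B) (axis C u)) = lmul (cbasis A * cbasis B) (axis C u)" for A B C and u :: 'v
  proof -
    have sd: "sym_diff A (sym_diff B C) = sym_diff (sym_diff A B) C"
      by blast
    show ?thesis
      unfolding cbasis_mult lmul_scaleR_left lmul_cbasis_axis linear_scale [OF linear_lmul] scaleR_scaleR
        reord_sign_sym_diff_left reord_sign_sym_diff_right sd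
      by (simp only: mult_ac)
  qed
  have basis: "lmul (cbasis A) (lmul (cbasis B) v) = lmul (cbasis A * cbasis B) v" for A B
    by (subst (1 2) vec_eq_sum_axis [of v]) (simp only: linear_sum [OF linear_lmul] basis_axis)
  have "lmul a (lmul b v) = (\<Sum>B\<in>UNIV. \<Sum>A\<in>UNIV. (coeff b B * coeff a A) *\<^sub>R lmul (cbasis A) (lmul (cbasis B) v))"
    by (subst (1) clifford_expansion [of a], subst (1) clifford_expansion [of b])
      (simp only: lmul_sum_left lmul_scaleR_left linear_sum [OF linear_lmul] linear_scale [OF linear_lmul]
        scaleR_sum_right scaleR_scaleR)
  also have "\<dots> = (\<Sum>A\<in>UNIV. \<Sum>B\<in>UNIV. (coeff a A * coeff b B) *\<^sub>R lmul (cbasis A) (lmul (cbasis B) v))"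
    by (subst sum.swap) (simp only: mult.commute)
  also have "\<dots> = lmul (\<Sum>A\<in>UNIV. \<Sum>B\<in>UNIV. (coeff a A * coeff b B) *\<^sub>R (cbasis A * cbasis B)) v"
    by (simp only: basis lmul_sum_left lmul_scaleR_left)
  also have "(\<Sum>A\<in>UNIV. \<Sum>B\<in>UNIV. (coeff a A * coeff b B) *\<^sub>R (cbasis A * cbasis B)) =
      (\<Sum>A\<in>UNIV. coeff a A *\<^sub>R cbasis A) * (\<Sum>B\<in>UNIV. coeff b B *\<^sub>R cbasis B)"
    by (simp add: sum_product mult.commute)
  also have "\<dots> = a * b"
    by (simp flip: clifford_expansion)
  finally show ?thesis .
qed

lemma lmul_of_real: "lmul (of_real r) v = r *\<^sub>R v"
  by (simp add: of_real_def lmul_scaleR_left lmul_one)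

lemma lmul_embed: "lmul (embed J z) v = Re z *\<^sub>R v + Im z *\<^sub>R lmul J v"
  by (simp add: embed_eq lmul_add_left lmul_of_real lmul_scaleR_left)

text \<open>Real scalars are a case of right multiplication; thereby right linearity of an operator
  yields its real homogeneity.\<close>

lemma rmul_of_real:
  fixes v :: "'v::real_vector ^ 'n::{finite,linorder} set"
  shows "rmul v (of_real r) = r *\<^sub>R v"
proof -
  have "rmul v (of_real r) = (\<Sum>A\<in>UNIV. \<Sum>B\<in>(UNIV :: 'n set set). if B = {} then axis A (r *\<^sub>R (v $ A)) else 0)"
    unfolding rmul_def
    by (rule sum.cong [OF refl], rule sum.cong [OF refl]) (auto simp: coeff_of_real vec_eq_iff axis_def)
  also have "\<dots> = (\<Sum>A\<in>UNIV. r *\<^sub>R axis A (v $ A))"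
    by (simp add: axis_scaleR)
  also have "\<dots> = r *\<^sub>R v"
    by (simp only: scaleR_sum_right [symmetric] vec_eq_sum_axis [symmetric])
  finally show ?thesis .
qed

section \<open>Operators at a point of the S-resolvent set\<close>

lemma bounded_inverse_eq:
  assumes "is_bounded_inverse P A"
  shows "bounded_inverse P = A"
  unfolding bounded_inverse_def
proof (rule the_equality [where P = "is_bounded_inverse P", OF assms])
  fix B assume "is_bounded_inverse P B"
  then have "blinfun_apply B w = blinfun_apply A w" for w
    using assms unfolding is_bounded_inverse_def by blast
  then show "B = A"
    by (rule blinfun_eqI)
qed

text \<open>\<open>A\<close> is the inverse of Q_s[T]; the maps \<open>TA\<close> and
  \<open>TTA\<close> introduced below are T A and T^2 A, defined everywhere because \<open>A\<close>
  maps into the domain of T^2.\<close>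

locale closed_operator_at =
  fixes T :: "'v::banach ^ 'n::{finite,linorder} set \<rightharpoonup> 'v ^ 'n set" and s :: "'n clifford"
    and A :: "('v ^ 'n set) \<Rightarrow>\<^sub>L ('v ^ 'n set)"
  assumes T: "T \<in> closed_right_linear" and inv: "is_bounded_inverse (Q_op s T) A"
begin

lemma T_add: "T u = Some x \<Longrightarrow> T v = Some y \<Longrightarrow> T (u + v) = Some (x + y)"
  using T by (simp add: closed_right_linear_def)

lemma T_scaleR: "T v = Some x \<Longrightarrow> T (r *\<^sub>R v) = Some (r *\<^sub>R x)"
proof -
  assume "T v = Some x"
  then have "T (rmul v (of_real r)) = Some (rmul x (of_real r))"
    using T by (simp add: closed_right_linear_def)
  then show ?thesis by (simp add: rmul_of_real)
qed

lemma T_diff: "T u = Some x \<Longrightarrow> T v = Some y \<Longrightarrow> T (u - v) = Some (x - y)"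
  using T_add [of u x "(- 1) *\<^sub>R v" "(- 1) *\<^sub>R y"] T_scaleR [of v y "- 1"] by simp

lemma closed_T: "closed {(v, x). T v = Some x}"
  using T by (simp add: closed_right_linear_def)

definition TA :: "'v ^ 'n set \<Rightarrow> 'v ^ 'n set" where "TA w = the (T (A w))"

definition TTA :: "'v ^ 'n set \<Rightarrow> 'v ^ 'n set" where "TTA w = the (T (TA w))"

lemma T_A: "T (A w) = Some (TA w)"
  and T_TA: "T (TA w) = Some (TTA w)"
  and Q_A: "TTA w - (2 * coeff s {}) *\<^sub>R TA w + (norm s)\<^sup>2 *\<^sub>R A w = w"
proof -
  have "Q_op s T (A w) = Some w"
    using inv by (simp add: is_bounded_inverse_def)
  then have dom: "A w \<in> dom (T \<circ>\<^sub>m T)"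
    and eq: "the ((T \<circ>\<^sub>m T) (A w)) - (2 * coeff s {}) *\<^sub>R the (T (A w)) + (norm s)\<^sup>2 *\<^sub>R A w = w"
    by (auto simp: Q_op_def split: if_splits)
  then obtain y z where "T (A w) = Some y" "T y = Some z"
    by (auto simp: map_comp_def split: option.splits)
  then show "T (A w) = Some (TA w)" "T (TA w) = Some (TTA w)"
    "TTA w - (2 * coeff s {}) *\<^sub>R TA w + (norm s)\<^sup>2 *\<^sub>R A w = w"
    using eq by (simp_all add: TA_def TTA_def map_comp_def)
qed

lemma linear_TA: "linear TA"
proof (rule linearI)
  show "TA (u + v) = TA u + TA v" for u v
    using T_add [OF T_A T_A, of u v] T_A [of "u + v"] by (simp add: blinfun.add_right)
  show "TA (r *\<^sub>R v) = r *\<^sub>R TA v" for r v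
    using T_scaleR [OF T_A, of r v] T_A [of "r *\<^sub>R v"] by (simp add: blinfun.scaleR_right)
qed

text \<open>Its graph is the preimage of the closed graph of \<open>T\<close> under the continuous
  map from (x, y) to (A x, y), so the closed graph theorem applies.\<close>

lemma bounded_linear_TA: "bounded_linear TA"
proof (rule closed_graph [OF linear_TA])
  have "{(x, y). TA x = y} = (\<lambda>p. (A (fst p), snd p)) -` {(v, x). T v = Some x}"
    using T_A by auto
  moreover have "closed ((\<lambda>p. (A (fst p), snd p)) -` {(v, x). T v = Some x})"
    by (rule closed_vimage [OF closed_T]) (intro continuous_intros)
  ultimately show "closed {(x, y). TA x = y}"
    by (simp only:)
qed

text \<open>\<open>T\<close> commutes with the inverse of Q_s[T] on its domain. Indeed T^2 A v is a
  combination of v, T A v and A v, which all lie in the domain of \<open>T\<close>; hence T A v is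
  in the domain of T^2, and Q_s[T] maps it to T v.\<close>

lemma commute:
  assumes v: "T v = Some x"
  shows "TA v = A x" and "TA x = TTA v"
proof -
  have "TTA v = v + (2 * coeff s {}) *\<^sub>R TA v - (norm s)\<^sup>2 *\<^sub>R A v"
    using Q_A [of v] by (simp add: algebra_simps)
  then have T_TTA: "T (TTA v) = Some (x + (2 * coeff s {}) *\<^sub>R TTA v - (norm s)\<^sup>2 *\<^sub>R TA v)"
    using T_diff [OF T_add [OF v T_scaleR [OF T_TA]] T_scaleR [OF T_A], of "2 * coeff s {}" v "(norm s)\<^sup>2" v] by simp
  then have "Q_op s T (TA v) = Some x"
    using T_TA [of v] by (auto simp: Q_op_def map_comp_def dom_def)
  then show "TA v = A x"
    using inv by (simp add: is_bounded_inverse_def)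
  then show "TA x = TTA v"
    using T_A [of x] T_TA [of v] by simp
qed

end

definition resolvent_Q :: "'n::{finite,linorder} clifford \<Rightarrow> ('v::banach ^ 'n set \<rightharpoonup> 'v ^ 'n set) \<Rightarrow> complex \<Rightarrow>
    ('v ^ 'n set) \<Rightarrow>\<^sub>L ('v ^ 'n set)" where
  "resolvent_Q J T z = bounded_inverse (Q_op (embed J z) T)"

definition resolvent_TQ :: "'n::{finite,linorder} clifford \<Rightarrow> ('v::banach ^ 'n set \<rightharpoonup> 'v ^ 'n set) \<Rightarrow> complex \<Rightarrow>
    ('v ^ 'n set) \<Rightarrow>\<^sub>L ('v ^ 'n set)" where
  "resolvent_TQ J T z = Blinfun (\<lambda>v. the (T (resolvent_Q J T z v)))"

text \<open>On the complexification, \<open>(z - T)\<inverse> = (cnj z - T) Q_z[T]\<inverse> = R0 + \<i> R1\<close>.\<close>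

definition resolvent_R0 :: "'n::{finite,linorder} clifford \<Rightarrow> ('v::banach ^ 'n set \<rightharpoonup> 'v ^ 'n set) \<Rightarrow> complex \<Rightarrow>
    ('v ^ 'n set) \<Rightarrow>\<^sub>L ('v ^ 'n set)" where
  "resolvent_R0 J T z = Re z *\<^sub>R resolvent_Q J T z - resolvent_TQ J T z"

definition resolvent_R1 :: "'n::{finite,linorder} clifford \<Rightarrow> ('v::banach ^ 'n set \<rightharpoonup> 'v ^ 'n set) \<Rightarrow> complex \<Rightarrow>
    ('v ^ 'n set) \<Rightarrow>\<^sub>L ('v ^ 'n set)" where
  "resolvent_R1 J T z = - Im z *\<^sub>R resolvent_Q J T z"

locale resolvent_point =
  fixes T :: "'v::banach ^ 'n::{finite,linorder} set \<rightharpoonup> 'v ^ 'n set" and J :: "'n clifford" and z :: complex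
  assumes T: "T \<in> closed_right_linear" and J: "J \<in> imag_sphere" and z: "embed J z \<in> S_resolvent_set T"
begin

abbreviation "A \<equiv> resolvent_Q J T z"
abbreviation "R0 \<equiv> resolvent_R0 J T z"
abbreviation "R1 \<equiv> resolvent_R1 J T z"

lemma is_inverse: "is_bounded_inverse (Q_op (embed J z) T) A"
proof -
  obtain A where "is_bounded_inverse (Q_op (embed J z) T) A"
    using z by (auto simp: S_resolvent_set_def)
  then show ?thesis
    unfolding resolvent_Q_def by (simp add: bounded_inverse_eq)
qed

sublocale closed_operator_at T "embed J z" A
  by standard (rule T, rule is_inverse)

lemma resolvent_TQ_apply: "blinfun_apply (resolvent_TQ J T z) v = TA v"
  using bounded_linear_TA unfolding resolvent_TQ_def TA_def [abs_def]
  by (simp add: bounded_linear_Blinfun_apply)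

lemma R_apply: "blinfun_apply R0 v = Re z *\<^sub>R A v - TA v" "blinfun_apply R1 v = - Im z *\<^sub>R A v"
  by (simp_all add: resolvent_R0_def resolvent_R1_def blinfun.diff_left blinfun.scaleR_left blinfun.minus_left resolvent_TQ_apply)

lemma Q_A': "TTA v - (2 * Re z) *\<^sub>R TA v + ((Re z)\<^sup>2 + (Im z)\<^sup>2) *\<^sub>R A v = v"
  using Q_A [of v] by (simp add: coeff_embed [OF J] norm_embed [OF J] cmod_power2)

text \<open>Real and imaginary part of (z - T)^-1 (z - T) v = v on the complexification.\<close>

lemma left_inverse:
  assumes v: "T v = Some x"
  shows "R0 (Re z *\<^sub>R v - x) - R1 (Im z *\<^sub>R v) = v" "R1 (Re z *\<^sub>R v - x) + R0 (Im z *\<^sub>R v) = 0"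
proof -
  have c: "A x = TA v" "TA x = TTA v"
    using commute [OF v] by simp_all
  have TTA: "TTA v = v + (Re z *\<^sub>R TA v + Re z *\<^sub>R TA v) - ((Re z)\<^sup>2 + (Im z)\<^sup>2) *\<^sub>R A v"
    using Q_A' [of v, unfolded mult_2 scaleR_add_left] by (simp add: algebra_simps)
  show "R0 (Re z *\<^sub>R v - x) - R1 (Im z *\<^sub>R v) = v" "R1 (Re z *\<^sub>R v - x) + R0 (Im z *\<^sub>R v) = 0"
    unfolding R_apply blinfun.diff_right blinfun.scaleR_right linear_diff [OF linear_TA] linear_scale [OF linear_TA] c TTA
    by (simp_all add: algebra_simps power2_eq_square)
qed

text \<open>Real and imaginary part of T (z - T)^-1 v = z (z - T)^-1 v - v on the
  complexification.\<close>

lemma right_inverse: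
  "T (R0 v) = Some (Re z *\<^sub>R R0 v - Im z *\<^sub>R R1 v - v)" "T (R1 v) = Some (Im z *\<^sub>R R0 v + Re z *\<^sub>R R1 v)"
proof -
  have TTA: "TTA v = v + (Re z *\<^sub>R TA v + Re z *\<^sub>R TA v) - ((Re z)\<^sup>2 + (Im z)\<^sup>2) *\<^sub>R A v"
    using Q_A' [of v, unfolded mult_2 scaleR_add_left] by (simp add: algebra_simps)
  show "T (R0 v) = Some (Re z *\<^sub>R R0 v - Im z *\<^sub>R R1 v - v)"
    using T_diff [OF T_scaleR [OF T_A] T_TA, of "Re z" v v] unfolding R_apply TTA
    by (simp add: algebra_simps power2_eq_square)
  show "T (R1 v) = Some (Im z *\<^sub>R R0 v + Re z *\<^sub>R R1 v)"
    using T_scaleR [OF T_A, of "- Im z" v] unfolding R_apply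
    by (simp add: algebra_simps)
qed

text \<open>For z = x + i y, Q^-1 (x - J y) - T Q^-1 regroups as (x Q^-1 - T Q^-1) - y Q^-1 J, with
  multiplication by J kept to the right of Q^-1.\<close>

lemma S_L_inv_eq: "S_L_inv (embed J z) T = R0 + (R1 o\<^sub>L lmul_op J)"
proof -
  have "blinfun_apply (bounded_inverse (Q_op (embed J z) T)) (lmul (pconj (embed J z)) v) -
      the (T (blinfun_apply (bounded_inverse (Q_op (embed J z) T)) v)) = blinfun_apply (R0 + (R1 o\<^sub>L lmul_op J)) v" for v
    unfolding resolvent_Q_def [symmetric] TA_def [symmetric] pconj_embed [OF J] lmul_embed
    by (simp add: blinfun.add_left R_apply lmul_op.rep_eq blinfun.add_right blinfun.diff_right blinfun.scaleR_right blinfun.minus_right)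
  then show ?thesis
    unfolding S_L_inv_def by (simp add: blinfun_apply_inverse)
qed

end

section \<open>The resolvent family of a bisectorial operator\<close>

text \<open>The usual computation with (z - T)^-1 ((z - T) - (w - T)) (w - T)^-1: the left inverse
  at z is applied to the vectors produced at w, on which \<open>T\<close> is known from the right
  inverse.\<close>

lemma resolvent_identity:
  assumes z: "resolvent_point T J z" and w: "resolvent_point T J w"
  shows "Re (w - z) *\<^sub>R ((resolvent_R0 J T z o\<^sub>L resolvent_R0 J T w) - (resolvent_R1 J T z o\<^sub>L resolvent_R1 J T w)) -
      Im (w - z) *\<^sub>R ((resolvent_R0 J T z o\<^sub>L resolvent_R1 J T w) + (resolvent_R1 J T z o\<^sub>L resolvent_R0 J T w)) =
      resolvent_R0 J T z - resolvent_R0 J T w"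
    and "Re (w - z) *\<^sub>R ((resolvent_R0 J T z o\<^sub>L resolvent_R1 J T w) + (resolvent_R1 J T z o\<^sub>L resolvent_R0 J T w)) +
      Im (w - z) *\<^sub>R ((resolvent_R0 J T z o\<^sub>L resolvent_R0 J T w) - (resolvent_R1 J T z o\<^sub>L resolvent_R1 J T w)) =
      resolvent_R1 J T z - resolvent_R1 J T w"
proof -
  interpret z: resolvent_point T J z by (rule z)
  interpret w: resolvent_point T J w by (rule w)
  note bl = blinfun.add_left blinfun.diff_left blinfun.scaleR_left blinfun.add_right blinfun.diff_right blinfun.scaleR_right
  note left0 = z.left_inverse [OF w.right_inverse(1)] and left1 = z.left_inverse [OF w.right_inverse(2)]
  show "Re (w - z) *\<^sub>R ((resolvent_R0 J T z o\<^sub>L resolvent_R0 J T w) - (resolvent_R1 J T z o\<^sub>L resolvent_R1 J T w)) -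
      Im (w - z) *\<^sub>R ((resolvent_R0 J T z o\<^sub>L resolvent_R1 J T w) + (resolvent_R1 J T z o\<^sub>L resolvent_R0 J T w)) =
      resolvent_R0 J T z - resolvent_R0 J T w"
  proof (rule blinfun_eqI)
    fix v
    have "z.R0 (Re z *\<^sub>R w.R0 v - (Re w *\<^sub>R w.R0 v - Im w *\<^sub>R w.R1 v - v)) - z.R1 (Im z *\<^sub>R w.R0 v) -
        (z.R1 (Re z *\<^sub>R w.R1 v - (Im w *\<^sub>R w.R0 v + Re w *\<^sub>R w.R1 v)) + z.R0 (Im z *\<^sub>R w.R1 v)) = w.R0 v - 0"
      unfolding left0(1) left1(2) ..
    then show "blinfun_apply (Re (w - z) *\<^sub>R ((z.R0 o\<^sub>L w.R0) - (z.R1 o\<^sub>L w.R1)) - Im (w - z) *\<^sub>R ((z.R0 o\<^sub>L w.R1) + (z.R1 o\<^sub>L w.R0))) v =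
        blinfun_apply (z.R0 - w.R0) v"
      by (simp add: bl algebra_simps)
  qed
  show "Re (w - z) *\<^sub>R ((resolvent_R0 J T z o\<^sub>L resolvent_R1 J T w) + (resolvent_R1 J T z o\<^sub>L resolvent_R0 J T w)) +
      Im (w - z) *\<^sub>R ((resolvent_R0 J T z o\<^sub>L resolvent_R0 J T w) - (resolvent_R1 J T z o\<^sub>L resolvent_R1 J T w)) =
      resolvent_R1 J T z - resolvent_R1 J T w"
  proof (rule blinfun_eqI)
    fix v
    have "z.R1 (Re z *\<^sub>R w.R0 v - (Re w *\<^sub>R w.R0 v - Im w *\<^sub>R w.R1 v - v)) + z.R0 (Im z *\<^sub>R w.R0 v) +
        (z.R0 (Re z *\<^sub>R w.R1 v - (Im w *\<^sub>R w.R0 v + Re w *\<^sub>R w.R1 v)) - z.R1 (Im z *\<^sub>R w.R1 v)) = 0 + w.R1 v"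
      unfolding left0(2) left1(1) ..
    then show "blinfun_apply (Re (w - z) *\<^sub>R ((z.R0 o\<^sub>L w.R1) + (z.R1 o\<^sub>L w.R0)) + Im (w - z) *\<^sub>R ((z.R0 o\<^sub>L w.R0) - (z.R1 o\<^sub>L w.R1))) v =
        blinfun_apply (z.R1 - w.R1) v"
      by (simp add: bl algebra_simps)
  qed
qed

lemma Q_op_cnj: "J \<in> imag_sphere \<Longrightarrow> Q_op (embed J (cnj z)) T = Q_op (embed J z) T"
  by (simp add: Q_op_def fun_eq_iff coeff_embed norm_embed)

lemma resolvent_R_cnj:
  assumes "J \<in> imag_sphere"
  shows "resolvent_R0 J T (cnj z) = resolvent_R0 J T z" "resolvent_R1 J T (cnj z) = - resolvent_R1 J T z"
  using assms by (simp_all add: resolvent_R0_def resolvent_R1_def resolvent_TQ_def resolvent_Q_def Q_op_cnj)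

lemma closure_double_sector_subset:
  assumes "0 < \<omega>" "\<omega> < pi / 2"
  shows "closure (double_sector \<omega> :: 'n::{finite,linorder} clifford set) \<subseteq> {s. cos \<omega> * norm s \<le> \<bar>coeff s {}\<bar>}"
proof (rule closure_minimal)
  show "(double_sector \<omega> :: 'n clifford set) \<subseteq> {s. cos \<omega> * norm s \<le> \<bar>coeff s {}\<bar>}"
  proof
    fix s :: "'n clifford" assume "s \<in> double_sector \<omega>"
    then obtain J z where "J \<in> imag_sphere" "z \<in> double_sector_complex \<omega>" "s = embed J z"
      using double_sector_cases assms by blast
    then show "s \<in> {s. cos \<omega> * norm s \<le> \<bar>coeff s {}\<bar>}"
      by (simp add: norm_embed coeff_embed double_sector_complex_def)
  qed
  have "continuous_on UNIV (\<lambda>s :: 'n clifford. coeff s {})"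
    by (rule linear_continuous_on [OF bounded_linear_coeff])
  then show "closed {s :: 'n clifford. cos \<omega> * norm s \<le> \<bar>coeff s {}\<bar>}"
    by (intro closed_Collect_le continuous_intros)
qed

text \<open>The angle \<phi>1 strictly between \<omega> and \<phi> leaves room on both sides:
  outside its closed double sector there is no spectrum and the estimate is uniform, while contours
  of angle \<phi> stay in that region. The hypothesis bounds only the combination R0 + R1 J, so it
  is used at z and at its conjugate, whose sum and difference are 2 R0 and 2 R1 J.\<close>

lemma bisectorial_resolvent_family:
  fixes T :: "'v::banach ^ 'n::{finite,linorder} set \<rightharpoonup> 'v ^ 'n set"
  assumes T: "bisectorial \<omega> T" and \<omega>: "0 < \<omega>" "\<omega> < \<phi>" "\<phi> < pi / 2" and J: "J \<in> imag_sphere"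
  obtains c M where "cos \<phi> < c" "resolvent_family (resolvent_R0 J T) (resolvent_R1 J T) c M"
    "\<And>z. \<bar>Re z\<bar> < c * norm z \<Longrightarrow> resolvent_point T J z"
proof -
  define \<phi>1 where "\<phi>1 = (\<omega> + \<phi>) / 2"
  have \<phi>1: "\<omega> < \<phi>1" "\<phi>1 < \<phi>" "0 < \<phi>1" "\<phi>1 < pi / 2" using \<omega> by (simp_all add: \<phi>1_def)
  define c where "c = cos \<phi>1"
  have c: "cos \<phi> < c" "c < cos \<omega>" "0 < c"
    using \<omega> \<phi>1 by (auto simp: c_def intro!: cos_monotone_0_pi cos_gt_zero)
  have closed: "T \<in> closed_right_linear" using T by (simp add: bisectorial_def)
  obtain C where C: "C \<ge> 0" "\<And>s. s \<in> paravectors - (double_sector \<phi>1 \<union> {0}) \<Longrightarrow> norm (S_L_inv s T) \<le> C / norm s"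
  proof -
    have "\<forall>\<phi>\<in>{\<omega> <..< pi / 2}. \<exists>C\<ge>0. \<forall>s\<in>paravectors - (double_sector \<phi> \<union> {0}). norm (S_L_inv s T) \<le> C / norm s"
      using T unfolding bisectorial_def by (elim conjE)
    moreover have "\<phi>1 \<in> {\<omega> <..< pi / 2}" using \<phi>1 by simp
    ultimately obtain C where "C \<ge> 0" "\<forall>s\<in>paravectors - (double_sector \<phi>1 \<union> {0}). norm (S_L_inv s T) \<le> C / norm s"
      by (elim ballE [where x = \<phi>1] exE conjE) (rule that, auto)
    then show ?thesis using that by blast
  qed
  have point: "resolvent_point T J z" if z: "\<bar>Re z\<bar> < c * norm z" for z
  proof
    have "z \<noteq> 0" using z by auto
    then have "c * norm z < cos \<omega> * norm z" using c by simp
    then have "\<not> cos \<omega> * norm (embed J z) \<le> \<bar>coeff (embed J z) {}\<bar>"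
      using z by (simp add: norm_embed [OF J] coeff_embed [OF J])
    then have "embed J z \<notin> closure (double_sector \<omega>)"
      using closure_double_sector_subset [of \<omega>] \<omega> by auto
    then show "embed J z \<in> S_resolvent_set T"
      using T embed_paravector [OF J, of z] unfolding bisectorial_def S_spectrum_def by blast
  qed (rule closed, rule J)
  define m where "m = norm (lmul_op J :: ('v ^ 'n set) \<Rightarrow>\<^sub>L ('v ^ 'n set))"
  define M where "M = C * (1 + m)"
  have m: "0 \<le> m" by (simp add: m_def)
  have bounds: "norm (resolvent_R0 J T z) * norm z \<le> M" "norm (resolvent_R1 J T z) * norm z \<le> M"
    if z: "\<bar>Re z\<bar> < c * norm z" for z
  proof -
    interpret z: resolvent_point T J z by (rule point [OF z])
    interpret zc: resolvent_point T J "cnj z" by (rule point) (use z in simp)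
    have nz: "norm z > 0" using z by (cases "z = 0") auto
    have norm_S: "norm (S_L_inv (embed J u) T) \<le> C / norm z" if "norm u = norm z" "\<bar>Re u\<bar> = \<bar>Re z\<bar>" for u
    proof -
      have "u \<notin> double_sector_complex \<phi>1"
        using that z by (simp add: double_sector_complex_def c_def)
      then have "embed J u \<notin> double_sector \<phi>1"
        using double_sector_embed_iff [OF J] \<phi>1 by blast
      moreover have "embed J u \<noteq> 0"
        using norm_embed [OF J, of u] that nz by auto
      ultimately have "norm (S_L_inv (embed J u) T) \<le> C / norm (embed J u)"
        using embed_paravector [OF J] by (intro C(2)) auto
      then show ?thesis using that by (simp add: norm_embed [OF J])
    qed
    have S: "S_L_inv (embed J z) T = z.R0 + (z.R1 o\<^sub>L lmul_op J)"
      "S_L_inv (embed J (cnj z)) T = z.R0 - (z.R1 o\<^sub>L lmul_op J)"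
    proof -
      have "(- z.R1) o\<^sub>L lmul_op J = - (z.R1 o\<^sub>L lmul_op J)"
        by (rule blinfun_eqI) (simp add: blinfun.minus_left)
      then show "S_L_inv (embed J z) T = z.R0 + (z.R1 o\<^sub>L lmul_op J)"
        "S_L_inv (embed J (cnj z)) T = z.R0 - (z.R1 o\<^sub>L lmul_op J)"
        using z.S_L_inv_eq zc.S_L_inv_eq by (simp_all add: resolvent_R_cnj [OF J])
    qed
    have S_le: "norm (S_L_inv (embed J z) T) \<le> C / norm z" "norm (S_L_inv (embed J (cnj z)) T) \<le> C / norm z"
      by (intro norm_S; simp)+
    have "2 *\<^sub>R z.R0 = S_L_inv (embed J z) T + S_L_inv (embed J (cnj z)) T"
      unfolding S by (simp add: scaleR_2)
    then have "norm (2 *\<^sub>R z.R0) \<le> C / norm z + C / norm z"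
      using add_mono [OF S_le] by (simp only: norm_triangle_le)
    then have "2 * norm z.R0 \<le> C / norm z + C / norm z" by simp
    then have R0: "norm z.R0 * norm z \<le> C"
      using nz by (simp add: field_simps)
    also have "C \<le> M" using C(1) m by (simp add: M_def algebra_simps)
    finally show "norm z.R0 * norm z \<le> M" .
    have "2 *\<^sub>R (z.R1 o\<^sub>L lmul_op J) = S_L_inv (embed J z) T - S_L_inv (embed J (cnj z)) T"
      unfolding S by (simp add: scaleR_2)
    then have "norm (2 *\<^sub>R (z.R1 o\<^sub>L lmul_op J)) \<le> C / norm z + C / norm z"
      using add_mono [OF S_le] by (simp only: norm_triangle_le_diff)
    then have "2 * norm (z.R1 o\<^sub>L lmul_op J) \<le> C / norm z + C / norm z" by simp
    then have R1J: "norm (z.R1 o\<^sub>L lmul_op J) * norm z \<le> C"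
      using nz by (simp add: field_simps)
    \<comment> \<open>Composition with -J undoes the factor J because J^2 = -1; the operator norm
      \<open>m\<close> of left multiplication by J thereby enters the constant.\<close>
    have "z.R1 = - ((z.R1 o\<^sub>L lmul_op J) o\<^sub>L lmul_op J)"
    proof (rule blinfun_eqI)
      fix v :: "'v ^ 'n set"
      have "lmul J (lmul J v) = - v"
        using lmul_of_real [of "- 1" v] by (simp add: lmul_lmul imag_sphere_square [OF J])
      then show "z.R1 v = blinfun_apply (- ((z.R1 o\<^sub>L lmul_op J) o\<^sub>L lmul_op J)) v"
        by (simp add: lmul_op.rep_eq blinfun.minus_left blinfun.minus_right)
    qed
    then have "norm z.R1 = norm ((z.R1 o\<^sub>L lmul_op J) o\<^sub>L lmul_op J)"
      by (metis norm_minus_cancel)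
    also have "\<dots> \<le> norm (z.R1 o\<^sub>L lmul_op J) * m"
      unfolding m_def by (rule norm_blinfun_compose)
    finally have "norm z.R1 * norm z \<le> norm (z.R1 o\<^sub>L lmul_op J) * m * norm z"
      by (rule mult_right_mono) simp
    also have "\<dots> = (norm (z.R1 o\<^sub>L lmul_op J) * norm z) * m"
      by simp
    also have "\<dots> \<le> C * m"
      by (rule mult_right_mono [OF R1J m])
    also have "\<dots> \<le> M" using C(1) by (simp add: M_def algebra_simps)
    finally show "norm z.R1 * norm z \<le> M" .
  qed
  have "resolvent_family (resolvent_R0 J T) (resolvent_R1 J T) c M"
  proof
    show "0 < c" by (rule c)
  qed (rule resolvent_identity bounds resolvent_R_cnj J point | assumption)+
  then show ?thesis using that c(1) point by blast
qed

text \<open>At s = J the scalar part is 0 and the norm is 1, so Q_s[T] is 1 + T^2.\<close>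

lemma bounded_inverse_one_plus_square:
  assumes J: "J \<in> imag_sphere"
  shows "bounded_inverse (one_plus_square T) = - resolvent_R1 J T \<i>"
proof -
  have "Q_op J T = one_plus_square T"
  proof
    fix v
    show "Q_op J T v = one_plus_square T v"
      using J by (cases "(T \<circ>\<^sub>m T) v") (auto simp: Q_op_def one_plus_square_def imag_sphere_def dom_def add.commute)
  qed
  then show ?thesis
    by (simp add: resolvent_R1_def resolvent_Q_def embed_ii)
qed

section \<open>Extended calculus and product rule\<close>

lemma contour_embed: "contour \<sigma> \<phi> J t = embed J (contour_pt \<sigma> \<phi> t)"
  unfolding contour_def contour_pt_def slice_exp_embed ..

text \<open>On either side of 0 the contour is linear in t with constant factor \<open>k\<close>,
  and 1 / J is the image of 1 / i because the inverse can be computed in the slice.\<close>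

lemma contour_derivative:
  assumes J: "J \<in> imag_sphere" and t: "t \<noteq> 0"
  shows "vector_derivative (contour \<sigma> \<phi> J) (at t) / J = embed J (contour_weight \<sigma> \<phi> t)"
proof -
  define k where "k = (\<sigma> * sgn t) *\<^sub>R slice_exp J (- sgn t * \<phi>)"
  have "(contour \<sigma> \<phi> J has_vector_derivative k) (at t)"
  proof (rule has_vector_derivative_transform_within_open)
    show "((\<lambda>u. u *\<^sub>R k) has_vector_derivative k) (at t)"
      by (auto intro!: derivative_eq_intros)
    show "open {u. 0 < sgn t * u}"
      by (intro open_Collect_less continuous_intros)
    show "t \<in> {u. 0 < sgn t * u}"
      using t by (simp add: sgn_if)
    show "u *\<^sub>R k = contour \<sigma> \<phi> J u" if "u \<in> {u. 0 < sgn t * u}" for u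
    proof -
      have "sgn u = sgn t" "\<bar>u\<bar> = u * sgn t"
        using that by (auto simp: sgn_if split: if_splits)
      then show ?thesis by (simp add: contour_def k_def mult_ac)
    qed
  qed
  then have "vector_derivative (contour \<sigma> \<phi> J) (at t) = embed J (of_real (\<sigma> * sgn t) * cis (- sgn t * \<phi>))"
    unfolding k_def slice_exp_embed by (rule vector_derivative_at)
  moreover have "inverse J = embed J (1 / \<i>)"
    using inverse_embed [OF J, of \<i>] by (simp add: embed_ii)
  ultimately show ?thesis
    unfolding divide_clifford_def contour_weight_def by (simp add: mult.commute flip: embed_mult [OF J])
qed

lemma inverse_one_plus_square_embed:
  assumes J: "J \<in> imag_sphere" and z: "1 + z\<^sup>2 \<noteq> 0"
  shows "1 / (1 + (embed J z)\<^sup>2) = embed J (1 / (1 + z\<^sup>2))"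
proof -
  have "1 + (embed J z)\<^sup>2 = embed J (1 + z\<^sup>2)"
    using embed_of_real [of J 1] by (simp add: power2_eq_square embed_add embed_mult [OF J])
  then show ?thesis
    using inverse_embed [OF J z] by (simp add: divide_clifford_def)
qed

lemma embed_scale: "J \<in> imag_sphere \<Longrightarrow> embed J (of_real r * w) = r *\<^sub>R embed J w"
  by (simp add: embed_mult embed_of_real of_real_mult_clifford)

lemma embed_mult_expansion:
  assumes J: "J \<in> imag_sphere"
  shows "embed J w * a = (\<Sum>A\<in>UNIV. embed J (of_real (coeff a A) * w) * cbasis A)"
proof -
  have "embed J w * a = embed J w * (\<Sum>A\<in>UNIV. coeff a A *\<^sub>R cbasis A)"
    by (simp flip: clifford_expansion)
  then show ?thesis
    by (simp add: sum_distrib_left embed_scale [OF J])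
qed

lemma slice_rep_cong:
  assumes "slice_rep \<theta> f F" "\<And>s. s \<in> double_sector \<theta> \<Longrightarrow> f s = g s" "0 < \<theta>" "\<theta> < pi / 2"
  shows "slice_rep \<theta> g F"
  using assms double_sector_embed_iff [OF _ assms(3,4)] unfolding slice_rep_def by metis

text \<open>Along the positive real axis the decaying part tends to 0 at both ends, while 1 / (1 +
  s^2) tends to 0 at infinity and to 1 at 0; so \<open>finf\<close> and \<open>f0\<close> are the
  two limits of \<open>f\<close>. This makes the choice inside \<open>ext_omega_calculus\<close>
  immaterial.\<close>

lemma bnd_decomposition_unique:
  fixes f :: "'n::{finite,linorder} clifford \<Rightarrow> 'n clifford"
  assumes 1: "bnd_decomposition \<theta> f f0 finf ft" and 2: "bnd_decomposition \<theta> f f0' finf' ft'"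
    and \<theta>: "0 < \<theta>" "\<theta> < pi / 2"
  shows "f0 = f0'" "finf = finf'" "\<And>s. s \<in> double_sector \<theta> \<Longrightarrow> ft s = ft' s"
proof -
  obtain J :: "'n clifford" where J: "J \<in> imag_sphere" using imag_sphere_nonempty by blast
  define ray where "ray x = embed J (ray_pt 0 x)" for x
  have dom: "ray_pt 0 x \<in> double_sector_complex \<theta>" for x
    using \<theta> cos_monotone_0_pi [of 0 \<theta>] by (simp add: ray_pt_in_double_sector)
  have lims: "((\<lambda>x. f (ray x)) \<longlongrightarrow> finf) at_top" "((\<lambda>x. f (ray x)) \<longlongrightarrow> f0) at_bot"
    if dec: "bnd_decomposition \<theta> f f0 finf ft" for f0 finf ft
  proof -
    have ft: "ft \<in> SH_L_0 \<theta>" and eq: "\<And>s. s \<in> double_sector \<theta> \<Longrightarrow> f s = finf + 1 / (1 + s\<^sup>2) * (f0 - finf) + ft s"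
      using dec by (auto simp: bnd_decomposition_def)
    obtain F where rep: "slice_rep \<theta> ft F" and F: "\<And>A. F A \<in> symmetric_decaying \<theta>"
      using SH_L_0_rep [OF ft \<theta>] by blast
    have f_eq: "f (ray x) = finf + (1 / (1 + (exp x)\<^sup>2)) *\<^sub>R (f0 - finf) + ft (ray x)" for x
    proof -
      have r: "ray_pt 0 x = of_real (exp x)" by (simp add: ray_pt_eq)
      have "1 / (1 + (ray x)\<^sup>2) = embed J (1 / (1 + (ray_pt 0 x)\<^sup>2))"
        unfolding ray_def by (rule inverse_one_plus_square_embed [OF J one_plus_square_nonzero [OF \<theta> dom]])
      also have "1 / (1 + (ray_pt 0 x)\<^sup>2) = of_real (1 / (1 + (exp x)\<^sup>2))"
        by (simp add: r)
      finally have "1 / (1 + (ray x)\<^sup>2) = of_real (1 / (1 + (exp x)\<^sup>2))"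
        by (simp only: embed_of_real)
      then have "1 / (1 + (ray x)\<^sup>2) * (f0 - finf) = (1 / (1 + (exp x)\<^sup>2)) *\<^sub>R (f0 - finf)"
        by (simp only: of_real_mult_clifford)
      moreover have "ray x \<in> double_sector \<theta>"
        unfolding ray_def using double_sector_embed_iff [OF J \<theta>] dom by blast
      ultimately show ?thesis using eq by simp
    qed
    have ft_lim: "((\<lambda>x. ft (ray x)) \<longlongrightarrow> 0) X"
      if X: "\<And>A. ((\<lambda>x. F A (ray_pt 0 x)) \<longlongrightarrow> 0) X" for X
    proof (rule Lim_null_comparison)
      show "\<forall>\<^sub>F x in X. norm (ft (ray x)) \<le> (\<Sum>A\<in>UNIV. norm (F A (ray_pt 0 x)) * (1 + norm (J * cbasis A)))"
        unfolding ray_def using slice_rep_norm_le [OF rep J dom] by simp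
      show "((\<lambda>x. \<Sum>A\<in>UNIV. norm (F A (ray_pt 0 x)) * (1 + norm (J * cbasis A))) \<longlongrightarrow> 0) X"
        using X by (intro tendsto_null_sum tendsto_mult_left_zero tendsto_norm_zero)
    qed
    have cos: "cos \<theta> < \<bar>cos 0\<bar>" using dom [of 0] by (simp add: ray_pt_in_double_sector)
    have "((\<lambda>x. 1 / (1 + (exp x)\<^sup>2) :: real) \<longlongrightarrow> 0) at_top"
      by real_asymp
    then have "((\<lambda>x. f (ray x)) \<longlongrightarrow> finf + 0 *\<^sub>R (f0 - finf) + 0) at_top"
      unfolding f_eq by (intro tendsto_intros ft_lim symmetric_decaying_tendsto_0 [OF F cos])
    moreover have "((\<lambda>x. 1 / (1 + (exp x)\<^sup>2) :: real) \<longlongrightarrow> 1) at_bot"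
      by real_asymp
    then have "((\<lambda>x. f (ray x)) \<longlongrightarrow> finf + 1 *\<^sub>R (f0 - finf) + 0) at_bot"
      unfolding f_eq by (intro tendsto_intros ft_lim symmetric_decaying_tendsto_0 [OF F cos])
    ultimately show "((\<lambda>x. f (ray x)) \<longlongrightarrow> finf) at_top" "((\<lambda>x. f (ray x)) \<longlongrightarrow> f0) at_bot"
      by simp_all
  qed
  show eq: "f0 = f0'" "finf = finf'"
    using tendsto_unique [OF _ lims(2) [OF 1] lims(2) [OF 2]] tendsto_unique [OF _ lims(1) [OF 1] lims(1) [OF 2]]
    by (simp_all add: trivial_limit_at_bot_linorder trivial_limit_at_top_linorder)
  show "ft s = ft' s" if "s \<in> double_sector \<theta>" for s
    using 1 2 that eq by (simp add: bnd_decomposition_def)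
qed

locale bisectorial_calculus = resolvent_family "resolvent_R0 J T" "resolvent_R1 J T" c M
  for T :: "'v::banach ^ 'n::{finite,linorder} set \<rightharpoonup> 'v ^ 'n set" and J :: "'n clifford" and c M :: real +
  fixes \<phi> \<theta> :: real
  assumes J: "J \<in> imag_sphere" and point: "\<And>z. \<bar>Re z\<bar> < c * norm z \<Longrightarrow> resolvent_point T J z"
    and \<phi>: "0 < \<phi>" "\<phi> < \<theta>" "\<theta> < pi / 2" "cos \<phi> < c"
begin

lemma \<theta>: "0 < \<theta>" "\<theta> < pi / 2"
  using \<phi> by auto

text \<open>With k the weight times the value of \<open>F A\<close>, the relation J^2 = -1 gives (R0
  + R1 J) (Re k + J Im k) = (Re k R0 - Im k R1) + (Re k R1 + Im k R0) J. The remaining J stands to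
  the right of the operators, where a constant factor can be pulled out of the integral.\<close>

lemma omega_integrand:
  assumes rep: "slice_rep \<theta> f F" and \<sigma>: "\<sigma> \<in> {1, - 1}" and t: "t \<noteq> 0"
  shows "S_L_inv (contour \<sigma> \<phi> J t) T o\<^sub>L lmul_op (vector_derivative (contour \<sigma> \<phi> J) (at t) / J)
      o\<^sub>L lmul_op (f (contour \<sigma> \<phi> J t)) =
    (\<Sum>A\<in>UNIV. (integrand_Re (F A) \<phi> \<sigma> t + (integrand_Im (F A) \<phi> \<sigma> t o\<^sub>L lmul_op J)) o\<^sub>L lmul_op (cbasis A))"
proof (rule blinfun_eqI)
  fix v :: "'v ^ 'n set"
  define z where "z = contour_pt \<sigma> \<phi> t"
  define w where "w = contour_weight \<sigma> \<phi> t"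
  have z: "\<bar>Re z\<bar> < c * norm z" "z \<in> double_sector_complex \<theta>"
    using contour_pt_dom [OF \<phi> t \<sigma>] by (simp_all add: z_def resolvent_dom_def)
  interpret z: resolvent_point T J z by (rule point [OF z(1)])
  have f: "f (embed J z) = (\<Sum>A\<in>UNIV. embed J (F A z) * cbasis A)"
    using rep J z(2) by (simp add: slice_rep_def)
  have JJ: "lmul J (lmul J u) = - u" for u :: "'v ^ 'n set"
    using lmul_of_real [of "- 1" u] by (simp add: lmul_lmul imag_sphere_square [OF J])
  have "lmul (embed J w) (lmul (f (embed J z)) v) = (\<Sum>A\<in>UNIV. lmul (embed J (w * F A z)) (lmul (cbasis A) v))"
    unfolding f lmul_sum_left by (simp add: linear_sum [OF linear_lmul] lmul_lmul embed_mult [OF J] mult.assoc)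
  then have "blinfun_apply (S_L_inv (embed J z) T) (lmul (embed J w) (lmul (f (embed J z)) v)) =
      (\<Sum>A\<in>UNIV. blinfun_apply (S_L_inv (embed J z) T) (lmul (embed J (w * F A z)) (lmul (cbasis A) v)))"
    by (simp add: blinfun.sum_right)
  also have "\<dots> = (\<Sum>A\<in>UNIV. blinfun_apply ((integrand_Re (F A) \<phi> \<sigma> t + (integrand_Im (F A) \<phi> \<sigma> t o\<^sub>L lmul_op J)) o\<^sub>L lmul_op (cbasis A)) v)"
  proof (rule sum.cong [OF refl])
    fix A
    define k where "k = w * F A z"
    have int: "integrand_Re (F A) \<phi> \<sigma> t = Re k *\<^sub>R z.R0 - Im k *\<^sub>R z.R1"
      "integrand_Im (F A) \<phi> \<sigma> t = Re k *\<^sub>R z.R1 + Im k *\<^sub>R z.R0"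
      by (simp_all only: integrand_Re_def integrand_Im_def k_def w_def z_def)
    show "blinfun_apply (S_L_inv (embed J z) T) (lmul (embed J (w * F A z)) (lmul (cbasis A) v)) =
        blinfun_apply ((integrand_Re (F A) \<phi> \<sigma> t + (integrand_Im (F A) \<phi> \<sigma> t o\<^sub>L lmul_op J)) o\<^sub>L lmul_op (cbasis A)) v"
      unfolding int k_def [symmetric] z.S_L_inv_eq lmul_embed
      by (simp add: lmul_op.rep_eq linear_add [OF linear_lmul] linear_scale [OF linear_lmul] JJ
          blinfun.add_left blinfun.diff_left blinfun.scaleR_left blinfun.add_right blinfun.scaleR_right
          blinfun.minus_right algebra_simps)
  qed
  finally show "blinfun_apply (S_L_inv (contour \<sigma> \<phi> J t) T o\<^sub>L lmul_op (vector_derivative (contour \<sigma> \<phi> J) (at t) / J)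
      o\<^sub>L lmul_op (f (contour \<sigma> \<phi> J t))) v =
    blinfun_apply (\<Sum>A\<in>UNIV. (integrand_Re (F A) \<phi> \<sigma> t + (integrand_Im (F A) \<phi> \<sigma> t o\<^sub>L lmul_op J)) o\<^sub>L lmul_op (cbasis A)) v"
    by (simp add: contour_derivative [OF J t] contour_embed lmul_op.rep_eq blinfun.sum_left flip: z_def w_def)
qed

text \<open>The terms with J carry \<open>integrand_Im\<close>, whose integral vanishes. The
  integrands are compared for nonzero \<open>t\<close>; the corner of the contour at 0 is a
  negligible set.\<close>

lemma omega_calculus_eq:
  assumes rep: "slice_rep \<theta> f F" and F: "\<And>A. F A \<in> symmetric_decaying \<theta>"
  shows "omega_calculus \<phi> J T f = (\<Sum>A\<in>UNIV. calc \<phi> (F A) o\<^sub>L lmul_op (cbasis A))"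
proof -
  have branch: "integral UNIV (\<lambda>t. S_L_inv (contour \<sigma> \<phi> J t) T
      o\<^sub>L lmul_op (vector_derivative (contour \<sigma> \<phi> J) (at t) / J) o\<^sub>L lmul_op (f (contour \<sigma> \<phi> J t))) =
      (\<Sum>A\<in>UNIV. integral UNIV (integrand_Re (F A) \<phi> \<sigma>) o\<^sub>L lmul_op (cbasis A))" if \<sigma>: "\<sigma> \<in> {1, - 1}" for \<sigma>
  proof (rule integral_unique)
    have comp: "((\<lambda>t. X t o\<^sub>L B) has_integral (I o\<^sub>L B)) UNIV" if "(X has_integral I) UNIV"
      for X :: "real \<Rightarrow> ('v ^ 'n set) \<Rightarrow>\<^sub>L ('v ^ 'n set)" and I B :: "('v ^ 'n set) \<Rightarrow>\<^sub>L ('v ^ 'n set)"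
      using has_integral_linear [OF that bounded_bilinear.bounded_linear_left [OF bounded_bilinear_blinfun_compose]]
      by (simp add: o_def)
    have "((\<lambda>t. (integrand_Re (F A) \<phi> \<sigma> t + (integrand_Im (F A) \<phi> \<sigma> t o\<^sub>L lmul_op J)) o\<^sub>L lmul_op (cbasis A)) has_integral
        ((integral UNIV (integrand_Re (F A) \<phi> \<sigma>) + (0 o\<^sub>L lmul_op J)) o\<^sub>L lmul_op (cbasis A))) UNIV" for A
    proof (intro comp has_integral_add)
      show "(integrand_Re (F A) \<phi> \<sigma> has_integral integral UNIV (integrand_Re (F A) \<phi> \<sigma>)) UNIV"
        by (rule integrable_integral [OF integrands_integrable(1) [OF \<phi> F \<sigma>]])
      show "(integrand_Im (F A) \<phi> \<sigma> has_integral 0) UNIV"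
        using integrable_integral [OF integrands_integrable(2) [OF \<phi> F \<sigma>]] integral_integrand_Im [OF \<phi> F \<sigma>] by simp
    qed
    then have "((\<lambda>t. \<Sum>A\<in>UNIV. (integrand_Re (F A) \<phi> \<sigma> t + (integrand_Im (F A) \<phi> \<sigma> t o\<^sub>L lmul_op J)) o\<^sub>L lmul_op (cbasis A))
        has_integral (\<Sum>A\<in>UNIV. (integral UNIV (integrand_Re (F A) \<phi> \<sigma>) + (0 o\<^sub>L lmul_op J)) o\<^sub>L lmul_op (cbasis A))) UNIV"
      by (intro has_integral_sum) auto
    moreover have "(0 o\<^sub>L lmul_op J) = (0 :: ('v ^ 'n set) \<Rightarrow>\<^sub>L ('v ^ 'n set))"
      by (rule blinfun_eqI) (simp add: blinfun.zero_left)
    ultimately have "((\<lambda>t. \<Sum>A\<in>UNIV. (integrand_Re (F A) \<phi> \<sigma> t + (integrand_Im (F A) \<phi> \<sigma> t o\<^sub>L lmul_op J)) o\<^sub>L lmul_op (cbasis A))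
        has_integral (\<Sum>A\<in>UNIV. integral UNIV (integrand_Re (F A) \<phi> \<sigma>) o\<^sub>L lmul_op (cbasis A))) UNIV"
      by simp
    then show "((\<lambda>t. S_L_inv (contour \<sigma> \<phi> J t) T
        o\<^sub>L lmul_op (vector_derivative (contour \<sigma> \<phi> J) (at t) / J) o\<^sub>L lmul_op (f (contour \<sigma> \<phi> J t)))
        has_integral (\<Sum>A\<in>UNIV. integral UNIV (integrand_Re (F A) \<phi> \<sigma>) o\<^sub>L lmul_op (cbasis A))) UNIV"
      by (rule has_integral_spike [OF negligible_sing [of 0], rotated]) (simp add: omega_integrand [OF rep \<sigma>])
  qed
  show ?thesis
  proof (rule blinfun_eqI)
    fix v
    have "blinfun_apply (omega_calculus \<phi> J T f) v = (1 / (2 * pi)) *\<^sub>R (\<Sum>\<sigma>\<in>{1, - 1}.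
        \<Sum>A\<in>UNIV. blinfun_apply (integral UNIV (integrand_Re (F A) \<phi> \<sigma>)) (lmul (cbasis A) v))"
      unfolding omega_calculus_def by (simp add: branch blinfun.scaleR_left blinfun.add_left blinfun.sum_left lmul_op.rep_eq)
    also have "\<dots> = (\<Sum>A\<in>UNIV. (1 / (2 * pi)) *\<^sub>R (\<Sum>\<sigma>\<in>{1, - 1}.
        blinfun_apply (integral UNIV (integrand_Re (F A) \<phi> \<sigma>)) (lmul (cbasis A) v)))"
      by (subst sum.swap) (simp only: scaleR_sum_right)
    also have "\<dots> = blinfun_apply (\<Sum>A\<in>UNIV. calc \<phi> (F A) o\<^sub>L lmul_op (cbasis A)) v"
      by (simp add: calc_def blinfun.sum_left blinfun.scaleR_left blinfun.add_left lmul_op.rep_eq)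
    finally show "blinfun_apply (omega_calculus \<phi> J T f) v = blinfun_apply (\<Sum>A\<in>UNIV. calc \<phi> (F A) o\<^sub>L lmul_op (cbasis A)) v" .
  qed
qed

lemma ext_omega_calculus_eq:
  assumes dec: "bnd_decomposition \<theta> f f0 finf ft" and rep: "slice_rep \<theta> ft F" and F: "\<And>A. F A \<in> symmetric_decaying \<theta>"
  shows "ext_omega_calculus \<theta> \<phi> J T f = (\<Sum>A\<in>UNIV. ext_calc \<phi> (coeff f0 A) (coeff finf A) (F A) o\<^sub>L lmul_op (cbasis A))"
proof -
  \<comment> \<open>The choice operator yields some decomposition; uniqueness identifies its
    constants with the given ones and its remainder with \<open>ft\<close> on the double sector,
    which is all that \<open>slice_rep\<close> depends on.\<close>
  obtain f0' finf' ft' where choice: "(SOME (f0, finf, ft). bnd_decomposition \<theta> f f0 finf ft) = (f0', finf', ft')"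
    by (metis prod_cases3)
  have dec': "bnd_decomposition \<theta> f f0' finf' ft'"
    using someI [of "\<lambda>(f0, finf, ft). bnd_decomposition \<theta> f f0 finf ft" "(f0, finf, ft)"] dec choice by simp
  note unique = bnd_decomposition_unique [OF dec dec' \<theta>]
  have rep': "slice_rep \<theta> ft' F"
    by (rule slice_rep_cong [OF rep unique(3) \<theta>])
  have "ext_omega_calculus \<theta> \<phi> J T f = lmul_op finf + (bounded_inverse (one_plus_square T) o\<^sub>L lmul_op (f0 - finf)) + omega_calculus \<phi> J T ft'"
    unfolding ext_omega_calculus_def choice by (simp flip: unique(1,2))
  also have "\<dots> = (\<Sum>A\<in>UNIV. ext_calc \<phi> (coeff f0 A) (coeff finf A) (F A) o\<^sub>L lmul_op (cbasis A))"
  proof (rule blinfun_eqI)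
    fix v :: "'v ^ 'n set"
    have expand: "lmul a v = (\<Sum>A\<in>UNIV. coeff a A *\<^sub>R lmul (cbasis A) v)" for a :: "'n clifford"
      by (subst clifford_expansion [of a]) (simp only: lmul_sum_left lmul_scaleR_left)
    have Ei: "bounded_inverse (one_plus_square T) = Ei"
      unfolding bounded_inverse_one_plus_square [OF J] Ei_def ..
    have "blinfun_apply (lmul_op finf + (bounded_inverse (one_plus_square T) o\<^sub>L lmul_op (f0 - finf)) + omega_calculus \<phi> J T ft') v =
        lmul finf v + Ei (lmul (f0 - finf) v) + (\<Sum>A\<in>UNIV. calc \<phi> (F A) (lmul (cbasis A) v))"
      unfolding omega_calculus_eq [OF rep' F] Ei
      by (simp add: blinfun.add_left blinfun.sum_left lmul_op.rep_eq)
    also have "\<dots> = (\<Sum>A\<in>UNIV. coeff finf A *\<^sub>R lmul (cbasis A) v + (coeff f0 A - coeff finf A) *\<^sub>R Ei (lmul (cbasis A) v) +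
        calc \<phi> (F A) (lmul (cbasis A) v))"
      unfolding expand [of finf] expand [of "f0 - finf"]
      by (simp add: blinfun.sum_right blinfun.scaleR_right sum.distrib)
    also have "\<dots> = blinfun_apply (\<Sum>A\<in>UNIV. ext_calc \<phi> (coeff f0 A) (coeff finf A) (F A) o\<^sub>L lmul_op (cbasis A)) v"
      by (simp add: ext_calc_def blinfun.sum_left blinfun.add_left blinfun.scaleR_left lmul_op.rep_eq)
    finally show "blinfun_apply (lmul_op finf + (bounded_inverse (one_plus_square T) o\<^sub>L lmul_op (f0 - finf)) + omega_calculus \<phi> J T ft') v =
        blinfun_apply (\<Sum>A\<in>UNIV. ext_calc \<phi> (coeff f0 A) (coeff finf A) (F A) o\<^sub>L lmul_op (cbasis A)) v" .
  qed
  finally show ?thesis .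
qed

lemma zero_symmetric_decaying: "(\<lambda>z. 0) \<in> symmetric_decaying \<theta>"
  by (auto simp: symmetric_decaying_def bounded_iff)

text \<open>Only the empty index contributes, and its basis element is 1; so the operator is built
  from the resolvent family alone, without multiplications by Clifford numbers.\<close>

lemma ext_omega_calculus_intrinsic:
  assumes dec: "bnd_decomposition \<theta> g (of_real g0) (of_real ginf) gt" and G: "G \<in> symmetric_decaying \<theta>"
    and rep: "\<And>J z. J \<in> imag_sphere \<Longrightarrow> z \<in> double_sector_complex \<theta> \<Longrightarrow> gt (embed J z) = embed J (G z)"
  shows "ext_omega_calculus \<theta> \<phi> J T g = ext_calc \<phi> g0 ginf G"
proof -
  define F where "F A = (if A = {} then G else (\<lambda>z. 0))" for A :: "'n set"
  have F: "F A \<in> symmetric_decaying \<theta>" for A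
    using G zero_symmetric_decaying by (simp add: F_def)
  have "embed I (F A z) * cbasis A = (if A = {} then embed I (G z) else 0)" for I :: "'n clifford" and A z
    by (simp add: F_def cbasis_empty embed_eq)
  then have "slice_rep \<theta> gt F"
    using F rep by (simp add: slice_rep_def symmetric_decaying_def)
  from ext_omega_calculus_eq [OF dec this F]
  have "ext_omega_calculus \<theta> \<phi> J T g =
      (\<Sum>A\<in>UNIV. ext_calc \<phi> (coeff (of_real g0) A) (coeff (of_real ginf) A) (F A) o\<^sub>L lmul_op (cbasis A))" .
  moreover have "calc \<phi> (\<lambda>z. 0) = 0"
    using calc_linear [OF \<phi> zero_symmetric_decaying zero_symmetric_decaying, of 0 0] by simp
  then have "ext_calc \<phi> (coeff (of_real g0) A) (coeff (of_real ginf) A) (F A) o\<^sub>L lmul_op (cbasis A) =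
      (if A = {} then ext_calc \<phi> g0 ginf G else 0)" for A
    by (intro blinfun_eqI) (simp add: coeff_of_real F_def ext_calc_def cbasis_empty lmul_op.rep_eq lmul_one blinfun.zero_left)
  ultimately show ?thesis by simp
qed

end

section \<open>Products and the product rule\<close>

text \<open>On a slice \<open>g\<close> is the image of one complex number \<gamma> at each point,
  and multiplying \<open>f\<close> by it from the left multiplies every coefficient function by
  \<gamma> in the complex plane. So each coefficient of the remainder is a
  \<open>product_remainder\<close>, whose decay is known.\<close>

lemma product_decomposition:
  fixes f g :: "'n::{finite,linorder} clifford \<Rightarrow> 'n clifford"
  assumes \<theta>: "0 < \<theta>" "\<theta> < pi / 2"
    and g: "bnd_decomposition \<theta> g (of_real g0) (of_real ginf) gt" "G \<in> symmetric_decaying \<theta>"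
      "\<And>J z. J \<in> imag_sphere \<Longrightarrow> z \<in> double_sector_complex \<theta> \<Longrightarrow> gt (embed J z) = embed J (G z)"
    and f: "bnd_decomposition \<theta> f f0 finf ft" "slice_rep \<theta> ft F" "\<And>A. F A \<in> symmetric_decaying \<theta>"
  obtains kt where "bnd_decomposition \<theta> (\<lambda>s. g s * f s) (of_real g0 * f0) (of_real ginf * finf) kt"
    "slice_rep \<theta> kt (\<lambda>A. product_remainder g0 ginf G (coeff f0 A) (coeff finf A) (F A))"
proof -
  define K where "K A = product_remainder g0 ginf G (coeff f0 A) (coeff finf A) (F A)" for A
  have K: "K A \<in> symmetric_decaying \<theta>" for A
    unfolding K_def by (rule product_remainder_symmetric_decaying [OF \<theta> g(2) f(3)])
  \<comment> \<open>Defined by subtraction, so that the decomposition holds by construction; what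
    has to be shown is the representation of \<open>kt\<close> on slices.\<close>
  define kt where "kt s = g s * f s - of_real ginf * finf - 1 / (1 + s\<^sup>2) * (of_real g0 * f0 - of_real ginf * finf)" for s
  have rep: "slice_rep \<theta> kt K"
    unfolding slice_rep_def
  proof (intro conjI allI ballI)
    show "K A holomorphic_on double_sector_complex \<theta>" for A
      using K by (simp add: symmetric_decaying_def)
    show "K A (cnj z) = cnj (K A z)" if "z \<in> double_sector_complex \<theta>" for A z
      using K that by (simp add: symmetric_decaying_def)
    fix J :: "'n clifford" and z assume J: "J \<in> imag_sphere" and z: "z \<in> double_sector_complex \<theta>"
    define e where "e = 1 / (1 + z\<^sup>2)"
    have nz: "1 + z\<^sup>2 \<noteq> 0" by (rule one_plus_square_nonzero [OF \<theta> z])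
    have s: "embed J z \<in> double_sector \<theta>" using double_sector_embed_iff [OF J \<theta>] z by blast
    have e: "1 / (1 + (embed J z)\<^sup>2) = embed J e"
      unfolding e_def by (rule inverse_one_plus_square_embed [OF J nz])
    have expand: "a = (\<Sum>A\<in>UNIV. embed J (of_real (coeff a A)) * cbasis A)" for a :: "'n clifford"
      using clifford_expansion [of a] by (simp add: embed_of_real of_real_mult_clifford)
    define \<gamma> where "\<gamma> = of_real ginf + of_real (g0 - ginf) * e + G z"
    have g_eq: "g (embed J z) = embed J \<gamma>"
    proof -
      have "g (embed J z) = of_real ginf + embed J e * (of_real g0 - of_real ginf) + embed J (G z)"
        using g(1,3) s J z by (simp add: bnd_decomposition_def e)
      also have "embed J e * (of_real g0 - of_real ginf) = embed J (of_real (g0 - ginf) * e)"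
        by (simp add: embed_scale [OF J] mult_of_real_clifford flip: of_real_diff)
      finally show ?thesis
        by (simp only: \<gamma>_def embed_add embed_of_real)
    qed
    define \<psi> where "\<psi> A = of_real (coeff finf A) + of_real (coeff f0 A - coeff finf A) * e + F A z" for A
    have f_eq: "f (embed J z) = (\<Sum>A\<in>UNIV. embed J (\<psi> A) * cbasis A)"
    proof -
      have "f (embed J z) = finf + embed J e * (f0 - finf) + ft (embed J z)"
        using f(1) s by (simp add: bnd_decomposition_def e)
      also have "finf = (\<Sum>A\<in>UNIV. embed J (of_real (coeff finf A)) * cbasis A)"
        by (rule expand)
      also have "embed J e * (f0 - (\<Sum>A\<in>UNIV. embed J (of_real (coeff finf A)) * cbasis A)) =
          (\<Sum>A\<in>UNIV. embed J (of_real (coeff f0 A - coeff finf A) * e) * cbasis A)"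
        using embed_mult_expansion [OF J, of e "f0 - finf"] expand [of finf] by simp
      also have "ft (embed J z) = (\<Sum>A\<in>UNIV. embed J (F A z) * cbasis A)"
        using f(2) J z by (simp add: slice_rep_def)
      finally show ?thesis
        by (simp add: \<psi>_def embed_add distrib_right sum.distrib)
    qed
    have "g (embed J z) * f (embed J z) = (\<Sum>A\<in>UNIV. embed J (\<gamma> * \<psi> A) * cbasis A)"
      unfolding g_eq f_eq by (simp add: sum_distrib_left embed_mult [OF J] mult.assoc)
    also have "\<dots> = (\<Sum>A\<in>UNIV. embed J (of_real (ginf * coeff finf A)) * cbasis A +
        embed J (of_real (g0 * coeff f0 A - ginf * coeff finf A) * e) * cbasis A + embed J (K A z) * cbasis A)"
    proof (rule sum.cong [OF refl])
      fix A
      have "\<gamma> * \<psi> A = of_real (ginf * coeff finf A) + of_real (g0 * coeff f0 A - ginf * coeff finf A) * e + K A z"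
        unfolding \<gamma>_def \<psi>_def K_def e_def by (rule product_remainder_eq [OF nz])
      then show "embed J (\<gamma> * \<psi> A) * cbasis A = embed J (of_real (ginf * coeff finf A)) * cbasis A +
        embed J (of_real (g0 * coeff f0 A - ginf * coeff finf A) * e) * cbasis A + embed J (K A z) * cbasis A"
        by (simp only: embed_add distrib_right)
    qed
    also have "\<dots> = of_real ginf * finf + embed J e * (of_real g0 * f0 - of_real ginf * finf) +
        (\<Sum>A\<in>UNIV. embed J (K A z) * cbasis A)"
    proof -
      have "of_real ginf * finf = (\<Sum>A\<in>UNIV. embed J (of_real (ginf * coeff finf A)) * cbasis A)"
        using expand [of "of_real ginf * finf"] by (simp only: of_real_mult_clifford coeff_linear)
      moreover have "embed J e * (of_real g0 * f0 - of_real ginf * finf) =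
          (\<Sum>A\<in>UNIV. embed J (of_real (g0 * coeff f0 A - ginf * coeff finf A) * e) * cbasis A)"
        using embed_mult_expansion [OF J, of e "of_real g0 * f0 - of_real ginf * finf"]
        by (simp only: of_real_mult_clifford coeff_linear)
      ultimately show ?thesis by (simp only: sum.distrib)
    qed
    finally show "kt (embed J z) = (\<Sum>A\<in>UNIV. embed J (K A z) * cbasis A)"
      by (simp add: kt_def e)
  qed
  have "openin (top_of_set paravectors) (double_sector \<theta> :: 'n clifford set)"
    "axially_symmetric (double_sector \<theta> :: 'n clifford set)"
    using f(1) by (auto simp: bnd_decomposition_def SH_L_0_def SH_L_def)
  then have "kt \<in> SH_L_0 \<theta>"
    by (rule rep_SH_L_0 [OF rep K \<theta>])
  then have "bnd_decomposition \<theta> (\<lambda>s. g s * f s) (of_real g0 * f0) (of_real ginf * finf) kt"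
    by (simp add: bnd_decomposition_def kt_def)
  then show ?thesis
    using that rep by (simp add: K_def [abs_def])
qed

theorem theorem4p7:
  fixes T :: "'v::banach ^ 'n::{finite,linorder} set \<rightharpoonup> 'v ^ 'n set"
    and f g :: "'n clifford \<Rightarrow> 'n clifford"
    and \<omega> \<theta> :: real
  assumes "0 < \<omega>" and "\<omega> < pi / 2"
    and "bisectorial \<omega> T"
    and "\<omega> < \<theta>" and "\<theta> < pi / 2"
    and "g \<in> N_bnd \<theta>" and "f \<in> SH_L_bnd \<theta>"
  shows "(\<lambda>s. g s * f s) \<in> SH_L_bnd \<theta> \<and>
    (\<forall>\<phi>\<in>{\<omega> <..< \<theta>}. \<forall>J\<in>imag_sphere.
      ext_omega_calculus \<theta> \<phi> J T (\<lambda>s. g s * f s) =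
      ext_omega_calculus \<theta> \<phi> J T g o\<^sub>L ext_omega_calculus \<theta> \<phi> J T f)"
proof -
  have \<theta>: "0 < \<theta>" "\<theta> < pi / 2" using assms by auto
  obtain g0 ginf gt where gdec: "bnd_decomposition \<theta> g (of_real g0) (of_real ginf) gt" and gt: "gt \<in> N_0 \<theta>"
    using assms(6) by (auto simp: N_bnd_def elim!: Reals_cases)
  obtain G where G: "G \<in> symmetric_decaying \<theta>"
    "\<And>J z. J \<in> imag_sphere \<Longrightarrow> z \<in> double_sector_complex \<theta> \<Longrightarrow> gt (embed J z) = embed J (G z)"
    using N_0_rep [OF gt \<theta>] by blast
  obtain f0 finf ft where fdec: "bnd_decomposition \<theta> f f0 finf ft"
    using assms(7) by (auto simp: SH_L_bnd_def)
  then have "ft \<in> SH_L_0 \<theta>" by (simp add: bnd_decomposition_def)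
  then obtain F where F: "slice_rep \<theta> ft F" "\<And>A. F A \<in> symmetric_decaying \<theta>"
    using SH_L_0_rep [OF _ \<theta>] by blast
  define K where "K A = product_remainder g0 ginf G (coeff f0 A) (coeff finf A) (F A)" for A
  obtain kt where kdec: "bnd_decomposition \<theta> (\<lambda>s. g s * f s) (of_real g0 * f0) (of_real ginf * finf) kt"
    and krep: "slice_rep \<theta> kt K"
    using product_decomposition [OF \<theta> gdec G fdec F] unfolding K_def [abs_def] by blast
  have K: "K A \<in> symmetric_decaying \<theta>" for A
    unfolding K_def by (rule product_remainder_symmetric_decaying [OF \<theta> G(1) F(2)])
  have "ext_omega_calculus \<theta> \<phi> J T (\<lambda>s. g s * f s) =
      ext_omega_calculus \<theta> \<phi> J T g o\<^sub>L ext_omega_calculus \<theta> \<phi> J T f"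
    if \<phi>: "\<phi> \<in> {\<omega> <..< \<theta>}" and J: "J \<in> imag_sphere" for \<phi> J
  proof -
    have \<phi>': "\<omega> < \<phi>" "\<phi> < pi / 2" "0 < \<phi>" "\<phi> < \<theta>" using \<phi> assms by auto
    obtain c M where c: "cos \<phi> < c" "resolvent_family (resolvent_R0 J T) (resolvent_R1 J T) c M"
      "\<And>z. \<bar>Re z\<bar> < c * norm z \<Longrightarrow> resolvent_point T J z"
      using bisectorial_resolvent_family [OF assms(3,1) \<phi>'(1,2) J] by blast
    interpret bisectorial_calculus T J c M \<phi> \<theta>
      using c J \<phi>' \<theta> by (intro bisectorial_calculus.intro bisectorial_calculus_axioms.intro)
    have "ext_omega_calculus \<theta> \<phi> J T (\<lambda>s. g s * f s) =
        (\<Sum>A\<in>UNIV. ext_calc \<phi> (g0 * coeff f0 A) (ginf * coeff finf A) (K A) o\<^sub>L lmul_op (cbasis A))"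
      using ext_omega_calculus_eq [OF kdec krep K] by (simp add: of_real_mult_clifford)
    \<comment> \<open>\<open>g\<close> contributes the same operator for every index, always on the
      left, and can therefore be taken out of the sum.\<close>
    also have "\<dots> = (\<Sum>A\<in>UNIV. ext_calc \<phi> g0 ginf G o\<^sub>L ext_calc \<phi> (coeff f0 A) (coeff finf A) (F A) o\<^sub>L lmul_op (cbasis A))"
      unfolding K_def using ext_calc_mult [OF bisectorial_calculus.\<phi> [OF bisectorial_calculus_axioms] G(1) F(2)] by simp
    also have "\<dots> = ext_calc \<phi> g0 ginf G o\<^sub>L
        (\<Sum>A\<in>UNIV. ext_calc \<phi> (coeff f0 A) (coeff finf A) (F A) o\<^sub>L lmul_op (cbasis A))"
      by (rule blinfun_eqI) (simp add: blinfun.sum_left blinfun.sum_right)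
    also have "\<dots> = ext_omega_calculus \<theta> \<phi> J T g o\<^sub>L ext_omega_calculus \<theta> \<phi> J T f"
      by (simp only: ext_omega_calculus_eq [OF fdec F] ext_omega_calculus_intrinsic [OF gdec G(1) G(2)])
    finally show ?thesis .
  qed
  then show ?thesis
    using kdec unfolding SH_L_bnd_def by blast
qed

end
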